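(* Let $\mathcal{C} \subset H^0([0,2\pi])$ be the set of potentials $q$ for which the equation $-v''(t) + q(t)v(t) = 0$, $t\in[0,2\pi]$, admits a nontrivial periodic solution $v$. Let $\Sigma_0 \subset \mathbb{R}^3$ be the plane $z=0$, for each integer $n > 0$ let $\Sigma_n \subset \mathbb{R}^3$ be the cone $$x^2 + y^2 = \tan^2 z, \quad 2\pi n - \frac{\pi}{2} < z < 2\pi n + \frac{\pi}{2},$$ and let $\Sigma = \bigcup_{n \ge 0}\Sigma_n$. Let $\mathbb{H}$ be the real infinite dimensional separable Hilbert space. Then there is a diffeomorphism between the pairs $(\mathbb{R}^3,\Sigma)\times\mathbb{H}$ and $(H^0([0,2\pi]),\mathcal{C})$, i.e. a diffeomorphism $\mathbb{R}^3\times\mathbb{H} \to H^0([0,2\pi])$ taking $\Sigma\times\mathbb{H}$ onto $\mathcal{C}$.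
   Context: $H^0([0,2\pi]) = L^2([0,2\pi])$ (real valued functions). For $q\in H^0([0,2\pi])$ the solutions $v$ of $-v''+qv=0$ lie in the Sobolev space $H^2([0,2\pi])$; such a solution is periodic if $v(0)=v(2\pi)$ and $v'(0)=v'(2\pi)$. *)

theory Defs
  imports "HOL-Analysis.Analysis"
begin

text \<open>
  A multilinear map of \<open>k\<close> arguments is encoded as a function on lists, of which only the
  values on lists of length \<open>k\<close> matter.
\<close>

definition bounded_multilinear :: "nat \<Rightarrow> ('a::real_normed_vector list \<Rightarrow> 'b::real_normed_vector) \<Rightarrow> bool" where
  "bounded_multilinear k T \<longleftrightarrow>
     (\<forall>us vs. length us + Suc (length vs) = k \<longrightarrow> linear (\<lambda>h. T (us @ h # vs))) \<and>
     (\<exists>K. \<forall>hs. length hs = k \<longrightarrow> norm (T hs) \<le> K * prod_list (map norm hs))"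

text \<open>
  For a list \<open>hs\<close> of length \<open>k\<close>, \<open>D x hs\<close> is the value of the \<open>k\<close>-th Frechet derivative
  of \<open>f\<close> at \<open>x\<close> on the directions \<open>hs\<close>.  The last clause says that, for the operator
  norm on \<open>k\<close>-linear maps, the \<open>k\<close>-th derivative is Frechet differentiable in \<open>x\<close>, with the
  \<open>Suc k\<close>-th derivative as its derivative; so all the derivatives are continuous as well.
\<close>

definition smooth :: "('a::real_normed_vector \<Rightarrow> 'b::real_normed_vector) \<Rightarrow> bool" where
  "smooth f \<longleftrightarrow> (\<exists>D :: 'a \<Rightarrow> 'a list \<Rightarrow> 'b.
     (\<forall>x. D x [] = f x) \<and>
     (\<forall>k x. bounded_multilinear k (D x)) \<and>
     (\<forall>k x. \<forall>e>0. \<exists>d>0. \<forall>h. norm h < d \<longrightarrow>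
        (\<forall>hs. length hs = k \<longrightarrow>
           norm (D (x + h) hs - D x hs - D x (h # hs)) \<le> e * norm h * prod_list (map norm hs))))"

lemma smooth_imp_differentiable:
  assumes "smooth f"
  shows "f differentiable (at x)"
proof -
  from assms obtain D where D0: "\<And>x. D x [] = f x"
    and ml: "\<And>k x. bounded_multilinear k (D x)"
    and der: "\<And>k x e. e > 0 \<Longrightarrow> \<exists>d>0. \<forall>h. norm h < d \<longrightarrow> (\<forall>hs. length hs = k \<longrightarrow>
           norm (D (x + h) hs - D x hs - D x (h # hs)) \<le> e * norm h * prod_list (map norm hs))"
    unfolding smooth_def by metis
  have lin: "linear (\<lambda>h. D x ([] @ h # []))"
    using ml[of 1 x] unfolding bounded_multilinear_def by (metis One_nat_def add_0 list.size(3))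
  obtain K where "\<And>hs. length hs = 1 \<Longrightarrow> norm (D x hs) \<le> K * prod_list (map norm hs)"
    using ml[of 1 x] unfolding bounded_multilinear_def by blast
  from this[of "[_]"] have K: "norm (D x [h]) \<le> K * norm h" for h by simp
  have bl: "bounded_linear (\<lambda>h. D x [h])"
    using lin K by (intro bounded_linear.intro bounded_linear_axioms.intro) (auto simp: mult.commute)
  have "(f has_derivative (\<lambda>h. D x [h])) (at x)"
    unfolding has_derivative_at_alt
  proof (intro conjI bl allI impI)
    fix e :: real assume "e > 0"
    from der[OF this, where k = 0 and x = x] obtain d where d: "d > 0"
      "\<And>h. norm h < d \<Longrightarrow> norm (D (x + h) [] - D x [] - D x [h]) \<le> e * norm h" by auto
    show "\<exists>d>0. \<forall>y. norm (y - x) < d \<longrightarrow> norm (f y - f x - D x [y - x]) \<le> e * norm (y - x)"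
    proof (intro exI[of _ d] conjI allI impI)
      fix y assume "norm (y - x) < d"
      from d(2)[OF this] show "norm (f y - f x - D x [y - x]) \<le> e * norm (y - x)"
        by (simp add: D0)
    qed (use d in simp)
  qed
  then show ?thesis unfolding differentiable_def by blast
qed

lemma bounded_linear_imp_smooth:
  assumes "bounded_linear f"
  shows "smooth f"
proof -
  interpret bounded_linear f by fact
  obtain K where K: "\<And>x. norm (f x) \<le> norm x * K" using bounded by blast
  define D where "D = (\<lambda>x hs. case hs of [] \<Rightarrow> f x | [h] \<Rightarrow> f h | _ \<Rightarrow> 0)"
  have D: "D x [] = f x" "D x [h] = f h" "D x (h # h' # hs) = 0" for x h h' hs
    by (simp_all add: D_def)
  have "bounded_multilinear k (D x)" for k x
  proof -
    have 1: "linear (\<lambda>h. D x (us @ h # vs))" for us vs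
    proof (cases "us = [] \<and> vs = []")
      case True
      then show ?thesis by (simp add: D linear_axioms)
    next
      case False
      then have "D x (us @ h # vs) = 0" for h
        by (cases us; cases vs; cases "tl us") (auto simp: D)
      then show ?thesis by (simp add: linear_iff)
    qed
    have 2: "norm (D x hs) \<le> max (norm (f x)) (max K 0) * prod_list (map norm hs)" for hs
    proof (cases hs rule: list.exhaust[case_names Nil Cons])
      case Nil
      then show ?thesis by (simp add: D)
    next
      case (Cons h hs')
      show ?thesis
      proof (cases hs')
        case Nil
        have "norm (f h) \<le> K * norm h" using K[of h] by (simp add: mult.commute)
        also have "\<dots> \<le> max (norm (f x)) (max K 0) * norm h"
          by (intro mult_right_mono) auto
        finally show ?thesis using Cons Nil by (simp add: D)
      next
        case (Cons h' hs'')
        have "0 \<le> prod_list (map norm hs)" by (induction hs) auto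
        then have "0 \<le> max (norm (f x)) (max K 0) * prod_list (map norm hs)"
          by (intro mult_nonneg_nonneg) auto
        then show ?thesis using Cons \<open>hs = h # hs'\<close> by (simp add: D)
      qed
    qed
    show ?thesis unfolding bounded_multilinear_def using 1 2 by blast
  qed
  moreover have "\<exists>d>0. \<forall>h. norm h < d \<longrightarrow> (\<forall>hs. length hs = k \<longrightarrow>
           norm (D (x + h) hs - D x hs - D x (h # hs)) \<le> e * norm h * prod_list (map norm hs))"
    if "e > 0" for k x and e :: real
  proof (intro exI[of _ 1] conjI allI impI)
    fix h hs
    have "D (x + h) hs - D x hs - D x (h # hs) = 0"
      by (cases hs; cases "tl hs") (auto simp: D add)
    moreover have "0 \<le> prod_list (map norm hs)" by (induction hs) auto
    ultimately show "norm (D (x + h) hs - D x hs - D x (h # hs)) \<le> e * norm h * prod_list (map norm hs)"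
      using that by simp
  qed simp
  ultimately show ?thesis unfolding smooth_def by (intro exI[of _ D]) (auto simp: D)
qed

definition diffeomorphism :: "('a::real_normed_vector \<Rightarrow> 'b::real_normed_vector) \<Rightarrow> bool" where
  "diffeomorphism f \<longleftrightarrow> bij f \<and> smooth f \<and> smooth (inv f)"

abbreviation L2_measure :: "real measure" where
  "L2_measure \<equiv> lebesgue_on {0..2*pi}"

definition square_integrable :: "(real \<Rightarrow> real) \<Rightarrow> bool" where
  "square_integrable f \<longleftrightarrow>
     f \<in> borel_measurable L2_measure \<and> integrable L2_measure (\<lambda>t. (f t)\<^sup>2)"

lemma square_integrable_mult:
  assumes "square_integrable f" "square_integrable g"
  shows "integrable L2_measure (\<lambda>t. f t * g t)"
proof (rule Bochner_Integration.integrable_bound)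
  show "integrable L2_measure (\<lambda>t. (f t)\<^sup>2 + (g t)\<^sup>2)"
    using assms by (auto simp: square_integrable_def)
  show "(\<lambda>t. f t * g t) \<in> borel_measurable L2_measure"
    using assms by (auto simp: square_integrable_def)
  have "\<bar>a * b\<bar> \<le> a\<^sup>2 + b\<^sup>2" for a b :: real
  proof -
    have "2 * (\<bar>a\<bar> * \<bar>b\<bar>) \<le> a\<^sup>2 + b\<^sup>2"
      using sum_squares_bound[of "\<bar>a\<bar>" "\<bar>b\<bar>"] by (simp add: mult.assoc)
    moreover have "0 \<le> \<bar>a\<bar> * \<bar>b\<bar>" by simp
    ultimately show ?thesis unfolding abs_mult by linarith
  qed
  then show "AE t in L2_measure. norm (f t * g t) \<le> norm ((f t)\<^sup>2 + (g t)\<^sup>2)"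
    by simp
qed

lemma square_integrable_0: "square_integrable (\<lambda>t. 0)"
  by (simp add: square_integrable_def)

lemma square_integrable_add:
  assumes "square_integrable f" "square_integrable g"
  shows "square_integrable (\<lambda>t. f t + g t)"
  using assms square_integrable_mult[OF assms]
  by (auto simp: square_integrable_def power2_sum mult.assoc)

lemma square_integrable_scale:
  assumes "square_integrable f"
  shows "square_integrable (\<lambda>t. c * f t)"
  using assms by (auto simp: square_integrable_def power_mult_distrib)

definition L2_rel :: "(real \<Rightarrow> real) \<Rightarrow> (real \<Rightarrow> real) \<Rightarrow> bool" where
  "L2_rel f g \<longleftrightarrow>
     square_integrable f \<and> square_integrable g \<and> (AE t in L2_measure. f t = g t)"

quotient_type L2 = "real \<Rightarrow> real" / partial: L2_rel
proof (rule part_equivpI)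
  show "\<exists>f. L2_rel f f"
    by (rule exI[of _ "\<lambda>t. 0"]) (simp add: L2_rel_def square_integrable_0)
  show "symp L2_rel"
    by (rule sympI) (auto simp: L2_rel_def elim: eventually_mono)
  show "transp L2_rel"
    by (rule transpI) (auto simp: L2_rel_def elim: eventually_elim2)
qed

instantiation L2 :: real_vector
begin

lift_definition zero_L2 :: L2 is "\<lambda>t. 0"
  by (simp add: L2_rel_def square_integrable_0)

lift_definition plus_L2 :: "L2 \<Rightarrow> L2 \<Rightarrow> L2" is "\<lambda>f g t. f t + g t"
  by (auto simp: L2_rel_def square_integrable_add elim: eventually_elim2)

lift_definition scaleR_L2 :: "real \<Rightarrow> L2 \<Rightarrow> L2" is "\<lambda>c f t. c * f t"
  by (auto simp: L2_rel_def square_integrable_scale elim: eventually_mono)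

definition uminus_L2 :: "L2 \<Rightarrow> L2" where "uminus_L2 f = (-1) *\<^sub>R f"

definition minus_L2 :: "L2 \<Rightarrow> L2 \<Rightarrow> L2" where "minus_L2 f g = f + (-1) *\<^sub>R g"

instance
proof
  fix f g h :: L2 and a b :: real
  show "f + g + h = f + (g + h)"
    by transfer (auto simp: L2_rel_def add.assoc square_integrable_add)
  show "f + g = g + f"
    by transfer (auto simp: L2_rel_def add.commute square_integrable_add)
  show "0 + f = f"
    by transfer (auto simp: L2_rel_def)
  show "- f + f = 0"
    unfolding uminus_L2_def
    by transfer (auto simp: L2_rel_def square_integrable_0 intro: square_integrable_add square_integrable_scale[of _ "-1", simplified])
  show "f - g = f + - g"
    by (simp add: uminus_L2_def minus_L2_def)
  show "a *\<^sub>R (f + g) = a *\<^sub>R f + a *\<^sub>R g"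
    by transfer (auto simp: L2_rel_def distrib_left intro!: square_integrable_add square_integrable_scale)
  show "(a + b) *\<^sub>R f = a *\<^sub>R f + b *\<^sub>R f"
    by transfer (auto simp: L2_rel_def distrib_right intro!: square_integrable_add square_integrable_scale)
  show "a *\<^sub>R b *\<^sub>R f = (a * b) *\<^sub>R f"
    by transfer (auto simp: L2_rel_def mult.assoc intro!: square_integrable_scale)
  show "1 *\<^sub>R f = f"
    by transfer (auto simp: L2_rel_def)
qed

end

instantiation L2 :: real_inner
begin

lift_definition inner_L2 :: "L2 \<Rightarrow> L2 \<Rightarrow> real" is
  "\<lambda>f g. integral\<^sup>L L2_measure (\<lambda>t. f t * g t)"
proof -
  fix f f' g g' assume "L2_rel f f'" "L2_rel g g'"
  then show "integral\<^sup>L L2_measure (\<lambda>t. f t * g t) = integral\<^sup>L L2_measure (\<lambda>t. f' t * g' t)"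
    by (intro integral_cong_AE)
       (auto simp: L2_rel_def square_integrable_def elim: eventually_elim2)
qed

definition norm_L2 :: "L2 \<Rightarrow> real" where "norm_L2 f = sqrt (inner f f)"

definition sgn_L2 :: "L2 \<Rightarrow> L2" where "sgn_L2 f = f /\<^sub>R norm f"

definition dist_L2 :: "L2 \<Rightarrow> L2 \<Rightarrow> real" where "dist_L2 f g = norm (f - g)"

definition uniformity_L2 :: "(L2 \<times> L2) filter" where
  "uniformity_L2 = (INF e\<in>{0<..}. principal {(f, g). dist f g < e})"

definition open_L2 :: "L2 set \<Rightarrow> bool" where
  "open_L2 U \<longleftrightarrow> (\<forall>f\<in>U. \<forall>\<^sub>F (f', g) in uniformity. f' = f \<longrightarrow> g \<in> U)"

instance
proof
  fix f g h :: L2 and a :: real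
  show "f \<bullet> g = g \<bullet> f"
    by transfer (simp add: mult.commute)
  show "(f + g) \<bullet> h = f \<bullet> h + g \<bullet> h"
    by transfer (simp add: L2_rel_def distrib_right square_integrable_mult)
  show "a *\<^sub>R f \<bullet> g = a * (f \<bullet> g)"
    by transfer (simp add: mult.assoc)
  show "0 \<le> f \<bullet> f"
    by transfer simp
  show "f \<bullet> f = 0 \<longleftrightarrow> f = 0"
  proof transfer
    fix f assume "L2_rel f f"
    then have f: "square_integrable f" by (simp add: L2_rel_def)
    have "integral\<^sup>L L2_measure (\<lambda>t. f t * f t) = 0 \<longleftrightarrow> (AE t in L2_measure. f t * f t = 0)"
      by (rule integral_nonneg_eq_0_iff_AE) (simp_all add: f square_integrable_mult)
    then show "integral\<^sup>L L2_measure (\<lambda>t. f t * f t) = 0 \<longleftrightarrow> L2_rel f (\<lambda>t. 0)"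
      by (simp add: L2_rel_def f square_integrable_0)
  qed
qed (simp_all add: norm_L2_def sgn_L2_def dist_L2_def uniformity_L2_def open_L2_def)

end

definition test_function :: "(real \<Rightarrow> real) \<Rightarrow> bool" where
  "test_function \<phi> \<longleftrightarrow> smooth \<phi> \<and> closure {t. \<phi> t \<noteq> 0} \<subseteq> {0<..<2*pi}"

definition weak_derivative :: "(real \<Rightarrow> real) \<Rightarrow> (real \<Rightarrow> real) \<Rightarrow> bool" where
  "weak_derivative f g \<longleftrightarrow> (\<forall>\<phi>. test_function \<phi> \<longrightarrow>
     integral\<^sup>L L2_measure (\<lambda>t. f t * deriv \<phi> t) = - integral\<^sup>L L2_measure (\<lambda>t. g t * \<phi> t))"

text \<open>
  \<open>v\<close> is in the Sobolev space $H^2([0,2\pi])$, with weak derivatives \<open>v'\<close> and \<open>v''\<close>.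
  Both \<open>v\<close> and \<open>v'\<close> are taken to be the continuous representatives of their classes, so
  that their values at the end points make sense; \<open>v''\<close> is an arbitrary representative.
\<close>

definition sobolev_H2 :: "(real \<Rightarrow> real) \<Rightarrow> (real \<Rightarrow> real) \<Rightarrow> (real \<Rightarrow> real) \<Rightarrow> bool" where
  "sobolev_H2 v v' v'' \<longleftrightarrow>
     square_integrable v \<and> square_integrable v' \<and> square_integrable v'' \<and>
     weak_derivative v v' \<and> weak_derivative v' v'' \<and>
     continuous_on {0..2*pi} v \<and> continuous_on {0..2*pi} v'"

lift_definition has_nontrivial_periodic_solution :: "L2 \<Rightarrow> bool" is
  "\<lambda>q. \<exists>v v' v''. sobolev_H2 v v' v'' \<and>
     (AE t in L2_measure. - v'' t + q t * v t = 0) \<and>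
     v 0 = v (2*pi) \<and> v' 0 = v' (2*pi) \<and>
     (\<exists>t\<in>{0..2*pi}. v t \<noteq> 0)"
proof -
  fix p q assume "L2_rel p q"
  then have "AE t in L2_measure. p t = q t" by (simp add: L2_rel_def)
  then have "(AE t in L2_measure. - v'' t + p t * v t = 0) \<longleftrightarrow>
             (AE t in L2_measure. - v'' t + q t * v t = 0)" for v v'' :: "real \<Rightarrow> real"
    by (intro iffI; elim eventually_rev_mp) (auto elim: eventually_mono)
  then show "?thesis p q" by simp
qed

definition periodic_potentials :: "L2 set" where
  "periodic_potentials = {q. has_nontrivial_periodic_solution q}"

definition Sigma_sheet :: "nat \<Rightarrow> (real^3) set" where
  "Sigma_sheet n =
     (if n = 0 then {p. p $ 3 = 0}
      else {p. (p $ 1)\<^sup>2 + (p $ 2)\<^sup>2 = (tan (p $ 3))\<^sup>2 \<and>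
               2 * pi * real n - pi / 2 < p $ 3 \<and> p $ 3 < 2 * pi * real n + pi / 2})"

definition Sigma_union :: "(real^3) set" where
  "Sigma_union = (\<Union>n. Sigma_sheet n)"

end

theory Submission
  imports Defs
begin

text \<open>
  For \<open>u \<in> L2\<close> let \<open>W0 u\<close> be its second primitive vanishing to first order at \<open>0\<close> and let
  \<open>\<phi>\<close>, the phase, be the primitive of \<open>exp (W0 u)\<close> with \<open>\<phi> 0 = 0\<close>.  The functions
  \<open>\<phi>' powr (-1/2) * cos \<phi>\<close> and \<open>\<phi>' powr (-1/2) * sin \<phi>\<close> solve \<open>v'' = q v\<close> for a unique potential \<open>q\<close>,
  and \<open>u \<mapsto> q\<close> is a diffeomorphism of \<open>L2\<close>.  A nontrivial periodic solution exists if and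
  only if the monodromy matrix has trace \<open>2\<close>, that is, if
  \<open>cosh (w/2) cos \<theta> - (b/4) exp (-w/2) sin \<theta> = 1\<close>, where \<open>w\<close>, \<open>b\<close>, \<open>\<theta>\<close> are the values of \<open>W0 u\<close>,
  its derivative and \<open>\<phi>\<close> at \<open>2\<pi>\<close>.

  The numbers \<open>w\<close> and \<open>b\<close> are linear functionals of \<open>u\<close>, and \<open>\<theta>\<close> is strictly monotone along a third
  direction orthogonal to both, with range \<open>(0, \<infinity>)\<close>.  So \<open>(w, b, ln \<theta>)\<close> together with the orthogonal
  complement are global coordinates, and the problem becomes three-dimensional.  With
  \<open>x = sinh (w/2)\<close>, \<open>y = - (b/4) exp (-w/2)\<close> and \<open>\<delta> = arctan (y / sqrt (1 + x\<^sup>2))\<close> the equation reads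
  \<open>sqrt (1 + x\<^sup>2 + y\<^sup>2) cos (\<theta> - \<delta>) = 1\<close>.  For \<open>\<theta> \<ge> \<pi>\<close>, setting \<open>z = \<theta> - \<delta>\<close>, it describes the cones; for
  \<open>\<theta> < \<pi>\<close> it is a graph over the \<open>(x, y)\<close>-plane, up to a shear in \<open>y\<close> that is flat at \<open>\<theta> = \<pi>\<close>, and it is
  moved to \<open>z = 0\<close> by a second such shear.  All coordinate changes have the form
  \<open>p \<mapsto> p + (f p - l p) e\<close>, with \<open>f\<close> increasing along \<open>e\<close>.
\<close>

section \<open>Iterated directional derivatives\<close>

text \<open>The trace sees only the three numbers \<open>w\<close>, \<open>b\<close>, \<theta>; once
  these are coordinates, no infinite dimensional topology remains and explicit shears suffice. The
  obstacle is the first sheet. For 0 < \<theta> < \<pi> the equation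
  \<open>amp x * cos \<theta> + Y * sin \<theta> = 1\<close> reads
  \<open>Y = (1 - amp x * cos \<theta>) / sin \<theta>\<close>. As \<theta> tends to 0 this tends to
  minus infinity if \<open>x\<close> is not 0, but to 0 if \<open>x = 0\<close>. So the sheet is a
  graph only over the plane slit along the half-line \<open>x = 0, Y \<le> 0\<close>: it is the
  upper half of a cone whose vertex and one ray lie on the excluded boundary \<theta> = 0.
  Subtracting from \<open>Y\<close> an amount that grows without bound as \<theta> tends to 0 opens
  the slit, and the sheet becomes a graph over a full plane. The amount has to vanish to infinite
  order at \<theta> = \<pi>, so that smoothness survives and the cones, which all lie at \<theta> >
  \<pi>, are not moved; hence the functions built from \<open>exp (- inverse r)\<close>. The
  calculus of forms exists because \<open>smooth\<close> asks for a whole tower of multilinear maps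
  with uniform estimates, which would be unwieldy to exhibit for exponentials, compositions and
  inverses.\<close>

text \<open>
  A form \<open>\<tau> x \<eta>\<close> depends on a point \<open>x\<close> and on directions \<open>\<eta> 0, \<eta> 1, \<dots>\<close>; differentiating prepends
  the new direction to the sequence.  For \<open>Cn\<close> only directional derivatives and local bounds are
  required: linearity in the directions and Frechet differentiability come for free.
\<close>

definition locally_bounded_form ::
    "('a::real_normed_vector \<Rightarrow> (nat \<Rightarrow> 'a) \<Rightarrow> 'b::real_normed_vector) \<Rightarrow> bool" where
  "locally_bounded_form \<tau> \<longleftrightarrow> (\<forall>x M. \<exists>r>0. \<exists>K. \<forall>y \<eta>.
     norm (y - x) < r \<longrightarrow> (\<forall>i. norm (\<eta> i) \<le> M) \<longrightarrow> norm (\<tau> y \<eta>) \<le> K)"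

definition form_derivative ::
    "('a::real_normed_vector \<Rightarrow> (nat \<Rightarrow> 'a) \<Rightarrow> 'b::real_normed_vector) \<Rightarrow> ('a \<Rightarrow> (nat \<Rightarrow> 'a) \<Rightarrow> 'b) \<Rightarrow> bool" where
  "form_derivative \<tau> \<tau>' \<longleftrightarrow>
     (\<forall>x h \<eta>. ((\<lambda>s. \<tau> (x + s *\<^sub>R h) \<eta>) has_vector_derivative \<tau>' x (case_nat h \<eta>)) (at 0))"

primrec Cn :: "nat \<Rightarrow> ('a::real_normed_vector \<Rightarrow> (nat \<Rightarrow> 'a) \<Rightarrow> 'b::real_normed_vector) \<Rightarrow> bool" where
  "Cn 0 \<tau> \<longleftrightarrow> locally_bounded_form \<tau>"
| "Cn (Suc n) \<tau> \<longleftrightarrow> locally_bounded_form \<tau> \<and> (\<exists>\<tau>'. form_derivative \<tau> \<tau>' \<and> Cn n \<tau>')"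

lemma locally_bounded_formI:
  fixes \<tau> :: "'a::real_normed_vector \<Rightarrow> (nat \<Rightarrow> 'a) \<Rightarrow> 'b::real_normed_vector"
  assumes "\<And>x M. \<exists>r>0. \<exists>K. \<forall>y \<eta>. norm (y - x) < r \<longrightarrow> (\<forall>i. norm (\<eta> i) \<le> M) \<longrightarrow> norm (\<tau> y \<eta>) \<le> K"
  shows "locally_bounded_form \<tau>"
  unfolding locally_bounded_form_def by (intro allI assms)

lemma locally_bounded_formD:
  fixes \<tau> :: "'a::real_normed_vector \<Rightarrow> (nat \<Rightarrow> 'a) \<Rightarrow> 'b::real_normed_vector"
  assumes "locally_bounded_form \<tau>"
  shows "\<exists>r>0. \<exists>K>0. \<forall>y \<eta>. norm (y - x) < r \<longrightarrow> (\<forall>i. norm (\<eta> i) \<le> M) \<longrightarrow> norm (\<tau> y \<eta>) \<le> K"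
proof -
  have "\<exists>r>0. \<exists>K. \<forall>y (\<eta> :: nat \<Rightarrow> 'a). norm (y - x) < r \<longrightarrow> (\<forall>i. norm (\<eta> i) \<le> M) \<longrightarrow> norm (\<tau> y \<eta>) \<le> K"
    using assms[unfolded locally_bounded_form_def, THEN spec, THEN spec, of x M] .
  then obtain r K where *: "r > 0" "\<forall>y (\<eta> :: nat \<Rightarrow> 'a). norm (y - x) < r \<longrightarrow> (\<forall>i. norm (\<eta> i) \<le> M) \<longrightarrow> norm (\<tau> y \<eta>) \<le> K"
    by (elim exE conjE) (rule that)
  show ?thesis
  proof (rule exI[of _ r], intro conjI exI[of _ "max K 1"] allI impI)
    fix y and \<eta> :: "nat \<Rightarrow> 'a" assume "norm (y - x) < r" "\<forall>i. norm (\<eta> i) \<le> M"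
    with *(2) have "norm (\<tau> y \<eta>) \<le> K" by simp
    then show "norm (\<tau> y \<eta>) \<le> max K 1" by simp
  qed (use *(1) in auto)
qed

lemma Cn_locally_bounded: "Cn n \<tau> \<Longrightarrow> locally_bounded_form \<tau>"
  by (cases n) auto

lemma Cn_SucD: "Cn (Suc n) \<tau> \<Longrightarrow> \<exists>\<tau>'. form_derivative \<tau> \<tau>' \<and> Cn n \<tau>'"
  by simp

lemma Cn_SucI: "locally_bounded_form \<tau> \<Longrightarrow> form_derivative \<tau> \<tau>' \<Longrightarrow> Cn n \<tau>' \<Longrightarrow> Cn (Suc n) \<tau>"
  by auto

declare Cn.simps(2) [simp del]

lemma Cn_Suc_imp: "Cn (Suc n) \<tau> \<Longrightarrow> Cn n \<tau>"
proof (induction n arbitrary: \<tau>)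
  case 0
  then show ?case by (simp add: Cn_locally_bounded)
next
  case (Suc n)
  obtain \<tau>' where \<tau>': "form_derivative \<tau> \<tau>'" "Cn (Suc n) \<tau>'"
    using Cn_SucD[OF Suc.prems] by blast
  from Cn_SucI[OF Cn_locally_bounded[OF Suc.prems] \<tau>'(1) Suc.IH[OF \<tau>'(2)]] show ?case .
qed

lemma case_nat_eta: "case_nat (\<eta> 0) (\<lambda>i. \<eta> (Suc i)) = (\<eta> :: nat \<Rightarrow> 'a)"
  by (auto split: nat.splits)

lemma Cn_const [intro]: "Cn n (\<lambda>(x::'a::real_normed_vector) \<eta>. c)"
proof (induction n arbitrary: c)
  have lb: "locally_bounded_form (\<lambda>(x::'a) \<eta>. c)" for c :: 'b
    by (rule locally_bounded_formI, rule exI[of _ "1::real"], intro conjI exI[of _ "norm c"]) auto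
  then show "Cn 0 (\<lambda>(x::'a) \<eta>. c)" for c :: 'b by simp
  have "form_derivative (\<lambda>(x::'a) \<eta>. c) (\<lambda>x \<eta>. 0)" for c :: 'b
    by (auto simp: form_derivative_def)
  with lb show "Cn (Suc n) (\<lambda>(x::'a) \<eta>. c)" if "\<And>c::'b. Cn n (\<lambda>(x::'a) \<eta>. c)" for n and c :: 'b
    using that by (rule Cn_SucI)
qed

lemma Cn_direction [intro]: "Cn n (\<lambda>x \<eta>. \<eta> i)"
proof -
  have "locally_bounded_form (\<lambda>x \<eta>. \<eta> i :: 'a)"
  proof (rule locally_bounded_formI)
    show "\<exists>r>0. \<exists>K. \<forall>y \<eta>. norm (y - x) < r \<longrightarrow> (\<forall>i. norm (\<eta> i) \<le> M) \<longrightarrow> norm (\<eta> i) \<le> K"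
      for x :: 'a and M :: real
      by (rule exI[of _ "1::real"], intro conjI exI[of _ M]) simp_all
  qed
  then show ?thesis
    by (cases n) (auto simp: form_derivative_def Cn.simps(2) intro!: exI[of _ "\<lambda>x \<eta>. 0"])
qed

lemma Cn_point [intro]: "Cn n (\<lambda>x \<eta>. x)"
proof -
  have "locally_bounded_form (\<lambda>x \<eta>. x :: 'a)"
  proof (rule locally_bounded_formI)
    fix x :: 'a and M :: real
    have "norm y \<le> norm x + 1" if "norm (y - x) < 1" for y
      using norm_triangle_sub[of y x] that by linarith
    then show "\<exists>r>0. \<exists>K. \<forall>y \<eta>. norm (y - x) < r \<longrightarrow> (\<forall>i. norm (\<eta> i :: 'a) \<le> M) \<longrightarrow> norm y \<le> K"
      by (intro exI[of _ "1::real"] conjI exI[of _ "norm x + 1"]) auto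
  qed
  moreover have "((\<lambda>s. x + s *\<^sub>R h) has_vector_derivative h) (at 0)" for x h :: 'a
    by (auto intro!: derivative_eq_intros)
  ultimately show ?thesis
    by (cases n) (auto simp: form_derivative_def Cn.simps(2) intro!: exI[of _ "\<lambda>x \<eta>. \<eta> 0"])
qed

lemma locally_bounded_reindex:
  assumes "locally_bounded_form \<tau>"
  shows "locally_bounded_form (\<lambda>x \<eta>. \<tau> x (\<lambda>i. \<eta> (\<rho> i)))"
proof (rule locally_bounded_formI)
  fix x M
  obtain r K where "r > 0" "\<forall>y \<eta>. norm (y - x) < r \<longrightarrow> (\<forall>i. norm (\<eta> i) \<le> M) \<longrightarrow> norm (\<tau> y \<eta>) \<le> K"
    using locally_bounded_formD[OF assms, of x M] by (elim exE conjE) (rule that)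
  then show "\<exists>r>0. \<exists>K. \<forall>y \<eta>. norm (y - x) < r \<longrightarrow> (\<forall>i. norm (\<eta> i) \<le> M) \<longrightarrow> norm (\<tau> y (\<lambda>i. \<eta> (\<rho> i))) \<le> K"
    by (intro exI[of _ r] conjI exI[of _ K]) simp_all
qed

text \<open>Differentiation prepends a direction, so a factor that is not differentiated must
  afterwards skip entry 0; \<open>Cn_shift\<close> is that case. In the induction \<rho> is extended
  by fixing 0 and shifting the rest.\<close>

lemma Cn_reindex: "Cn n \<tau> \<Longrightarrow> Cn n (\<lambda>x \<eta>. \<tau> x (\<lambda>i. \<eta> (\<rho> i)))"
proof (induction n arbitrary: \<tau> \<rho>)
  case 0
  then show ?case by (simp add: locally_bounded_reindex)
next
  case (Suc n)
  obtain \<tau>' where \<tau>': "form_derivative \<tau> \<tau>'" "Cn n \<tau>'" using Cn_SucD[OF Suc.prems] by blast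
  have eq: "(\<lambda>i. case_nat h \<eta> (case_nat 0 (\<lambda>j. Suc (\<rho> j)) i)) = case_nat h (\<lambda>i. \<eta> (\<rho> i))" for h :: 'a and \<eta>
    by (auto split: nat.splits)
  have "form_derivative (\<lambda>x \<eta>. \<tau> x (\<lambda>i. \<eta> (\<rho> i))) (\<lambda>x \<eta>. \<tau>' x (\<lambda>i. \<eta> (case_nat 0 (\<lambda>j. Suc (\<rho> j)) i)))"
    unfolding form_derivative_def eq
    by (intro allI) (rule \<tau>'(1)[unfolded form_derivative_def, rule_format])
  moreover have "Cn n (\<lambda>x \<eta>. \<tau>' x (\<lambda>i. \<eta> (case_nat 0 (\<lambda>j. Suc (\<rho> j)) i)))"
    by (rule Suc.IH[OF \<tau>'(2)])
  ultimately show ?case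
    by (rule Cn_SucI[OF locally_bounded_reindex[OF Cn_locally_bounded[OF Suc.prems]]])
qed

lemma Cn_shift: "Cn n \<tau> \<Longrightarrow> Cn n (\<lambda>x \<eta>. \<tau> x (\<lambda>i. \<eta> (Suc i)))"
  by (rule Cn_reindex)

lemma locally_bounded_combine:
  assumes "locally_bounded_form \<tau>" "locally_bounded_form \<sigma>"
    and B: "\<And>K L. \<exists>R. \<forall>a b. norm a \<le> K \<longrightarrow> norm b \<le> L \<longrightarrow> norm (B a b) \<le> R"
  shows "locally_bounded_form (\<lambda>x \<eta>. B (\<tau> x \<eta>) (\<sigma> x \<eta>))"
proof (rule locally_bounded_formI)
  fix x M
  obtain r K where 1: "r > 0" "\<forall>y \<eta>. norm (y - x) < r \<longrightarrow> (\<forall>i. norm (\<eta> i) \<le> M) \<longrightarrow> norm (\<tau> y \<eta>) \<le> K"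
    using locally_bounded_formD[OF assms(1), of x M] by (elim exE conjE) (rule that)
  obtain s L where 2: "s > 0" "\<forall>y \<eta>. norm (y - x) < s \<longrightarrow> (\<forall>i. norm (\<eta> i) \<le> M) \<longrightarrow> norm (\<sigma> y \<eta>) \<le> L"
    using locally_bounded_formD[OF assms(2), of x M] by (elim exE conjE) (rule that)
  obtain R where "\<forall>a b. norm a \<le> K \<longrightarrow> norm b \<le> L \<longrightarrow> norm (B a b) \<le> R" using B by blast
  with 1 2 show "\<exists>r>0. \<exists>K. \<forall>y \<eta>. norm (y - x) < r \<longrightarrow> (\<forall>i. norm (\<eta> i) \<le> M) \<longrightarrow> norm (B (\<tau> y \<eta>) (\<sigma> y \<eta>)) \<le> K"
    by (intro exI[of _ "min r s"] conjI exI[of _ R]) simp_all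
qed

lemma locally_bounded_add:
  "locally_bounded_form \<tau> \<Longrightarrow> locally_bounded_form \<sigma> \<Longrightarrow> locally_bounded_form (\<lambda>x \<eta>. \<tau> x \<eta> + \<sigma> x \<eta>)"
proof (rule locally_bounded_combine[where B = "(+)"])
  show "\<exists>R. \<forall>a b :: 'b. norm a \<le> K \<longrightarrow> norm b \<le> L \<longrightarrow> norm (a + b) \<le> R" for K L :: real
    by (intro exI[of _ "K + L"]) (auto intro: norm_triangle_mono)
qed

lemma Cn_add: "Cn n \<tau> \<Longrightarrow> Cn n \<sigma> \<Longrightarrow> Cn n (\<lambda>x \<eta>. \<tau> x \<eta> + \<sigma> x \<eta>)"
proof (induction n arbitrary: \<tau> \<sigma>)
  case 0
  then show ?case by (simp add: locally_bounded_add)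
next
  case (Suc n)
  obtain \<tau>' \<sigma>' where *: "form_derivative \<tau> \<tau>'" "Cn n \<tau>'" "form_derivative \<sigma> \<sigma>'" "Cn n \<sigma>'"
    using Cn_SucD[OF Suc.prems(1)] Cn_SucD[OF Suc.prems(2)] by blast
  have "form_derivative (\<lambda>x \<eta>. \<tau> x \<eta> + \<sigma> x \<eta>) (\<lambda>x \<eta>. \<tau>' x \<eta> + \<sigma>' x \<eta>)"
    using * unfolding form_derivative_def by (auto intro!: has_vector_derivative_add)
  then show ?case
    by (rule Cn_SucI[OF locally_bounded_add[OF Suc.prems[THEN Cn_locally_bounded]] _ Suc.IH[OF *(2,4)]])
qed

lemma Cn_bilinear:
  assumes B: "bounded_bilinear B"
  shows "Cn n \<tau> \<Longrightarrow> Cn n \<sigma> \<Longrightarrow> Cn n (\<lambda>x \<eta>. B (\<tau> x \<eta>) (\<sigma> x \<eta>))"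
proof -
  interpret bounded_bilinear B by fact
  obtain C where C: "C > 0" "\<And>a b. norm (B a b) \<le> norm a * norm b * C" using pos_bounded by auto
  have lb: "locally_bounded_form (\<lambda>x \<eta>. B (\<tau> x \<eta>) (\<sigma> x \<eta>))"
    if "locally_bounded_form \<tau>" "locally_bounded_form \<sigma>" for \<tau> \<sigma>
  proof (rule locally_bounded_combine[OF that])
    fix K L :: real
    have "norm (B a b) \<le> (\<bar>K\<bar> * \<bar>L\<bar>) * C" if "norm a \<le> K" "norm b \<le> L" for a b
    proof -
      have "norm a * norm b * C \<le> (\<bar>K\<bar> * \<bar>L\<bar>) * C"
        using that C(1) by (intro mult_right_mono mult_mono) auto
      with C(2)[of a b] show ?thesis by linarith
    qed
    then show "\<exists>R. \<forall>a b. norm a \<le> K \<longrightarrow> norm b \<le> L \<longrightarrow> norm (B a b) \<le> R" by blast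
  qed
  show "Cn n \<tau> \<Longrightarrow> Cn n \<sigma> \<Longrightarrow> Cn n (\<lambda>x \<eta>. B (\<tau> x \<eta>) (\<sigma> x \<eta>))"
  proof (induction n arbitrary: \<tau> \<sigma>)
    case 0
    then show ?case by (simp add: lb)
  next
    case (Suc n)
    obtain \<tau>' \<sigma>' where *: "form_derivative \<tau> \<tau>'" "Cn n \<tau>'" "form_derivative \<sigma> \<sigma>'" "Cn n \<sigma>'"
      using Cn_SucD[OF Suc.prems(1)] Cn_SucD[OF Suc.prems(2)] by blast
    define \<phi> where "\<phi> = (\<lambda>x \<eta>. B (\<tau> x (\<lambda>i. \<eta> (Suc i))) (\<sigma>' x \<eta>) + B (\<tau>' x \<eta>) (\<sigma> x (\<lambda>i. \<eta> (Suc i))))"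
    have "((\<lambda>s. B (\<tau> (x + s *\<^sub>R h) \<eta>) (\<sigma> (x + s *\<^sub>R h) \<eta>)) has_vector_derivative \<phi> x (case_nat h \<eta>)) (at 0)" for x h \<eta>
      using has_vector_derivative[of "\<lambda>s. \<tau> (x + s *\<^sub>R h) \<eta>" "\<tau>' x (case_nat h \<eta>)" 0 UNIV
          "\<lambda>s. \<sigma> (x + s *\<^sub>R h) \<eta>" "\<sigma>' x (case_nat h \<eta>)"] *(1,3)
      unfolding form_derivative_def \<phi>_def by simp
    then have "form_derivative (\<lambda>x \<eta>. B (\<tau> x \<eta>) (\<sigma> x \<eta>)) \<phi>"
      unfolding form_derivative_def by blast
    moreover have "Cn n \<phi>" unfolding \<phi>_def
      by (rule Cn_add[OF Suc.IH[OF Cn_shift[OF Cn_Suc_imp[OF Suc.prems(1)]] *(4)]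
            Suc.IH[OF *(2) Cn_shift[OF Cn_Suc_imp[OF Suc.prems(2)]]]])
    ultimately show ?case
      by (rule Cn_SucI[OF lb[OF Suc.prems[THEN Cn_locally_bounded]]])
  qed
qed

lemma Cn_linear:
  assumes "bounded_linear L" "Cn n \<tau>"
  shows "Cn n (\<lambda>x \<eta>. L (\<tau> x \<eta>))"
proof -
  interpret bounded_linear L by fact
  have "bounded_bilinear (\<lambda>(c::real) v. c *\<^sub>R L v)"
    by (rule bounded_bilinear.comp[OF bounded_bilinear_scaleR bounded_linear_ident assms(1)])
  from Cn_bilinear[OF this Cn_const[of n 1] assms(2)] show ?thesis by simp
qed

lemma Cn_minus: "Cn n \<tau> \<Longrightarrow> Cn n (\<lambda>x \<eta>. - \<tau> x \<eta>)"
  by (rule Cn_linear[OF bounded_linear_minus[OF bounded_linear_ident]])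

lemma Cn_sum: "(\<And>i. i \<in> I \<Longrightarrow> Cn n (\<tau> i)) \<Longrightarrow> Cn n (\<lambda>x \<eta>. \<Sum>i\<in>I. \<tau> i x \<eta>)"
  by (induction I rule: infinite_finite_induct) (auto intro: Cn_add)

lemma form_derivative_line:
  assumes "form_derivative \<tau> \<tau>'"
  shows "((\<lambda>s. \<tau> (x + s *\<^sub>R h) \<eta>) has_vector_derivative \<tau>' (x + c *\<^sub>R h) (case_nat h \<eta>)) (at c)"
proof -
  let ?g = "\<lambda>s. \<tau> ((x + c *\<^sub>R h) + s *\<^sub>R h) \<eta>"
  have 1: "((\<lambda>s. s - c) has_vector_derivative 1) (at c)"
    by (auto intro!: derivative_eq_intros)
  have 2: "(?g has_vector_derivative \<tau>' (x + c *\<^sub>R h) (case_nat h \<eta>)) (at (c - c))"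
    using assms unfolding form_derivative_def by simp
  have "?g \<circ> (\<lambda>s. s - c) = (\<lambda>s. \<tau> (x + s *\<^sub>R h) \<eta>)"
    by (auto simp: algebra_simps)
  with vector_diff_chain_at[OF 1 2] show ?thesis by simp
qed

text \<open>Mean value inequality along the segment from \<open>z\<close> to \<open>y\<close>. The
  segment is run with the vector \<open>sgn (y - z)\<close>, so the local bound of the derivative is
  needed only for directions bounded by \<open>max M 1\<close>.\<close>

lemma Cn_Suc_lipschitz:
  assumes "Cn (Suc n) \<tau>"
  obtains r K where "r > 0" "K > 0"
    "\<And>y z \<eta>. norm (y - x) < r \<Longrightarrow> norm (z - x) < r \<Longrightarrow> (\<And>i. norm (\<eta> i) \<le> M) \<Longrightarrow>
       norm (\<tau> y \<eta> - \<tau> z \<eta>) \<le> K * norm (y - z)"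
proof -
  obtain \<tau>' where \<tau>': "form_derivative \<tau> \<tau>'" "Cn n \<tau>'" using Cn_SucD[OF assms] by blast
  obtain r K where rK: "r > 0" "K > 0"
    "\<forall>y \<eta>. norm (y - x) < r \<longrightarrow> (\<forall>i. norm (\<eta> i) \<le> max M 1) \<longrightarrow> norm (\<tau>' y \<eta>) \<le> K"
    using locally_bounded_formD[OF Cn_locally_bounded[OF \<tau>'(2)], of x "max M 1"] by (elim exE conjE) (rule that)
  have "norm (\<tau> y \<eta> - \<tau> z \<eta>) \<le> K * norm (y - z)"
    if yz: "norm (y - x) < r" "norm (z - x) < r" and \<eta>: "\<And>i. norm (\<eta> i) \<le> M" for y z \<eta>
  proof -
    define e where "e = sgn (y - z)"
    define l where "l = norm (y - z)"
    have y: "y = z + l *\<^sub>R e" unfolding e_def l_def sgn_div_norm by (cases "y = z") simp_all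
    have "norm (\<tau> (z + l *\<^sub>R e) \<eta> - \<tau> (z + 0 *\<^sub>R e) \<eta>) \<le> K * norm (l - 0)"
    proof (rule differentiable_bound[of "{0..l}" "\<lambda>s. \<tau> (z + s *\<^sub>R e) \<eta>"
          "\<lambda>c t. t *\<^sub>R \<tau>' (z + c *\<^sub>R e) (case_nat e \<eta>)"])
      fix c assume c: "c \<in> {0..l}"
      show "((\<lambda>s. \<tau> (z + s *\<^sub>R e) \<eta>) has_derivative (\<lambda>t. t *\<^sub>R \<tau>' (z + c *\<^sub>R e) (case_nat e \<eta>))) (at c within {0..l})"
        using form_derivative_line[OF \<tau>'(1)] unfolding has_vector_derivative_def
        by (rule has_derivative_at_withinI)
      have "z + c *\<^sub>R e \<in> ball x r"
      proof -
        have "z + c *\<^sub>R e \<in> closed_segment z y"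
        proof (cases "l = 0")
          case False
          then have "c / l \<in> {0..1}" using c by (auto simp: field_simps)
          moreover have "z + c *\<^sub>R e = (1 - c / l) *\<^sub>R z + (c / l) *\<^sub>R y"
            using False by (simp add: y algebra_simps)
          ultimately show ?thesis unfolding closed_segment_def by fastforce
        qed (use c in simp)
        moreover have "closed_segment z y \<subseteq> ball x r"
          using yz by (intro closed_segment_subset) (auto simp: dist_norm norm_minus_commute)
        ultimately show ?thesis by blast
      qed
      moreover have "norm (case_nat e \<eta> i) \<le> max M 1" for i
        using \<eta> by (auto simp: e_def norm_sgn max.coboundedI1 split: nat.splits)
      ultimately have "norm (\<tau>' (z + c *\<^sub>R e) (case_nat e \<eta>)) \<le> K"
        by (intro rK(3)[rule_format]) (auto simp: dist_norm norm_minus_commute)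
      then show "onorm (\<lambda>t. t *\<^sub>R \<tau>' (z + c *\<^sub>R e) (case_nat e \<eta>)) \<le> K"
        by (intro onorm_le) (simp add: mult.commute[of K] mult_left_mono)
    qed (auto simp: l_def)
    moreover have "norm (l - 0) = norm (y - z)" by (simp add: l_def)
    ultimately show ?thesis unfolding y[symmetric] by simp
  qed
  then show thesis by (rule that[OF rK(1,2)])
qed

lemma Cn_Suc_isCont:
  assumes "Cn (Suc n) \<tau>" and M: "\<And>i. norm (\<eta> i) \<le> M"
  shows "isCont (\<lambda>x. \<tau> x \<eta>) x"
proof (rule Cn_Suc_lipschitz[OF assms(1), where x = x and M = M])
  fix r K assume rK: "r > 0" "K > 0" and
    *: "\<And>y z \<eta>. norm (y - x) < r \<Longrightarrow> norm (z - x) < r \<Longrightarrow> (\<And>i. norm (\<eta> i) \<le> M) \<Longrightarrow>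
       norm (\<tau> y \<eta> - \<tau> z \<eta>) \<le> K * norm (y - z)"
  have "((\<lambda>y. \<tau> y \<eta> - \<tau> x \<eta>) \<longlongrightarrow> 0) (at x)"
  proof (rule Lim_null_comparison)
    have "norm (\<tau> y \<eta> - \<tau> x \<eta>) \<le> K * norm (y - x)" if "dist y x < r" for y
      using *[of y x \<eta>] that rK(1) M unfolding dist_norm by (metis diff_self norm_zero)
    then show "\<forall>\<^sub>F y in at x. norm (\<tau> y \<eta> - \<tau> x \<eta>) \<le> K * norm (y - x)"
      unfolding eventually_at using rK(1) by (intro exI[of _ r]) simp
    have "((\<lambda>y. K * norm (y - x)) \<longlongrightarrow> K * norm (x - x)) (at x)" by (intro tendsto_intros)
    then show "((\<lambda>y. K * norm (y - x)) \<longlongrightarrow> 0) (at x)" by simp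
  qed
  then show ?thesis unfolding isCont_def using Lim_null[of "\<lambda>y. \<tau> y \<eta>" "\<tau> x \<eta>" "at x"] by simp
qed

section \<open>Derivative towers: the Frechet side of smoothness\<close>

definition derivative_tower :: "('a::real_normed_vector \<Rightarrow> 'a list \<Rightarrow> 'b::real_normed_vector) \<Rightarrow> bool" where
  "derivative_tower D \<longleftrightarrow>
     (\<forall>k x. bounded_multilinear k (D x)) \<and>
     (\<forall>k x. \<forall>e>0. \<exists>d>0. \<forall>h. norm h < d \<longrightarrow>
        (\<forall>hs. length hs = k \<longrightarrow>
           norm (D (x + h) hs - D x hs - D x (h # hs)) \<le> e * norm h * prod_list (map norm hs)))"

lemma smooth_iff_tower: "smooth f \<longleftrightarrow> (\<exists>D. (\<forall>x. D x [] = f x) \<and> derivative_tower D)"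
  unfolding smooth_def derivative_tower_def by blast

lemma prod_list_norm_nonneg: "0 \<le> prod_list (map norm (hs :: 'a::real_normed_vector list))"
  by (induction hs) auto

lemma tower_linear:
  assumes "derivative_tower D"
  shows "linear (\<lambda>h. D x (us @ h # vs))"
  using assms unfolding derivative_tower_def bounded_multilinear_def by blast

lemma tower_linear_Cons: "derivative_tower D \<Longrightarrow> linear (\<lambda>h. D x (h # vs))"
  using tower_linear[of D x "[]" vs] by simp

lemma tower_bound:
  assumes "derivative_tower D"
  obtains K where "K > 0" "\<And>hs. length hs = k \<Longrightarrow> norm (D x hs) \<le> K * prod_list (map norm hs)"
proof -
  obtain K where K: "\<forall>hs. length hs = k \<longrightarrow> norm (D x hs) \<le> K * prod_list (map norm hs)"
    using assms unfolding derivative_tower_def bounded_multilinear_def by meson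
  show thesis
  proof (rule that[of "max K 1"])
    fix hs :: "'a list" assume "length hs = k"
    then have "norm (D x hs) \<le> K * prod_list (map norm hs)" using K by simp
    also have "\<dots> \<le> max K 1 * prod_list (map norm hs)"
      by (intro mult_right_mono prod_list_norm_nonneg) simp
    finally show "norm (D x hs) \<le> max K 1 * prod_list (map norm hs)" .
  qed simp
qed

lemma tower_approx:
  assumes "derivative_tower D" "e > 0"
  obtains d where "d > 0" "\<And>h hs. norm h < d \<Longrightarrow> length hs = k \<Longrightarrow>
     norm (D (x + h) hs - D x hs - D x (h # hs)) \<le> e * norm h * prod_list (map norm hs)"
proof -
  have "\<exists>d>0. \<forall>h. norm h < d \<longrightarrow> (\<forall>hs. length hs = k \<longrightarrow>
     norm (D (x + h) hs - D x hs - D x (h # hs)) \<le> e * norm h * prod_list (map norm hs))"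
    using assms unfolding derivative_tower_def by blast
  then obtain d where "d > 0" "\<forall>h. norm h < d \<longrightarrow> (\<forall>hs. length hs = k \<longrightarrow>
     norm (D (x + h) hs - D x hs - D x (h # hs)) \<le> e * norm h * prod_list (map norm hs))"
    by (elim exE conjE) (rule that)
  then show thesis by (intro that[of d]) simp_all
qed

text \<open>Accuracy 1 in the differentiability clause is enough: the remainder is then at most
  \<open>norm h\<close> times the product of the norms, and the bound of the next derivative at
  \<open>x\<close> contributes the rest.\<close>

lemma tower_lipschitz:
  assumes "derivative_tower D"
  obtains d K where "d > 0" "K > 0" "\<And>h hs. norm h < d \<Longrightarrow> length hs = k \<Longrightarrow>
     norm (D (x + h) hs - D x hs) \<le> K * norm h * prod_list (map norm hs)"
proof -
  obtain d where d: "d > 0" "\<And>h hs. norm h < d \<Longrightarrow> length hs = k \<Longrightarrow>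
     norm (D (x + h) hs - D x hs - D x (h # hs)) \<le> 1 * norm h * prod_list (map norm hs)"
    using tower_approx[OF assms zero_less_one, where x = x and k = k] by blast
  obtain K where K: "K > 0" "\<And>hs. length hs = Suc k \<Longrightarrow> norm (D x hs) \<le> K * prod_list (map norm hs)"
    using tower_bound[OF assms, where x = x and k = "Suc k"] by blast
  have "norm (D (x + h) hs - D x hs) \<le> (K + 1) * norm h * prod_list (map norm hs)"
    if "norm h < d" "length hs = k" for h hs
  proof -
    have "norm (D (x + h) hs - D x hs) \<le> norm (D (x + h) hs - D x hs - D x (h # hs)) + norm (D x (h # hs))"
      using norm_triangle_ineq[of "D (x + h) hs - D x hs - D x (h # hs)" "D x (h # hs)"] by simp
    also have "norm (D (x + h) hs - D x hs - D x (h # hs)) \<le> 1 * norm h * prod_list (map norm hs)"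
      using d(2) that .
    also have "norm (D x (h # hs)) \<le> K * (norm h * prod_list (map norm hs))"
      using K(2)[of "h # hs"] that by simp
    finally show ?thesis by (simp add: algebra_simps)
  qed
  with d(1) K(1) show thesis by (intro that[of d "K + 1"]) simp_all
qed

text \<open>\<open>bounded_multilinear\<close> gives a constant for each point separately; the
  Lipschitz estimate makes it uniform near \<open>x\<close>, which is what
  \<open>locally_bounded_form\<close> asks for.\<close>

lemma tower_bound_local:
  assumes "derivative_tower D"
  obtains d K where "d > 0" "K > 0" "\<And>y hs. norm (y - x) < d \<Longrightarrow> length hs = k \<Longrightarrow>
     norm (D y hs) \<le> K * prod_list (map norm hs)"
proof -
  obtain d L where d: "d > 0" "L > 0" "\<And>h hs. norm h < d \<Longrightarrow> length hs = k \<Longrightarrow>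
     norm (D (x + h) hs - D x hs) \<le> L * norm h * prod_list (map norm hs)"
    using tower_lipschitz[OF assms, where x = x and k = k] by blast
  obtain K where K: "K > 0" "\<And>hs. length hs = k \<Longrightarrow> norm (D x hs) \<le> K * prod_list (map norm hs)"
    using tower_bound[OF assms, where x = x and k = k] by blast
  have "norm (D y hs) \<le> (L * d + K) * prod_list (map norm hs)" if "norm (y - x) < d" "length hs = k" for y hs
  proof -
    have "norm (D y hs) \<le> norm (D y hs - D x hs) + norm (D x hs)"
      using norm_triangle_ineq[of "D y hs - D x hs" "D x hs"] by simp
    also have "norm (D y hs - D x hs) \<le> L * norm (y - x) * prod_list (map norm hs)"
      using d(3)[of "y - x" hs] that by simp
    also have "\<dots> \<le> L * d * prod_list (map norm hs)"
      using that d(2) by (intro mult_right_mono mult_left_mono prod_list_norm_nonneg) auto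
    also have "norm (D x hs) \<le> K * prod_list (map norm hs)" using K(2) that(2) .
    finally show ?thesis by (simp add: algebra_simps)
  qed
  moreover have "0 < L * d + K" using d K by (simp add: add_pos_pos)
  ultimately show thesis using d(1) by (intro that[of d "L * d + K"]) simp_all
qed

lemma tower_has_derivative:
  assumes "derivative_tower D"
  shows "((\<lambda>x. D x hs) has_derivative (\<lambda>h. D x (h # hs))) (at x)"
  unfolding has_derivative_at_alt
proof (intro conjI allI impI)
  let ?P = "prod_list (map norm hs)"
  have P: "0 \<le> ?P" by (rule prod_list_norm_nonneg)
  obtain K where K: "K > 0" "\<And>gs. length gs = Suc (length hs) \<Longrightarrow> norm (D x gs) \<le> K * prod_list (map norm gs)"
    using tower_bound[OF assms, where x = x and k = "Suc (length hs)"] by blast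
  show "bounded_linear (\<lambda>h. D x (h # hs))"
  proof (rule linear_conv_bounded_linear[THEN iffD1] bounded_linear.intro, rule tower_linear_Cons[OF assms], unfold_locales, rule exI[of _ "K * ?P"], rule allI)
    fix h show "norm (D x (h # hs)) \<le> norm h * (K * ?P)"
      using K(2)[of "h # hs"] by (simp add: mult_ac)
  qed
  fix e :: real assume e: "e > 0"
  \<comment> \<open>The product of the norms may be 0, hence the denominator
    \<open>?P + 1\<close>.\<close>
  then have "e / (?P + 1) > 0" using P by simp
  then obtain d where d: "d > 0" "\<And>h gs. norm h < d \<Longrightarrow> length gs = length hs \<Longrightarrow>
     norm (D (x + h) gs - D x gs - D x (h # gs)) \<le> e / (?P + 1) * norm h * prod_list (map norm gs)"
    using tower_approx[OF assms, where x = x and k = "length hs" and e = "e / (?P + 1)"] by blast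
  show "\<exists>d>0. \<forall>y. norm (y - x) < d \<longrightarrow> norm (D y hs - D x hs - D x ((y - x) # hs)) \<le> e * norm (y - x)"
  proof (rule exI[of _ d], intro conjI d(1) allI impI)
    fix y assume "norm (y - x) < d"
    then have "norm (D y hs - D x hs - D x ((y - x) # hs)) \<le> e / (?P + 1) * norm (y - x) * ?P"
      using d(2)[of "y - x" hs] by simp
    also have "\<dots> = (e * norm (y - x)) * (?P / (?P + 1))" by simp
    also have "\<dots> \<le> (e * norm (y - x)) * 1"
      using P e by (intro mult_left_mono) (auto simp: divide_le_eq_1)
    finally show "norm (D y hs - D x hs - D x ((y - x) # hs)) \<le> e * norm (y - x)" by simp
  qed
qed

lemma prod_list_norm_le_power:
  assumes "\<And>i. norm (\<eta> i) \<le> M"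
  shows "prod_list (map norm (map \<eta> [0..<k])) \<le> M ^ k"
proof (induction k)
  case (Suc k)
  have "0 \<le> M" using assms[of 0] norm_ge_zero order_trans by blast
  have "prod_list (map norm (map \<eta> [0..<Suc k])) = prod_list (map norm (map \<eta> [0..<k])) * norm (\<eta> k)"
    by (simp add: comp_def)
  also have "\<dots> \<le> M ^ k * M"
    using \<open>0 \<le> M\<close> by (intro mult_mono Suc.IH assms) auto
  finally show ?case by (simp add: mult.commute)
qed simp

text \<open>The form of level \<open>k\<close> reads the first \<open>k\<close> entries of the
  direction sequence. Prepending a direction and reading one entry more produces the list
  \<open>h # hs\<close>, so differentiation leads from level \<open>k\<close> to level
  \<open>Suc k\<close>.\<close>

lemma tower_Cn:
  assumes "derivative_tower D"
  shows "Cn n (\<lambda>x \<eta>. D x (map \<eta> [0..<k]))"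
proof (induction n arbitrary: k)
  have lb: "locally_bounded_form (\<lambda>x \<eta>. D x (map \<eta> [0..<k]))" for k
  proof (rule locally_bounded_formI)
    fix x :: 'a and M :: real
    obtain d K where dK: "d > 0" "K > 0" "\<And>y hs. norm (y - x) < d \<Longrightarrow> length hs = k \<Longrightarrow>
        norm (D y hs) \<le> K * prod_list (map norm hs)"
      using tower_bound_local[OF assms, where x = x and k = k] by blast
    show "\<exists>r>0. \<exists>K. \<forall>y \<eta>. norm (y - x) < r \<longrightarrow> (\<forall>i. norm (\<eta> i) \<le> M) \<longrightarrow> norm (D y (map \<eta> [0..<k])) \<le> K"
    proof (rule exI[of _ d], intro conjI exI[of _ "K * M ^ k"] allI impI)
      fix y and \<eta> :: "nat \<Rightarrow> 'a" assume y: "norm (y - x) < d" and \<eta>: "\<forall>i. norm (\<eta> i) \<le> M"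
      have "norm (D y (map \<eta> [0..<k])) \<le> K * prod_list (map norm (map \<eta> [0..<k]))"
        using dK(3)[OF y, of "map \<eta> [0..<k]"] by simp
      also have "\<dots> \<le> K * M ^ k"
        using dK(2) \<eta> by (intro mult_left_mono prod_list_norm_le_power) auto
      finally show "norm (D y (map \<eta> [0..<k])) \<le> K * M ^ k" .
    qed (rule dK(1))
  qed
  show "Cn 0 (\<lambda>x \<eta>. D x (map \<eta> [0..<k]))" for k using lb by simp
  fix n k assume IH: "\<And>k. Cn n (\<lambda>x \<eta>. D x (map \<eta> [0..<k]))"
  have map_case: "map (case_nat h \<eta>) [0..<Suc k] = h # map \<eta> [0..<k]" for h :: 'a and \<eta>
    by (simp add: map_upt_Suc del: upt_Suc)
  have "form_derivative (\<lambda>x \<eta>. D x (map \<eta> [0..<k])) (\<lambda>x \<eta>. D x (map \<eta> [0..<Suc k]))"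
    unfolding form_derivative_def map_case
  proof (intro allI)
    fix x h :: 'a and \<eta> :: "nat \<Rightarrow> 'a"
    let ?hs = "map \<eta> [0..<k]"
    have "((\<lambda>s. x + s *\<^sub>R h) has_derivative (\<lambda>s. s *\<^sub>R h)) (at 0)"
      by (auto intro!: derivative_eq_intros)
    from has_derivative_compose[OF this, of "\<lambda>x. D x ?hs" "\<lambda>h. D x (h # ?hs)"]
    have "((\<lambda>s. D (x + s *\<^sub>R h) ?hs) has_derivative (\<lambda>s. D x ((s *\<^sub>R h) # ?hs))) (at 0)"
      using tower_has_derivative[OF assms, of ?hs x] by simp
    then show "((\<lambda>s. D (x + s *\<^sub>R h) ?hs) has_vector_derivative D x (h # ?hs)) (at 0)"
      unfolding has_vector_derivative_def linear_scale[OF tower_linear_Cons[OF assms]] .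
  qed
  then show "Cn (Suc n) (\<lambda>x \<eta>. D x (map \<eta> [0..<k]))"
    using Cn_SucI[OF lb _ IH] by blast
qed

lemma smooth_imp_Cn: "smooth f \<Longrightarrow> Cn n (\<lambda>x \<eta>. f x)"
proof -
  assume "smooth f"
  then obtain D where "\<forall>x. D x [] = f x" "derivative_tower D" unfolding smooth_iff_tower by blast
  with tower_Cn[of D n 0] show ?thesis by simp
qed

section \<open>From directional derivatives back to multilinear maps\<close>

lemma multilinear_normalize:
  fixes T :: "'a::real_normed_vector list \<Rightarrow> 'b::real_normed_vector"
  assumes lin: "\<And>us vs. length us + Suc (length vs) = k \<Longrightarrow> linear (\<lambda>h. T (us @ h # vs))"
  shows "length us + length hs = k \<Longrightarrow> T (us @ hs) = prod_list (map norm hs) *\<^sub>R T (us @ map sgn hs)"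
proof (induction hs arbitrary: us)
  case (Cons h hs)
  have "h = norm h *\<^sub>R sgn h" by (cases "h = 0") (simp_all add: sgn_div_norm)
  then have "T (us @ h # hs) = T (us @ (norm h *\<^sub>R sgn h) # hs)" by simp
  also have "\<dots> = norm h *\<^sub>R T (us @ sgn h # hs)"
    using linear_scale[OF lin[of us hs]] Cons.prems by simp
  also have "T (us @ sgn h # hs) = prod_list (map norm hs) *\<^sub>R T (us @ map sgn (h # hs))"
    using Cons.IH[of "us @ [sgn h]"] Cons.prems by simp
  finally show ?case by simp
qed simp

text \<open>By homogeneity each argument may be replaced by its \<open>sgn\<close>, of norm at most
  1, at the price of the factor \<open>prod_list (map norm hs)\<close>.\<close>

lemma multilinear_bound:
  fixes T :: "'a::real_normed_vector list \<Rightarrow> 'b::real_normed_vector"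
  assumes lin: "\<And>us vs. length us + Suc (length vs) = k \<Longrightarrow> linear (\<lambda>h. T (us @ h # vs))"
    and K: "\<And>hs. length hs = k \<Longrightarrow> \<forall>h\<in>set hs. norm h \<le> 1 \<Longrightarrow> norm (T hs) \<le> K"
    and len: "length hs = k"
  shows "norm (T hs) \<le> K * prod_list (map norm hs)"
proof -
  have "T hs = prod_list (map norm hs) *\<^sub>R T (map sgn hs)"
    using multilinear_normalize[of k T "[]" hs, OF lin] len by simp
  then have "norm (T hs) = prod_list (map norm hs) * norm (T (map sgn hs))"
    using prod_list_norm_nonneg[of hs] by simp
  also have "\<dots> \<le> prod_list (map norm hs) * K"
    using len by (intro mult_left_mono prod_list_norm_nonneg K) (auto simp: norm_sgn)
  finally show ?thesis by (simp add: mult.commute)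
qed

text \<open>Quadratic remainders arise in two places: from a derivative that is Lipschitz in the
  base point, and from the Taylor remainder of the exponential.\<close>

lemma has_vector_derivative_quadratic:
  fixes f :: "real \<Rightarrow> 'b::real_normed_vector"
  assumes "d > 0" and bound: "\<And>s. \<bar>s\<bar> < d \<Longrightarrow> norm (f s - f 0 - s *\<^sub>R v) \<le> L * s\<^sup>2"
  shows "(f has_vector_derivative v) (at 0)"
  unfolding has_vector_derivative_def has_derivative_at_alt
proof (intro conjI allI impI)
  fix e :: real assume "e > 0"
  define \<delta> where "\<delta> = min d (e / (\<bar>L\<bar> + 1))"
  have "\<delta> > 0" using \<open>e > 0\<close> \<open>d > 0\<close> by (simp add: \<delta>_def)
  moreover have "norm (f y - f 0 - (y - 0) *\<^sub>R v) \<le> e * norm (y - 0)" if "norm (y - 0) < \<delta>" for y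
  proof -
    have "norm (f y - f 0 - y *\<^sub>R v) \<le> L * y\<^sup>2" using that by (intro bound) (auto simp: \<delta>_def)
    also have "\<dots> \<le> (\<bar>L\<bar> + 1) * (\<bar>y\<bar> * \<bar>y\<bar>)"
      by (simp add: power2_eq_square abs_mult_self_eq) (intro mult_right_mono, auto)
    also have "\<dots> \<le> (\<bar>L\<bar> + 1) * (e / (\<bar>L\<bar> + 1) * \<bar>y\<bar>)"
      using that by (intro mult_left_mono mult_right_mono) (auto simp: \<delta>_def)
    also have "\<dots> = e * \<bar>y\<bar>" by (simp add: field_simps)
    finally show ?thesis by simp
  qed
  ultimately show "\<exists>d>0. \<forall>y. norm (y - 0) < d \<longrightarrow> norm (f y - f 0 - (y - 0) *\<^sub>R v) \<le> e * norm (y - 0)"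
    by blast
qed (rule bounded_linear_scaleR_left)

lemma form_derivative_scale:
  assumes "form_derivative \<tau> \<tau>'"
  shows "\<tau>' x (case_nat (c *\<^sub>R h) \<eta>) = c *\<^sub>R \<tau>' x (case_nat h \<eta>)"
proof -
  let ?g = "\<lambda>s. \<tau> (x + s *\<^sub>R h) \<eta>"
  have 1: "((\<lambda>s. s * c) has_vector_derivative c) (at 0)"
    by (auto intro!: derivative_eq_intros simp: has_real_derivative_iff_has_vector_derivative[symmetric])
  have "(?g has_vector_derivative \<tau>' x (case_nat h \<eta>)) (at (0 * c))"
    using assms unfolding form_derivative_def by simp
  from vector_diff_chain_at[OF 1 this]
  have "((\<lambda>s. \<tau> (x + s *\<^sub>R (c *\<^sub>R h)) \<eta>) has_vector_derivative c *\<^sub>R \<tau>' x (case_nat h \<eta>)) (at 0)"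
    by (simp add: o_def)
  moreover have "((\<lambda>s. \<tau> (x + s *\<^sub>R (c *\<^sub>R h)) \<eta>) has_vector_derivative \<tau>' x (case_nat (c *\<^sub>R h) \<eta>)) (at 0)"
    using assms unfolding form_derivative_def by blast
  ultimately show ?thesis by (rule vector_derivative_unique_at[symmetric])
qed

text \<open>
  Additivity in the direction holds because the derivative is locally Lipschitz in the base point.
\<close>

lemma form_derivative_add:
  assumes \<tau>: "form_derivative \<tau> \<tau>'" and \<tau>': "Cn (Suc n) \<tau>'" and M: "\<And>i. norm (\<eta> i) \<le> M"
  shows "\<tau>' x (case_nat (h + h') \<eta>) = \<tau>' x (case_nat h \<eta>) + \<tau>' x (case_nat h' \<eta>)"
proof (rule Cn_Suc_lipschitz[OF \<tau>', where x = x and M = "max M (norm h')"])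
  fix r K assume rK: "r > 0" "K > 0" and lip: "\<And>y z \<eta>. norm (y - x) < r \<Longrightarrow> norm (z - x) < r \<Longrightarrow>
      (\<And>i. norm (\<eta> i) \<le> max M (norm h')) \<Longrightarrow> norm (\<tau>' y \<eta> - \<tau>' z \<eta>) \<le> K * norm (y - z)"
  let ?\<zeta> = "case_nat h' \<eta>"
  have \<zeta>: "norm (?\<zeta> i) \<le> max M (norm h')" for i
    using M by (cases i) (auto simp: max.coboundedI1)
  \<comment> \<open>For \<open>\<bar>s\<bar> < r / N\<close> the whole parallelogram spanned by
    \<open>s *\<^sub>R h\<close> and \<open>s *\<^sub>R h'\<close> stays inside the ball of radius
    \<open>r\<close>; the 1 only makes \<open>N\<close> positive.\<close>
  define N where "N = norm h + norm h' + 1"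
  have N: "N > 0" unfolding N_def using norm_ge_zero[of h] norm_ge_zero[of h'] by linarith
  \<comment> \<open>The derivative of \<theta> at 0 is computed twice: by the Lipschitz estimate it
    is the derivative in direction \<open>h'\<close> at \<open>x\<close>, by subtraction it is the
    difference of the derivatives along \<open>h + h'\<close> and along \<open>h\<close>.\<close>
  define \<theta> where "\<theta> = (\<lambda>s. \<tau> (x + s *\<^sub>R (h + h')) \<eta> - \<tau> (x + s *\<^sub>R h) \<eta>)"
  have "(\<theta> has_vector_derivative \<tau>' x ?\<zeta>) (at 0)"
  proof (rule has_vector_derivative_quadratic[where d = "r / N" and L = "K * (norm h + norm h')"])
    fix s :: real assume s: "\<bar>s\<bar> < r / N"
    then have sN: "\<bar>s\<bar> * N < r" using N by (simp add: pos_less_divide_eq)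
    have near: "norm ((x + s *\<^sub>R h + c *\<^sub>R h') - x) < r" if "\<bar>c\<bar> \<le> \<bar>s\<bar>" for c
    proof -
      have "norm ((x + s *\<^sub>R h + c *\<^sub>R h') - x) \<le> \<bar>s\<bar> * norm h + \<bar>c\<bar> * norm h'"
        by (simp add: add.assoc norm_triangle_le)
      also have "\<dots> \<le> \<bar>s\<bar> * norm h + \<bar>s\<bar> * norm h'"
        using that by (intro add_mono mult_right_mono) auto
      also have "\<dots> \<le> \<bar>s\<bar> * N" unfolding N_def by (simp add: algebra_simps)
      finally show ?thesis using sN by simp
    qed
    have "norm (\<tau> (x + s *\<^sub>R h + s *\<^sub>R h') \<eta> - \<tau> (x + s *\<^sub>R h + 0 *\<^sub>R h') \<eta>
        - (s - 0) *\<^sub>R \<tau>' (x + s *\<^sub>R h + 0 *\<^sub>R h') ?\<zeta>) \<le> norm (s - 0) * (K * (\<bar>s\<bar> * norm h'))"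
    proof (rule vector_differentiable_bound_linearization[where S = "closed_segment 0 s" and
          f = "\<lambda>c. \<tau> (x + s *\<^sub>R h + c *\<^sub>R h') \<eta>" and f' = "\<lambda>c. \<tau>' (x + s *\<^sub>R h + c *\<^sub>R h') ?\<zeta>"])
      fix c assume "c \<in> closed_segment 0 s"
      then have c: "\<bar>c\<bar> \<le> \<bar>s\<bar>" by (auto simp: closed_segment_eq_real_ivl split: if_splits)
      show "((\<lambda>c. \<tau> (x + s *\<^sub>R h + c *\<^sub>R h') \<eta>) has_vector_derivative \<tau>' (x + s *\<^sub>R h + c *\<^sub>R h') ?\<zeta>)
          (at c within closed_segment 0 s)"
        by (rule has_vector_derivative_at_within[OF form_derivative_line[OF \<tau>]])
      have "norm (\<tau>' (x + s *\<^sub>R h + c *\<^sub>R h') ?\<zeta> - \<tau>' (x + s *\<^sub>R h + 0 *\<^sub>R h') ?\<zeta>)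
          \<le> K * norm ((x + s *\<^sub>R h + c *\<^sub>R h') - (x + s *\<^sub>R h + 0 *\<^sub>R h'))"
        by (rule lip[OF near near \<zeta>]) (use c in auto)
      also have "\<dots> \<le> K * (\<bar>s\<bar> * norm h')"
        using rK c by (auto intro!: mult_left_mono mult_right_mono)
      finally show "norm (\<tau>' (x + s *\<^sub>R h + c *\<^sub>R h') ?\<zeta> - \<tau>' (x + s *\<^sub>R h + 0 *\<^sub>R h') ?\<zeta>) \<le> K * (\<bar>s\<bar> * norm h')" .
    qed auto
    moreover have "norm (s *\<^sub>R (\<tau>' (x + s *\<^sub>R h) ?\<zeta> - \<tau>' x ?\<zeta>)) \<le> \<bar>s\<bar> * (K * (\<bar>s\<bar> * norm h))"
    proof -
      have "norm (\<tau>' (x + s *\<^sub>R h) ?\<zeta> - \<tau>' x ?\<zeta>) \<le> K * norm ((x + s *\<^sub>R h) - x)"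
        using near[of 0] rK(1) by (intro lip \<zeta>) simp_all
      then show ?thesis by (simp add: mult_left_mono)
    qed
    moreover have "\<theta> s - \<theta> 0 - s *\<^sub>R \<tau>' x ?\<zeta> =
        (\<tau> (x + s *\<^sub>R h + s *\<^sub>R h') \<eta> - \<tau> (x + s *\<^sub>R h) \<eta> - s *\<^sub>R \<tau>' (x + s *\<^sub>R h) ?\<zeta>)
        + s *\<^sub>R (\<tau>' (x + s *\<^sub>R h) ?\<zeta> - \<tau>' x ?\<zeta>)"
      by (simp add: \<theta>_def algebra_simps)
    ultimately have "norm (\<theta> s - \<theta> 0 - s *\<^sub>R \<tau>' x ?\<zeta>)
        \<le> \<bar>s\<bar> * (K * (\<bar>s\<bar> * norm h')) + \<bar>s\<bar> * (K * (\<bar>s\<bar> * norm h))"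
      using norm_triangle_mono by (simp only: diff_zero scaleR_zero_left add.right_neutral real_norm_def)
    also have "\<dots> = K * (norm h + norm h') * s\<^sup>2"
    proof -
      have "\<bar>s\<bar> * \<bar>s\<bar> = s\<^sup>2" by (simp add: power2_eq_square)
      then show ?thesis by (metis (no_types, opaque_lifting) add.commute distrib_left mult.assoc mult.commute)
    qed
    finally show "norm (\<theta> s - \<theta> 0 - s *\<^sub>R \<tau>' x ?\<zeta>) \<le> K * (norm h + norm h') * s\<^sup>2" .
  qed (use rK N in simp)
  moreover have "(\<theta> has_vector_derivative \<tau>' x (case_nat (h + h') \<eta>) - \<tau>' x (case_nat h \<eta>)) (at 0)"
    unfolding \<theta>_def using \<tau> unfolding form_derivative_def by (intro has_vector_derivative_diff) simp_all
  ultimately have "\<tau>' x (case_nat (h + h') \<eta>) - \<tau>' x (case_nat h \<eta>) = \<tau>' x ?\<zeta>"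
    by (rule vector_derivative_unique_at[symmetric])
  then show ?thesis by (simp add: algebra_simps)
qed

text \<open>Replaces the existential quantifier in \<open>Cn\<close> by a function, so that higher
  derivatives are a plain recursion; wherever a \<open>form_derivative\<close> exists, it is this
  one.\<close>

definition line_derivative ::
    "('a::real_normed_vector \<Rightarrow> (nat \<Rightarrow> 'a) \<Rightarrow> 'b::real_normed_vector) \<Rightarrow> 'a \<Rightarrow> (nat \<Rightarrow> 'a) \<Rightarrow> 'b" where
  "line_derivative \<tau> x \<eta> = vector_derivative (\<lambda>s. \<tau> (x + s *\<^sub>R \<eta> 0) (\<lambda>i. \<eta> (Suc i))) (at 0)"

primrec iterated_derivative ::
    "('a::real_normed_vector \<Rightarrow> 'b::real_normed_vector) \<Rightarrow> nat \<Rightarrow> 'a \<Rightarrow> (nat \<Rightarrow> 'a) \<Rightarrow> 'b" where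
  "iterated_derivative f 0 = (\<lambda>x \<eta>. f x)"
| "iterated_derivative f (Suc k) = line_derivative (iterated_derivative f k)"

lemma line_derivative_eq: "form_derivative \<tau> \<tau>' \<Longrightarrow> line_derivative \<tau> = \<tau>'"
proof (intro ext)
  fix x and \<eta> :: "nat \<Rightarrow> 'a" assume "form_derivative \<tau> \<tau>'"
  then have "((\<lambda>s. \<tau> (x + s *\<^sub>R \<eta> 0) (\<lambda>i. \<eta> (Suc i))) has_vector_derivative
      \<tau>' x (case_nat (\<eta> 0) (\<lambda>i. \<eta> (Suc i)))) (at 0)"
    unfolding form_derivative_def by blast
  from vector_derivative_at[OF this] show "line_derivative \<tau> x \<eta> = \<tau>' x \<eta>"
    unfolding line_derivative_def by (simp add: case_nat_eta)
qed

lemma Cn_line_derivative: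
  assumes "Cn (Suc n) \<tau>"
  shows "Cn n (line_derivative \<tau>)" "form_derivative \<tau> (line_derivative \<tau>)"
  using Cn_SucD[OF assms] line_derivative_eq by blast+

lemma iterated_derivative_Cn:
  assumes "\<And>n. Cn n (\<lambda>x \<eta>. f x)"
  shows "Cn n (iterated_derivative f k)"
  by (induction k arbitrary: n) (auto intro: Cn_line_derivative assms)

lemma iterated_derivative_form_derivative:
  assumes "\<And>n. Cn n (\<lambda>x \<eta>. f x)"
  shows "form_derivative (iterated_derivative f k) (iterated_derivative f (Suc k))"
  using Cn_line_derivative(2)[OF iterated_derivative_Cn[OF assms]] by simp

text \<open>Slot 0 is handled by \<open>form_derivative_add\<close> and
  \<open>form_derivative_scale\<close>. A later slot is linear because the previous derivative is
  linear in it at every point of the line along \<open>\<eta> 0\<close>, and linearity survives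
  differentiation along that line. Boundedness of \<eta> is what the local bounds of forms
  presuppose.\<close>

lemma iterated_derivative_linear:
  assumes f: "\<And>n. Cn n (\<lambda>x \<eta>. f x)"
  shows "j < k \<Longrightarrow> (\<And>i. norm (\<eta> i) \<le> M) \<Longrightarrow> linear (\<lambda>h. iterated_derivative f k x (\<eta>(j := h)))"
proof (induction k arbitrary: x \<eta> j)
  case (Suc k)
  let ?\<zeta> = "\<lambda>i. \<eta> (Suc i)"
  note fd = iterated_derivative_form_derivative[OF f, of k]
  show ?case
  proof (cases j)
    case 0
    have eq: "\<eta>(j := h) = case_nat h ?\<zeta>" for h by (auto simp: 0 split: nat.splits)
    show ?thesis unfolding eq
      by (rule linearI[OF form_derivative_add[OF fd iterated_derivative_Cn[OF f] Suc.prems(2)]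
            form_derivative_scale[OF fd]])
  next
    case (Suc j')
    have eq: "\<eta>(j := h) = case_nat (\<eta> 0) (?\<zeta>(j' := h))" for h by (auto simp: Suc split: nat.splits)
    have lin: "linear (\<lambda>h. iterated_derivative f k y (?\<zeta>(j' := h)))" for y
      using Suc.prems Suc by (intro Suc.IH) auto
    have d: "((\<lambda>s. iterated_derivative f k (x + s *\<^sub>R \<eta> 0) (?\<zeta>(j' := h))) has_vector_derivative
        iterated_derivative f (Suc k) x (\<eta>(j := h))) (at 0)" for h
      using fd unfolding form_derivative_def eq by blast
    show ?thesis
    proof (rule linearI)
      fix a b
      have "((\<lambda>s. iterated_derivative f k (x + s *\<^sub>R \<eta> 0) (?\<zeta>(j' := a + b))) has_vector_derivative
        iterated_derivative f (Suc k) x (\<eta>(j := a)) + iterated_derivative f (Suc k) x (\<eta>(j := b))) (at 0)"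
        unfolding linear_add[OF lin] by (intro has_vector_derivative_add d)
      then show "iterated_derivative f (Suc k) x (\<eta>(j := a + b)) =
          iterated_derivative f (Suc k) x (\<eta>(j := a)) + iterated_derivative f (Suc k) x (\<eta>(j := b))"
        using d by (rule vector_derivative_unique_at[symmetric])
    next
      fix c b
      have "((\<lambda>s. iterated_derivative f k (x + s *\<^sub>R \<eta> 0) (?\<zeta>(j' := c *\<^sub>R b))) has_vector_derivative
        c *\<^sub>R iterated_derivative f (Suc k) x (\<eta>(j := b))) (at 0)"
        unfolding linear_scale[OF lin] using bounded_linear.has_vector_derivative[OF bounded_linear_scaleR_right d] .
      then show "iterated_derivative f (Suc k) x (\<eta>(j := c *\<^sub>R b)) = c *\<^sub>R iterated_derivative f (Suc k) x (\<eta>(j := b))"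
        using d by (rule vector_derivative_unique_at[symmetric])
    qed
  qed
qed simp

text \<open>Filling up with 0 keeps the sequence of directions bounded, as the local bounds of forms
  require.\<close>

definition pad :: "'a::real_normed_vector list \<Rightarrow> nat \<Rightarrow> 'a" where
  "pad hs i = (if i < length hs then hs ! i else 0)"

lemma pad_Cons: "pad (h # hs) = case_nat h (pad hs)"
  by (auto simp: pad_def split: nat.splits)

lemma pad_middle: "pad (us @ h # vs) = (pad (us @ 0 # vs))(length us := h)"
  by (auto simp: pad_def nth_append nth_Cons split: nat.splits)

lemma pad_bounded: "(\<forall>h\<in>set hs. norm h \<le> M) \<Longrightarrow> 0 \<le> M \<Longrightarrow> norm (pad hs i) \<le> M"
  by (auto simp: pad_def)

lemma pad_bounded_ex: "norm (pad hs i) \<le> sum_list (map norm hs)"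
proof (induction hs arbitrary: i)
  case (Cons h hs)
  have "0 \<le> sum_list (map norm hs)" by (rule sum_list_nonneg) auto
  then show ?case using Cons.IH[of "i - 1"] by (cases i) (auto simp: pad_Cons intro: add_increasing)
qed (simp add: pad_def)

text \<open>The Frechet estimate comes from the Lipschitz bound of the next derivative: along the
  segment from \<open>x\<close> to \<open>x + h\<close> the remainder is at most
  \<open>K * (norm h)\<^sup>2\<close>, uniformly over directions of norm at most 1, and
  \<open>norm h < e / K\<close> turns this into \<open>e * norm h\<close>.\<close>

lemma Cn_imp_smooth:
  fixes f :: "'a::real_normed_vector \<Rightarrow> 'b::real_normed_vector"
  assumes f: "\<And>n. Cn n (\<lambda>x \<eta>. f x)"
  shows "smooth f"
proof -
  define D where "D = (\<lambda>x hs. iterated_derivative f (length hs) x (pad hs))"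
  have lin: "linear (\<lambda>h. D x (us @ h # vs))" for x us vs
  proof -
    have "linear (\<lambda>h. iterated_derivative f (length us + Suc (length vs)) x ((pad (us @ 0 # vs))(length us := h)))"
      by (rule iterated_derivative_linear[OF f _ pad_bounded_ex]) simp
    then show ?thesis by (simp add: D_def pad_middle[symmetric])
  qed
  have "bounded_multilinear k (D x)" for k x
  proof -
    obtain r K where rK: "r > 0" "\<forall>y \<eta>. norm (y - x) < r \<longrightarrow> (\<forall>i. norm (\<eta> i) \<le> 1) \<longrightarrow>
        norm (iterated_derivative f k y \<eta>) \<le> K"
      using locally_bounded_formD[OF Cn_locally_bounded[OF iterated_derivative_Cn[OF f, of 0 k]], of x 1]
      by (elim exE conjE) (rule that)
    have "norm (D x hs) \<le> K * prod_list (map norm hs)" if "length hs = k" for hs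
    proof (rule multilinear_bound[OF lin _ that])
      fix hs :: "'a list" assume "length hs = k" "\<forall>h\<in>set hs. norm h \<le> 1"
      then show "norm (D x hs) \<le> K"
        unfolding D_def using rK by (simp add: pad_bounded)
    qed
    with lin show ?thesis unfolding bounded_multilinear_def by blast
  qed
  moreover have "\<exists>d>0. \<forall>h. norm h < d \<longrightarrow> (\<forall>hs. length hs = k \<longrightarrow>
       norm (D (x + h) hs - D x hs - D x (h # hs)) \<le> e * norm h * prod_list (map norm hs))"
    if e: "e > 0" for k and x :: 'a and e :: real
  proof (rule Cn_Suc_lipschitz[OF iterated_derivative_Cn[OF f, of "Suc 0" "Suc k"], where x = x and M = 1])
    fix r K assume rK: "r > 0" "K > 0" and lip: "\<And>y z \<eta>. norm (y - x) < r \<Longrightarrow> norm (z - x) < r \<Longrightarrow>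
      (\<And>i. norm (\<eta> i) \<le> 1) \<Longrightarrow>
      norm (iterated_derivative f (Suc k) y \<eta> - iterated_derivative f (Suc k) z \<eta>) \<le> K * norm (y - z)"
    show ?thesis
    proof (rule exI[of _ "min r (e / K)"], intro conjI allI impI)
      fix h :: 'a and hs :: "'a list" assume h: "norm h < min r (e / K)" and len: "length hs = k"
      show "norm (D (x + h) hs - D x hs - D x (h # hs)) \<le> e * norm h * prod_list (map norm hs)"
      \<comment> \<open>The remainder is itself multilinear in \<open>hs\<close>, so directions of
        norm at most 1 suffice.\<close>
      proof (rule multilinear_bound[OF _ _ len])
        fix us vs :: "'a list"
        show "linear (\<lambda>g. D (x + h) (us @ g # vs) - D x (us @ g # vs) - D x (h # us @ g # vs))"
          using lin[of _ "h # us"] by (intro linear_compose_sub lin) simp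
      next
        fix hs :: "'a list" assume len: "length hs = k" and le: "\<forall>h\<in>set hs. norm h \<le> 1"
        let ?l = "norm h" and ?e = "sgn h" and ?F = "iterated_derivative f k" and ?F' = "iterated_derivative f (Suc k)"
        have h': "h = ?l *\<^sub>R ?e" by (cases "h = 0") (simp_all add: sgn_div_norm)
        have pad: "norm (pad (?e # hs) i) \<le> 1" for i
          using le by (intro pad_bounded) (auto simp: norm_sgn)
        note fd = iterated_derivative_form_derivative[OF f, of k]
        have near: "norm (x + c *\<^sub>R ?e - x) < r" if "\<bar>c\<bar> \<le> ?l" for c
          using that h rK(1) by (auto simp: norm_sgn)
        have "norm (?F (x + ?l *\<^sub>R ?e) (pad hs) - ?F (x + 0 *\<^sub>R ?e) (pad hs) -
           (?l - 0) *\<^sub>R ?F' (x + 0 *\<^sub>R ?e) (pad (?e # hs))) \<le> norm (?l - 0) * (K * ?l)"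
        proof (rule vector_differentiable_bound_linearization[where S = "{0..?l}" and
              f = "\<lambda>c. ?F (x + c *\<^sub>R ?e) (pad hs)" and f' = "\<lambda>c. ?F' (x + c *\<^sub>R ?e) (pad (?e # hs))"])
          fix c assume c: "c \<in> {0..?l}"
          show "((\<lambda>c. ?F (x + c *\<^sub>R ?e) (pad hs)) has_vector_derivative ?F' (x + c *\<^sub>R ?e) (pad (?e # hs))) (at c within {0..?l})"
            unfolding pad_Cons by (rule has_vector_derivative_at_within[OF form_derivative_line[OF fd]])
          have "norm (?F' (x + c *\<^sub>R ?e) (pad (?e # hs)) - ?F' (x + 0 *\<^sub>R ?e) (pad (?e # hs)))
            \<le> K * norm ((x + c *\<^sub>R ?e) - (x + 0 *\<^sub>R ?e))"
            by (rule lip[OF near near pad]) (use c in auto)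
          also have "\<dots> \<le> K * ?l"
            using rK c by (intro mult_left_mono) (auto simp: norm_sgn)
          finally show "norm (?F' (x + c *\<^sub>R ?e) (pad (?e # hs)) - ?F' (x + 0 *\<^sub>R ?e) (pad (?e # hs))) \<le> K * ?l" .
        qed (auto simp: closed_segment_eq_real_ivl)
        moreover have "?l *\<^sub>R ?F' x (pad (?e # hs)) = ?F' x (pad (h # hs))"
          using form_derivative_scale[OF fd, of x ?l ?e "pad hs"] h' by (simp add: pad_Cons)
        ultimately have "norm (D (x + h) hs - D x hs - D x (h # hs)) \<le> ?l * (K * ?l)"
          using len by (simp add: D_def h'[symmetric] del: iterated_derivative.simps)
        also have "\<dots> \<le> ?l * e"
          using h rK(2) by (intro mult_left_mono) (auto simp: field_simps)
        finally show "norm (D (x + h) hs - D x hs - D x (h # hs)) \<le> e * norm h" by (simp add: mult.commute)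
      qed
    qed (use rK e in simp)
  qed
  ultimately show ?thesis
    unfolding smooth_def by (intro exI[of _ D]) (auto simp: D_def)
qed

lemma smooth_iff_Cn: "smooth f \<longleftrightarrow> (\<forall>n. Cn n (\<lambda>x \<eta>. f x))"
  using smooth_imp_Cn Cn_imp_smooth by blast

section \<open>The chain rule for towers\<close>

lemma has_vector_derivative_quotient_iff:
  fixes f :: "real \<Rightarrow> 'b::real_normed_vector"
  shows "(f has_vector_derivative d) (at 0) \<longleftrightarrow> ((\<lambda>s. (f s - f 0) /\<^sub>R s) \<longlongrightarrow> d) (at 0)"
proof -
  have "(f has_vector_derivative d) (at 0) \<longleftrightarrow> ((\<lambda>h. norm (f h - f 0 - h *\<^sub>R d) / norm h) \<longlongrightarrow> 0) (at 0)"
    unfolding has_vector_derivative_def has_derivative_at by (simp add: bounded_linear_scaleR_left)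
  also have "\<dots> \<longleftrightarrow> ((\<lambda>s. norm ((f s - f 0) /\<^sub>R s - d)) \<longlongrightarrow> 0) (at 0)"
  proof (rule filterlim_cong)
    have "norm (f h - f 0 - h *\<^sub>R d) / norm h = norm ((f h - f 0) /\<^sub>R h - d)" if "h \<noteq> 0" for h
    proof -
      have "(f h - f 0) /\<^sub>R h - d = (f h - f 0 - h *\<^sub>R d) /\<^sub>R h"
        using that by (simp add: algebra_simps)
      then show ?thesis by (simp add: divide_inverse mult.commute)
    qed
    then show "\<forall>\<^sub>F h in at 0. norm (f h - f 0 - h *\<^sub>R d) / norm h = norm ((f h - f 0) /\<^sub>R h - d)"
      unfolding eventually_at by (intro exI[of _ 1]) simp
  qed simp_all
  also have "\<dots> \<longleftrightarrow> ((\<lambda>s. (f s - f 0) /\<^sub>R s) \<longlongrightarrow> d) (at 0)"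
    by (simp add: tendsto_norm_zero_iff LIM_zero_iff)
  finally show ?thesis .
qed

lemma tendsto_prod_list_norm:
  assumes "list_all2 (\<lambda>c l. (c \<longlongrightarrow> l) F) cs ls"
  shows "((\<lambda>s. prod_list (map norm (map (\<lambda>c. c s) cs))) \<longlongrightarrow> prod_list (map norm ls)) F"
  using assms by (induction rule: list_all2_induct) (auto intro!: tendsto_mult tendsto_norm)

text \<open>One slot at a time: the first argument splits as \<open>(c s - l) + l\<close>. The first
  part is killed by the norm bound, the second has a fixed first argument and falls under the
  induction hypothesis.\<close>

lemma tendsto_multilinear:
  assumes "list_all2 (\<lambda>c l. (c \<longlongrightarrow> l) F) cs ls"
    and "bounded_multilinear (length cs) T"
  shows "((\<lambda>s. T (map (\<lambda>c. c s) cs)) \<longlongrightarrow> T ls) F"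
  using assms
proof (induction arbitrary: T rule: list_all2_induct)
  case Nil
  then show ?case by simp
next
  case (Cons c cs l ls)
  have lin: "linear (\<lambda>h. T (us @ h # vs))" if "length us + length vs = length cs" for us vs
    using Cons.prems that unfolding bounded_multilinear_def by simp
  obtain K where K: "\<And>hs. length hs = Suc (length cs) \<Longrightarrow> norm (T hs) \<le> K * prod_list (map norm hs)"
    using Cons.prems unfolding bounded_multilinear_def by auto
  have "bounded_multilinear (length cs) (\<lambda>hs. T (l # hs))"
    unfolding bounded_multilinear_def
  proof (intro conjI allI impI)
    fix us vs :: "'b list" assume "length us + Suc (length vs) = length cs"
    then show "linear (\<lambda>h. T (l # us @ h # vs))" using lin[of "l # us" vs] by simp
  next
    show "\<exists>K. \<forall>hs. length hs = length cs \<longrightarrow> norm (T (l # hs)) \<le> K * prod_list (map norm hs)"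
    proof (intro exI[of _ "K * norm l"] allI impI)
      fix hs :: "'b list" assume "length hs = length cs"
      then show "norm (T (l # hs)) \<le> K * norm l * prod_list (map norm hs)"
        using K[of "l # hs"] by (simp add: mult.assoc)
    qed
  qed
  from Cons.IH[OF this] have 1: "((\<lambda>s. T (l # map (\<lambda>c. c s) cs)) \<longlongrightarrow> T (l # ls)) F" .
  have "((\<lambda>s. T ((c s - l) # map (\<lambda>c. c s) cs)) \<longlongrightarrow> 0) F"
  proof (rule Lim_null_comparison)
    show "\<forall>\<^sub>F s in F. norm (T ((c s - l) # map (\<lambda>c. c s) cs))
        \<le> K * (norm (c s - l) * prod_list (map norm (map (\<lambda>c. c s) cs)))"
    proof (rule always_eventually, rule allI)
      fix s show "norm (T ((c s - l) # map (\<lambda>c. c s) cs))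
        \<le> K * (norm (c s - l) * prod_list (map norm (map (\<lambda>c. c s) cs)))"
        using K[of "(c s - l) # map (\<lambda>c. c s) cs"] by simp
    qed
    have "((\<lambda>s. c s - l) \<longlongrightarrow> 0) F" using Cons.hyps(1) by (simp add: LIM_zero)
    from tendsto_mult[OF tendsto_norm_zero[OF this] tendsto_prod_list_norm[OF Cons.hyps(2)]]
    have "((\<lambda>s. norm (c s - l) * prod_list (map norm (map (\<lambda>c. c s) cs))) \<longlongrightarrow> 0) F" by simp
    from tendsto_mult_right_zero[OF this]
    show "((\<lambda>s. K * (norm (c s - l) * prod_list (map norm (map (\<lambda>c. c s) cs)))) \<longlongrightarrow> 0) F" .
  qed
  from tendsto_add[OF this 1]
  have "((\<lambda>s. T ((c s - l) # map (\<lambda>c. c s) cs) + T (l # map (\<lambda>c. c s) cs)) \<longlongrightarrow> T (l # ls)) F" by simp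
  moreover have "T ((c s - l) # map (\<lambda>c. c s) cs) + T (l # map (\<lambda>c. c s) cs) = T (map (\<lambda>c. c s) (c # cs))" for s
    using linear_add[OF lin[of "[]" "map (\<lambda>c. c s) cs"], of "c s - l" l] by simp
  ultimately show ?case by simp
qed

text \<open>Product rule. The first slot is split into increment and initial value; the difference
  quotient of the increment converges to \<open>d\<close> while the other slots converge to their
  values at 0, so \<open>tendsto_multilinear\<close> gives the first summand.\<close>

lemma multilinear_curve_derivative:
  assumes "list_all2 (\<lambda>c d. (c has_vector_derivative d) (at 0)) cs ds"
    and "bounded_multilinear (length cs) T"
  shows "((\<lambda>s. T (map (\<lambda>c. c s) cs)) has_vector_derivative
      (\<Sum>i<length cs. T ((map (\<lambda>c. c 0) cs)[i := ds ! i]))) (at (0::real))"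
  using assms
proof (induction arbitrary: T rule: list_all2_induct)
  case Nil
  then show ?case by simp
next
  case (Cons c cs d ds)
  have lin: "linear (\<lambda>h. T (us @ h # vs))" if "length us + length vs = length cs" for us vs
    using Cons.prems that unfolding bounded_multilinear_def by simp
  have lin0: "linear (\<lambda>h. T (h # vs))" if "length vs = length cs" for vs
    using lin[of "[]" vs] that by simp
  obtain K where K: "\<And>hs. length hs = Suc (length cs) \<Longrightarrow> norm (T hs) \<le> K * prod_list (map norm hs)"
    using Cons.prems unfolding bounded_multilinear_def by auto
  have "bounded_multilinear (length cs) (\<lambda>hs. T (c 0 # hs))"
    unfolding bounded_multilinear_def
  proof (intro conjI allI impI)
    fix us vs :: "'a list" assume "length us + Suc (length vs) = length cs"
    then show "linear (\<lambda>h. T (c 0 # us @ h # vs))" using lin[of "c 0 # us" vs] by simp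
  next
    show "\<exists>K. \<forall>hs. length hs = length cs \<longrightarrow> norm (T (c 0 # hs)) \<le> K * prod_list (map norm hs)"
    proof (intro exI[of _ "K * norm (c 0)"] allI impI)
      fix hs :: "'a list" assume "length hs = length cs"
      then show "norm (T (c 0 # hs)) \<le> K * norm (c 0) * prod_list (map norm hs)"
        using K[of "c 0 # hs"] by (simp add: mult.assoc)
    qed
  qed
  from Cons.IH[OF this] have 1: "((\<lambda>s. T (c 0 # map (\<lambda>c. c s) cs)) has_vector_derivative
      (\<Sum>i<length cs. T (c 0 # (map (\<lambda>c. c 0) cs)[i := ds ! i]))) (at 0)" .
  have "list_all2 (\<lambda>c l. (c \<longlongrightarrow> l) (at 0)) cs (map (\<lambda>c. c 0) cs)"
    using Cons.hyps(2)
  proof (induction rule: list_all2_induct)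
    case (Cons c cs d ds)
    then have "isCont c 0" using has_vector_derivative_continuous by blast
    with Cons show ?case by (simp add: isCont_def)
  qed simp
  then have "list_all2 (\<lambda>c l. (c \<longlongrightarrow> l) (at 0)) ((\<lambda>s. (c s - c 0) /\<^sub>R s) # cs) (d # map (\<lambda>c. c 0) cs)"
    using Cons.hyps(1) by (simp add: has_vector_derivative_quotient_iff)
  from tendsto_multilinear[OF this, of T] Cons.prems
  have "((\<lambda>s. T (((c s - c 0) /\<^sub>R s) # map (\<lambda>c. c s) cs)) \<longlongrightarrow> T (d # map (\<lambda>c. c 0) cs)) (at 0)" by simp
  then have 2: "((\<lambda>s. T ((c s - c 0) # map (\<lambda>c. c s) cs)) has_vector_derivative T (d # map (\<lambda>c. c 0) cs)) (at 0)"
    unfolding has_vector_derivative_quotient_iff by (simp add: linear_scale[OF lin0] linear_0[OF lin0])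
  have "T ((c s - c 0) # map (\<lambda>c. c s) cs) + T (c 0 # map (\<lambda>c. c s) cs) = T (map (\<lambda>c. c s) (c # cs))" for s
    using linear_add[OF lin0[of "map (\<lambda>c. c s) cs"], of "c s - c 0" "c 0"] by simp
  with has_vector_derivative_add[OF 2 1] show ?case
    by (simp add: sum.lessThan_Suc_shift del: sum.lessThan_Suc)
qed

lemma tower_curve_derivative:
  assumes D: "derivative_tower D" and b: "(b has_vector_derivative b') (at 0)"
    and cs: "list_all2 (\<lambda>c d. (c has_vector_derivative d) (at 0)) cs ds"
  shows "((\<lambda>s. D (b s) (map (\<lambda>c. c s) cs)) has_vector_derivative
      D (b 0) (b' # map (\<lambda>c. c 0) cs) + (\<Sum>i<length cs. D (b 0) ((map (\<lambda>c. c 0) cs)[i := ds ! i]))) (at (0::real))"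
proof -
  have ml: "bounded_multilinear k (D x)" for k x using D unfolding derivative_tower_def by blast
  let ?r = "\<lambda>s. map (\<lambda>c. c s) cs"
  let ?q = "\<lambda>s. (b s - b 0) /\<^sub>R s"
  have bcont: "(b \<longlongrightarrow> b 0) (at 0)"
    using has_vector_derivative_continuous[OF b] by (simp add: isCont_def)
  have ccont: "list_all2 (\<lambda>c l. (c \<longlongrightarrow> l) (at 0)) cs (?r 0)"
    using cs
  proof (induction rule: list_all2_induct)
    case (Cons c cs d ds)
    then have "isCont c 0" using has_vector_derivative_continuous by blast
    with Cons show ?case by (simp add: isCont_def)
  qed simp
  \<comment> \<open>\<open>E\<close> is the Frechet remainder for the moving base point, taken at
    the directions of time \<open>s\<close>; it is \<open>o(s)\<close>. The rest of the increment is
    multilinear at the fixed point \<open>b 0\<close>.\<close>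
  define E where "E = (\<lambda>s. D (b s) (?r s) - D (b 0) (?r s) - D (b 0) ((b s - b 0) # ?r s))"
  have E0: "E 0 = 0" unfolding E_def by (simp add: linear_0[OF tower_linear_Cons[OF D]])
  have "((\<lambda>s. E s /\<^sub>R s) \<longlongrightarrow> 0) (at 0)"
  proof (rule tendstoI)
    fix e :: real assume e: "e > 0"
    \<comment> \<open>Near 0 the norm of the difference quotient of \<open>b\<close> and the product
      of the norms stay below the two factors of \<open>L\<close>; the 2 in
      \<open>e / (2 * L)\<close> leaves room for a strict inequality.\<close>
    define L where "L = (norm b' + 1) * (prod_list (map norm (?r 0)) + 1)"
    have L: "L > 0" unfolding L_def using prod_list_norm_nonneg[of "?r 0"]
      by (intro mult_pos_pos) (auto simp: add_nonneg_pos)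
    have "e / (2 * L) > 0" using e L by simp
    then obtain \<delta> where \<delta>: "\<delta> > 0" "\<And>h hs. norm h < \<delta> \<Longrightarrow> length hs = length cs \<Longrightarrow>
       norm (D (b 0 + h) hs - D (b 0) hs - D (b 0) (h # hs)) \<le> e / (2 * L) * norm h * prod_list (map norm hs)"
      using tower_approx[OF D, where e = "e / (2 * L)" and x = "b 0" and k = "length cs"] by blast
    have "\<forall>\<^sub>F s in at 0. norm (b s - b 0) < \<delta>"
      using tendstoD[OF bcont \<delta>(1)] by (simp add: dist_norm)
    moreover have "\<forall>\<^sub>F s in at 0. norm (?q s) < norm b' + 1"
      using tendsto_norm[OF b[unfolded has_vector_derivative_quotient_iff]] by (rule order_tendstoD(2)) simp
    moreover have "\<forall>\<^sub>F s in at 0. prod_list (map norm (?r s)) < prod_list (map norm (?r 0)) + 1"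
      using tendsto_prod_list_norm[OF ccont] by (rule order_tendstoD(2)) simp
    moreover have "\<forall>\<^sub>F s in at 0. s \<noteq> (0::real)" by (rule eventually_neq_at_within)
    ultimately show "\<forall>\<^sub>F s in at 0. dist (E s /\<^sub>R s) 0 < e"
    proof eventually_elim
      case (elim s)
      have "norm (E s) \<le> e / (2 * L) * norm (b s - b 0) * prod_list (map norm (?r s))"
        using \<delta>(2)[OF elim(1), of "?r s"] unfolding E_def by simp
      then have "norm (E s) / \<bar>s\<bar> \<le> e / (2 * L) * norm (b s - b 0) * prod_list (map norm (?r s)) / \<bar>s\<bar>"
        by (rule divide_right_mono) simp
      also have "\<dots> = e / (2 * L) * ((norm (b s - b 0) / \<bar>s\<bar>) * prod_list (map norm (?r s)))"
        by simp
      also have "norm (b s - b 0) / \<bar>s\<bar> = norm (?q s)"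
        by (simp add: divide_inverse mult.commute)
      also have "e / (2 * L) * (norm (?q s) * prod_list (map norm (?r s))) \<le> e / (2 * L) * L"
      proof (rule mult_left_mono)
        show "norm (?q s) * prod_list (map norm (?r s)) \<le> L"
          unfolding L_def
          by (rule mult_mono[OF less_imp_le[OF elim(2)] less_imp_le[OF elim(3)] _ prod_list_norm_nonneg]) simp
        show "0 \<le> e / (2 * L)" using e L by simp
      qed
      also have "\<dots> = e / 2" using L by simp
      also have "\<dots> < e" using e by simp
      finally have "norm (E s) / \<bar>s\<bar> < e" .
      moreover have "norm (E s /\<^sub>R s) = norm (E s) / \<bar>s\<bar>" by (simp add: divide_inverse mult.commute)
      ultimately show ?case unfolding dist_norm by simp
    qed
  qed
  then have 1: "(E has_vector_derivative 0) (at 0)"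
    unfolding has_vector_derivative_quotient_iff E0 by simp
  have "list_all2 (\<lambda>c d. (c has_vector_derivative d) (at 0)) ((\<lambda>s. b s - b 0) # cs) (b' # ds)"
    using cs has_vector_derivative_diff[OF b has_vector_derivative_const[of "b 0" "at 0"]] by simp
  from multilinear_curve_derivative[OF this, of "D (b 0)", OF ml]
  have 2: "((\<lambda>s. D (b 0) ((b s - b 0) # ?r s)) has_vector_derivative D (b 0) (b' # ?r 0)) (at 0)"
    by (simp add: sum.lessThan_Suc_shift linear_0[OF tower_linear_Cons[OF D]] del: sum.lessThan_Suc)
  note 3 = multilinear_curve_derivative[OF cs, of "D (b 0)", OF ml]
  from has_vector_derivative_add[OF has_vector_derivative_add[OF 1 2] 3]
  show ?thesis unfolding E_def by simp
qed

text \<open>Takes the place of the Faa di Bruno formula. The derivative of such an expression is a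
  sum of expressions of the same kind, with either the derivative of \<open>b\<close> prepended as a
  new direction or one entry of the list differentiated; arbitrary lists are therefore what makes
  the induction close. Continuity of \<open>b\<close> is a separate assumption because
  \<open>Cn 0\<close> yields only a local bound.\<close>

lemma Cn_tower_compose:
  assumes D: "derivative_tower D" and cont: "\<And>x. isCont b x"
  shows "Cn n (\<lambda>x \<eta>. b x) \<Longrightarrow> (\<And>\<tau>. \<tau> \<in> set \<tau>s \<Longrightarrow> Cn n \<tau>) \<Longrightarrow>
    Cn n (\<lambda>x \<eta>. D (b x) (map (\<lambda>\<tau>. \<tau> x \<eta>) \<tau>s))"
proof (induction n arbitrary: \<tau>s)
  have lb: "locally_bounded_form (\<lambda>x \<eta>. D (b x) (map (\<lambda>\<tau>. \<tau> x \<eta>) \<tau>s))"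
    if "\<And>\<tau>. \<tau> \<in> set \<tau>s \<Longrightarrow> locally_bounded_form \<tau>" for \<tau>s
  proof (rule locally_bounded_formI)
    fix x and M :: real
    obtain d K where dK: "d > 0" "K > 0" "\<And>y hs. norm (y - b x) < d \<Longrightarrow> length hs = length \<tau>s \<Longrightarrow>
       norm (D y hs) \<le> K * prod_list (map norm hs)"
      using tower_bound_local[OF D, where x = "b x" and k = "length \<tau>s"] by blast
    obtain r where r: "r > 0" "\<And>y. norm (y - x) < r \<Longrightarrow> norm (b y - b x) < d"
      using cont[of x] dK(1) unfolding continuous_at_eps_delta dist_norm by blast
    have "\<exists>r>0. \<exists>L\<ge>0. \<forall>y \<eta>. norm (y - x) < r \<longrightarrow> (\<forall>i. norm (\<eta> i) \<le> M) \<longrightarrow>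
        prod_list (map norm (map (\<lambda>\<tau>. \<tau> y \<eta>) \<tau>s)) \<le> L"
      using that
    proof (induction \<tau>s)
      case Nil
      show ?case by (rule exI[of _ "1::real"], intro conjI exI[of _ "1::real"]) simp_all
    next
      case (Cons \<tau> \<tau>s)
      have "\<exists>r>0. \<exists>L\<ge>0. \<forall>y \<eta>. norm (y - x) < r \<longrightarrow> (\<forall>i. norm (\<eta> i) \<le> M) \<longrightarrow>
        prod_list (map norm (map (\<lambda>\<tau>. \<tau> y \<eta>) \<tau>s)) \<le> L"
        by (rule Cons.IH) (simp add: Cons.prems)
      then obtain r L where 1: "r > 0" "L \<ge> 0" "\<forall>y \<eta>. norm (y - x) < r \<longrightarrow> (\<forall>i. norm (\<eta> i) \<le> M) \<longrightarrow>
        prod_list (map norm (map (\<lambda>\<tau>. \<tau> y \<eta>) \<tau>s)) \<le> L" by (elim exE conjE) (rule that)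
      obtain r' L' where 2: "r' > 0" "L' > 0" "\<forall>y \<eta>. norm (y - x) < r' \<longrightarrow> (\<forall>i. norm (\<eta> i) \<le> M) \<longrightarrow>
        norm (\<tau> y \<eta>) \<le> L'"
        using locally_bounded_formD[OF Cons.prems[of \<tau>], of x M] by (auto simp del: map_map)
      show ?case
      proof (rule exI[of _ "min r r'"], intro conjI exI[of _ "L' * L"] allI impI)
        fix y and \<eta> :: "nat \<Rightarrow> 'c" assume "norm (y - x) < min r r'" "\<forall>i. norm (\<eta> i) \<le> M"
        then have "norm (\<tau> y \<eta>) * prod_list (map norm (map (\<lambda>\<tau>. \<tau> y \<eta>) \<tau>s)) \<le> L' * L"
          using 1 2 by (intro mult_mono prod_list_norm_nonneg) simp_all
        then show "prod_list (map norm (map (\<lambda>\<tau>. \<tau> y \<eta>) (\<tau> # \<tau>s))) \<le> L' * L" by simp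
      qed (use 1 2 in simp_all)
    qed
    then obtain r' L where L: "r' > 0" "L \<ge> 0" "\<forall>y \<eta>. norm (y - x) < r' \<longrightarrow> (\<forall>i. norm (\<eta> i) \<le> M) \<longrightarrow>
        prod_list (map norm (map (\<lambda>\<tau>. \<tau> y \<eta>) \<tau>s)) \<le> L" by (elim exE conjE) (rule that)
    show "\<exists>r>0. \<exists>K. \<forall>y \<eta>. norm (y - x) < r \<longrightarrow> (\<forall>i. norm (\<eta> i) \<le> M) \<longrightarrow>
        norm (D (b y) (map (\<lambda>\<tau>. \<tau> y \<eta>) \<tau>s)) \<le> K"
    proof (rule exI[of _ "min r r'"], intro conjI exI[of _ "K * L"] allI impI)
      fix y and \<eta> :: "nat \<Rightarrow> 'c" assume y: "norm (y - x) < min r r'" "\<forall>i. norm (\<eta> i) \<le> M"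
      have "norm (D (b y) (map (\<lambda>\<tau>. \<tau> y \<eta>) \<tau>s)) \<le> K * prod_list (map norm (map (\<lambda>\<tau>. \<tau> y \<eta>) \<tau>s))"
        using y r(2) by (intro dK(3)) simp_all
      also have "\<dots> \<le> K * L" using y L dK(2) by (intro mult_left_mono) simp_all
      finally show "norm (D (b y) (map (\<lambda>\<tau>. \<tau> y \<eta>) \<tau>s)) \<le> K * L" .
    qed (use r L in simp_all)
  qed
  {
    case 0
    then show ?case using lb by simp
  next
    case (Suc n)
    obtain b' where b': "form_derivative (\<lambda>x \<eta>. b x) b'" "Cn n b'"
      using Cn_SucD[OF Suc.prems(1)] by blast
    have "\<forall>\<tau>\<in>set \<tau>s. \<exists>\<tau>'. form_derivative \<tau> \<tau>' \<and> Cn n \<tau>'"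
      by (rule ballI, rule Cn_SucD, rule Suc.prems(2))
    from bchoice[OF this] obtain d where "\<forall>\<tau>\<in>set \<tau>s. form_derivative \<tau> (d \<tau>) \<and> Cn n (d \<tau>)"
      by (elim exE) (rule that)
    then have d: "\<And>\<tau>. \<tau> \<in> set \<tau>s \<Longrightarrow> form_derivative \<tau> (d \<tau>)" "\<And>\<tau>. \<tau> \<in> set \<tau>s \<Longrightarrow> Cn n (d \<tau>)"
      by simp_all
    define sh where "sh = (\<lambda>\<tau> :: 'c \<Rightarrow> (nat \<Rightarrow> 'c) \<Rightarrow> 'a. \<lambda>x \<eta>. \<tau> x (\<lambda>i. \<eta> (Suc i)))"
    have sh: "Cn n (sh \<tau>)" if "\<tau> \<in> set \<tau>s" for \<tau>
      unfolding sh_def by (rule Cn_shift[OF Cn_Suc_imp[OF Suc.prems(2)[OF that]]])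
    define \<phi> where "\<phi> = (\<lambda>x \<eta>. D (b x) (map (\<lambda>\<tau>. \<tau> x \<eta>) (b' # map sh \<tau>s)) +
       (\<Sum>i<length \<tau>s. D (b x) (map (\<lambda>\<tau>. \<tau> x \<eta>) ((map sh \<tau>s)[i := d (\<tau>s ! i)]))))"
    have "form_derivative (\<lambda>x \<eta>. D (b x) (map (\<lambda>\<tau>. \<tau> x \<eta>) \<tau>s)) \<phi>"
      unfolding form_derivative_def
    proof (intro allI)
      fix x h and \<eta> :: "nat \<Rightarrow> 'c"
      have 1: "((\<lambda>s. b (x + s *\<^sub>R h)) has_vector_derivative b' x (case_nat h \<eta>)) (at 0)"
        using b'(1) unfolding form_derivative_def by simp
      have 2: "list_all2 (\<lambda>c d. (c has_vector_derivative d) (at 0)) (map (\<lambda>\<tau> s. \<tau> (x + s *\<^sub>R h) \<eta>) \<tau>s)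
         (map (\<lambda>\<tau>. d \<tau> x (case_nat h \<eta>)) \<tau>s)"
        unfolding list_all2_conv_all_nth using d(1) unfolding form_derivative_def by simp
      have upd: "(map (\<lambda>c. c 0) (map (\<lambda>\<tau> s. \<tau> (x + s *\<^sub>R h) \<eta>) \<tau>s))[i := map (\<lambda>\<tau>. d \<tau> x (case_nat h \<eta>)) \<tau>s ! i] =
          map (\<lambda>\<tau>. \<tau> x (case_nat h \<eta>)) ((map sh \<tau>s)[i := d (\<tau>s ! i)])" if "i \<in> {..<length \<tau>s}" for i
        using that by (simp add: map_update sh_def comp_def)
      have "D (b (x + 0 *\<^sub>R h)) (b' x (case_nat h \<eta>) # map (\<lambda>c. c 0) (map (\<lambda>\<tau> s. \<tau> (x + s *\<^sub>R h) \<eta>) \<tau>s)) +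
          (\<Sum>i<length (map (\<lambda>\<tau> s. \<tau> (x + s *\<^sub>R h) \<eta>) \<tau>s). D (b (x + 0 *\<^sub>R h))
            ((map (\<lambda>c. c 0) (map (\<lambda>\<tau> s. \<tau> (x + s *\<^sub>R h) \<eta>) \<tau>s))[i := map (\<lambda>\<tau>. d \<tau> x (case_nat h \<eta>)) \<tau>s ! i]))
          = \<phi> x (case_nat h \<eta>)"
        unfolding \<phi>_def
        by (intro arg_cong2[where f = "(+)"] sum.cong) (simp_all only: upd length_map, simp_all add: sh_def comp_def)
      with tower_curve_derivative[OF D 1 2]
      show "((\<lambda>s. D (b (x + s *\<^sub>R h)) (map (\<lambda>\<tau>. \<tau> (x + s *\<^sub>R h) \<eta>) \<tau>s)) has_vector_derivative \<phi> x (case_nat h \<eta>)) (at 0)"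
        by (simp only: map_map comp_def)
    qed
    moreover have "Cn n \<phi>"
      unfolding \<phi>_def
    proof (rule Cn_add[OF _ Cn_sum])
      show "Cn n (\<lambda>x \<eta>. D (b x) (map (\<lambda>\<tau>. \<tau> x \<eta>) (b' # map sh \<tau>s)))"
        by (rule Suc.IH[OF Cn_Suc_imp[OF Suc.prems(1)]]) (use b' sh in auto)
      fix i assume "i \<in> {..<length \<tau>s}"
      then show "Cn n (\<lambda>x \<eta>. D (b x) (map (\<lambda>\<tau>. \<tau> x \<eta>) ((map sh \<tau>s)[i := d (\<tau>s ! i)])))"
        by (intro Suc.IH[OF Cn_Suc_imp[OF Suc.prems(1)]])
           (use d sh in \<open>auto dest!: set_update_subset_insert[THEN subsetD]\<close>)
    qed
    moreover have "locally_bounded_form (\<lambda>x \<eta>. D (b x) (map (\<lambda>\<tau>. \<tau> x \<eta>) \<tau>s))"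
      by (rule lb) (rule Cn_locally_bounded[OF Suc.prems(2)])
    ultimately show ?case using Cn_SucI by blast
  }
qed

lemma smooth_isCont: "smooth f \<Longrightarrow> isCont f x"
  using smooth_imp_differentiable differentiable_imp_continuous_within by blast

lemma smooth_compose:
  assumes "smooth g" "smooth f"
  shows "smooth (\<lambda>x. g (f x))"
proof -
  obtain D where D: "\<And>x. D x [] = g x" "derivative_tower D"
    using assms(1) unfolding smooth_iff_tower by blast
  have "Cn n (\<lambda>x \<eta>. D (f x) (map (\<lambda>\<tau>. \<tau> x \<eta>) []))" for n
    by (rule Cn_tower_compose[OF D(2)]) (use assms(2) smooth_isCont smooth_imp_Cn in auto)
  then show ?thesis by (intro Cn_imp_smooth) (simp add: D)
qed

section \<open>Smooth maps and diffeomorphisms\<close>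

lemma smooth_const: "smooth (\<lambda>x. c)"
  unfolding smooth_iff_Cn using Cn_const by blast

lemma smooth_ident: "smooth (\<lambda>x. x)"
  unfolding smooth_iff_Cn using Cn_point by blast

lemma smooth_add: "smooth f \<Longrightarrow> smooth g \<Longrightarrow> smooth (\<lambda>x. f x + g x)"
  unfolding smooth_iff_Cn by (auto intro: Cn_add[where \<tau> = "\<lambda>x \<eta>. f x" and \<sigma> = "\<lambda>x \<eta>. g x"])

lemma smooth_bilinear: "bounded_bilinear B \<Longrightarrow> smooth f \<Longrightarrow> smooth g \<Longrightarrow> smooth (\<lambda>x. B (f x) (g x))"
  unfolding smooth_iff_Cn by (auto intro: Cn_bilinear[where \<tau> = "\<lambda>x \<eta>. f x" and \<sigma> = "\<lambda>x \<eta>. g x"])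

lemma smooth_linear: "bounded_linear L \<Longrightarrow> smooth f \<Longrightarrow> smooth (\<lambda>x. L (f x))"
  by (rule smooth_compose[OF bounded_linear_imp_smooth])

lemma smooth_mult: "smooth f \<Longrightarrow> smooth g \<Longrightarrow> smooth (\<lambda>x. f x * g x :: real)"
  by (rule smooth_bilinear[OF bounded_bilinear_mult])

lemma smooth_scaleR: "smooth f \<Longrightarrow> smooth g \<Longrightarrow> smooth (\<lambda>x. f x *\<^sub>R g x)"
  by (rule smooth_bilinear[OF bounded_bilinear_scaleR])

lemma smooth_minus: "smooth f \<Longrightarrow> smooth (\<lambda>x. - f x)"
  by (rule smooth_linear[OF bounded_linear_minus[OF bounded_linear_ident]])

lemma smooth_diff: "smooth f \<Longrightarrow> smooth g \<Longrightarrow> smooth (\<lambda>x. f x - g x)"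
  using smooth_add[OF _ smooth_minus] by simp

lemma smooth_power2: "smooth f \<Longrightarrow> smooth (\<lambda>x. (f x)\<^sup>2 :: real)"
  using smooth_mult[of f f] by (simp add: power2_eq_square)

section \<open>Elementary functions of smooth real functions\<close>

lemma locally_bounded_isCont:
  assumes "\<And>x. isCont f x"
  shows "locally_bounded_form (\<lambda>x \<eta>. f x)"
proof (rule locally_bounded_formI)
  fix x and M :: real
  obtain r where r: "r > 0" "\<And>y. norm (y - x) < r \<Longrightarrow> norm (f y - f x) < 1"
    using assms[of x] zero_less_one unfolding continuous_at_eps_delta dist_norm by blast
  have "norm (f y) \<le> norm (f x) + 1" if "norm (y - x) < r" for y
    using r(2)[OF that] norm_triangle_sub[of "f y" "f x"] by linarith
  then show "\<exists>r>0. \<exists>K. \<forall>y \<eta>. norm (y - x) < r \<longrightarrow> (\<forall>i. norm (\<eta> i :: 'a) \<le> M) \<longrightarrow> norm (f y) \<le> K"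
    using r(1) by (intro exI[of _ r] conjI exI[of _ "norm (f x) + 1"]) simp_all
qed

text \<open>Peels off one order. It fits functions whose derivative is an expression in the function
  itself, such as \<open>inverse\<close> and \<open>exp\<close>, and asks for differentiability of
  \<open>g\<close> only at values of \<open>f\<close>, which admits \<open>ln\<close> of a positive
  function.\<close>

lemma Cn_real_chain:
  fixes f :: "'a::real_normed_vector \<Rightarrow> real"
  assumes g: "\<And>x. (g has_real_derivative g' (f x)) (at (f x))"
    and f: "smooth f" and g': "Cn n (\<lambda>x \<eta>. g' (f x))"
  shows "Cn (Suc n) (\<lambda>x \<eta>. g (f x))"
proof -
  have "Cn (Suc n) (\<lambda>x \<eta>. f x)" using f smooth_iff_Cn by blast
  then obtain f1 where f1: "form_derivative (\<lambda>x \<eta>. f x) f1" "Cn n f1"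
    using Cn_SucD by blast
  have "isCont (\<lambda>x. g (f x)) x" for x
    using isCont_o2[OF smooth_isCont[OF f] DERIV_isCont[OF g]] .
  then have "locally_bounded_form (\<lambda>x \<eta>. g (f x))" by (rule locally_bounded_isCont)
  moreover have "form_derivative (\<lambda>x \<eta>. g (f x)) (\<lambda>x \<eta>. g' (f x) * f1 x \<eta>)"
    unfolding form_derivative_def
  proof (intro allI)
    fix x h and \<eta> :: "nat \<Rightarrow> 'a"
    have 1: "((\<lambda>s. f (x + s *\<^sub>R h)) has_real_derivative f1 x (case_nat h \<eta>)) (at 0)"
      using f1(1) unfolding form_derivative_def has_real_derivative_iff_has_vector_derivative by blast
    have "(g has_real_derivative g' (f x)) (at (f (x + 0 *\<^sub>R h)))" using g by simp
    from DERIV_chain2[OF this 1]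
    show "((\<lambda>s. g (f (x + s *\<^sub>R h))) has_vector_derivative g' (f x) * f1 x (case_nat h \<eta>)) (at 0)"
      unfolding has_real_derivative_iff_has_vector_derivative .
  qed
  moreover have "Cn n (\<lambda>x \<eta>. g' (f x) * f1 x \<eta>)"
    by (rule Cn_bilinear[OF bounded_bilinear_mult g' f1(2)])
  ultimately show ?thesis by (rule Cn_SucI)
qed

lemma smooth_real_chain:
  fixes f :: "'a::real_normed_vector \<Rightarrow> real"
  assumes g: "\<And>x. (g has_real_derivative g' (f x)) (at (f x))"
    and f: "smooth f" and g': "smooth (\<lambda>x. g' (f x))"
  shows "smooth (\<lambda>x. g (f x))"
  unfolding smooth_iff_Cn
proof
  fix n
  have "Cn (Suc n) (\<lambda>x \<eta>. g (f x))"
    using g f smooth_imp_Cn[OF g'] by (rule Cn_real_chain)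
  then show "Cn n (\<lambda>x \<eta>. g (f x))" by (rule Cn_Suc_imp)
qed

lemma smooth_inverse_real:
  fixes f :: "'a::real_normed_vector \<Rightarrow> real"
  assumes f: "smooth f" and nz: "\<And>x. f x \<noteq> 0"
  shows "smooth (\<lambda>x. inverse (f x))"
  unfolding smooth_iff_Cn
proof
  fix n show "Cn n (\<lambda>x \<eta>. inverse (f x))"
  proof (induction n)
    case 0
    have "isCont (\<lambda>x. inverse (f x)) x" for x
      by (intro continuous_intros smooth_isCont[OF f] nz)
    then show ?case using locally_bounded_isCont[of "\<lambda>x. inverse (f x)"] by simp
  next
    case (Suc n)
    have 1: "(inverse has_real_derivative - (inverse (f x) * inverse (f x))) (at (f x))" for x
      using DERIV_inverse[OF nz[of x], of UNIV] by (simp add: power2_eq_square)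
    have 2: "Cn n (\<lambda>x \<eta>. - (inverse (f x) * inverse (f x)))"
      by (rule Cn_minus[OF Cn_bilinear[OF bounded_bilinear_mult Suc Suc]])
    show ?case
      by (rule Cn_real_chain[where g' = "\<lambda>t. - (inverse t * inverse t)", OF 1 f 2])
  qed
qed

lemma smooth_exp_real:
  fixes f :: "'a::real_normed_vector \<Rightarrow> real"
  assumes f: "smooth f"
  shows "smooth (\<lambda>x. exp (f x))"
  unfolding smooth_iff_Cn
proof
  fix n show "Cn n (\<lambda>x \<eta>. exp (f x))"
  proof (induction n)
    case 0
    have "isCont (\<lambda>x. exp (f x)) x" for x
      by (intro continuous_intros smooth_isCont[OF f])
    then show ?case using locally_bounded_isCont[of "\<lambda>x. exp (f x)"] by simp
  next
    case (Suc n)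
    show ?case by (rule Cn_real_chain[where g' = exp, OF DERIV_exp f Suc])
  qed
qed

lemma smooth_ln:
  fixes f :: "'a::real_normed_vector \<Rightarrow> real"
  assumes f: "smooth f" and pos: "\<And>x. f x > 0"
  shows "smooth (\<lambda>x. ln (f x))"
proof (rule smooth_real_chain[where g' = inverse, OF _ f])
  show "(ln has_real_derivative inverse (f x)) (at (f x))" for x
    using DERIV_ln[OF pos[of x]] .
  show "smooth (\<lambda>x. inverse (f x))"
    using smooth_inverse_real[OF f] pos by (metis less_irrefl)
qed

lemma smooth_arctan:
  fixes f :: "'a::real_normed_vector \<Rightarrow> real"
  assumes f: "smooth f"
  shows "smooth (\<lambda>x. arctan (f x))"
proof (rule smooth_real_chain[where g' = "\<lambda>t. inverse (1 + t\<^sup>2)", OF _ f])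
  show "(arctan has_real_derivative inverse (1 + (f x)\<^sup>2)) (at (f x))" for x
    by (rule DERIV_arctan)
  have "1 + (f x)\<^sup>2 \<noteq> 0" for x by (metis add_pos_nonneg less_irrefl zero_le_power2 zero_less_one)
  then show "smooth (\<lambda>x. inverse (1 + (f x)\<^sup>2))"
    by (intro smooth_inverse_real smooth_add smooth_const smooth_power2 f)
qed

lemma smooth_sqrt:
  fixes f :: "'a::real_normed_vector \<Rightarrow> real"
  assumes f: "smooth f" and pos: "\<And>x. f x > 0"
  shows "smooth (\<lambda>x. sqrt (f x))"
proof -
  have "sqrt (f x) = exp (ln (f x) * (1 / 2))" for x
    using pos[of x] by (simp add: powr_half_sqrt[symmetric] powr_def)
  moreover have "smooth (\<lambda>x. exp (ln (f x) * (1 / 2)))"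
    by (intro smooth_exp_real smooth_mult smooth_ln smooth_const f pos)
  ultimately show ?thesis by simp
qed

text \<open>
  The inverse function theorem: the contraction \<open>x \<mapsto> x + A (y - f x)\<close> makes \<open>inv f\<close> continuous.
  Then \<open>inv f\<close> is differentiable with derivative \<open>B y = A (inv f y)\<close>, and \<open>y \<mapsto> B y (\<sigma> y)\<close> has
  derivative \<open>B y (\<sigma>' y h - f'' (B y h) (B y (\<sigma> y)))\<close>, which gives all higher derivatives inductively.
\<close>

theorem smooth_inv:
  fixes f :: "'a::{real_normed_vector,complete_space} \<Rightarrow> 'b::real_normed_vector"
  assumes smooth: "smooth f" and bij: "bij f"
    and der: "\<And>x. (f has_derivative f' x) (at x)"
    and inverse: "\<And>x. \<exists>A. bounded_linear A \<and> (\<forall>h. A (f' x h) = h) \<and> (\<forall>k. f' x (A k) = k)"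
  shows "smooth (inv f)"
proof -
  obtain D where D0: "\<And>x. D x [] = f x" and D: "derivative_tower D"
    using smooth unfolding smooth_iff_tower by blast
  have Df: "(f has_derivative (\<lambda>h. D x [h])) (at x)" for x
    using tower_has_derivative[OF D, of "[]" x] unfolding D0 .
  have f': "f' x = (\<lambda>h. D x [h])" for x by (rule has_derivative_unique[OF der Df])
  obtain A where Abl: "\<And>x. bounded_linear (A x)" and AD: "\<And>x h. A x (D x [h]) = h"
    and DA: "\<And>x k. D x [A x k] = k"
    using choice[of "\<lambda>x A. bounded_linear A \<and> (\<forall>h. A (f' x h) = h) \<and> (\<forall>k. f' x (A k) = k)"] inverse
    unfolding f' by blast
  define g where "g = inv f"
  have fg: "f (g y) = y" for y unfolding g_def using bij by (simp add: bij_is_surj surj_f_inv_f)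
  have gf: "g (f x) = x" for x unfolding g_def using bij by (simp add: bij_is_inj inv_f_f)
  have linD: "linear (\<lambda>h. D x [h])" for x using tower_linear_Cons[OF D] .
  have linA: "linear (A x)" for x using Abl bounded_linear.linear by blast
  \<comment> \<open>\<open>C\<close> bounds the inverse of the derivative at \<open>x0\<close>; a
    deviation of at most \<open>1 / (2 * C)\<close> gives the map \<phi> below the contraction
    factor 1/2.\<close>
  have near: "\<exists>C>0. \<exists>\<delta>>0. (\<forall>k. norm (A x0 k) \<le> C * norm k) \<and>
      (\<forall>x h. norm (x - x0) < \<delta> \<longrightarrow> norm (D x [h] - D x0 [h]) \<le> 1 / (2 * C) * norm h)" for x0
  proof -
    obtain C where C: "C > 0" "\<And>k. norm (A x0 k) \<le> norm k * C"
      using bounded_linear.pos_bounded[OF Abl] by blast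
    obtain d K where dK: "d > 0" "K > 0" "\<And>h hs. norm h < d \<Longrightarrow> length hs = 1 \<Longrightarrow>
       norm (D (x0 + h) hs - D x0 hs) \<le> K * norm h * prod_list (map norm hs)"
      using tower_lipschitz[OF D, where x = x0 and k = 1] by blast
    have "norm (D x [h] - D x0 [h]) \<le> 1 / (2 * C) * norm h" if x: "norm (x - x0) < min d (1 / (2 * C * K))" for x h
    proof -
      have "norm (D x [h] - D x0 [h]) \<le> K * norm (x - x0) * norm h"
        using dK(3)[of "x - x0" "[h]"] x by simp
      also have "\<dots> \<le> 1 / (2 * C) * norm h"
        using x dK(2) C(1) by (intro mult_right_mono) (auto simp: field_simps)
      finally show ?thesis .
    qed
    moreover have "min d (1 / (2 * C * K)) > 0" using dK C by simp
    ultimately show ?thesis using C by (metis mult.commute)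
  qed
  have gcont: "isCont g y0" for y0
    unfolding continuous_at_eps_delta
  proof (intro allI impI)
    fix e :: real assume e: "e > 0"
    define x0 where "x0 = g y0"
    obtain C \<delta> where C: "C > 0" "\<delta> > 0" "\<And>k. norm (A x0 k) \<le> C * norm k"
      "\<And>x h. norm (x - x0) < \<delta> \<Longrightarrow> norm (D x [h] - D x0 [h]) \<le> 1 / (2 * C) * norm h"
      using near[of x0] by blast
    define \<rho> where "\<rho> = min (\<delta> / 2) (e / 2)"
    have \<rho>: "\<rho> > 0" "\<rho> < \<delta>" "\<rho> < e" using C e by (auto simp: \<rho>_def)
    show "\<exists>d>0. \<forall>y. dist y y0 < d \<longrightarrow> dist (g y) (g y0) < e"
    proof (rule exI[of _ "\<rho> / (2 * C)"], intro conjI allI impI)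
      fix y assume y: "dist y y0 < \<rho> / (2 * C)"
      define \<phi> where "\<phi> = (\<lambda>x. x + A x0 (y - f x))"
      have contr: "dist (\<phi> x) (\<phi> x') \<le> 1 / 2 * dist x x'" if "x \<in> cball x0 \<rho>" "x' \<in> cball x0 \<rho>" for x x'
      proof -
        have "norm (f x - f x' - D x0 [x - x']) \<le> norm (x - x') * (1 / (2 * C))"
        proof (rule differentiable_bound_linearization[where S = "cball x0 \<rho>" and f' = "\<lambda>x h. D x [h]"])
          show "x' + t *\<^sub>R (x - x') \<in> cball x0 \<rho>" if "t \<in> {0..1}" for t
            using convexD_alt[OF convex_cball \<open>x' \<in> cball x0 \<rho>\<close> \<open>x \<in> cball x0 \<rho>\<close>, of t] that
            by (simp add: algebra_simps)
          show "(f has_derivative (\<lambda>h. D z [h])) (at z within cball x0 \<rho>)" for z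
            using Df by (rule has_derivative_at_withinI)
          fix z assume "z \<in> cball x0 \<rho>"
          then have "norm (z - x0) < \<delta>" using \<rho> by (simp add: dist_norm norm_minus_commute)
          note * = C(4)[OF this]
          show "onorm ((\<lambda>h. D z [h]) - (\<lambda>h. D x0 [h])) \<le> 1 / (2 * C)"
          proof (rule onorm_bound)
            show "0 \<le> 1 / (2 * C)" using C(1) by simp
            fix h show "norm (((\<lambda>h. D z [h]) - (\<lambda>h. D x0 [h])) h) \<le> 1 / (2 * C) * norm h"
              using *[of h] by simp
          qed
        qed (use \<rho> in simp)
        moreover have "\<phi> x - \<phi> x' = - A x0 (f x - f x' - D x0 [x - x'])"
          unfolding \<phi>_def by (simp add: linear_diff[OF linA] AD)
        ultimately have "norm (\<phi> x - \<phi> x') \<le> C * (norm (x - x') * (1 / (2 * C)))"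
          using C(1) C(3)[of "f x - f x' - D x0 [x - x']"]
          by (metis (no_types, lifting) mult_left_mono norm_minus_cancel order_trans less_imp_le)
        then show ?thesis using C(1) by (simp add: dist_norm)
      qed
      have self: "\<phi> ` cball x0 \<rho> \<subseteq> cball x0 \<rho>"
      proof
        fix z assume "z \<in> \<phi> ` cball x0 \<rho>"
        then obtain x where x: "x \<in> cball x0 \<rho>" "z = \<phi> x" by blast
        have "dist (\<phi> x) (\<phi> x0) \<le> 1 / 2 * dist x x0" using x \<rho> by (intro contr) auto
        also have "\<dots> \<le> \<rho> / 2" using x by (simp add: dist_commute)
        finally have "dist (\<phi> x) (\<phi> x0) \<le> \<rho> / 2" .
        moreover have "dist (\<phi> x0) x0 \<le> \<rho> / 2"
        proof -
          have "dist (\<phi> x0) x0 = norm (A x0 (y - y0))" by (simp add: \<phi>_def x0_def fg dist_norm)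
          also have "\<dots> \<le> C * norm (y - y0)" by (rule C(3))
          also have "\<dots> \<le> C * (\<rho> / (2 * C))" using y C(1) by (intro mult_left_mono) (auto simp: dist_norm)
          finally show ?thesis using C(1) by simp
        qed
        ultimately have "dist z x0 \<le> \<rho>" using dist_triangle[of "\<phi> x" x0 "\<phi> x0"] x(2) by simp
        then show "z \<in> cball x0 \<rho>" by (simp add: dist_commute)
      qed
      have "complete (cball x0 \<rho>)" by (simp add: complete_eq_closed)
      then have "\<exists>!x. x \<in> cball x0 \<rho> \<and> \<phi> x = x"
        by (rule Banach_fix[where c = "1/2"]) (use contr self \<rho> in auto)
      then obtain x where x: "x \<in> cball x0 \<rho>" "\<phi> x = x" by blast
      then have "A x0 (y - f x) = 0" by (simp add: \<phi>_def)
      then have "D x0 [A x0 (y - f x)] = 0" using linear_0[OF linD] by simp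
      then have "g y = x" using gf[of x] by (simp add: DA)
      then show "dist (g y) (g y0) < e" using x(1) \<rho> by (simp add: x0_def dist_commute)
    qed (use \<rho> C in simp)
  qed
  have gder: "(g has_derivative A (g y)) (at y)" for y
  proof (rule has_derivative_inverse_basic[where f = f and T = UNIV])
    show "(f has_derivative (\<lambda>h. D (g y) [h])) (at (g y))" by (rule Df)
  qed (use Abl AD fg gcont in \<open>auto simp: fun_eq_iff\<close>)
  define B where "B = (\<lambda>y. A (g y))"
  have linB: "linear (B y)" for y unfolding B_def by (rule linA)
  \<comment> \<open>The inverses are bounded locally uniformly: for \<open>h = B y k\<close> the
    comparison with the derivative at \<open>g y0\<close> gives
    \<open>norm h \<le> C * norm k + norm h / 2\<close>, and the last term is absorbed on the
    left.\<close>
  have Bbound: "\<exists>r>0. \<exists>C>0. \<forall>y k. norm (y - y0) < r \<longrightarrow> norm (B y k) \<le> C * norm k" for y0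
  proof -
    obtain C \<delta> where C: "C > 0" "\<delta> > 0" "\<And>k. norm (A (g y0) k) \<le> C * norm k"
      "\<And>x h. norm (x - g y0) < \<delta> \<Longrightarrow> norm (D x [h] - D (g y0) [h]) \<le> 1 / (2 * C) * norm h"
      using near[of "g y0"] by blast
    obtain r where r: "r > 0" "\<And>y. norm (y - y0) < r \<Longrightarrow> norm (g y - g y0) < \<delta>"
      using gcont[of y0] C(2) unfolding continuous_at_eps_delta dist_norm by blast
    have "norm (B y k) \<le> (2 * C) * norm k" if "norm (y - y0) < r" for y k
    proof -
      define h where "h = B y k"
      have k: "D (g y) [h] = k" unfolding h_def B_def by (rule DA)
      have "norm h = norm (A (g y0) (D (g y0) [h]))" by (simp add: AD)
      also have "\<dots> \<le> C * norm (D (g y0) [h])" by (rule C(3))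
      also have "\<dots> \<le> C * (norm k + 1 / (2 * C) * norm h)"
      proof (rule mult_left_mono)
        have "norm (D (g y0) [h]) \<le> norm (D (g y) [h]) + norm (D (g y) [h] - D (g y0) [h])"
          by (metis norm_minus_commute norm_triangle_sub)
        also have "norm (D (g y) [h] - D (g y0) [h]) \<le> 1 / (2 * C) * norm h" by (rule C(4)[OF r(2)[OF that]])
        finally show "norm (D (g y0) [h]) \<le> norm k + 1 / (2 * C) * norm h" by (simp add: k)
      qed (use C(1) in simp)
      also have "\<dots> = C * norm k + norm h / 2" using C(1) by (simp add: field_simps)
      finally show ?thesis unfolding h_def[symmetric] by simp
    qed
    then show ?thesis using r(1) C(1) by (intro exI[of _ r] conjI exI[of _ "2 * C"]) simp_all
  qed
  have lbB: "locally_bounded_form (\<lambda>y \<eta>. B y (\<sigma> y \<eta>))" if lb: "locally_bounded_form \<sigma>" for \<sigma>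
  proof (rule locally_bounded_formI)
    fix y0 :: 'b and M :: real
    obtain r C where r: "r > 0" "C > 0" "\<forall>y k. norm (y - y0) < r \<longrightarrow> norm (B y k) \<le> C * norm k"
      using Bbound[of y0] by blast
    obtain s K where s: "s > 0" "\<forall>y \<eta>. norm (y - y0) < s \<longrightarrow> (\<forall>i. norm (\<eta> i) \<le> M) \<longrightarrow> norm (\<sigma> y \<eta>) \<le> K"
      using locally_bounded_formD[OF lb, of y0 M] by (elim exE conjE) (rule that)
    show "\<exists>r>0. \<exists>K. \<forall>y \<eta>. norm (y - y0) < r \<longrightarrow> (\<forall>i. norm (\<eta> i) \<le> M) \<longrightarrow> norm (B y (\<sigma> y \<eta>)) \<le> K"
    proof (rule exI[of _ "min r s"], intro conjI exI[of _ "C * K"] allI impI)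
      fix y and \<eta> :: "nat \<Rightarrow> 'b" assume y: "norm (y - y0) < min r s" "\<forall>i. norm (\<eta> i) \<le> M"
      then have "norm (B y (\<sigma> y \<eta>)) \<le> C * norm (\<sigma> y \<eta>)" using r(3) by simp
      also have "\<dots> \<le> C * K" using y s(2) r(2) by (intro mult_left_mono) simp_all
      finally show "norm (B y (\<sigma> y \<eta>)) \<le> C * K" .
    qed (use r s in simp_all)
  qed
  have Bder: "form_derivative (\<lambda>y \<eta>. B y (\<sigma> y \<eta>))
      (\<lambda>y \<eta>. B y (\<sigma>' y \<eta> - D (g y) [B y (\<eta> 0), B y (\<sigma> y (\<lambda>i. \<eta> (Suc i)))]))"
    if \<sigma>: "form_derivative \<sigma> \<sigma>'" for \<sigma> \<sigma>'
    unfolding form_derivative_def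
  proof (intro allI)
    fix y h :: 'b and \<eta> :: "nat \<Rightarrow> 'b"
    define w where "w = (\<lambda>s. \<sigma> (y + s *\<^sub>R h) \<eta>)"
    define k where "k = (\<lambda>s. B (y + s *\<^sub>R h) (w s))"
    define d where "d = (\<lambda>s v. D (g (y + s *\<^sub>R h)) [v])"
    have gline: "((\<lambda>s. g (y + s *\<^sub>R h)) has_derivative (\<lambda>s. B y (s *\<^sub>R h))) (at 0)"
    proof -
      have "((\<lambda>s. y + s *\<^sub>R h) has_derivative (\<lambda>s. s *\<^sub>R h)) (at 0)"
        by (auto intro!: derivative_eq_intros)
      from has_derivative_compose[OF this, of g "B y"] show ?thesis
        using gder[of y] unfolding B_def by simp
    qed
    have dder: "((\<lambda>s. d s v) has_vector_derivative D (g y) [B y h, v]) (at 0)" for v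
      using has_derivative_compose[OF gline, of "\<lambda>x. D x [v]" "\<lambda>h. D (g y) [h, v]"] tower_has_derivative[OF D, of "[v]" "g y"]
      unfolding has_vector_derivative_def d_def
      by (simp add: linear_scale[OF linB] linear_scale[OF tower_linear_Cons[OF D]])
    define z where "z = (\<lambda>s. (w s - w 0) /\<^sub>R s - (d s (k 0) - d 0 (k 0)) /\<^sub>R s)"
    define z0 where "z0 = \<sigma>' y (case_nat h \<eta>) - D (g y) [B y h, k 0]"
    have wd: "(w has_vector_derivative \<sigma>' y (case_nat h \<eta>)) (at 0)"
      using \<sigma> unfolding form_derivative_def w_def by blast
    have z: "(z \<longlongrightarrow> z0) (at 0)"
      unfolding z_def z0_def using wd dder[of "k 0"]
      unfolding has_vector_derivative_quotient_iff by (rule tendsto_diff)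
    have Bd: "B (y + s *\<^sub>R h) (d s v) = v" for s v unfolding B_def d_def by (rule AD)
    have d0: "d 0 (k 0) = w 0" unfolding d_def k_def B_def by (simp add: DA)
    \<comment> \<open>Resolvent identity in disguise: as \<open>B (y + s *\<^sub>R h)\<close>
      inverts \<open>d s\<close>, the increment of \<open>k\<close> is this operator applied to the
      increment of \<open>w\<close> minus the increment of \<open>d\<close> at the fixed vector
      \<open>k 0\<close>. So the operator family \<open>B\<close> never has to be
      differentiated.\<close>
    have kq: "(k s - k 0) /\<^sub>R s = B (y + s *\<^sub>R h) (z s)" for s
    proof -
      have "z s = (w s - d s (k 0)) /\<^sub>R s" unfolding z_def d0 by (simp add: algebra_simps)
      then have "B (y + s *\<^sub>R h) (z s) = (B (y + s *\<^sub>R h) (w s) - B (y + s *\<^sub>R h) (d s (k 0))) /\<^sub>R s"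
        by (simp add: linear_scale[OF linB] linear_diff[OF linB])
      then show ?thesis unfolding Bd by (simp add: k_def)
    qed
    have "((\<lambda>s. B (y + s *\<^sub>R h) (z s) - B y z0) \<longlongrightarrow> 0) (at 0)"
    proof -
      obtain r C where r: "r > 0" "C > 0" "\<forall>y' k. norm (y' - y) < r \<longrightarrow> norm (B y' k) \<le> C * norm k"
        using Bbound[of y] by blast
      have lim: "((\<lambda>s. z s - d s (B y z0)) \<longlongrightarrow> z0 - d 0 (B y z0)) (at 0)"
        using has_vector_derivative_continuous[OF dder] by (intro tendsto_diff z) (simp add: isCont_def)
      have "d 0 (B y z0) = z0" unfolding d_def B_def by (simp add: DA)
      with lim have lim0: "((\<lambda>s. z s - d s (B y z0)) \<longlongrightarrow> 0) (at 0)" by simp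
      show ?thesis
      proof (rule Lim_null_comparison)
        have "((\<lambda>s. s *\<^sub>R h) \<longlongrightarrow> 0 *\<^sub>R h) (at 0)" by (intro tendsto_intros)
        then have "\<forall>\<^sub>F s in at 0. norm (s *\<^sub>R h) < r"
          using r(1) by (auto simp: tendsto_iff)
        then show "\<forall>\<^sub>F s in at 0. norm (B (y + s *\<^sub>R h) (z s) - B y z0) \<le> C * norm (z s - d s (B y z0))"
        proof eventually_elim
          case (elim s)
          have "B (y + s *\<^sub>R h) (z s) - B y z0 = B (y + s *\<^sub>R h) (z s - d s (B y z0))"
            by (simp add: linear_diff[OF linB] Bd)
          then show ?case using r(3) elim by simp
        qed
        show "((\<lambda>s. C * norm (z s - d s (B y z0))) \<longlongrightarrow> 0) (at 0)"
          using tendsto_mult_right_zero[OF tendsto_norm_zero[OF lim0]] .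
      qed
    qed
    then have "(k has_vector_derivative B y z0) (at 0)"
      unfolding has_vector_derivative_quotient_iff kq using LIM_zero_iff by blast
    then show "((\<lambda>s. B (y + s *\<^sub>R h) (\<sigma> (y + s *\<^sub>R h) \<eta>)) has_vector_derivative
        B y (\<sigma>' y (case_nat h \<eta>) - D (g y) [B y (case_nat h \<eta> 0), B y (\<sigma> y (\<lambda>i. case_nat h \<eta> (Suc i)))])) (at 0)"
      unfolding k_def w_def z0_def by simp
  qed
  \<comment> \<open>The derivative of \<open>B y (\<sigma> y \<eta>)\<close> contains only
    \<open>g\<close>, \<open>B\<close> and forms at one order less, so order \<open>n\<close> of
    \<open>g\<close> yields order \<open>n\<close> of \<open>B\<close>. Since \<open>B\<close> is
    the derivative of \<open>g\<close>, this then raises \<open>g\<close> to order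
    \<open>Suc n\<close>.\<close>
  have BCn: "Cn n (\<lambda>y \<eta>. g y) \<Longrightarrow> Cn n \<sigma> \<Longrightarrow> Cn n (\<lambda>y \<eta>. B y (\<sigma> y \<eta>))" for n \<sigma>
  proof (induction n arbitrary: \<sigma>)
    case 0
    then show ?case using lbB by simp
  next
    case (Suc n)
    obtain \<sigma>' where \<sigma>': "form_derivative \<sigma> \<sigma>'" "Cn n \<sigma>'" using Cn_SucD[OF Suc.prems(2)] by blast
    note IH = Suc.IH[OF Cn_Suc_imp[OF Suc.prems(1)]]
    let ?ts = "[\<lambda>y \<eta>. B y (\<eta> 0), \<lambda>y \<eta>. B y (\<sigma> y (\<lambda>i. \<eta> (Suc i)))]"
    have "Cn n \<tau>" if "\<tau> \<in> set ?ts" for \<tau>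
      using that IH[OF Cn_direction] IH[OF Cn_shift[OF Cn_Suc_imp[OF Suc.prems(2)]]] by auto
    with Cn_tower_compose[OF D gcont Cn_Suc_imp[OF Suc.prems(1)], of ?ts]
    have "Cn n (\<lambda>y \<eta>. D (g y) [B y (\<eta> 0), B y (\<sigma> y (\<lambda>i. \<eta> (Suc i)))])" by simp
    from Cn_add[OF \<sigma>'(2) Cn_minus[OF this]]
    have "Cn n (\<lambda>y \<eta>. \<sigma>' y \<eta> - D (g y) [B y (\<eta> 0), B y (\<sigma> y (\<lambda>i. \<eta> (Suc i)))])" by simp
    from Cn_SucI[OF lbB[OF Cn_locally_bounded[OF Suc.prems(2)]] Bder[OF \<sigma>'(1)] IH[OF this]]
    show ?case .
  qed
  have "Cn n (\<lambda>y \<eta>. g y)" for n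
  proof (induction n)
    case 0
    show ?case using locally_bounded_isCont[OF gcont] by simp
  next
    case (Suc n)
    have "form_derivative (\<lambda>y \<eta>. g y) (\<lambda>y \<eta>. B y (\<eta> 0))"
      unfolding form_derivative_def
    proof (intro allI)
      fix y h :: 'b and \<eta> :: "nat \<Rightarrow> 'b"
      have "((\<lambda>s. y + s *\<^sub>R h) has_derivative (\<lambda>s. s *\<^sub>R h)) (at 0)"
        by (auto intro!: derivative_eq_intros)
      from has_derivative_compose[OF this, of g "B y"]
      have "((\<lambda>s. g (y + s *\<^sub>R h)) has_derivative (\<lambda>s. B y (s *\<^sub>R h))) (at 0)"
        using gder[of y] unfolding B_def by simp
      then show "((\<lambda>s. g (y + s *\<^sub>R h)) has_vector_derivative B y (case_nat h \<eta> 0)) (at 0)"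
        unfolding has_vector_derivative_def by (simp add: linear_scale[OF linB])
    qed
    from Cn_SucI[OF locally_bounded_isCont[OF gcont] this BCn[OF Suc Cn_direction]]
    show ?case .
  qed
  then show ?thesis unfolding g_def by (rule Cn_imp_smooth)
qed

lemma diffeomorphism_compose:
  assumes "diffeomorphism f" "diffeomorphism g"
  shows "diffeomorphism (\<lambda>x. g (f x))"
proof -
  have "bij (\<lambda>x. g (f x))" using bij_comp[of f g] assms by (simp add: diffeomorphism_def comp_def)
  moreover have "inv (\<lambda>x. g (f x)) = (\<lambda>y. inv f (inv g y))"
    using o_inv_distrib[of g f] assms by (simp add: diffeomorphism_def comp_def fun_eq_iff)
  ultimately show ?thesis
    using assms by (simp add: diffeomorphism_def smooth_compose)
qed

lemma diffeomorphism_inv: "diffeomorphism f \<Longrightarrow> diffeomorphism (inv f)"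
  by (simp add: diffeomorphism_def bij_imp_bij_inv inv_inv_eq)

text \<open>The map replaces the coordinate \<open>l\<close> by \<open>f\<close> and moves points
  only along \<open>e\<close>, so bijectivity is a statement about increasing functions on the lines
  in direction \<open>e\<close>, and its derivative differs from the identity by a map of rank
  one.\<close>

lemma diffeomorphism_shear:
  fixes f :: "'a::{real_normed_vector,complete_space} \<Rightarrow> real"
  assumes l: "bounded_linear l" "l e = 1" and f: "smooth f"
    and pos: "\<And>p. \<exists>d>0. ((\<lambda>s. f (p + s *\<^sub>R e)) has_real_derivative d) (at 0)"
    and surj: "\<And>p y. \<exists>s. f (p + s *\<^sub>R e) = y"
  shows "diffeomorphism (\<lambda>p. p + (f p - l p) *\<^sub>R e)"
proof -
  interpret l: bounded_linear l by fact
  let ?S = "\<lambda>p. p + (f p - l p) *\<^sub>R e"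
  have lS: "l (?S p) = f p" for p by (simp add: l.add l.scaleR l(2))
  have pos': "\<exists>d. ((\<lambda>s. f (p + s *\<^sub>R e)) has_real_derivative d) (at c) \<and> 0 < d" for p c
  proof -
    obtain d where d: "d > 0" "((\<lambda>s. f ((p + c *\<^sub>R e) + s *\<^sub>R e)) has_real_derivative d) (at (c + - c))"
      using pos[of "p + c *\<^sub>R e"] by auto
    from DERIV_shift[THEN iffD1, OF d(2)] have "((\<lambda>s. f ((p + c *\<^sub>R e) + (s + - c) *\<^sub>R e)) has_real_derivative d) (at c)" .
    moreover have "(\<lambda>s. f ((p + c *\<^sub>R e) + (s + - c) *\<^sub>R e)) = (\<lambda>s. f (p + s *\<^sub>R e))"
      by (simp add: algebra_simps)
    ultimately show ?thesis using d(1) by (intro exI[of _ d]) (simp only:)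
  qed
  have mono: "f (p + a *\<^sub>R e) < f (p + b *\<^sub>R e)" if "a < b" for p a b
    by (rule DERIV_pos_imp_increasing[OF that]) (use pos' in blast)
  have bij: "bij ?S"
    unfolding bij_def
  proof
    show "inj ?S"
    proof (rule injI)
      fix p q assume eq: "?S p = ?S q"
      define s where "s = l p - l q"
      have "f p = f q" using lS[of p] lS[of q] eq by simp
      with eq have p: "p = q + s *\<^sub>R e" by (simp add: s_def algebra_simps)
      with \<open>f p = f q\<close> have "\<not> s < 0" "\<not> 0 < s"
        using mono[of s 0 q] mono[of 0 s q] by auto
      then show "p = q" using p by simp
    qed
    show "surj ?S"
      unfolding surj_def
    proof
      fix r obtain s where s: "f (r + s *\<^sub>R e) = l r" using surj by blast
      show "\<exists>p. r = ?S p"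
        by (rule exI[of _ "r + s *\<^sub>R e"]) (simp add: s l.add l.scaleR l(2) algebra_simps)
    qed
  qed
  have smooth: "smooth ?S"
    by (intro smooth_add smooth_scaleR smooth_diff smooth_ident smooth_const f bounded_linear_imp_smooth l)
  have "\<exists>f'. (f has_derivative f') (at p)" for p
    using smooth_imp_differentiable[OF f] unfolding differentiable_def .
  then obtain f' where f': "\<And>p. (f has_derivative f' p) (at p)" by metis
  have "smooth (inv ?S)"
  proof (rule smooth_inv[OF smooth bij])
    show "(?S has_derivative (\<lambda>h. h + (f' p h - l h) *\<^sub>R e)) (at p)" for p
      by (auto intro!: derivative_eq_intros f' bounded_linear_imp_has_derivative l(1))
    fix p
    interpret f': bounded_linear "f' p" using f' has_derivative_bounded_linear by blast
    obtain d where d: "d > 0" "((\<lambda>s. f (p + s *\<^sub>R e)) has_real_derivative d) (at 0)"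
      using pos by blast
    have "((\<lambda>s. p + s *\<^sub>R e) has_derivative (\<lambda>s. s *\<^sub>R e)) (at 0)"
      by (auto intro!: derivative_eq_intros)
    from has_derivative_compose[OF this, of f "f' p"] f'
    have "((\<lambda>s. f (p + s *\<^sub>R e)) has_derivative (\<lambda>s. f' p (s *\<^sub>R e))) (at 0)" by simp
    with d(2) have "(\<lambda>s. d * s) = (\<lambda>s. f' p (s *\<^sub>R e))"
      unfolding has_field_derivative_def by (rule has_derivative_unique)
    from fun_cong[OF this, of 1] have fe: "f' p e = d" by simp
    \<comment> \<open>Inverting the rank-one change means solving for the shift along
      \<open>e\<close>, which divides by \<open>f' p e = d > 0\<close>.\<close>
    define A where "A = (\<lambda>k. k + ((l k - f' p k) / d) *\<^sub>R e)"
    have "bounded_linear A"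
      unfolding A_def using d(1)
      by (intro bounded_linear_add bounded_linear_ident bounded_linear_compose[OF bounded_linear_scaleR_left]
          bounded_linear_compose[OF bounded_linear_divide] bounded_linear_sub l f'.bounded_linear_axioms)
    moreover have "A (h + (f' p h - l h) *\<^sub>R e) = h" for h
    proof -
      define c where "c = f' p h - l h"
      have "(l (h + c *\<^sub>R e) - f' p (h + c *\<^sub>R e)) / d = - c"
        using d(1) by (simp add: f'.add f'.scaleR l.add l.scaleR l(2) fe field_simps)
          (simp add: c_def algebra_simps)
      then show ?thesis unfolding A_def c_def[symmetric] by simp
    qed
    moreover have "A k + (f' p (A k) - l (A k)) *\<^sub>R e = k" for k
    proof -
      have "f' p (A k) - l (A k) = - ((l k - f' p k) / d)"
        using d(1) by (simp add: A_def f'.add f'.scaleR l.add l.scaleR l(2) fe field_simps)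
      then show ?thesis unfolding A_def by simp
    qed
    ultimately show "\<exists>A. bounded_linear A \<and> (\<forall>h. A (h + (f' p h - l h) *\<^sub>R e) = h) \<and>
        (\<forall>k. A k + (f' p (A k) - l (A k)) *\<^sub>R e = k)" by blast
  qed
  with smooth bij show ?thesis by (simp add: diffeomorphism_def)
qed

section \<open>The space of square integrable functions\<close>

lemma finite_measure_L2: "finite_measure L2_measure"
  by (intro finite_measure_lebesgue_on) simp

lemma continuous_on_measurable_L2:
  "continuous_on {0..2 * pi} f \<Longrightarrow> (f :: real \<Rightarrow> real) \<in> borel_measurable L2_measure"
  by (rule continuous_imp_measurable_on_sets_lebesgue) auto

lemma square_integrable_mult_bounded:
  assumes f: "f \<in> borel_measurable L2_measure" "\<And>t. t \<in> {0..2 * pi} \<Longrightarrow> \<bar>f t\<bar> \<le> K"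
    and g: "square_integrable g"
  shows "square_integrable (\<lambda>t. f t * g t)"
  unfolding square_integrable_def
proof
  have gm: "g \<in> borel_measurable L2_measure" using g by (simp add: square_integrable_def)
  then show m: "(\<lambda>t. f t * g t) \<in> borel_measurable L2_measure" using f(1) by simp
  show "integrable L2_measure (\<lambda>t. (f t * g t)\<^sup>2)"
  proof (rule Bochner_Integration.integrable_bound)
    show "integrable L2_measure (\<lambda>t. K\<^sup>2 * (g t)\<^sup>2)" using g by (simp add: square_integrable_def)
    show "(\<lambda>t. (f t * g t)\<^sup>2) \<in> borel_measurable L2_measure" using m by simp
    have "(f t * g t)\<^sup>2 \<le> K\<^sup>2 * (g t)\<^sup>2" if "t \<in> {0..2 * pi}" for t
    proof -
      have "(f t)\<^sup>2 \<le> K\<^sup>2" using power_mono[OF f(2)[OF that], of 2] by simp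
      then show ?thesis by (simp add: power_mult_distrib mult_right_mono)
    qed
    then show "AE t in L2_measure. norm ((f t * g t)\<^sup>2) \<le> norm (K\<^sup>2 * (g t)\<^sup>2)"
      by (intro AE_I2) (auto simp: space_restrict_space)
  qed
qed

lemma square_integrable_const: "square_integrable (\<lambda>t. c)"
  unfolding square_integrable_def
  using finite_measure.integrable_const[OF finite_measure_L2] by simp

lemma square_integrable_bounded:
  assumes "f \<in> borel_measurable L2_measure" "\<And>t. t \<in> {0..2 * pi} \<Longrightarrow> \<bar>f t\<bar> \<le> K"
  shows "square_integrable f"
  using square_integrable_mult_bounded[OF assms square_integrable_const[of 1]] by simp

lemma square_integrable_continuous:
  fixes f :: "real \<Rightarrow> real"
  assumes "continuous_on {0..2 * pi} f"
  shows "square_integrable f"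
proof -
  have "bounded (f ` {0..2 * pi})"
    by (intro compact_imp_bounded compact_continuous_image assms) simp
  then obtain K where "\<forall>t\<in>{0..2 * pi}. \<bar>f t\<bar> \<le> K" unfolding bounded_iff by auto
  then have "\<And>t. t \<in> {0..2 * pi} \<Longrightarrow> \<bar>f t\<bar> \<le> K" by blast
  then show ?thesis by (rule square_integrable_bounded[OF continuous_on_measurable_L2[OF assms]])
qed

lemma square_integrable_mult_continuous:
  fixes f :: "real \<Rightarrow> real"
  assumes "continuous_on {0..2 * pi} f" "square_integrable g"
  shows "square_integrable (\<lambda>t. f t * g t)"
proof -
  have "bounded (f ` {0..2 * pi})"
    by (intro compact_imp_bounded compact_continuous_image assms) simp
  then obtain K where "\<forall>t\<in>{0..2 * pi}. \<bar>f t\<bar> \<le> K" unfolding bounded_iff by auto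
  then have "\<And>t. t \<in> {0..2 * pi} \<Longrightarrow> \<bar>f t\<bar> \<le> K" by blast
  then show ?thesis by (rule square_integrable_mult_bounded[OF continuous_on_measurable_L2[OF assms(1)] _ assms(2)])
qed

lemma indicator_measurable_L2: "indicat_real {a..b} \<in> borel_measurable L2_measure"
  by (rule measurable_restrict_space1, rule borel_measurable_indicator) simp

lemma square_integrable_indicator: "square_integrable (indicator {a..b})"
  by (rule square_integrable_bounded[where K = 1, OF indicator_measurable_L2]) (simp add: indicator_def)

lemma square_integrable_cut:
  assumes "square_integrable f"
  shows "square_integrable (\<lambda>t. indicator {a..b} t * f t)"
  by (rule square_integrable_mult_bounded[where K = 1, OF indicator_measurable_L2 _ assms]) (simp add: indicator_def)

lemma square_integrable_minus: "square_integrable f \<Longrightarrow> square_integrable (\<lambda>t. - f t)"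
  using square_integrable_scale[of f "-1"] by simp

lemma square_integrable_diff:
  "square_integrable f \<Longrightarrow> square_integrable g \<Longrightarrow> square_integrable (\<lambda>t. f t - g t)"
  using square_integrable_add[OF _ square_integrable_minus] by simp

lemma square_integrable_imp_integrable: "square_integrable f \<Longrightarrow> integrable L2_measure f"
  using square_integrable_mult[OF _ square_integrable_const[of 1]] by simp

lemma integral_L2_measure: "integrable L2_measure f \<Longrightarrow> integral\<^sup>L L2_measure f = integral {0..2 * pi} f"
  for f :: "real \<Rightarrow> real"
  by (intro lebesgue_integral_eq_integral) simp_all

lemma L2_rel_self: "L2_rel f f \<longleftrightarrow> square_integrable f"
  by (simp add: L2_rel_def)

lemma square_integrable_rep: "square_integrable (rep_L2 q)"
  using Quotient3_rep_reflp[OF Quotient3_L2] L2_rel_self by blast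

lemma abs_rep_L2: "abs_L2 (rep_L2 q) = q"
  using Quotient3_abs_rep[OF Quotient3_L2] .

lemma L2_cases: obtains f where "square_integrable f" "q = abs_L2 f"
  using square_integrable_rep abs_rep_L2 by metis

lemma abs_L2_eq_iff:
  "square_integrable f \<Longrightarrow> square_integrable g \<Longrightarrow> abs_L2 f = abs_L2 g \<longleftrightarrow> (AE t in L2_measure. f t = g t)"
  using Quotient3_rel[OF Quotient3_L2, of f g] unfolding L2_rel_def by blast

lemma rep_abs_L2: "square_integrable f \<Longrightarrow> AE t in L2_measure. rep_L2 (abs_L2 f) t = f t"
  by (simp add: abs_L2_eq_iff[symmetric] square_integrable_rep abs_rep_L2)

lemma abs_L2_cong: "(\<And>t. t \<in> {0..2 * pi} \<Longrightarrow> f t = g t) \<Longrightarrow> square_integrable f \<Longrightarrow> square_integrable g \<Longrightarrow> abs_L2 f = abs_L2 g"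
  by (subst abs_L2_eq_iff) (auto intro!: AE_I2 simp: space_restrict_space)

lemma abs_L2_zero: "0 = abs_L2 (\<lambda>t. 0)"
  by (simp add: zero_L2.abs_eq)

lemma abs_L2_add: "square_integrable f \<Longrightarrow> square_integrable g \<Longrightarrow> abs_L2 f + abs_L2 g = abs_L2 (\<lambda>t. f t + g t)"
  by (rule plus_L2.abs_eq) (simp_all add: L2_rel_self)

lemma abs_L2_scaleR: "square_integrable f \<Longrightarrow> c *\<^sub>R abs_L2 f = abs_L2 (\<lambda>t. c * f t)"
  by (rule scaleR_L2.abs_eq) (simp_all add: L2_rel_self)

lemma abs_L2_diff: "square_integrable f \<Longrightarrow> square_integrable g \<Longrightarrow> abs_L2 f - abs_L2 g = abs_L2 (\<lambda>t. f t - g t)"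
  by (simp only: minus_L2_def abs_L2_scaleR abs_L2_add square_integrable_scale) simp

lemma inner_abs_L2_LINT:
  "square_integrable f \<Longrightarrow> square_integrable g \<Longrightarrow> abs_L2 f \<bullet> abs_L2 g = integral\<^sup>L L2_measure (\<lambda>t. f t * g t)"
  by (rule inner_L2.abs_eq) (simp_all add: L2_rel_self)

lemma inner_abs_L2:
  "square_integrable f \<Longrightarrow> square_integrable g \<Longrightarrow> abs_L2 f \<bullet> abs_L2 g = integral {0..2 * pi} (\<lambda>t. f t * g t)"
  by (simp add: inner_abs_L2_LINT integral_L2_measure square_integrable_mult)

lemma norm_abs_L2: "square_integrable f \<Longrightarrow> (norm (abs_L2 f))\<^sup>2 = integral\<^sup>L L2_measure (\<lambda>t. (f t)\<^sup>2)"
  by (simp only: power2_norm_eq_inner inner_abs_L2_LINT) (simp only: power2_eq_square)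

lemma square_integrable_abs: "square_integrable f \<Longrightarrow> square_integrable (\<lambda>t. \<bar>f t\<bar>)"
  by (auto simp: square_integrable_def)

lemma norm_abs_L2_bounded:
  assumes f: "square_integrable f" and K: "\<And>t. t \<in> {0..2 * pi} \<Longrightarrow> \<bar>f t\<bar> \<le> K"
  shows "norm (abs_L2 f) \<le> sqrt (2 * pi) * K"
proof -
  have "0 \<le> K" using K[of 0] by simp
  have "(norm (abs_L2 f))\<^sup>2 \<le> integral\<^sup>L L2_measure (\<lambda>t. K\<^sup>2)"
    unfolding norm_abs_L2[OF f]
  proof (rule integral_mono_AE)
    show "integrable L2_measure (\<lambda>t. (f t)\<^sup>2)" using f by (simp add: square_integrable_def)
    show "integrable L2_measure (\<lambda>t. K\<^sup>2)" using square_integrable_const[of K] by (simp add: square_integrable_def)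
    have "(f t)\<^sup>2 \<le> K\<^sup>2" if "t \<in> {0..2 * pi}" for t
      using power_mono[OF K[OF that], of 2] by simp
    then show "AE t in L2_measure. (f t)\<^sup>2 \<le> K\<^sup>2" by (intro AE_I2) (simp add: space_restrict_space)
  qed
  also have "\<dots> = (sqrt (2 * pi) * K)\<^sup>2" by (simp add: power_mult_distrib measure_restrict_space)
  finally show ?thesis by (rule power2_le_imp_le) (simp add: \<open>0 \<le> K\<close>)
qed

text \<open>
  A subsequence with \<open>norm (X (n + 1) - X n) < 2 ^ -n\<close> is absolutely summable in \<open>L1\<close>, hence converges
  almost everywhere; Fatou's lemma bounds the distance to its limit.
\<close>

lemma L2_fast_Cauchy_convergent:
  fixes X :: "nat \<Rightarrow> L2"
  assumes fast: "\<And>n m. n \<le> m \<Longrightarrow> norm (X m - X n) \<le> (1 / 2) ^ n"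
  shows "convergent X"
proof -
  let ?M = L2_measure
  define f where "f = (\<lambda>n. rep_L2 (X n))"
  have f: "square_integrable (f n)" "X n = abs_L2 (f n)" for n
    by (simp_all add: f_def square_integrable_rep abs_rep_L2)
  have fm [measurable]: "f n \<in> borel_measurable ?M" for n
    using f(1) by (simp add: square_integrable_def)
  define d where "d = (\<lambda>n t. f (Suc n) t - f n t)"
  have d: "square_integrable (d n)" for n unfolding d_def by (intro square_integrable_diff f)
  have dm [measurable]: "d n \<in> borel_measurable ?M" for n
    using d by (simp add: square_integrable_def)
  have normd: "norm (abs_L2 (d n)) \<le> (1 / 2) ^ n" for n
    using fast[of n "Suc n"] by (simp add: d_def f abs_L2_diff)
  \<comment> \<open>Cauchy-Schwarz against the constant 1, of norm at most
    \<open>sqrt (2 * pi)\<close>.\<close>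
  have L1: "(\<integral>\<^sup>+t. ennreal \<bar>d n t\<bar> \<partial>?M) \<le> ennreal (sqrt (2 * pi) * (1 / 2) ^ n)" for n
  proof -
    have "(\<integral>\<^sup>+t. ennreal \<bar>d n t\<bar> \<partial>?M) = ennreal (integral\<^sup>L ?M (\<lambda>t. \<bar>d n t\<bar>))"
      by (rule nn_integral_eq_integral) (simp_all add: square_integrable_imp_integrable d)
    also have "integral\<^sup>L ?M (\<lambda>t. \<bar>d n t\<bar>) = abs_L2 (\<lambda>t. 1) \<bullet> abs_L2 (\<lambda>t. \<bar>d n t\<bar>)"
      by (simp add: inner_abs_L2_LINT square_integrable_abs d square_integrable_const)
    also have "\<dots> \<le> norm (abs_L2 (\<lambda>t. 1)) * norm (abs_L2 (\<lambda>t. \<bar>d n t\<bar>))"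
      by (rule norm_cauchy_schwarz)
    also have "(norm (abs_L2 (\<lambda>t. \<bar>d n t\<bar>)))\<^sup>2 = (norm (abs_L2 (d n)))\<^sup>2"
      by (simp add: norm_abs_L2 d square_integrable_abs)
    then have "norm (abs_L2 (\<lambda>t. \<bar>d n t\<bar>)) = norm (abs_L2 (d n))" by simp
    also have "norm (abs_L2 (\<lambda>t. 1)) * norm (abs_L2 (d n)) \<le> sqrt (2 * pi) * (1 / 2) ^ n"
      using norm_abs_L2_bounded[OF square_integrable_const, of 1 1] normd by (intro mult_mono) auto
    finally show ?thesis by (simp add: ennreal_leI)
  qed
  have "(\<integral>\<^sup>+t. (\<Sum>n. ennreal \<bar>d n t\<bar>) \<partial>?M) = (\<Sum>n. \<integral>\<^sup>+t. ennreal \<bar>d n t\<bar> \<partial>?M)"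
    by (rule nn_integral_suminf) simp
  also have "\<dots> \<le> (\<Sum>n. ennreal (sqrt (2 * pi) * (1 / 2) ^ n))"
    by (rule suminf_le[OF L1]) auto
  also have "\<dots> = ennreal (\<Sum>n. sqrt (2 * pi) * (1 / 2) ^ n)"
    by (rule suminf_ennreal2) (auto intro!: summable_mult summable_geometric)
  also have "\<dots> < \<infinity>" by simp
  finally have "(\<integral>\<^sup>+t. (\<Sum>n. ennreal \<bar>d n t\<bar>) \<partial>?M) \<noteq> \<infinity>" by (rule less_imp_neq)
  moreover have "(\<lambda>t. \<Sum>n. ennreal \<bar>d n t\<bar>) \<in> borel_measurable ?M" by measurable
  ultimately have "AE t in ?M. (\<Sum>n. ennreal \<bar>d n t\<bar>) \<noteq> \<infinity>"
    by (rule nn_integral_PInf_AE[rotated])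
  then have conv: "AE t in ?M. convergent (\<lambda>n. f n t)"
  proof eventually_elim
    case (elim t)
    have "summable (\<lambda>n. \<bar>d n t\<bar>)" by (rule summable_suminf_not_top) (use elim in simp_all)
    then have "summable (\<lambda>n. d n t)" by (rule summable_rabs_cancel)
    then have "convergent (\<lambda>n. \<Sum>i<n. d i t)" by (simp add: summable_iff_convergent)
    then have "convergent (\<lambda>n. (\<Sum>i<n. d i t) + f 0 t)"
      by (intro convergent_add convergent_const)
    moreover have "(\<Sum>i<n. d i t) + f 0 t = f n t" for n
      using sum_lessThan_telescope[of "\<lambda>i. f i t" n] by (simp add: d_def)
    ultimately show ?case by simp
  qed
  define F where "F = (\<lambda>t. lim (\<lambda>n. f n t))"
  have Fm [measurable]: "F \<in> borel_measurable ?M"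
    unfolding F_def by (rule borel_measurable_lim_metric) simp
  have lim: "AE t in ?M. (\<lambda>n. f n t) \<longlonglongrightarrow> F t"
    using conv unfolding F_def by eventually_elim (simp add: convergent_LIMSEQ_iff)
  have fatou: "(\<integral>\<^sup>+t. ennreal ((F t - f n t)\<^sup>2) \<partial>?M) \<le> ennreal (((1 / 2) ^ n)\<^sup>2)" for n
  proof -
    have "(\<integral>\<^sup>+t. ennreal ((F t - f n t)\<^sup>2) \<partial>?M) = (\<integral>\<^sup>+t. liminf (\<lambda>m. ennreal ((f m t - f n t)\<^sup>2)) \<partial>?M)"
    proof (rule nn_integral_cong_AE)
      show "AE t in ?M. ennreal ((F t - f n t)\<^sup>2) = liminf (\<lambda>m. ennreal ((f m t - f n t)\<^sup>2))"
        using lim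
      proof eventually_elim
        case (elim t)
        then have "(\<lambda>m. ennreal ((f m t - f n t)\<^sup>2)) \<longlonglongrightarrow> ennreal ((F t - f n t)\<^sup>2)"
          by (intro tendsto_ennrealI tendsto_intros)
        from lim_imp_Liminf[OF trivial_limit_sequentially this] show ?case by (rule sym)
      qed
    qed
    also have "\<dots> \<le> liminf (\<lambda>m. \<integral>\<^sup>+t. ennreal ((f m t - f n t)\<^sup>2) \<partial>?M)"
      by (rule nn_integral_liminf) simp
    also have "\<dots> \<le> ennreal (((1 / 2) ^ n)\<^sup>2)"
    proof (rule Liminf_le)
      show "\<forall>\<^sub>F m in sequentially. (\<integral>\<^sup>+t. ennreal ((f m t - f n t)\<^sup>2) \<partial>?M) \<le> ennreal (((1 / 2) ^ n)\<^sup>2)"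
        using eventually_ge_at_top[of n]
      proof eventually_elim
        case (elim m)
        have sq: "square_integrable (\<lambda>t. f m t - f n t)" by (intro square_integrable_diff f)
        have "(\<integral>\<^sup>+t. ennreal ((f m t - f n t)\<^sup>2) \<partial>?M) = ennreal (integral\<^sup>L ?M (\<lambda>t. (f m t - f n t)\<^sup>2))"
          by (rule nn_integral_eq_integral) (use sq in \<open>simp_all add: square_integrable_def\<close>)
        also have "\<dots> = ennreal ((norm (X m - X n))\<^sup>2)"
          by (simp add: norm_abs_L2[OF sq, symmetric] f abs_L2_diff)
        also have "\<dots> \<le> ennreal (((1 / 2) ^ n)\<^sup>2)"
          using fast[OF elim] by (intro ennreal_leI power_mono) auto
        finally show ?case .
      qed
    qed simp
    finally show ?thesis .
  qed
  have FmF: "square_integrable (\<lambda>t. F t - f n t)" for n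
    unfolding square_integrable_def
  proof
    show "integrable ?M (\<lambda>t. (F t - f n t)\<^sup>2)"
    proof (rule integrableI_bounded)
      show "(\<integral>\<^sup>+t. ennreal (norm ((F t - f n t)\<^sup>2)) \<partial>?M) < \<infinity>"
        using le_less_trans[OF fatou[of n] ennreal_less_top] by simp
    qed simp
  qed simp
  have F: "square_integrable F"
    using square_integrable_add[OF FmF[of 0] f(1)[of 0]] by simp
  have "norm (abs_L2 F - X n) \<le> (1 / 2) ^ n" for n
  proof -
    have "ennreal ((norm (abs_L2 F - X n))\<^sup>2) = ennreal (integral\<^sup>L ?M (\<lambda>t. (F t - f n t)\<^sup>2))"
      by (simp add: f abs_L2_diff F norm_abs_L2[OF FmF])
    also have "\<dots> = (\<integral>\<^sup>+t. ennreal ((F t - f n t)\<^sup>2) \<partial>?M)"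
      by (rule nn_integral_eq_integral[symmetric]) (use FmF[of n] in \<open>simp_all add: square_integrable_def\<close>)
    also note fatou[of n]
    finally have "(norm (abs_L2 F - X n))\<^sup>2 \<le> ((1 / 2) ^ n)\<^sup>2"
      by (simp add: ennreal_le_iff)
    then show ?thesis by (rule power2_le_imp_le) simp
  qed
  then have "\<forall>\<^sub>F n in sequentially. norm (X n - abs_L2 F) \<le> (1 / 2) ^ n"
    by (simp add: norm_minus_commute)
  moreover have "(\<lambda>n. (1 / 2) ^ n :: real) \<longlonglongrightarrow> 0" by (intro LIMSEQ_power_zero) simp
  ultimately have "(\<lambda>n. X n - abs_L2 F) \<longlonglongrightarrow> 0" by (rule Lim_null_comparison)
  then have "X \<longlonglongrightarrow> abs_L2 F" by (simp add: LIM_zero_iff)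
  then show ?thesis by (rule convergentI)
qed

instance L2 :: complete_space
proof
  fix X :: "nat \<Rightarrow> L2" assume X: "Cauchy X"
  have "\<exists>N. \<forall>m\<ge>N. \<forall>k\<ge>N. norm (X m - X k) < (1 / 2) ^ n" for n
    using X zero_less_power[of "1/2 :: real" n] unfolding Cauchy_iff by simp
  then have "\<exists>N. \<forall>n. \<forall>m\<ge>N n. \<forall>k\<ge>N n. norm (X m - X k) < (1 / 2) ^ n"
    by (intro choice allI)
  then obtain N where "\<forall>n. \<forall>m\<ge>N n. \<forall>k\<ge>N n. norm (X m - X k) < (1 / 2) ^ n" ..
  then have N: "norm (X m - X k) < (1 / 2) ^ n" if "m \<ge> N n" "k \<ge> N n" for n m k
    using that by blast
  \<comment> \<open>The sum gives \<open>r n \<ge> N n\<close>, the added \<open>n\<close> makes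
    \<open>r\<close> strictly increasing.\<close>
  define r where "r = (\<lambda>n. (\<Sum>i\<le>n. N i) + n)"
  have r: "strict_mono r" unfolding r_def by (rule strict_monoI_Suc) simp
  have rN: "r n \<ge> N n" for n
    unfolding r_def using member_le_sum[of n "{..n}" N] by simp
  have "convergent (X \<circ> r)"
  proof (rule L2_fast_Cauchy_convergent)
    fix n m :: nat assume "n \<le> m"
    then have "r m \<ge> N n" using rN[of n] strict_mono_mono[OF r] by (meson monoD order_trans)
    then show "norm ((X \<circ> r) m - (X \<circ> r) n) \<le> (1 / 2) ^ n"
      using N[of n "r m" "r n"] rN[of n] by (simp add: less_imp_le)
  qed
  then obtain l where "(X \<circ> r) \<longlonglongrightarrow> l" by (auto simp: convergent_def)
  then have "X \<longlonglongrightarrow> l" using Cauchy_converges_subseq[OF X r] by blast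
  then show "convergent X" by (rule convergentI)
qed

text \<open>
  If all interval integrals of \<open>f\<close> vanish, Henstock's lemma bounds the Riemann sums of \<open>\<bar>f\<bar>\<close>.
\<close>

lemma has_integral_abs_0:
  fixes f :: "real \<Rightarrow> real"
  assumes f: "f integrable_on {a..b}"
    and 0: "\<And>c d. a \<le> c \<Longrightarrow> c \<le> d \<Longrightarrow> d \<le> b \<Longrightarrow> integral {c..d} f = 0"
  shows "((\<lambda>t. \<bar>f t\<bar>) has_integral 0) {a..b}"
proof -
  have "((\<lambda>t. \<bar>f t\<bar>) has_integral 0) (cbox a b)"
    unfolding has_integral
  proof (intro allI impI)
    fix e :: real assume "e > 0"
    have "f integrable_on cbox a b" using f by simp
    then show "\<exists>\<gamma>. gauge \<gamma> \<and> (\<forall>p. p tagged_division_of cbox a b \<and> \<gamma> fine p \<longrightarrow>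
        norm ((\<Sum>(x, k)\<in>p. measure lborel k *\<^sub>R \<bar>f x\<bar>) - 0) < e)"
    proof (rule Henstock_lemma[OF _ \<open>e > 0\<close>], intro exI conjI allI impI)
      fix \<gamma> assume \<gamma>: "gauge \<gamma>" "\<And>p. p tagged_partial_division_of cbox a b \<Longrightarrow> \<gamma> fine p \<Longrightarrow>
        (\<Sum>(x, k)\<in>p. norm (measure lborel k *\<^sub>R f x - integral k f)) < e"
      then show "gauge \<gamma>" by simp
      fix p assume p: "p tagged_division_of cbox a b \<and> \<gamma> fine p"
      \<comment> \<open>As \<open>integral k f = 0\<close> on every tile, the Henstock deviation of
        a tile is the absolute value of its own summand.\<close>
      have "(\<Sum>(x, k)\<in>p. measure lborel k *\<^sub>R \<bar>f x\<bar>) = (\<Sum>(x, k)\<in>p. norm (measure lborel k *\<^sub>R f x - integral k f))"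
      proof (rule sum.cong[OF refl], clarify)
        fix x k assume xk: "(x, k) \<in> p"
        have td: "p tagged_division_of cbox a b" using p by simp
        obtain c d where k: "k = cbox c d" using tagged_division_ofD(4)[OF td xk] by blast
        have "x \<in> k" "k \<subseteq> cbox a b" using tagged_division_ofD(2,3)[OF td xk] by auto
        then have "a \<le> c" "c \<le> d" "d \<le> b" unfolding k by auto
        then have "integral k f = 0" unfolding k using 0 by simp
        then show "measure lborel k *\<^sub>R \<bar>f x\<bar> = norm (measure lborel k *\<^sub>R f x - integral k f)"
          by (simp add: abs_mult)
      qed
      also have "\<dots> < e" using p by (intro \<gamma>(2)) (auto simp: tagged_division_of_def)
      finally have "(\<Sum>(x, k)\<in>p. measure lborel k *\<^sub>R \<bar>f x\<bar>) < e" .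
      moreover have "(\<Sum>(x, k)\<in>p. measure lborel k *\<^sub>R \<bar>f x\<bar>) \<ge> 0"
        by (intro sum_nonneg) (auto intro: mult_nonneg_nonneg)
      ultimately show "norm ((\<Sum>(x, k)\<in>p. measure lborel k *\<^sub>R \<bar>f x\<bar>) - 0) < e" by simp
    qed
  qed
  then show ?thesis by simp
qed

lemma integral_cut:
  fixes f :: "real \<Rightarrow> real"
  assumes "0 \<le> a" "b \<le> 2 * pi"
  shows "integral {0..2 * pi} (\<lambda>t. indicator {a..b} t * f t) = integral {a..b} f"
proof -
  have eq: "(\<lambda>t. indicator {a..b} t * f t) = (\<lambda>t. if t \<in> {a..b} then f t else 0)"
    by (auto simp: indicator_def)
  have "{a..b} \<inter> {0..2 * pi} = {a..b}" using assms by auto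
  then show ?thesis unfolding eq Henstock_Kurzweil_Integration.integral_restrict_Int by (rule arg_cong)
qed

lemma square_integrable_integrable_on:
  assumes "square_integrable f" "0 \<le> a" "b \<le> 2 * pi"
  shows "f integrable_on {a..b}"
proof -
  have "f integrable_on {0..2 * pi}"
    by (rule integrable_on_lebesgue_on[OF square_integrable_imp_integrable[OF assms(1)]]) simp
  then show ?thesis by (rule integrable_subinterval_real) (use assms in auto)
qed

text \<open>The primitive of a representative vanishes identically, hence so do all its interval
  integrals and, by \<open>has_integral_abs_0\<close>, the integral of its absolute value.\<close>

lemma L2_eq_0I:
  assumes "\<And>c. c \<in> {0..2 * pi} \<Longrightarrow> u \<bullet> abs_L2 (indicator {0..c}) = 0"
  shows "u = 0"
proof -
  obtain f where f: "square_integrable f" "u = abs_L2 f" by (rule L2_cases)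
  have 0: "integral {0..c} f = 0" if "0 \<le> c" "c \<le> 2 * pi" for c
    using assms[of c] that integral_cut[of 0 c f]
    by (simp add: f inner_abs_L2 square_integrable_indicator mult.commute)
  have "((\<lambda>t. \<bar>f t\<bar>) has_integral 0) {0..2 * pi}"
  proof (rule has_integral_abs_0)
    show "f integrable_on {0..2 * pi}" by (rule square_integrable_integrable_on[OF f(1)]) simp_all
    fix c d :: real assume cd: "0 \<le> c" "c \<le> d" "d \<le> 2 * pi"
    then show "integral {c..d} f = 0"
      using Henstock_Kurzweil_Integration.integral_combine[of 0 c d f]
        square_integrable_integrable_on[OF f(1), of 0 d] 0[of c] 0[of d] by simp
  qed
  then have "integral\<^sup>L L2_measure (\<lambda>t. \<bar>f t\<bar>) = 0"
    using integral_L2_measure[OF square_integrable_imp_integrable[OF square_integrable_abs[OF f(1)]]]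
    by (simp add: integral_unique)
  then have "AE t in L2_measure. \<bar>f t\<bar> = 0"
    by (subst (asm) integral_nonneg_eq_0_iff_AE)
       (simp_all add: square_integrable_imp_integrable square_integrable_abs f)
  then show ?thesis
    by (simp add: f abs_L2_zero abs_L2_eq_iff square_integrable_const)
qed

section \<open>Orthonormal bases\<close>

definition orthonormal_seq :: "(nat \<Rightarrow> 'a::real_inner) \<Rightarrow> bool" where
  "orthonormal_seq e \<longleftrightarrow> (\<forall>m n. e m \<bullet> e n = (if m = n then 1 else 0))"

text \<open>In a Hilbert space this is density of the span; orthogonality is the form in which
  \<open>fourier_map_inverse\<close> consumes it.\<close>

definition total_seq :: "(nat \<Rightarrow> 'a::real_inner) \<Rightarrow> bool" where
  "total_seq b \<longleftrightarrow> (\<forall>u. (\<forall>n. u \<bullet> b n = 0) \<longrightarrow> u = 0)"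

lemma norm_sum_orthonormal:
  assumes "orthonormal_seq e" "finite A"
  shows "(norm (\<Sum>n\<in>A. a n *\<^sub>R e n))\<^sup>2 = (\<Sum>n\<in>A. (a n)\<^sup>2)"
proof -
  have "(norm (\<Sum>n\<in>A. a n *\<^sub>R e n))\<^sup>2 = (\<Sum>n\<in>A. \<Sum>m\<in>A. a n * (a m * (e n \<bullet> e m)))"
    by (simp add: power2_norm_eq_inner inner_sum_left inner_sum_right sum_distrib_left inner_commute mult.left_commute)
  also have "\<dots> = (\<Sum>n\<in>A. \<Sum>m\<in>A. if n = m then a n * a m else 0)"
    using assms(1) by (intro sum.cong refl) (simp add: orthonormal_seq_def)
  also have "\<dots> = (\<Sum>n\<in>A. (a n)\<^sup>2)"
    using assms(2) by (simp add: power2_eq_square)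
  finally show ?thesis .
qed

lemma bessel_inequality:
  assumes e: "orthonormal_seq e" and "finite A"
  shows "(\<Sum>n\<in>A. (x \<bullet> e n)\<^sup>2) \<le> (norm x)\<^sup>2"
proof -
  define s where "s = (\<Sum>n\<in>A. (x \<bullet> e n) *\<^sub>R e n)"
  have ss: "(norm s)\<^sup>2 = (\<Sum>n\<in>A. (x \<bullet> e n)\<^sup>2)"
    unfolding s_def by (rule norm_sum_orthonormal[OF assms])
  have xs: "x \<bullet> s = (\<Sum>n\<in>A. (x \<bullet> e n)\<^sup>2)"
    unfolding s_def by (simp add: inner_sum_right power2_eq_square)
  have "0 \<le> (norm (x - s))\<^sup>2" by simp
  also have "\<dots> = (norm x)\<^sup>2 - 2 * (x \<bullet> s) + (norm s)\<^sup>2"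
    by (simp add: power2_norm_eq_inner inner_diff_left inner_diff_right inner_commute)
  finally show ?thesis using ss xs by simp
qed

lemma summable_bessel:
  assumes "orthonormal_seq e"
  shows "summable (\<lambda>n. (x \<bullet> e n)\<^sup>2)"
  by (rule bounded_imp_summable[where B = "(norm x)\<^sup>2"]) (use bessel_inequality[OF assms] in auto)

text \<open>Riesz-Fischer: by Pythagoras the squared norm of a block of the series is a block of the
  scalar series.\<close>

lemma summable_orthonormal:
  fixes f :: "nat \<Rightarrow> 'b::{real_inner,complete_space}"
  assumes f: "orthonormal_seq f" and a: "summable (\<lambda>n. (a n)\<^sup>2)"
  shows "summable (\<lambda>n. a n *\<^sub>R f n)"
proof -
  have "Cauchy (\<lambda>n. \<Sum>i<n. a i *\<^sub>R f i)"
    unfolding Cauchy_iff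
  proof (intro allI impI)
    fix e :: real assume e: "0 < e"
    have "Cauchy (\<lambda>n. \<Sum>i<n. (a i)\<^sup>2)" using a by (simp add: summable_iff_convergent Cauchy_convergent_iff)
    then obtain M where M: "\<And>m n. m \<ge> M \<Longrightarrow> n \<ge> M \<Longrightarrow> norm ((\<Sum>i<m. (a i)\<^sup>2) - (\<Sum>i<n. (a i)\<^sup>2)) < e\<^sup>2"
      unfolding Cauchy_iff using e by (meson zero_less_power)
    have *: "norm ((\<Sum>i<n. a i *\<^sub>R f i) - (\<Sum>i<m. a i *\<^sub>R f i)) < e" if "m \<ge> M" "m \<le> n" for m n
    proof -
      have eq: "(\<Sum>i<n. g i) - (\<Sum>i<m. g i) = (\<Sum>i\<in>{m..<n}. g i)" for g :: "nat \<Rightarrow> 'c::ab_group_add"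
        using sum_diff_nat_ivl[of 0 m n g] that by (simp add: atLeast0LessThan)
      have "(norm ((\<Sum>i<n. a i *\<^sub>R f i) - (\<Sum>i<m. a i *\<^sub>R f i)))\<^sup>2 = (\<Sum>i<n. (a i)\<^sup>2) - (\<Sum>i<m. (a i)\<^sup>2)"
        unfolding eq by (rule norm_sum_orthonormal[OF f]) simp
      also have "\<dots> < e\<^sup>2" using M[of n m] that by simp
      finally show ?thesis by (rule power_less_imp_less_base) (use e in simp)
    qed
    show "\<exists>M. \<forall>m\<ge>M. \<forall>n\<ge>M. norm ((\<Sum>i<m. a i *\<^sub>R f i) - (\<Sum>i<n. a i *\<^sub>R f i)) < e"
    proof (rule exI[of _ M], intro allI impI)
      fix m n assume "m \<ge> M" "n \<ge> M"
      then show "norm ((\<Sum>i<m. a i *\<^sub>R f i) - (\<Sum>i<n. a i *\<^sub>R f i)) < e"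
        using *[of m n] *[of n m] by (cases "m \<le> n") (auto simp: norm_minus_commute)
    qed
  qed
  then have "convergent (\<lambda>n. \<Sum>i<n. a i *\<^sub>R f i)" by (rule Cauchy_convergent)
  then show ?thesis by (simp add: summable_iff_convergent)
qed

text \<open>The linear map matching two orthonormal systems; between bases it is unitary, with
  \<open>fourier_map f e\<close> as its inverse.\<close>

definition fourier_map :: "(nat \<Rightarrow> 'a::real_inner) \<Rightarrow> (nat \<Rightarrow> 'b::{real_inner,complete_space}) \<Rightarrow> 'a \<Rightarrow> 'b" where
  "fourier_map e f x = (\<Sum>n. (x \<bullet> e n) *\<^sub>R f n)"

context
  fixes e :: "nat \<Rightarrow> 'a::real_inner" and f :: "nat \<Rightarrow> 'b::{real_inner,complete_space}"
  assumes e: "orthonormal_seq e" and f: "orthonormal_seq f"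
begin

lemma fourier_map_sums: "(\<lambda>n. (x \<bullet> e n) *\<^sub>R f n) sums fourier_map e f x"
  unfolding fourier_map_def by (intro summable_sums summable_orthonormal f summable_bessel e)

lemma inner_fourier_map: "fourier_map e f x \<bullet> f n = x \<bullet> e n"
proof -
  have "(\<lambda>k. ((x \<bullet> e k) *\<^sub>R f k) \<bullet> f n) sums (fourier_map e f x \<bullet> f n)"
    by (rule bounded_linear.sums[OF bounded_linear_inner_left fourier_map_sums])
  moreover have "(\<lambda>k. ((x \<bullet> e k) *\<^sub>R f k) \<bullet> f n) = (\<lambda>k. if k = n then x \<bullet> e n else 0)"
    using f by (auto simp: orthonormal_seq_def)
  ultimately have "(\<lambda>k. if k = n then x \<bullet> e n else 0) sums (fourier_map e f x \<bullet> f n)" by simp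
  from sums_unique2[OF this sums_single[of n "\<lambda>_. x \<bullet> e n"]] show ?thesis by simp
qed

lemma bounded_linear_fourier_map: "bounded_linear (fourier_map e f)"
proof (rule bounded_linear_intro[where K = 1])
  fix x y c
  have "(\<lambda>n. (x \<bullet> e n) *\<^sub>R f n + (y \<bullet> e n) *\<^sub>R f n) sums (fourier_map e f x + fourier_map e f y)"
    by (intro sums_add fourier_map_sums)
  then show "fourier_map e f (x + y) = fourier_map e f x + fourier_map e f y"
    using sums_unique2[OF fourier_map_sums[of "x + y"]] by (simp add: inner_add_left scaleR_add_left)
  have "(\<lambda>n. c *\<^sub>R ((x \<bullet> e n) *\<^sub>R f n)) sums (c *\<^sub>R fourier_map e f x)"
    by (intro sums_scaleR_right fourier_map_sums)
  then show "fourier_map e f (c *\<^sub>R x) = c *\<^sub>R fourier_map e f x"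
    using sums_unique2[OF fourier_map_sums[of "c *\<^sub>R x"]] by simp
  have "norm (\<Sum>n<N. (x \<bullet> e n) *\<^sub>R f n) \<le> norm x" for N
  proof -
    have "(norm (\<Sum>n<N. (x \<bullet> e n) *\<^sub>R f n))\<^sup>2 \<le> (norm x)\<^sup>2"
      using norm_sum_orthonormal[OF f, of "{..<N}"] bessel_inequality[OF e, of "{..<N}"] by simp
    then show ?thesis by (rule power2_le_imp_le) simp
  qed
  then have "norm (fourier_map e f x) \<le> norm x"
    using tendsto_norm[OF fourier_map_sums[of x, unfolded sums_def]]
    by (intro LIMSEQ_le_const2) auto
  then show "norm (fourier_map e f x) \<le> norm x * 1" by simp
qed

end

lemma fourier_map_inverse:
  fixes e :: "nat \<Rightarrow> 'a::{real_inner,complete_space}" and f :: "nat \<Rightarrow> 'b::{real_inner,complete_space}"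
  assumes e: "orthonormal_seq e" and f: "orthonormal_seq f" and tot: "total_seq f"
  shows "fourier_map e f (fourier_map f e y) = y"
proof -
  have "(fourier_map e f (fourier_map f e y) - y) \<bullet> f n = 0" for n
    by (simp add: inner_diff_left inner_fourier_map[OF e f] inner_fourier_map[OF f e])
  with tot have "fourier_map e f (fourier_map f e y) - y = 0" unfolding total_seq_def by blast
  then show ?thesis by simp
qed

lemma diffeomorphism_fourier_map:
  fixes e :: "nat \<Rightarrow> 'a::{real_inner,complete_space}" and f :: "nat \<Rightarrow> 'b::{real_inner,complete_space}"
  assumes e: "orthonormal_seq e" "total_seq e" and f: "orthonormal_seq f" "total_seq f"
  shows "diffeomorphism (fourier_map e f)"
proof -
  note 1 = fourier_map_inverse[OF e(1) f] and 2 = fourier_map_inverse[OF f(1) e]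
  have bij: "bij (fourier_map e f)" by (rule o_bij[of "fourier_map f e"]) (auto simp: fun_eq_iff 1 2)
  have "inv (fourier_map e f) = fourier_map f e" by (rule inv_unique_comp) (auto simp: fun_eq_iff 1 2)
  with bij show ?thesis
    by (simp add: diffeomorphism_def bounded_linear_imp_smooth bounded_linear_fourier_map e f)
qed

text \<open>No independence is assumed: as \<open>sgn 0 = 0\<close>, a vector that depends on its
  predecessors is sent to 0, and such entries are discarded in
  \<open>exists_orthonormal_basis\<close>.\<close>

fun gram_schmidt :: "(nat \<Rightarrow> 'a::real_inner) \<Rightarrow> nat \<Rightarrow> 'a" where
  "gram_schmidt b n = sgn (b n - (\<Sum>i<n. (b n \<bullet> gram_schmidt b i) *\<^sub>R gram_schmidt b i))"

declare gram_schmidt.simps [simp del]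

lemma gram_schmidt_self: "gram_schmidt b n = 0 \<or> gram_schmidt b n \<bullet> gram_schmidt b n = 1"
  by (subst (1 2 3) gram_schmidt.simps) (auto simp: power2_norm_eq_inner[symmetric] norm_sgn)

lemma gram_schmidt_residual:
  assumes ON: "\<And>i j. i < j \<Longrightarrow> j < n \<Longrightarrow> gram_schmidt b i \<bullet> gram_schmidt b j = 0" and "j < n"
  shows "(x - (\<Sum>i<n. (x \<bullet> gram_schmidt b i) *\<^sub>R gram_schmidt b i)) \<bullet> gram_schmidt b j = 0"
proof -
  have "(\<Sum>i<n. (x \<bullet> gram_schmidt b i) * (gram_schmidt b i \<bullet> gram_schmidt b j)) =
      (\<Sum>i<n. if i = j then x \<bullet> gram_schmidt b j else 0)"
  proof (rule sum.cong[OF refl])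
    fix i assume "i \<in> {..<n}"
    then show "(x \<bullet> gram_schmidt b i) * (gram_schmidt b i \<bullet> gram_schmidt b j) = (if i = j then x \<bullet> gram_schmidt b j else 0)"
      using ON[of i j] ON[of j i] gram_schmidt_self[of b j] \<open>j < n\<close>
      by (cases i j rule: linorder_cases) (auto simp: inner_commute)
  qed
  then show ?thesis using \<open>j < n\<close> by (simp add: inner_diff_left inner_sum_left)
qed

lemma gram_schmidt_orthogonal: "m < n \<Longrightarrow> gram_schmidt b m \<bullet> gram_schmidt b n = 0"
proof (induction n arbitrary: m rule: less_induct)
  case (less n)
  have "(b n - (\<Sum>i<n. (b n \<bullet> gram_schmidt b i) *\<^sub>R gram_schmidt b i)) \<bullet> gram_schmidt b m = 0"
    using less by (intro gram_schmidt_residual) auto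
  then show ?case
    by (subst inner_commute, subst gram_schmidt.simps) (simp add: sgn_div_norm)
qed

lemma gram_schmidt_orthogonal_iff: "m \<noteq> n \<Longrightarrow> gram_schmidt b m \<bullet> gram_schmidt b n = 0"
  using gram_schmidt_orthogonal[of m n b] gram_schmidt_orthogonal[of n m b]
  by (cases m n rule: linorder_cases) (auto simp: inner_commute)

lemma gram_schmidt_total:
  assumes b: "total_seq b" and u: "\<And>n. u \<bullet> gram_schmidt b n = 0"
  shows "u = 0"
proof -
  have "u \<bullet> b n = 0" for n
  proof -
    define r where "r = b n - (\<Sum>i<n. (b n \<bullet> gram_schmidt b i) *\<^sub>R gram_schmidt b i)"
    have "r = norm r *\<^sub>R gram_schmidt b n"
      by (subst gram_schmidt.simps) (cases "r = 0", auto simp: r_def[symmetric] sgn_div_norm)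
    then have "u \<bullet> r = 0" using u by (metis inner_scaleR_right mult_zero_right)
    moreover have "b n = r + (\<Sum>i<n. (b n \<bullet> gram_schmidt b i) *\<^sub>R gram_schmidt b i)" by (simp add: r_def)
    then have "u \<bullet> b n = u \<bullet> (r + (\<Sum>i<n. (b n \<bullet> gram_schmidt b i) *\<^sub>R gram_schmidt b i))" by (rule arg_cong)
    ultimately show ?thesis by (simp add: inner_add_right inner_sum_right u)
  qed
  with b show ?thesis by (simp add: total_seq_def)
qed

text \<open>A beginning that is already orthonormal survives unchanged; this is how the three
  normalized modes come to head a basis of \<open>L2\<close>.\<close>

lemma gram_schmidt_orthonormal_prefix:
  assumes ON: "\<And>i j. i < k \<Longrightarrow> j < k \<Longrightarrow> b i \<bullet> b j = (if i = j then 1 else 0)"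
  shows "n < k \<Longrightarrow> gram_schmidt b n = b n"
proof (induction n rule: less_induct)
  case (less n)
  have "(\<Sum>i<n. (b n \<bullet> gram_schmidt b i) *\<^sub>R gram_schmidt b i) = 0"
    using less ON by (intro sum.neutral) auto
  moreover have "norm (b n) = 1" using ON[of n n] less.prems by (simp add: norm_eq_sqrt_inner)
  ultimately show ?case by (subst gram_schmidt.simps) (simp add: sgn_div_norm)
qed

text \<open>If only finitely many Gram-Schmidt vectors were nonzero, every vector would equal its
  finite Fourier sum by totality, and the space would have finite dimension. So the nonzero ones
  beyond the prefix form an infinite set and can be enumerated.\<close>

lemma exists_orthonormal_basis:
  fixes b :: "nat \<Rightarrow> 'a::real_inner"
  assumes tot: "total_seq b" and inf: "\<not> (\<exists>B :: 'a set. finite B \<and> span B = UNIV)"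
    and ON: "\<And>i j. i < k \<Longrightarrow> j < k \<Longrightarrow> b i \<bullet> b j = (if i = j then 1 else 0)"
  obtains e where "orthonormal_seq e" "total_seq e" "\<And>n. n < k \<Longrightarrow> e n = b n"
proof -
  let ?g = "gram_schmidt b"
  define I where "I = {n. ?g n \<noteq> 0}"
  have "infinite I"
  proof
    assume fin: "finite I"
    have "x \<in> span (?g ` I)" for x
    proof -
      have "(x - (\<Sum>i\<in>I. (x \<bullet> ?g i) *\<^sub>R ?g i)) \<bullet> ?g n = 0" for n
      proof (cases "n \<in> I")
        case True
        have "(\<Sum>i\<in>I. (x \<bullet> ?g i) * (?g i \<bullet> ?g n)) = (\<Sum>i\<in>I. if i = n then x \<bullet> ?g n else 0)"
          using gram_schmidt_orthogonal_iff[of _ n b] gram_schmidt_self[of b n] True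
          by (intro sum.cong refl) (auto simp: I_def)
        then show ?thesis using fin True by (simp add: inner_diff_left inner_sum_left)
      qed (simp add: I_def)
      from gram_schmidt_total[OF tot this] have "x = (\<Sum>i\<in>I. (x \<bullet> ?g i) *\<^sub>R ?g i)" by simp
      also have "\<dots> \<in> span (?g ` I)" by (intro span_sum span_scale span_base) simp
      finally show ?thesis .
    qed
    with inf fin show False by blast
  qed
  define J where "J = I - {..<k}"
  have J: "infinite J" using \<open>infinite I\<close> by (simp add: J_def)
  define e where "e = (\<lambda>n. if n < k then b n else ?g (enumerate J (n - k)))"
  have pre: "?g n = b n" if "n < k" for n using gram_schmidt_orthonormal_prefix[OF ON that] by simp
  define \<iota> where "\<iota> = (\<lambda>n. if n < k then n else enumerate J (n - k))"
  have e\<iota>: "e n = ?g (\<iota> n)" for n by (simp add: e_def \<iota>_def pre)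
  have inJ: "enumerate J n \<in> J" for n by (rule enumerate_in_set[OF J])
  have \<iota>: "\<iota> m = \<iota> n \<longleftrightarrow> m = n" for m n
    using inJ[of "m - k"] inJ[of "n - k"] strict_mono_eq[OF strict_mono_enumerate[OF J], of "m - k" "n - k"]
    unfolding \<iota>_def J_def by (cases "m < k"; cases "n < k") auto
  have self: "?g (\<iota> n) \<bullet> ?g (\<iota> n) = 1" for n
  proof (cases "n < k")
    case True
    then show ?thesis using ON[of n n] by (simp add: \<iota>_def pre)
  next
    case False
    then have "?g (\<iota> n) \<noteq> 0" using inJ[of "n - k"] by (simp add: \<iota>_def J_def I_def)
    then show ?thesis using gram_schmidt_self[of b "\<iota> n"] by simp
  qed
  have "orthonormal_seq e"
    unfolding orthonormal_seq_def e\<iota> by (auto simp: self gram_schmidt_orthogonal_iff \<iota>)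
  moreover have "total_seq e"
    unfolding total_seq_def
  proof (intro allI impI)
    fix u assume u: "\<forall>n. u \<bullet> e n = 0"
    show "u = 0"
    proof (rule gram_schmidt_total[OF tot])
      fix n
      consider "n < k" | "n \<in> J" | "?g n = 0" by (auto simp: J_def I_def)
      then show "u \<bullet> ?g n = 0"
      proof cases
        case 1
        then show ?thesis using u[rule_format, of n] by (simp add: e_def pre)
      next
        case 2
        then obtain j where "n = enumerate J j" using enumerate_Ex[OF J 2] by metis
        then show ?thesis using u[rule_format, of "j + k"] by (simp add: e_def)
      qed simp
    qed
  qed
  ultimately show thesis by (rule that) (simp add: e_def)
qed

lemma total_seq_separable:
  fixes S :: "'a::real_inner set"
  assumes "countable S" "closure S = UNIV"
  shows "total_seq (from_nat_into S)"
  unfolding total_seq_def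
proof (intro allI impI)
  fix u assume u: "\<forall>n. u \<bullet> from_nat_into S n = 0"
  have "S \<subseteq> {v. u \<bullet> v = 0}" using u from_nat_into_surj[OF assms(1)] by blast
  moreover have "closed {v. u \<bullet> v = 0}" by (intro closed_Collect_eq continuous_intros)
  ultimately have "UNIV \<subseteq> {v. u \<bullet> v = 0}" using closure_minimal assms(2) by metis
  then have "u \<bullet> u = 0" by blast
  then show "u = 0" by simp
qed

lemma inner_abs_L2_indicator:
  assumes f: "square_integrable f" and c: "0 \<le> a" "b \<le> 2 * pi"
  shows "abs_L2 f \<bullet> abs_L2 (indicator {a..b}) = integral {a..b} f"
  using integral_cut[OF c, of f] by (simp add: inner_abs_L2 square_integrable_indicator f mult.commute)

lemma L2_infinite_dimensional: "\<not> (\<exists>B :: L2 set. finite B \<and> span B = UNIV)"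
proof
  assume "\<exists>B :: L2 set. finite B \<and> span B = UNIV"
  then obtain B :: "L2 set" where B: "finite B" "span B = UNIV" by blast
  \<comment> \<open>Strictly increasing from 0 and below \<open>2 * pi\<close>; two of the intervals
    share at most an end point, so their indicators are orthogonal.\<close>
  define a where "a = (\<lambda>n. 2 * pi * (1 - 1 / real (Suc n)))"
  define v where "v = (\<lambda>n. abs_L2 (indicator {a n..a (Suc n)}))"
  have a: "a m < a n" if "m < n" for m n
    using that by (simp add: a_def frac_less2)
  have a0: "0 \<le> a n" "a n \<le> 2 * pi" for n
    unfolding a_def by (auto intro!: mult_nonneg_nonneg simp: field_simps)
  have inner: "v m \<bullet> v n = integral {a n..a (Suc n)} (indicator {a m..a (Suc m)})" for m n
    unfolding v_def by (rule inner_abs_L2_indicator[OF square_integrable_indicator]) (use a0 in auto)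
  have orth: "v m \<bullet> v n = 0" if "m < n" for m n
  proof -
    have "a (Suc m) \<le> a n" using a[of "Suc m" n] that by (cases "Suc m = n") (auto simp: less_imp_le)
    have "integral {a n..a (Suc n)} (indicat_real {a m..a (Suc m)}) = integral {a n..a (Suc n)} (\<lambda>t. 0)"
      by (rule integral_spike[of "{a n}"]) (use \<open>a (Suc m) \<le> a n\<close> in \<open>auto simp: indicator_def\<close>)
    then show ?thesis using inner by simp
  qed
  have self: "v n \<bullet> v n \<noteq> 0" for n
  proof -
    have "integral {a n..a (Suc n)} (indicat_real {a n..a (Suc n)}) = integral {a n..a (Suc n)} (\<lambda>t. 1)"
      by (rule Henstock_Kurzweil_Integration.integral_cong) simp
    also have "\<dots> = a (Suc n) - a n" using a[of n "Suc n"] by simp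
    finally show ?thesis using inner[of n n] a[of n "Suc n"] by simp
  qed
  have neq: "v m \<noteq> v n" if "m \<noteq> n" for m n
    using orth[of m n] orth[of n m] self[of n] self[of m] that by (metis nat_neq_iff)
  have "pairwise orthogonal (range v)"
    unfolding pairwise_def orthogonal_def using orth by (metis inner_commute nat_neq_iff rangeE)
  moreover have "0 \<notin> range v" using self by (metis imageE inner_zero_left)
  ultimately have "independent (range v)" by (rule pairwise_orthogonal_independent)
  then have "finite (range v)" using independent_span_bound[OF B(1)] B(2) by auto
  moreover have "inj v" using neq by (auto simp: inj_def)
  ultimately show False using finite_imageD by (metis infinite_UNIV_nat)
qed

text \<open>Total rather than dense: the inner products with these indicators are the values of the
  primitive at rational points, which determine it by continuity.\<close>

definition L2_dense_seq :: "nat \<Rightarrow> L2" where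
  "L2_dense_seq n = abs_L2 (indicator {0..from_nat_into (\<rat> \<inter> {0..2 * pi}) n})"

lemma continuous_on_prim:
  assumes "square_integrable f"
  shows "continuous_on {0..2 * pi} (\<lambda>c. integral {0..c} f)"
  by (rule indefinite_integral_continuous_1) (rule square_integrable_integrable_on[OF assms], simp_all)

lemma L2_dense_seq_total:
  assumes "\<And>n. u \<bullet> L2_dense_seq n = 0"
  shows "u = 0"
proof (rule L2_eq_0I)
  obtain f where f: "square_integrable f" "u = abs_L2 f" by (rule L2_cases)
  define F where "F = (\<lambda>c. integral {0..c} f)"
  have inner: "u \<bullet> abs_L2 (indicator {0..c}) = F c" if "c \<in> {0..2 * pi}" for c
    using that by (simp add: f F_def inner_abs_L2_indicator)
  have Q: "F c = 0" if "c \<in> \<rat> \<inter> {0..2 * pi}" for c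
  proof -
    have "countable (\<rat> \<inter> {0..2 * pi} :: real set)" by (simp add: countable_rat countable_Int1)
    from from_nat_into_surj[OF this that] obtain n where "from_nat_into (\<rat> \<inter> {0..2 * pi}) n = c" ..
    then show ?thesis using assms[of n] inner[of c] that by (simp add: L2_dense_seq_def)
  qed
  fix c :: real assume c: "c \<in> {0..2 * pi}"
  have "F c = 0"
  proof (rule ccontr)
    assume "F c \<noteq> 0"
    then have "\<bar>F c\<bar> > 0" by simp
    have cont: "continuous_on {0..2 * pi} F" unfolding F_def by (rule continuous_on_prim[OF f(1)])
    have "\<exists>d>0. \<forall>x\<in>{0..2 * pi}. dist x c < d \<longrightarrow> dist (F x) (F c) < \<bar>F c\<bar>"
      using cont[unfolded continuous_on_iff, rule_format, OF c \<open>\<bar>F c\<bar> > 0\<close>] by simp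
    then obtain d where d: "d > 0" "\<forall>x\<in>{0..2 * pi}. dist x c < d \<longrightarrow> dist (F x) (F c) < \<bar>F c\<bar>" by blast
    have "max 0 (c - d) < min (2 * pi) (c + d)" using c d(1) pi_gt_zero by simp
    then obtain q where q: "q \<in> \<rat>" "max 0 (c - d) < q" "q < min (2 * pi) (c + d)"
      using Rats_dense_in_real by blast
    then have "dist q c < d" "q \<in> {0..2 * pi}" by (simp_all add: dist_real_def abs_less_iff)
    then have "dist (F q) (F c) < \<bar>F c\<bar>" using d(2) by blast
    moreover have "q \<in> \<rat> \<inter> {0..2 * pi}" using q(1) \<open>q \<in> {0..2 * pi}\<close> by blast
    ultimately show False using Q[of q] by (simp add: dist_real_def)
  qed
  then show "u \<bullet> abs_L2 (indicator {0..c}) = 0" using inner[OF c] by simp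
qed

section \<open>Primitives of square integrable functions\<close>

definition W1 :: "L2 \<Rightarrow> real \<Rightarrow> real" where
  "W1 u t = integral {0..t} (rep_L2 u)"

definition W0 :: "L2 \<Rightarrow> real \<Rightarrow> real" where
  "W0 u t = integral {0..t} (W1 u)"

definition ind_L2 :: "real \<Rightarrow> L2" where
  "ind_L2 t = abs_L2 (indicator {0..t})"

text \<open>Represents the functional \<open>u \<mapsto> W0 u t\<close>, by Cauchy's formula for
  repeated integration, as \<open>ind_L2 t\<close> represents \<open>W1 u t\<close>. Linearity and
  bounds of both primitives then come from the inner product.\<close>

definition ramp_L2 :: "real \<Rightarrow> L2" where
  "ramp_L2 t = abs_L2 (\<lambda>s. indicator {0..t} s * (t - s))"

lemma square_integrable_ramp: "square_integrable (\<lambda>s. indicator {0..t} s * (t - s))"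
  by (intro square_integrable_cut square_integrable_continuous continuous_intros)

lemma W1_inner: "t \<in> {0..2 * pi} \<Longrightarrow> W1 u t = u \<bullet> ind_L2 t"
  using inner_abs_L2_indicator[OF square_integrable_rep[of u], of 0 t]
  by (simp add: W1_def ind_L2_def abs_rep_L2)

lemma W1_abs: "square_integrable f \<Longrightarrow> t \<in> {0..2 * pi} \<Longrightarrow> W1 (abs_L2 f) t = integral {0..t} f"
  by (simp add: W1_inner ind_L2_def inner_abs_L2_indicator)

lemma W1_0 [simp]: "W1 u 0 = 0" by (simp add: W1_def)
lemma W0_0 [simp]: "W0 u 0 = 0" by (simp add: W0_def)

lemma continuous_on_W1: "continuous_on {0..2 * pi} (W1 u)"
  unfolding W1_def by (rule continuous_on_prim[OF square_integrable_rep])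

lemma W1_integrable: "0 \<le> a \<Longrightarrow> b \<le> 2 * pi \<Longrightarrow> W1 u integrable_on {a..b}"
  by (rule integrable_continuous_real[OF continuous_on_subset[OF continuous_on_W1]]) auto

lemma W0_has_derivative:
  assumes "t \<in> {0..2 * pi}"
  shows "(W0 u has_real_derivative W1 u t) (at t within {0..2 * pi})"
  unfolding W0_def by (rule integral_has_real_derivative[OF continuous_on_W1 assms])

lemma continuous_on_W0: "continuous_on {0..2 * pi} (W0 u)"
  using W0_has_derivative DERIV_continuous_on by blast

lemma integral_interval_diff:
  fixes f :: "real \<Rightarrow> real"
  assumes "f integrable_on {a..c}" "a \<le> b" "b \<le> c"
  shows "integral {b..c} f = integral {a..c} f - integral {a..b} f"
  using Henstock_Kurzweil_Integration.integral_combine[OF assms(2,3,1)] by simp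

text \<open>The increments are \<open>o(t - s)\<close>, so the derivative vanishes at every point.
  This serves for primitives of square integrable functions, which need not be differentiable
  everywhere.\<close>

lemma constant_if_three_halves_bound:
  fixes D :: "real \<Rightarrow> real"
  assumes K: "\<And>s t. s \<in> {a..b} \<Longrightarrow> t \<in> {a..b} \<Longrightarrow> s \<le> t \<Longrightarrow> \<bar>D t - D s\<bar> \<le> K * sqrt (t - s) * (t - s)"
    and t: "t \<in> {a..b}"
  shows "D t = D a"
proof -
  have "(D has_field_derivative 0) (at x within {a..b})" if x: "x \<in> {a..b}" for x
    unfolding has_field_derivative_iff
  proof (rule Lim_null_comparison)
    have "norm ((D y - D x) / (y - x)) \<le> \<bar>K\<bar> * sqrt \<bar>y - x\<bar>" if y: "y \<in> {a..b}" "y \<noteq> x" for y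
    proof -
      have "\<bar>D y - D x\<bar> \<le> K * sqrt \<bar>y - x\<bar> * \<bar>y - x\<bar>"
        using K[of x y] K[of y x] x y by (cases "x \<le> y") (auto simp: abs_minus_commute)
      also have "\<dots> \<le> \<bar>K\<bar> * sqrt \<bar>y - x\<bar> * \<bar>y - x\<bar>"
        by (intro mult_right_mono) auto
      finally show ?thesis using y by (simp add: pos_divide_le_eq)
    qed
    then show "\<forall>\<^sub>F y in at x within {a..b}. norm ((D y - D x) / (y - x)) \<le> \<bar>K\<bar> * sqrt \<bar>y - x\<bar>"
      unfolding eventually_at by (intro exI[of _ 1]) simp
    have "((\<lambda>y. \<bar>K\<bar> * sqrt \<bar>y - x\<bar>) \<longlongrightarrow> \<bar>K\<bar> * sqrt \<bar>x - x\<bar>) (at x within {a..b})"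
      by (intro tendsto_intros)
    then show "((\<lambda>y. \<bar>K\<bar> * sqrt \<bar>y - x\<bar>) \<longlongrightarrow> 0) (at x within {a..b})" by simp
  qed
  from has_field_derivative_zero_constant[OF convex_real_interval(5) this]
  obtain c where "\<And>x. x \<in> {a..b} \<Longrightarrow> D x = c" by blast
  then show ?thesis using t by auto
qed

lemma integral_abs_bound_sqrt:
  assumes f: "square_integrable f" and st: "0 \<le> s" "s \<le> t" "t \<le> 2 * pi"
  shows "integral {s..t} (\<lambda>r. \<bar>f r\<bar>) \<le> norm (abs_L2 f) * sqrt (t - s)"
proof -
  have fa: "square_integrable (\<lambda>r. \<bar>f r\<bar>)" by (rule square_integrable_abs[OF f])
  have n: "norm (abs_L2 (\<lambda>r. \<bar>f r\<bar>)) = norm (abs_L2 f)"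
  proof -
    have "(norm (abs_L2 (\<lambda>r. \<bar>f r\<bar>)))\<^sup>2 = (norm (abs_L2 f))\<^sup>2" by (simp add: norm_abs_L2 f fa)
    then show ?thesis by simp
  qed
  have i: "(norm (abs_L2 (indicator {s..t})))\<^sup>2 = t - s"
  proof -
    have "(norm (abs_L2 (indicator {s..t})))\<^sup>2 = integral {s..t} (indicat_real {s..t})"
      unfolding power2_norm_eq_inner using st
      by (intro inner_abs_L2_indicator square_integrable_indicator) auto
    also have "\<dots> = integral {s..t} (\<lambda>r. 1)" by (rule Henstock_Kurzweil_Integration.integral_cong) simp
    finally show ?thesis using st by simp
  qed
  have "integral {s..t} (\<lambda>r. \<bar>f r\<bar>) = abs_L2 (\<lambda>r. \<bar>f r\<bar>) \<bullet> abs_L2 (indicator {s..t})"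
    using st by (intro inner_abs_L2_indicator[symmetric] fa) auto
  also have "\<dots> \<le> norm (abs_L2 (\<lambda>r. \<bar>f r\<bar>)) * norm (abs_L2 (indicator {s..t}))"
    by (rule norm_cauchy_schwarz)
  also have "norm (abs_L2 (indicator {s..t})) = sqrt (t - s)"
    using i st by (metis norm_ge_zero real_sqrt_unique)
  finally show ?thesis unfolding n .
qed

text \<open>
  The defect of the formula, as a function of \<open>t\<close>, has increments \<open>O(\<bar>t - s\<bar> powr (3/2))\<close> by the
  Cauchy-Schwarz inequality, hence is constant.
\<close>

lemma prim_mult:
  assumes f: "square_integrable f" and F: "\<And>t. t \<in> {0..2 * pi} \<Longrightarrow> F t = F 0 + integral {0..t} f"
    and m: "\<And>t. t \<in> {0..2 * pi} \<Longrightarrow> (m has_real_derivative m' t) (at t within {0..2 * pi})"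
    and m': "continuous_on {0..2 * pi} m'" and t: "t \<in> {0..2 * pi}"
  shows "F t * m t = F 0 * m 0 + integral {0..t} (\<lambda>s. f s * m s + F s * m' s)"
proof -
  have mc: "continuous_on {0..2 * pi} m" using m DERIV_continuous_on by blast
  have Fc: "continuous_on {0..2 * pi} F"
  proof (subst continuous_on_cong[OF refl F])
    show "continuous_on {0..2 * pi} (\<lambda>t. F 0 + integral {0..t} f)"
      by (intro continuous_intros continuous_on_prim f)
  qed
  have int_f: "f integrable_on {a..b}" if "0 \<le> a" "b \<le> 2 * pi" for a b
    using square_integrable_integrable_on[OF f] that .
  have fm: "square_integrable (\<lambda>s. f s * m s)"
    using square_integrable_mult_continuous[OF mc f] by (simp add: mult.commute)
  have int_fm: "(\<lambda>s. f s * m s) integrable_on {a..b}" if "0 \<le> a" "b \<le> 2 * pi" for a b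
    using square_integrable_integrable_on[OF fm] that .
  have int_c: "g integrable_on {a..b}" if "continuous_on {0..2 * pi} g" "0 \<le> a" "b \<le> 2 * pi" for a b and g :: "real \<Rightarrow> real"
    by (rule integrable_continuous_real[OF continuous_on_subset[OF that(1)]]) (use that in auto)
  have Fm': "continuous_on {0..2 * pi} (\<lambda>s. F s * m' s)" by (intro continuous_intros Fc m')
  have "bounded (m' ` {0..2 * pi})"
    by (intro compact_imp_bounded compact_continuous_image m') simp
  then obtain B where B: "\<forall>t\<in>{0..2 * pi}. \<bar>m' t\<bar> \<le> B" unfolding bounded_iff by auto
  have B0: "B \<ge> 0" using B[rule_format, of 0] by simp
  define N where "N = norm (abs_L2 f)"
  define D where "D = (\<lambda>t. F t * m t - integral {0..t} (\<lambda>s. f s * m s + F s * m' s))"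
  have int_sum: "(\<lambda>s. f s * m s + F s * m' s) integrable_on {a..b}" if "0 \<le> a" "b \<le> 2 * pi" for a b
    by (intro Henstock_Kurzweil_Integration.integrable_add int_fm int_c Fm' that)
  have "D t = D 0"
  proof (rule constant_if_three_halves_bound[OF _ t, where K = "2 * N * B"])
    fix s t :: real assume st: "s \<in> {0..2 * pi}" "t \<in> {0..2 * pi}" "s \<le> t"
    have Fdiff: "F r - F s = integral {s..r} f" if "s \<le> r" "r \<le> t" for r
      using F[of r] F[of s] integral_interval_diff[OF int_f[of 0 r], of s] that st by auto
    have mdiff: "m t - m r = integral {r..t} m'" if "s \<le> r" "r \<le> t" for r
    proof -
      have "(m' has_integral (m t - m r)) {r..t}"
        using that st by (intro fundamental_theorem_of_calculus)
          (auto simp: has_real_derivative_iff_has_vector_derivative[symmetric] intro: DERIV_subset[OF m])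
      then show ?thesis by (simp add: integral_unique)
    qed
    have Nf: "integral {s..t} (\<lambda>r. \<bar>f r\<bar>) \<le> N * sqrt (t - s)"
      unfolding N_def using st by (intro integral_abs_bound_sqrt f) auto
    have int_abs: "(\<lambda>r. \<bar>f r\<bar>) integrable_on {a..b}" if "0 \<le> a" "b \<le> 2 * pi" for a b
      using square_integrable_integrable_on[OF square_integrable_abs[OF f]] that .
    have FB: "\<bar>F r - F s\<bar> \<le> N * sqrt (t - s)" if "s \<le> r" "r \<le> t" for r
    proof -
      have "\<bar>F r - F s\<bar> \<le> integral {s..r} (\<lambda>r. \<bar>f r\<bar>)"
        unfolding Fdiff[OF that] using st that
          Henstock_Kurzweil_Integration.integral_norm_bound_integral[OF int_f[of s r] int_abs[of s r]] by auto
      also have "\<dots> \<le> integral {s..t} (\<lambda>r. \<bar>f r\<bar>)"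
        using st that by (intro integral_subset_le int_abs) auto
      finally show ?thesis using Nf by linarith
    qed
    have mB: "\<bar>m t - m r\<bar> \<le> B * (t - s)" if "s \<le> r" "r \<le> t" for r
    proof -
      have "continuous_on {r..t} m'" using that st by (intro continuous_on_subset[OF m']) auto
      then have "\<bar>m t - m r\<bar> \<le> B * (t - r)"
        unfolding mdiff[OF that] using integral_bound[of r t m' B] that st B by auto
      also have "\<dots> \<le> B * (t - s)" using B0 that by (intro mult_left_mono) auto
      finally show ?thesis .
    qed
    have st0: "0 \<le> s" "t \<le> 2 * pi" using st by auto
    have i1: "(\<lambda>r. f r * (m t - m r)) integrable_on {s..t}"
    proof -
      have "(\<lambda>r. m t * f r - f r * m r) integrable_on {s..t}"
        by (intro Henstock_Kurzweil_Integration.integrable_diff int_fm st0 integrable_on_mult_right int_f)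
      then show ?thesis by (simp add: algebra_simps)
    qed
    have i2: "(\<lambda>r. (F s - F r) * m' r) integrable_on {s..t}"
      by (intro int_c continuous_intros Fc m' st0)
    have e1: "integral {s..t} (\<lambda>r. f r * (m t - m r)) = (F t - F s) * m t - integral {s..t} (\<lambda>r. f r * m r)"
    proof -
      have "integral {s..t} (\<lambda>r. m t * f r - f r * m r) = m t * integral {s..t} f - integral {s..t} (\<lambda>r. f r * m r)"
        by (subst Henstock_Kurzweil_Integration.integral_diff)
           (auto intro!: int_fm st0 integrable_on_mult_right int_f)
      then show ?thesis using Fdiff[of t] st by (simp add: algebra_simps)
    qed
    have e2: "integral {s..t} (\<lambda>r. (F s - F r) * m' r) = F s * (m t - m s) - integral {s..t} (\<lambda>r. F r * m' r)"
    proof -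
      have "integral {s..t} (\<lambda>r. F s * m' r - F r * m' r) = F s * integral {s..t} m' - integral {s..t} (\<lambda>r. F r * m' r)"
        by (subst Henstock_Kurzweil_Integration.integral_diff)
           (auto intro!: int_c st0 integrable_on_mult_right m' Fm')
      then show ?thesis using mdiff[of s] st by (simp add: algebra_simps)
    qed
    have e3: "integral {0..t} (\<lambda>s. f s * m s + F s * m' s) - integral {0..s} (\<lambda>s. f s * m s + F s * m' s)
        = integral {s..t} (\<lambda>r. f r * m r) + integral {s..t} (\<lambda>r. F r * m' r)"
      using integral_interval_diff[OF int_sum[of 0 t], of s] st
        Henstock_Kurzweil_Integration.integral_add[OF int_fm[OF st0] int_c[OF Fm' st0]] by auto
    \<comment> \<open>Each integral pairs the derivative of one factor with an increment of the
      other: \<open>integral {s..t} \<bar>f\<bar>\<close> and the increment of \<open>F\<close> are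
      \<open>O(sqrt (t - s))\<close>, while the increment of \<open>m\<close> and the integral of
      \<open>m'\<close> are \<open>O(t - s)\<close>.\<close>
    have "D t - D s = integral {s..t} (\<lambda>r. f r * (m t - m r)) + integral {s..t} (\<lambda>r. (F s - F r) * m' r)"
      unfolding D_def e1 e2 using e3 by (simp add: algebra_simps)
    moreover have "\<bar>integral {s..t} (\<lambda>r. f r * (m t - m r))\<bar> \<le> N * sqrt (t - s) * (B * (t - s))"
    proof -
      have "norm (integral {s..t} (\<lambda>r. f r * (m t - m r))) \<le> integral {s..t} (\<lambda>r. \<bar>f r\<bar> * (B * (t - s)))"
      proof (rule Henstock_Kurzweil_Integration.integral_norm_bound_integral[OF i1])
        show "(\<lambda>r. \<bar>f r\<bar> * (B * (t - s))) integrable_on {s..t}"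
          by (intro integrable_on_mult_left int_abs st0)
        fix r assume "r \<in> {s..t}"
        then show "norm (f r * (m t - m r)) \<le> \<bar>f r\<bar> * (B * (t - s))"
          using mB[of r] by (simp add: abs_mult mult_left_mono)
      qed
      also have "\<dots> = integral {s..t} (\<lambda>r. \<bar>f r\<bar>) * (B * (t - s))" by simp
      also have "\<dots> \<le> N * sqrt (t - s) * (B * (t - s))"
        using Nf B0 st by (intro mult_right_mono) auto
      finally show ?thesis by simp
    qed
    moreover have "\<bar>integral {s..t} (\<lambda>r. (F s - F r) * m' r)\<bar> \<le> N * sqrt (t - s) * B * (t - s)"
    proof -
      have "norm ((F s - F r) * m' r) \<le> N * sqrt (t - s) * B" if "r \<in> {s..t}" for r
      proof -
        have "\<bar>F s - F r\<bar> * \<bar>m' r\<bar> \<le> (N * sqrt (t - s)) * B"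
          using FB[of r] B that st by (intro mult_mono) (auto simp: N_def abs_minus_commute)
        then show ?thesis by (simp add: abs_mult)
      qed
      moreover have "continuous_on {s..t} (\<lambda>r. (F s - F r) * m' r)"
        using st0 by (intro continuous_intros continuous_on_subset[OF Fc] continuous_on_subset[OF m']) auto
      ultimately show ?thesis using integral_bound[of s t "\<lambda>r. (F s - F r) * m' r" "N * sqrt (t - s) * B"] st by auto
    qed
    ultimately show "\<bar>D t - D s\<bar> \<le> 2 * N * B * sqrt (t - s) * (t - s)"
      by (simp add: algebra_simps)
  qed
  then show ?thesis by (simp add: D_def)
qed

lemma W0_inner:
  assumes t: "t \<in> {0..2 * pi}"
  shows "W0 u t = u \<bullet> ramp_L2 t"
proof -
  let ?f = "rep_L2 u"
  \<comment> \<open>Integration by parts against \<open>t - s\<close>: both boundary terms vanish,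
    as \<open>t - t = 0\<close> and \<open>W1 u 0 = 0\<close>.\<close>
  have "W1 u t * (t - t) = W1 u 0 * (t - 0) + integral {0..t} (\<lambda>s. ?f s * (t - s) + W1 u s * (- 1))"
    by (rule prim_mult[where m = "\<lambda>s. t - s", OF square_integrable_rep _ _ _ t])
       (auto simp: W1_def intro!: derivative_eq_intros)
  moreover have "integral {0..t} (\<lambda>s. ?f s * (t - s) + W1 u s * (- 1)) =
      integral {0..t} (\<lambda>s. ?f s * (t - s)) - W0 u t"
  proof -
    have "square_integrable (\<lambda>s. (t - s) * ?f s)"
      by (intro square_integrable_mult_continuous square_integrable_rep continuous_intros)
    then have "(\<lambda>s. ?f s * (t - s)) integrable_on {0..t}"
      using square_integrable_integrable_on[of "\<lambda>s. (t - s) * ?f s" 0 t] t by (simp add: mult.commute)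
    from Henstock_Kurzweil_Integration.integral_diff[OF this W1_integrable[of 0 t u]] t
    show ?thesis by (simp add: W0_def)
  qed
  ultimately have "W0 u t = integral {0..t} (\<lambda>s. ?f s * (t - s))" by simp
  also have "\<dots> = integral {0..2 * pi} (\<lambda>s. indicator {0..t} s * (?f s * (t - s)))"
    using t by (intro integral_cut[symmetric]) auto
  also have "\<dots> = abs_L2 ?f \<bullet> ramp_L2 t"
    unfolding ramp_L2_def
    by (subst inner_abs_L2[OF square_integrable_rep square_integrable_ramp]) (simp add: mult_ac)
  finally show ?thesis by (simp add: abs_rep_L2)
qed

lemma integral_ramp:
  assumes f: "square_integrable f" and t: "t \<in> {0..2 * pi}"
  shows "integral {0..t} (\<lambda>s. integral {0..s} f) = integral {0..t} (\<lambda>s. (t - s) * f s)"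
proof -
  have "integral {0..t} (\<lambda>s. integral {0..s} f) = W0 (abs_L2 f) t"
    unfolding W0_def using t by (intro Henstock_Kurzweil_Integration.integral_cong) (simp add: W1_abs f)
  also have "\<dots> = abs_L2 f \<bullet> ramp_L2 t" by (rule W0_inner[OF t])
  also have "\<dots> = integral {0..2 * pi} (\<lambda>s. indicator {0..t} s * ((t - s) * f s))"
    unfolding ramp_L2_def by (subst inner_abs_L2[OF f square_integrable_ramp]) (simp add: mult_ac)
  also have "\<dots> = integral {0..t} (\<lambda>s. (t - s) * f s)"
    using t by (intro integral_cut) auto
  finally show ?thesis .
qed

section \<open>Neumann series and Volterra operators\<close>

lemma bounded_linear_funpow: "bounded_linear (V :: 'a::real_normed_vector \<Rightarrow> 'a) \<Longrightarrow> bounded_linear (V ^^ n)"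
  by (induction n) (auto simp: o_def id_def intro: bounded_linear_ident bounded_linear_compose)

text \<open>Only the power \<open>V ^^ N\<close> is a contraction. The truncated Neumann series
  \<open>S\<close> commutes with \<open>V\<close> and satisfies
  \<open>S (h - V h) = h - (V ^^ N) h\<close>. This bounds \<open>h - V h\<close> from below, and
  Banach's fixed point theorem for \<open>V ^^ N\<close> supplies surjectivity.\<close>

lemma neumann_inverse:
  fixes V :: "'a::{real_normed_vector,complete_space} \<Rightarrow> 'a"
  assumes V: "bounded_linear V" and N: "\<And>h. norm ((V ^^ N) h) \<le> 1 / 2 * norm h"
  shows "\<exists>A. bounded_linear A \<and> (\<forall>h. A (h - V h) = h) \<and> (\<forall>k. A k - V (A k) = k)"
proof -
  interpret V: bounded_linear V by fact
  define S where "S = (\<lambda>h. \<Sum>j<N. (V ^^ j) h)"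
  have S: "bounded_linear S" unfolding S_def by (intro bounded_linear_sum bounded_linear_funpow V)
  interpret S: bounded_linear S by fact
  have VN: "bounded_linear (V ^^ N)" by (rule bounded_linear_funpow[OF V])
  interpret VN: bounded_linear "V ^^ N" by fact
  have comm: "(V ^^ j) (V h) = V ((V ^^ j) h)" for j h by (induction j) auto
  have ST: "S (h - V h) = h - (V ^^ N) h" for h
  proof -
    have "S (h - V h) = (\<Sum>j<N. (V ^^ j) h - (V ^^ Suc j) h)"
      unfolding S_def using bounded_linear_funpow[OF V]
      by (intro sum.cong refl) (simp add: linear_diff bounded_linear.linear comm)
    also have "\<dots> = (V ^^ 0) h - (V ^^ N) h" by (rule sum_lessThan_telescope')
    finally show ?thesis by simp
  qed
  have VS: "V (S h) = S (V h)" for h by (simp add: S_def V.sum comm)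
  have TS: "S h - V (S h) = h - (V ^^ N) h" for h
    unfolding VS S.diff[symmetric] by (rule ST)
  obtain M where M: "M > 0" "\<And>h. norm (S h) \<le> norm h * M" using S.pos_bounded by blast
  have lower: "norm h \<le> norm (h - V h) * (2 * M)" for h
  proof -
    have "norm h \<le> norm (h - (V ^^ N) h) + norm ((V ^^ N) h)"
      using norm_triangle_sub[of h "(V ^^ N) h"] by simp
    then have "norm h \<le> 2 * norm (h - (V ^^ N) h)" using N[of h] by simp
    then show ?thesis using M(2)[of "h - V h"] unfolding ST by simp
  qed
  have surj: "\<exists>h. h - V h = k" for k
  proof -
    have "\<exists>!h. k + (V ^^ N) h = h"
    proof (rule banach_fix_type[where c = "1/2"])
      show "\<forall>x y. dist (k + (V ^^ N) x) (k + (V ^^ N) y) \<le> 1 / 2 * dist x y"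
        using N by (simp add: dist_norm VN.diff[symmetric])
    qed simp_all
    then obtain h where "k + (V ^^ N) h = h" by blast
    then have "S h - V (S h) = k" unfolding TS by (simp add: algebra_simps)
    then show ?thesis by blast
  qed
  have uniq: "h = h'" if "h - V h = h' - V h'" for h h'
    using lower[of "h - h'"] that by (simp add: V.diff algebra_simps)
  obtain A where A: "\<And>k. A k - V (A k) = k" using surj by metis
  have AT: "A (h - V h) = h" for h by (rule uniq) (rule A)
  have "bounded_linear A"
  proof (rule bounded_linear_intro[where K = "2 * M"])
    show "A (x + y) = A x + A y" for x y
    proof (rule uniq)
      have "(A x + A y) - V (A x + A y) = (A x - V (A x)) + (A y - V (A y))" by (simp add: V.add)
      then show "A (x + y) - V (A (x + y)) = (A x + A y) - V (A x + A y)" unfolding A by simp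
    qed
    show "A (c *\<^sub>R x) = c *\<^sub>R A x" for c x
    proof (rule uniq)
      have "c *\<^sub>R A x - V (c *\<^sub>R A x) = c *\<^sub>R (A x - V (A x))" by (simp add: V.scaleR scaleR_diff_right)
      then show "A (c *\<^sub>R x) - V (A (c *\<^sub>R x)) = c *\<^sub>R A x - V (c *\<^sub>R A x)" unfolding A by simp
    qed
    show "norm (A k) \<le> norm k * (2 * M)" for k
      using lower[of "A k"] unfolding A .
  qed
  with A AT show ?thesis by blast
qed

text \<open>The integral kernel is encoded as a curve of vectors in \<open>L2\<close>; continuity of
  the curve then takes the place of joint measurability in two variables.\<close>

definition volterra :: "(real \<Rightarrow> L2) \<Rightarrow> L2 \<Rightarrow> L2" where
  "volterra \<kappa> h = abs_L2 (\<lambda>t. h \<bullet> \<kappa> t)"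

lemma square_integrable_inner:
  assumes "continuous_on {0..2 * pi} \<kappa>"
  shows "square_integrable (\<lambda>t. h \<bullet> \<kappa> t)"
  by (intro square_integrable_continuous continuous_intros assms)

text \<open>The support condition makes the operator causal: each iteration integrates the previous
  bound once more from 0 to \<open>t\<close>. Hence the squared norm of the \<open>n\<close>-th
  power is at most \<open>(K\<^sup>2 * (2 * pi)) ^ n / fact n\<close>, and some power contracts
  however large the kernel is.\<close>

lemma volterra_invertible:
  assumes cont: "continuous_on {0..2 * pi} \<kappa>"
    and supp: "\<And>t. t \<in> {0..2 * pi} \<Longrightarrow> \<exists>k. square_integrable k \<and> \<kappa> t = abs_L2 (\<lambda>s. indicator {0..t} s * k s)"
  shows "\<exists>A. bounded_linear A \<and> (\<forall>h. A (h - volterra \<kappa> h) = h) \<and> (\<forall>k. A k - volterra \<kappa> (A k) = k)"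
proof -
  have "bounded (\<kappa> ` {0..2 * pi})"
    by (intro compact_imp_bounded compact_continuous_image cont) simp
  then obtain K where K: "\<forall>t\<in>{0..2 * pi}. norm (\<kappa> t) \<le> K" unfolding bounded_iff by auto
  have K0: "K \<ge> 0" using order_trans[OF norm_ge_zero K[rule_format, of 0]] by simp
  let ?V = "volterra \<kappa>"
  have pointwise: "(h \<bullet> \<kappa> t)\<^sup>2 \<le> K\<^sup>2 * integral {0..t} (\<lambda>s. (rep_L2 h s)\<^sup>2)" if t: "t \<in> {0..2 * pi}" for h t
  proof -
    let ?f = "rep_L2 h"
    obtain k where k: "square_integrable k" "\<kappa> t = abs_L2 (\<lambda>s. indicator {0..t} s * k s)" using supp[OF t] by blast
    define P where "P = abs_L2 (\<lambda>s. indicator {0..t} s * ?f s)"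
    note sq = square_integrable_cut[OF k(1)] square_integrable_cut[OF square_integrable_rep] square_integrable_rep
    have "h \<bullet> \<kappa> t = abs_L2 ?f \<bullet> \<kappa> t" by (simp add: abs_rep_L2)
    \<comment> \<open>As \<open>\<kappa> t\<close> lives on \<open>{0..t}\<close>, only the part
      \<open>P\<close> of \<open>h\<close> there contributes; this truncation is what produces the
      factorials.\<close>
    also have "\<dots> = P \<bullet> \<kappa> t"
      unfolding P_def k(2) by (simp add: inner_abs_L2 sq) (intro Henstock_Kurzweil_Integration.integral_cong, simp add: indicator_def)
    finally have "\<bar>h \<bullet> \<kappa> t\<bar> \<le> norm P * norm (\<kappa> t)" using Cauchy_Schwarz_ineq2 by simp
    also have "\<dots> \<le> norm P * K" using K t by (intro mult_left_mono) auto
    finally have "(h \<bullet> \<kappa> t)\<^sup>2 \<le> (norm P * K)\<^sup>2" using K0 by (intro abs_le_square_iff[THEN iffD1]) simp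
    moreover have "(norm P)\<^sup>2 = integral {0..t} (\<lambda>s. (?f s)\<^sup>2)"
    proof -
      have "(norm P)\<^sup>2 = integral {0..2 * pi} (\<lambda>s. indicator {0..t} s * (?f s)\<^sup>2)"
        unfolding P_def power2_norm_eq_inner
        by (simp add: inner_abs_L2 sq) (intro Henstock_Kurzweil_Integration.integral_cong, simp add: indicator_def power2_eq_square)
      also have "\<dots> = integral {0..t} (\<lambda>s. (?f s)\<^sup>2)" using t by (intro integral_cut) auto
      finally show ?thesis .
    qed
    ultimately show ?thesis by (simp add: power_mult_distrib mult.commute)
  qed
  have integral_abs: "integral {0..t} (\<lambda>s. (rep_L2 (abs_L2 f) s)\<^sup>2) = integral {0..t} (\<lambda>s. (f s)\<^sup>2)"
    if f: "square_integrable f" and t: "t \<in> {0..2 * pi}" for f t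
  proof -
    have "integral {0..t} (\<lambda>s. (g s)\<^sup>2) = abs_L2 (\<lambda>s. indicator {0..t} s * g s) \<bullet> abs_L2 g"
      if g: "square_integrable g" for g
      using integral_cut[of 0 t "\<lambda>s. (g s)\<^sup>2"] t
      by (simp add: inner_abs_L2 g square_integrable_cut power2_eq_square mult.assoc)
    moreover have "abs_L2 (\<lambda>s. indicator {0..t} s * rep_L2 (abs_L2 f) s) = abs_L2 (\<lambda>s. indicator {0..t} s * f s)"
      using rep_abs_L2[OF f] by (subst abs_L2_eq_iff) (auto simp: square_integrable_cut square_integrable_rep f elim: eventually_mono)
    ultimately show ?thesis using f by (simp add: square_integrable_rep abs_rep_L2)
  qed
  have iterate: "integral {0..t} (\<lambda>s. (rep_L2 ((?V ^^ n) h) s)\<^sup>2) \<le> (K\<^sup>2 * t) ^ n / fact n * (norm h)\<^sup>2"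
    if "t \<in> {0..2 * pi}" for n h t
    using that
  proof (induction n arbitrary: t)
    case 0
    have "integral {0..t} (\<lambda>s. (rep_L2 h s)\<^sup>2) \<le> integral {0..2 * pi} (\<lambda>s. (rep_L2 h s)\<^sup>2)"
    proof -
      have i: "(\<lambda>s. (rep_L2 h s)\<^sup>2) integrable_on {0..2 * pi}"
        using integrable_on_lebesgue_on[of "{0..2 * pi}" "\<lambda>s. (rep_L2 h s)\<^sup>2"] square_integrable_rep[of h]
        by (simp add: square_integrable_def)
      then show ?thesis using 0 by (intro integral_subset_le integrable_subinterval_real[OF i]) auto
    qed
    also have "\<dots> = (norm (abs_L2 (rep_L2 h)))\<^sup>2"
      unfolding power2_norm_eq_inner inner_abs_L2[OF square_integrable_rep square_integrable_rep]
      by (simp only: power2_eq_square)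
    finally show ?case by (simp add: abs_rep_L2)
  next
    case (Suc n)
    define g where "g = (?V ^^ n) h"
    have gc: "continuous_on {0..2 * pi} (\<lambda>s. (g \<bullet> \<kappa> s)\<^sup>2)" by (intro continuous_intros cont)
    have "integral {0..t} (\<lambda>s. (rep_L2 ((?V ^^ Suc n) h) s)\<^sup>2) = integral {0..t} (\<lambda>s. (g \<bullet> \<kappa> s)\<^sup>2)"
      using integral_abs[OF square_integrable_inner[OF cont] Suc.prems, of g] by (simp add: g_def volterra_def)
    also have "\<dots> \<le> integral {0..t} (\<lambda>s. K\<^sup>2 * ((K\<^sup>2 * s) ^ n / fact n * (norm h)\<^sup>2))"
    proof (rule integral_le)
      show "(\<lambda>s. (g \<bullet> \<kappa> s)\<^sup>2) integrable_on {0..t}"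
        using Suc.prems by (intro integrable_continuous_real continuous_on_subset[OF gc]) auto
      show "(\<lambda>s. K\<^sup>2 * ((K\<^sup>2 * s) ^ n / fact n * (norm h)\<^sup>2)) integrable_on {0..t}"
        by (intro integrable_continuous_real continuous_intros) auto
      fix s assume s: "s \<in> {0..t}"
      then have "(g \<bullet> \<kappa> s)\<^sup>2 \<le> K\<^sup>2 * integral {0..s} (\<lambda>s. (rep_L2 g s)\<^sup>2)"
        using Suc.prems by (intro pointwise) auto
      also have "\<dots> \<le> K\<^sup>2 * ((K\<^sup>2 * s) ^ n / fact n * (norm h)\<^sup>2)"
        unfolding g_def using s Suc.prems by (intro mult_left_mono Suc.IH) auto
      finally show "(g \<bullet> \<kappa> s)\<^sup>2 \<le> K\<^sup>2 * ((K\<^sup>2 * s) ^ n / fact n * (norm h)\<^sup>2)" .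
    qed
    also have "\<dots> = (K\<^sup>2 * t) ^ Suc n / fact (Suc n) * (norm h)\<^sup>2"
    proof -
      have d: "((\<lambda>s. (K\<^sup>2 * s) ^ Suc n / fact (Suc n) * (norm h)\<^sup>2) has_real_derivative
          K\<^sup>2 * ((K\<^sup>2 * s) ^ n / fact n * (norm h)\<^sup>2)) (at s within {0..t})" for s
      proof -
        have "((\<lambda>s. K\<^sup>2 * s) has_real_derivative K\<^sup>2) (at s within {0..t})"
          by (auto intro!: derivative_eq_intros)
        from DERIV_power_Suc[OF this, of n]
        have "((\<lambda>s. (K\<^sup>2 * s) ^ Suc n * ((norm h)\<^sup>2 / fact (Suc n))) has_real_derivative
          (1 + real n) * (K\<^sup>2 * (K\<^sup>2 * s) ^ n) * ((norm h)\<^sup>2 / fact (Suc n))) (at s within {0..t})"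
          by (rule DERIV_cmult_right)
        moreover have "(1 + real n) * (K\<^sup>2 * (K\<^sup>2 * s) ^ n) * ((norm h)\<^sup>2 / fact (Suc n)) =
            K\<^sup>2 * ((K\<^sup>2 * s) ^ n / fact n * (norm h)\<^sup>2)"
        proof -
          define c where "c = 1 + real n"
          have "c \<noteq> 0" "fact (Suc n) = c * fact n" by (simp_all add: c_def)
          then show ?thesis unfolding c_def[symmetric] by simp
        qed
        ultimately show ?thesis by (simp only: times_divide_eq_left times_divide_eq_right)
      qed
      have "((\<lambda>s. K\<^sup>2 * ((K\<^sup>2 * s) ^ n / fact n * (norm h)\<^sup>2)) has_integral
          ((K\<^sup>2 * t) ^ Suc n / fact (Suc n) * (norm h)\<^sup>2 - (K\<^sup>2 * 0) ^ Suc n / fact (Suc n) * (norm h)\<^sup>2)) {0..t}"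
        using Suc.prems d
        by (intro fundamental_theorem_of_calculus) (auto simp only: has_real_derivative_iff_has_vector_derivative atLeastAtMost_iff)
      from integral_unique[OF this] show ?thesis by (simp only: mult_zero_right power_0_Suc div_0 divide_eq_0_iff mult_zero_left diff_zero)
    qed
    finally show ?case .
  qed
  have norm_iterate: "(norm ((?V ^^ n) h))\<^sup>2 \<le> (K\<^sup>2 * (2 * pi)) ^ n / fact n * (norm h)\<^sup>2" for n h
  proof -
    have "(norm ((?V ^^ n) h))\<^sup>2 = (norm (abs_L2 (rep_L2 ((?V ^^ n) h))))\<^sup>2" by (simp add: abs_rep_L2)
    also have "\<dots> = integral {0..2 * pi} (\<lambda>s. (rep_L2 ((?V ^^ n) h) s)\<^sup>2)"
      unfolding power2_norm_eq_inner by (simp add: inner_abs_L2 square_integrable_rep power2_eq_square)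
    finally show ?thesis using iterate[of "2 * pi" n h] by simp
  qed
  have blV: "bounded_linear ?V"
  proof (rule bounded_linear_intro[where K = "sqrt (2 * pi) * K"])
    show "?V (x + y) = ?V x + ?V y" for x y
      by (simp add: volterra_def abs_L2_add square_integrable_inner cont inner_add_left)
    show "?V (c *\<^sub>R x) = c *\<^sub>R ?V x" for c x
      by (simp add: volterra_def abs_L2_scaleR square_integrable_inner cont)
    show "norm (?V h) \<le> norm h * (sqrt (2 * pi) * K)" for h
    proof -
      have "norm (?V h) \<le> sqrt (2 * pi) * (norm h * K)"
        unfolding volterra_def
      proof (rule norm_abs_L2_bounded[OF square_integrable_inner[OF cont]])
        fix t assume t: "t \<in> {0..2 * pi}"
        have "\<bar>h \<bullet> \<kappa> t\<bar> \<le> norm h * norm (\<kappa> t)" by (rule Cauchy_Schwarz_ineq2)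
        also have "\<dots> \<le> norm h * K" using K t by (intro mult_left_mono) auto
        finally show "\<bar>h \<bullet> \<kappa> t\<bar> \<le> norm h * K" .
      qed
      then show ?thesis by (simp add: mult_ac)
    qed
  qed
  have "(\<lambda>n. (K\<^sup>2 * (2 * pi)) ^ n / fact n) \<longlonglongrightarrow> 0"
    using summable_LIMSEQ_zero[OF summable_exp[of "K\<^sup>2 * (2 * pi)"]] by (simp add: divide_inverse mult.commute)
  \<comment> \<open>The bound concerns squared norms, so 1/4 corresponds to the factor 1/2 in
    \<open>neumann_inverse\<close>.\<close>
  then have "\<forall>\<^sub>F n in sequentially. (K\<^sup>2 * (2 * pi)) ^ n / fact n < 1 / 4"
    by (rule order_tendstoD) simp
  then obtain N where N: "(K\<^sup>2 * (2 * pi)) ^ N / fact N < 1 / 4" using eventually_happens' sequentially_bot by blast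
  have "norm ((?V ^^ N) h) \<le> 1 / 2 * norm h" for h
  proof -
    have "(norm ((?V ^^ N) h))\<^sup>2 \<le> 1 / 4 * (norm h)\<^sup>2"
      by (rule order_trans[OF norm_iterate mult_right_mono[OF less_imp_le[OF N]]]) simp
    also have "\<dots> = (1 / 2 * norm h)\<^sup>2" by (simp add: power2_eq_square)
    finally show ?thesis by (rule power2_le_imp_le) simp
  qed
  from neumann_inverse[OF blV this] show ?thesis .
qed

text \<open>The equation \<open>v'' = q v\<close> in integrated form: \<open>v\<close> is
  continuously differentiable and \<open>v'\<close> is a primitive of the integrable function
  \<open>q v\<close>, so no second derivative has to be formed pointwise.\<close>

definition solution :: "L2 \<Rightarrow> (real \<Rightarrow> real) \<Rightarrow> (real \<Rightarrow> real) \<Rightarrow> bool" where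
  "solution q v v' \<longleftrightarrow> continuous_on {0..2 * pi} v' \<and>
     (\<forall>t\<in>{0..2 * pi}. (v has_real_derivative v' t) (at t within {0..2 * pi})) \<and>
     (\<forall>t\<in>{0..2 * pi}. v' t = v' 0 + integral {0..t} (\<lambda>s. rep_L2 q s * v s))"

lemma integral_rep_mult:
  assumes f: "square_integrable f" and m: "continuous_on {0..2 * pi} m" and t: "t \<in> {0..2 * pi}"
  shows "integral {0..t} (\<lambda>s. rep_L2 (abs_L2 f) s * m s) = integral {0..t} (\<lambda>s. f s * m s)"
proof -
  have sq: "square_integrable (\<lambda>s. g s * m s)" if "square_integrable g" for g
    using square_integrable_mult_continuous[OF m that] by (simp add: mult.commute)
  have "abs_L2 (\<lambda>s. rep_L2 (abs_L2 f) s * m s) = abs_L2 (\<lambda>s. f s * m s)"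
    using rep_abs_L2[OF f] by (subst abs_L2_eq_iff) (auto simp: sq f square_integrable_rep elim: eventually_mono)
  then show ?thesis using W1_abs[OF sq[OF f] t] W1_abs[OF sq[OF square_integrable_rep[of "abs_L2 f"]] t] by simp
qed

lemma solution_abs_iff:
  assumes "square_integrable f"
  shows "solution (abs_L2 f) v v' \<longleftrightarrow> continuous_on {0..2 * pi} v' \<and>
     (\<forall>t\<in>{0..2 * pi}. (v has_real_derivative v' t) (at t within {0..2 * pi})) \<and>
     (\<forall>t\<in>{0..2 * pi}. v' t = v' 0 + integral {0..t} (\<lambda>s. f s * v s))"
proof -
  have "integral {0..t} (\<lambda>s. rep_L2 (abs_L2 f) s * v s) = integral {0..t} (\<lambda>s. f s * v s)"
    if "\<forall>t\<in>{0..2 * pi}. (v has_real_derivative v' t) (at t within {0..2 * pi})" "t \<in> {0..2 * pi}" for t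
    by (rule integral_rep_mult[OF assms DERIV_continuous_on that(2)]) (use that(1) in blast)
  then show ?thesis unfolding solution_def
    by (intro conj_cong[OF refl conj_cong[OF refl ball_cong[OF refl]]]) simp
qed

lemma solutionD:
  assumes "solution q v v'"
  shows "continuous_on {0..2 * pi} v'" "continuous_on {0..2 * pi} v"
    "\<And>t. t \<in> {0..2 * pi} \<Longrightarrow> (v has_real_derivative v' t) (at t within {0..2 * pi})"
    "\<And>t. t \<in> {0..2 * pi} \<Longrightarrow> v' t = v' 0 + integral {0..t} (\<lambda>s. rep_L2 q s * v s)"
    "square_integrable (\<lambda>s. rep_L2 q s * v s)"
proof -
  show d: "\<And>t. t \<in> {0..2 * pi} \<Longrightarrow> (v has_real_derivative v' t) (at t within {0..2 * pi})"
    using assms unfolding solution_def by blast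
  then show c: "continuous_on {0..2 * pi} v" using DERIV_continuous_on by blast
  show "square_integrable (\<lambda>s. rep_L2 q s * v s)"
    using square_integrable_mult_continuous[OF c square_integrable_rep[of q]] by (simp add: mult.commute)
qed (use assms in \<open>unfold solution_def, blast+\<close>)

lemma solution_product:
  assumes v: "solution q v v'" and m: "\<And>t. t \<in> {0..2 * pi} \<Longrightarrow> (m has_real_derivative m' t) (at t within {0..2 * pi})"
    and m': "continuous_on {0..2 * pi} m'" and t: "t \<in> {0..2 * pi}"
  shows "v' t * m t = v' 0 * m 0 + integral {0..t} (\<lambda>s. rep_L2 q s * v s * m s + v' s * m' s)"
  by (rule prim_mult[OF solutionD(5,4)[OF v] m m' t])

text \<open>By \<open>solution_product\<close>, \<open>v * w'\<close> and \<open>v' * w\<close> are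
  primitives of the same integrand \<open>q v w + v' w'\<close>.\<close>

lemma wronskian_constant:
  assumes v: "solution q v v'" and w: "solution q w w'" and t: "t \<in> {0..2 * pi}"
  shows "v t * w' t - v' t * w t = v 0 * w' 0 - v' 0 * w 0"
proof -
  have "w' t * v t = w' 0 * v 0 + integral {0..t} (\<lambda>s. rep_L2 q s * w s * v s + w' s * v' s)"
    by (rule solution_product[OF w solutionD(3,1)[OF v] t])
  moreover have "v' t * w t = v' 0 * w 0 + integral {0..t} (\<lambda>s. rep_L2 q s * v s * w s + v' s * w' s)"
    by (rule solution_product[OF v solutionD(3,1)[OF w] t])
  moreover have "(\<lambda>s. rep_L2 q s * w s * v s + w' s * v' s) = (\<lambda>s. rep_L2 q s * v s * w s + v' s * w' s)"
    by (auto simp: mult_ac)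
  ultimately show ?thesis by (simp add: mult.commute)
qed

text \<open>Cramer's rule: the coefficients are Wronskians, hence constant, and the Wronskian of
  \<open>v1\<close> and \<open>v2\<close> is 1. Uniqueness of the initial value problem follows
  without a Gronwall estimate.\<close>

lemma solution_combination:
  assumes v: "solution q v v'" and v1: "solution q v1 v1'" "v1 0 = 1" "v1' 0 = 0"
    and v2: "solution q v2 v2'" "v2 0 = 0" "v2' 0 = 1" and t: "t \<in> {0..2 * pi}"
  shows "v t = v 0 * v1 t + v' 0 * v2 t" "v' t = v 0 * v1' t + v' 0 * v2' t"
proof -
  have 1: "v t * v1' t - v' t * v1 t = - v' 0" using wronskian_constant[OF v v1(1) t] v1 by simp
  have 2: "v t * v2' t - v' t * v2 t = v 0" using wronskian_constant[OF v v2(1) t] v2 by simp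
  have 3: "v1 t * v2' t - v1' t * v2 t = 1" using wronskian_constant[OF v1(1) v2(1) t] v1 v2 by simp
  have "v t = v t * (v1 t * v2' t - v1' t * v2 t)" using 3 by simp
  also have "\<dots> = (v t * v2' t - v' t * v2 t) * v1 t - (v t * v1' t - v' t * v1 t) * v2 t" by (simp add: algebra_simps)
  finally show "v t = v 0 * v1 t + v' 0 * v2 t" using 1 2 by simp
  have "v' t = v' t * (v1 t * v2' t - v1' t * v2 t)" using 3 by simp
  also have "\<dots> = (v t * v2' t - v' t * v2 t) * v1' t - (v t * v1' t - v' t * v1 t) * v2' t" by (simp add: algebra_simps)
  finally show "v' t = v 0 * v1' t + v' 0 * v2' t" using 1 2 by simp
qed

lemma solution_linear:
  assumes v: "solution q v v'" and w: "solution q w w'"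
  shows "solution q (\<lambda>t. a * v t + b * w t) (\<lambda>t. a * v' t + b * w' t)"
  unfolding solution_def
proof (intro conjI ballI)
  show "continuous_on {0..2 * pi} (\<lambda>t. a * v' t + b * w' t)"
    by (intro continuous_intros solutionD[OF v] solutionD[OF w])
  fix t :: real assume t: "t \<in> {0..2 * pi}"
  show "((\<lambda>t. a * v t + b * w t) has_real_derivative a * v' t + b * w' t) (at t within {0..2 * pi})"
    by (intro DERIV_add DERIV_cmult solutionD[OF v] solutionD[OF w] t)
  have i: "(\<lambda>s. rep_L2 q s * x s) integrable_on {0..t}" if "solution q x x'" for x x'
    using square_integrable_integrable_on[OF solutionD(5)[OF that], of 0 t] t by simp
  have "integral {0..t} (\<lambda>s. rep_L2 q s * (a * v s + b * w s)) =
     integral {0..t} (\<lambda>s. a * (rep_L2 q s * v s) + b * (rep_L2 q s * w s))"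
    by (simp add: algebra_simps)
  also have "\<dots> = a * integral {0..t} (\<lambda>s. rep_L2 q s * v s) + b * integral {0..t} (\<lambda>s. rep_L2 q s * w s)"
    by (subst Henstock_Kurzweil_Integration.integral_add) (auto intro!: integrable_on_mult_right i v w)
  finally show "a * v' t + b * w' t = a * v' 0 + b * w' 0 + integral {0..t} (\<lambda>s. rep_L2 q s * (a * v s + b * w s))"
    using solutionD(4)[OF v t] solutionD(4)[OF w t] by (simp add: algebra_simps)
qed

text \<open>Integrating twice turns the initial value problem into a Volterra equation of the second
  kind: \<open>v t\<close> equals \<open>a + b * t\<close> plus the integral of
  \<open>(t - s) * q s * v s\<close> over \<open>{0..t}\<close>.\<close>

lemma solution_exists: "\<exists>v v'. solution q v v' \<and> v 0 = a \<and> v' 0 = b"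
proof -
  let ?q = "rep_L2 q"
  note q = square_integrable_rep[of q]
  define k where "k = (\<lambda>t s. (t - s) * ?q s)"
  have k: "square_integrable (k t)" for t
    unfolding k_def by (intro square_integrable_mult_continuous q continuous_intros)
  define \<kappa> where "\<kappa> = (\<lambda>t. abs_L2 (\<lambda>s. indicator {0..t} s * k t s))"
  have cont: "continuous_on {0..2 * pi} \<kappa>"
  proof -
    \<comment> \<open>The two cut-off ramps differ by at most \<open>\<bar>t - t'\<bar>\<close> at
      every point, so \<kappa> is Lipschitz although \<open>q\<close> is only square
      integrable.\<close>
    have lip: "norm (\<kappa> t - \<kappa> t') \<le> norm q * \<bar>t - t'\<bar>" if "t \<in> {0..2 * pi}" "t' \<in> {0..2 * pi}" for t t'
    proof -
      define m where "m = (\<lambda>s. indicator {0..t} s * (t - s) - indicator {0..t'} s * (t' - s))"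
      have mm: "m \<in> borel_measurable L2_measure"
        unfolding m_def using square_integrable_ramp[of t] square_integrable_ramp[of t'] by (auto simp: square_integrable_def)
      have mb: "\<bar>m s\<bar> \<le> \<bar>t - t'\<bar>" if "s \<in> {0..2 * pi}" for s
        using that by (auto simp: m_def indicator_def abs_if)
      have sq: "square_integrable (\<lambda>s. m s * ?q s)"
        by (rule square_integrable_mult_bounded[OF mm mb q])
      have eq: "\<kappa> t - \<kappa> t' = abs_L2 (\<lambda>s. m s * ?q s)"
        unfolding \<kappa>_def by (simp add: abs_L2_diff square_integrable_cut k) (simp add: m_def k_def algebra_simps)
      have "(norm (abs_L2 (\<lambda>s. m s * ?q s)))\<^sup>2 \<le> integral\<^sup>L L2_measure (\<lambda>s. \<bar>t - t'\<bar>\<^sup>2 * (?q s)\<^sup>2)"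
        unfolding norm_abs_L2[OF sq]
      proof (rule integral_mono_AE)
        show "integrable L2_measure (\<lambda>s. (m s * ?q s)\<^sup>2)" using sq by (simp add: square_integrable_def)
        show "integrable L2_measure (\<lambda>s. \<bar>t - t'\<bar>\<^sup>2 * (?q s)\<^sup>2)" using q by (simp add: square_integrable_def)
        have "(m s * ?q s)\<^sup>2 \<le> \<bar>t - t'\<bar>\<^sup>2 * (?q s)\<^sup>2" if "s \<in> {0..2 * pi}" for s
        proof -
          have "(m s)\<^sup>2 \<le> \<bar>t - t'\<bar>\<^sup>2" using power_mono[OF mb[OF that], of 2] by simp
          then show ?thesis unfolding power_mult_distrib by (rule mult_right_mono) simp
        qed
        then show "AE s in L2_measure. (m s * ?q s)\<^sup>2 \<le> \<bar>t - t'\<bar>\<^sup>2 * (?q s)\<^sup>2"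
          by (intro AE_I2) (simp add: space_restrict_space)
      qed
      also have "\<dots> = (norm q * \<bar>t - t'\<bar>)\<^sup>2"
        using norm_abs_L2[OF q] by (simp add: abs_rep_L2 power_mult_distrib)
      finally show ?thesis unfolding eq by (rule power2_le_imp_le) simp
    qed
    show ?thesis
      unfolding continuous_on_iff
    proof (intro ballI allI impI)
      fix t e :: real assume t: "t \<in> {0..2 * pi}" and e: "e > 0"
      show "\<exists>d>0. \<forall>t'\<in>{0..2 * pi}. dist t' t < d \<longrightarrow> dist (\<kappa> t') (\<kappa> t) < e"
      proof (rule exI[of _ "e / (norm q + 1)"], intro conjI ballI impI)
        show "e / (norm q + 1) > 0" using e by (simp add: add_nonneg_pos)
        fix t' assume t': "t' \<in> {0..2 * pi}" "dist t' t < e / (norm q + 1)"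
        have "dist (\<kappa> t') (\<kappa> t) \<le> norm q * \<bar>t' - t\<bar>" using lip[OF t'(1) t] by (simp add: dist_norm)
        also have "\<dots> \<le> (norm q + 1) * \<bar>t' - t\<bar>" by (intro mult_right_mono) auto
        also have "\<dots> < e" using t'(2) by (simp add: dist_real_def pos_less_divide_eq add_nonneg_pos mult.commute)
        finally show "dist (\<kappa> t') (\<kappa> t) < e" .
      qed
    qed
  qed
  have "\<exists>k. square_integrable k \<and> \<kappa> t = abs_L2 (\<lambda>s. indicator {0..t} s * k s)" for t
    using k \<kappa>_def by blast
  from volterra_invertible[OF cont this] obtain A where A: "\<And>k. A k - volterra \<kappa> (A k) = k" by blast
  have lin: "continuous_on {0..2 * pi} (\<lambda>t. a + b * t)" by (intro continuous_intros)
  define h where "h = A (abs_L2 (\<lambda>t. a + b * t))"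
  \<comment> \<open>\<open>h\<close> is only a class; the right-hand side of its own equation is a
    continuous representative.\<close>
  define v where "v = (\<lambda>t. a + b * t + h \<bullet> \<kappa> t)"
  have vc: "continuous_on {0..2 * pi} v" unfolding v_def by (intro continuous_intros cont)
  have h: "h = abs_L2 v"
  proof -
    have "h = abs_L2 (\<lambda>t. a + b * t) + volterra \<kappa> h" using A[of "abs_L2 (\<lambda>t. a + b * t)"] by (simp add: h_def algebra_simps)
    also have "\<dots> = abs_L2 v"
      unfolding volterra_def v_def by (rule abs_L2_add[OF square_integrable_continuous[OF lin] square_integrable_inner[OF cont]])
    finally show ?thesis .
  qed
  have qv: "square_integrable (\<lambda>s. ?q s * v s)"
    using square_integrable_mult_continuous[OF vc q] by (simp add: mult.commute)
  define v' where "v' = (\<lambda>t. b + integral {0..t} (\<lambda>s. ?q s * v s))"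
  have v'c: "continuous_on {0..2 * pi} v'" unfolding v'_def by (intro continuous_intros continuous_on_prim qv)
  have v: "v t = a + integral {0..t} v'" if t: "t \<in> {0..2 * pi}" for t
  proof -
    have "h \<bullet> \<kappa> t = integral {0..2 * pi} (\<lambda>s. indicator {0..t} s * (v s * k t s))"
      unfolding h \<kappa>_def by (subst inner_abs_L2[OF square_integrable_continuous[OF vc] square_integrable_cut[OF k]]) (simp add: mult_ac)
    also have "\<dots> = integral {0..t} (\<lambda>s. v s * k t s)" using t by (intro integral_cut) auto
    also have "\<dots> = integral {0..t} (\<lambda>s. (t - s) * (?q s * v s))" by (simp add: k_def mult_ac)
    also have "\<dots> = integral {0..t} (\<lambda>s. integral {0..s} (\<lambda>r. ?q r * v r))"
      by (rule integral_ramp[OF qv t, symmetric])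
    finally have 1: "h \<bullet> \<kappa> t = integral {0..t} (\<lambda>s. integral {0..s} (\<lambda>r. ?q r * v r))" .
    have "integral {0..t} v' = integral {0..t} (\<lambda>s. b) + integral {0..t} (\<lambda>s. integral {0..s} (\<lambda>r. ?q r * v r))"
      unfolding v'_def using t
      by (intro Henstock_Kurzweil_Integration.integral_add integrable_continuous_real
          continuous_on_subset[OF continuous_on_prim[OF qv]] continuous_intros) auto
    then show ?thesis using t 1 by (simp add: v_def mult.commute)
  qed
  have dv: "(v has_real_derivative v' t) (at t within {0..2 * pi})" if t: "t \<in> {0..2 * pi}" for t
  proof -
    have "((\<lambda>x. a + integral {0..x} v') has_real_derivative 0 + v' t) (at t within {0..2 * pi})"
      by (intro DERIV_add DERIV_const integral_has_real_derivative v'c t)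
    then show ?thesis
      unfolding has_field_derivative_def by (intro has_derivative_transform[OF t v]) simp_all
  qed
  have "solution q v v'"
    unfolding solution_def using v'c dv by (simp add: v'_def)
  moreover have "v 0 = a" "v' 0 = b" using v[of 0] by (simp_all add: v'_def)
  ultimately show ?thesis by blast
qed

section \<open>Flat functions and smooth steps\<close>

definition flat :: "nat \<Rightarrow> real \<Rightarrow> real" where
  "flat k r = (if r > 0 then exp (- inverse r) * inverse r ^ k else 0)"

lemma flat_tendsto_0: "(flat k \<longlongrightarrow> 0) (at 0)"
  unfolding filterlim_at_split
proof
  have "\<forall>\<^sub>F x in at_left 0. flat k x = 0"
    unfolding eventually_at_filter by (simp add: flat_def)
  then show "(flat k \<longlongrightarrow> 0) (at_left 0)" by (rule tendsto_eventually)
  have "((\<lambda>x. inverse x ^ k / exp (inverse x)) \<longlongrightarrow> (0::real)) (at_right 0)"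
    by (rule filterlim_compose[OF tendsto_power_div_exp_0 filterlim_inverse_at_top_right])
  moreover have "\<forall>\<^sub>F x in at_right 0. inverse x ^ k / exp (inverse x) = flat k x"
    unfolding eventually_at_filter by (simp add: flat_def exp_minus divide_inverse mult.commute)
  ultimately show "(flat k \<longlongrightarrow> 0) (at_right 0)" by (rule Lim_transform_eventually)
qed

lemma flat_derivative: "(flat k has_real_derivative flat (k + 2) r - real k * flat (k + 1) r) (at r)"
proof (cases r "0 :: real" rule: linorder_cases)
  case less
  have "((\<lambda>x. 0) has_real_derivative 0) (at r)" by simp
  then have "(flat k has_real_derivative 0) (at r)"
    by (rule has_field_derivative_transform_within_open[where S = "{..<0}"]) (use less in \<open>auto simp: flat_def\<close>)
  then show ?thesis using less by (simp add: flat_def)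
next
  case equal
  have "((\<lambda>x. (flat k x - flat k 0) / (x - 0)) \<longlongrightarrow> 0) (at 0)"
  proof (rule Lim_transform_eventually[OF flat_tendsto_0[of "Suc k"]])
    show "\<forall>\<^sub>F x in at 0. flat (Suc k) x = (flat k x - flat k 0) / (x - 0)"
      by (rule always_eventually) (auto simp: flat_def divide_inverse)
  qed
  then have "(flat k has_real_derivative 0) (at 0)" by (simp add: has_field_derivative_iff)
  then show ?thesis using equal by (simp add: flat_def)
next
  case greater
  have inv: "(inverse has_real_derivative - (inverse r * inverse r)) (at r)"
    using DERIV_inverse[of r UNIV] greater by (simp add: power2_eq_square)
  have 1: "((\<lambda>x. exp (- inverse x)) has_real_derivative exp (- inverse r) * (inverse r * inverse r)) (at r)"
    using DERIV_fun_exp[OF DERIV_minus[OF inv]] by simp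
  have 2: "((\<lambda>x. inverse x ^ k) has_real_derivative - (real k * inverse r ^ (k + 1))) (at r)"
  proof (cases k)
    case (Suc j)
    show ?thesis
      using DERIV_power_Suc[OF inv, of j] unfolding Suc by (simp add: mult_ac)
  qed simp
  have "((\<lambda>x. exp (- inverse x) * inverse x ^ k) has_real_derivative
      flat (k + 2) r - real k * flat (k + 1) r) (at r)"
    using DERIV_mult[OF 1 2] greater by (simp add: flat_def algebra_simps)
  then show ?thesis
    by (rule has_field_derivative_transform_within_open[where S = "{0<..}"]) (use greater in \<open>auto simp: flat_def\<close>)
qed

text \<open>The powers of \<open>inverse r\<close> make the family closed under differentiation up
  to linear combinations, so one induction for all \<open>k\<close> at once suffices.\<close>

lemma smooth_flat: "smooth (flat k)"
proof -
  have "Cn n (\<lambda>r \<eta>. flat k r)" for n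
  proof (induction n arbitrary: k)
    case 0
    have "isCont (flat k) x" for x by (rule DERIV_isCont[OF flat_derivative])
    then show ?case using locally_bounded_isCont[of "flat k"] by simp
  next
    case (Suc n)
    have "Cn n (\<lambda>r \<eta>. flat (k + 2) r + - (real k * flat (k + 1) r))"
      by (rule Cn_add[OF Suc Cn_minus[OF Cn_bilinear[OF bounded_bilinear_mult Cn_const Suc]]])
    then show ?case
      using Cn_real_chain[where f = "\<lambda>x. x" and g = "flat k" and g' = "\<lambda>r. flat (k + 2) r - real k * flat (k + 1) r",
          OF flat_derivative smooth_ident] by simp
  qed
  then show ?thesis by (rule Cn_imp_smooth)
qed

lemma flat_nonneg: "0 \<le> flat k r" by (simp add: flat_def)
lemma flat_pos: "0 < r \<Longrightarrow> 0 < flat k r" by (simp add: flat_def)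
lemma flat_eq_0: "r \<le> 0 \<Longrightarrow> flat k r = 0" by (simp add: flat_def)

definition smooth_step :: "real \<Rightarrow> real" where
  "smooth_step t = flat 0 t * inverse (flat 0 t + flat 0 (1 - t))"

lemma smooth_step_denominator: "flat 0 t + flat 0 (1 - t) > 0"
proof (cases "t > 0")
  case True
  then show ?thesis using flat_pos[of t 0] flat_nonneg[of 0 "1 - t"] by linarith
next
  case False
  then show ?thesis using flat_pos[of "1 - t" 0] flat_nonneg[of 0 t] by linarith
qed

lemma smooth_smooth_step: "smooth smooth_step"
proof -
  have "smooth (\<lambda>t. flat 0 (1 - t))"
    by (rule smooth_compose[OF smooth_flat smooth_diff[OF smooth_const smooth_ident]])
  then have "smooth (\<lambda>t. flat 0 t * inverse (flat 0 t + flat 0 (1 - t)))"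
    using smooth_step_denominator[THEN less_imp_neq, THEN not_sym]
    by (intro smooth_mult smooth_inverse_real smooth_add smooth_flat)
  then show ?thesis by (simp add: smooth_step_def[abs_def])
qed

lemma smooth_step_0: "t \<le> 0 \<Longrightarrow> smooth_step t = 0" by (simp add: smooth_step_def flat_eq_0)

lemma smooth_step_1: "t \<ge> 1 \<Longrightarrow> smooth_step t = 1"
  using flat_pos[of t 0] by (simp add: smooth_step_def flat_eq_0)

lemma smooth_real_deriv:
  fixes f :: "real \<Rightarrow> real"
  assumes "smooth f"
  shows "(f has_real_derivative deriv f x) (at x)" "isCont (deriv f) x"
proof -
  obtain f1 where f1: "form_derivative (\<lambda>x \<eta>. f x) f1" "Cn (Suc 0) f1"
    using Cn_SucD[OF smooth_imp_Cn[OF assms, of "Suc (Suc 0)"]] by blast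
  have d: "(f has_real_derivative f1 x (case_nat 1 (\<lambda>_. 0))) (at x)" for x
    using form_derivative_line[OF f1(1), where x = 0 and h = 1 and \<eta> = "\<lambda>_. 0" and c = x]
    by (simp add: has_real_derivative_iff_has_vector_derivative)
  have eq: "deriv f = (\<lambda>x. f1 x (case_nat 1 (\<lambda>_. 0)))"
    using DERIV_imp_deriv[OF d] by (rule ext)
  show "(f has_real_derivative deriv f x) (at x)" unfolding eq by (rule d)
  show "isCont (deriv f) x" unfolding eq
    by (rule Cn_Suc_isCont[OF f1(2), where M = 1]) (auto split: nat.splits)
qed

lemma smooth_step_deriv_bound:
  obtains M where "M > 0" "\<And>t. \<bar>deriv smooth_step t\<bar> \<le> M" "\<And>t. t \<notin> {0..1} \<Longrightarrow> deriv smooth_step t = 0"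
proof -
  note d = smooth_real_deriv[OF smooth_smooth_step]
  have "bounded (deriv smooth_step ` {0..1})"
    by (intro compact_imp_bounded compact_continuous_image continuous_at_imp_continuous_on ballI d) simp
  then obtain M where M: "\<forall>t\<in>{0..1}. \<bar>deriv smooth_step t\<bar> \<le> M" unfolding bounded_iff by auto
  have out: "deriv smooth_step t = 0" if "t \<notin> {0..1}" for t
  proof (cases "t < 0")
    case True
    have "((\<lambda>x. 0) has_real_derivative 0) (at t)" by simp
    then have "(smooth_step has_real_derivative 0) (at t)"
      by (rule has_field_derivative_transform_within_open[where S = "{..<0}"]) (use True in \<open>auto simp: smooth_step_0\<close>)
    then show ?thesis by (rule DERIV_imp_deriv)
  next
    case False
    have "((\<lambda>x. 1) has_real_derivative 0) (at t)" by simp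
    then have "(smooth_step has_real_derivative 0) (at t)"
      by (rule has_field_derivative_transform_within_open[where S = "{1<..}"]) (use False that in \<open>auto simp: smooth_step_1\<close>)
    then show ?thesis by (rule DERIV_imp_deriv)
  qed
  show thesis
  proof (rule that[of "max M 1"])
    show "\<bar>deriv smooth_step t\<bar> \<le> max M 1" for t
      using M out[of t] by (cases "t \<in> {0..1}") (auto simp: max.coboundedI1)
  qed (use out in auto)
qed

section \<open>Weak derivatives and primitives\<close>

lemma test_function_ends:
  assumes "test_function \<phi>" "t \<notin> {0<..<2 * pi}"
  shows "\<phi> t = 0"
  using assms closure_subset[of "{t. \<phi> t \<noteq> 0}"] unfolding test_function_def by blast

lemma prim_imp_weak_derivative:
  assumes f: "square_integrable f" and F: "\<And>t. t \<in> {0..2 * pi} \<Longrightarrow> F t = F 0 + integral {0..t} f"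
  shows "weak_derivative F f"
    and "test_function \<phi> \<Longrightarrow> integral {0..2 * pi} (\<lambda>t. F t * deriv \<phi> t) = - integral {0..2 * pi} (\<lambda>t. f t * \<phi> t)"
proof -
  have Fc: "continuous_on {0..2 * pi} F"
    by (subst continuous_on_cong[OF refl F]) (auto intro!: continuous_intros continuous_on_prim f)
  have *: "integral {0..2 * pi} (\<lambda>t. F t * deriv \<phi> t) = - integral {0..2 * pi} (\<lambda>t. f t * \<phi> t) \<and>
     square_integrable (\<lambda>t. f t * \<phi> t) \<and> square_integrable (\<lambda>t. F t * deriv \<phi> t)"
    if \<phi>: "test_function \<phi>" for \<phi>
  proof -
    have sm: "smooth \<phi>" using \<phi> by (simp add: test_function_def)
    note d = smooth_real_deriv[OF sm]
    have dc: "continuous_on {0..2 * pi} (deriv \<phi>)" by (intro continuous_at_imp_continuous_on ballI d)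
    have \<phi>c: "continuous_on {0..2 * pi} \<phi>" by (intro continuous_at_imp_continuous_on ballI smooth_isCont sm)
    have sq1: "square_integrable (\<lambda>t. f t * \<phi> t)"
      using square_integrable_mult_continuous[OF \<phi>c f] by (simp add: mult.commute)
    have c2: "continuous_on {0..2 * pi} (\<lambda>t. F t * deriv \<phi> t)" by (intro continuous_intros Fc dc)
    have "F (2 * pi) * \<phi> (2 * pi) = F 0 * \<phi> 0 + integral {0..2 * pi} (\<lambda>s. f s * \<phi> s + F s * deriv \<phi> s)"
      by (rule prim_mult[OF f F _ dc]) (auto intro: has_field_derivative_at_within[OF d(1)])
    moreover have "\<phi> 0 = 0" "\<phi> (2 * pi) = 0" using test_function_ends[OF \<phi>] by auto
    moreover have "integral {0..2 * pi} (\<lambda>s. f s * \<phi> s + F s * deriv \<phi> s) =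
        integral {0..2 * pi} (\<lambda>s. f s * \<phi> s) + integral {0..2 * pi} (\<lambda>s. F s * deriv \<phi> s)"
      using square_integrable_integrable_on[OF sq1, of 0 "2 * pi"] integrable_continuous_real[OF c2]
      by (intro Henstock_Kurzweil_Integration.integral_add) auto
    ultimately show ?thesis using sq1 square_integrable_continuous[OF c2] by simp
  qed
  then show "test_function \<phi> \<Longrightarrow> integral {0..2 * pi} (\<lambda>t. F t * deriv \<phi> t) = - integral {0..2 * pi} (\<lambda>t. f t * \<phi> t)"
    by blast
  show "weak_derivative F f"
    unfolding weak_derivative_def using * by (simp add: integral_L2_measure square_integrable_imp_integrable)
qed

text \<open>
  Du Bois-Reymond: the test functions \<open>step ((t - a) / \<delta>) - step ((t - b) / \<delta>)\<close> approximate the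
  indicator of \<open>[a, b]\<close>, and their derivatives evaluate a continuous function at \<open>a\<close> and \<open>b\<close>.
\<close>

lemma weak_derivative_imp_prim:
  assumes v: "continuous_on {0..2 * pi} v" and g: "square_integrable g" and weak: "weak_derivative v g"
    and t: "t \<in> {0..2 * pi}"
  shows "v t = v 0 + integral {0..t} g"
proof -
  define F where "F = (\<lambda>t. integral {0..t} g)"
  \<comment> \<open>The defect \<open>H\<close> is continuous with weak derivative 0; it has to be
    shown constant.\<close>
  define H where "H = (\<lambda>t. v t - F t)"
  have Fc: "continuous_on {0..2 * pi} F" unfolding F_def by (rule continuous_on_prim[OF g])
  have Hc: "continuous_on {0..2 * pi} H" unfolding H_def by (intro continuous_intros v Fc)
  have Hphi: "integral {0..2 * pi} (\<lambda>t. H t * deriv \<phi> t) = 0" if \<phi>: "test_function \<phi>" for \<phi>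
  proof -
    have sm: "smooth \<phi>" using \<phi> by (simp add: test_function_def)
    note d = smooth_real_deriv[OF sm]
    have dc: "continuous_on {0..2 * pi} (deriv \<phi>)" by (intro continuous_at_imp_continuous_on ballI d)
    have \<phi>c: "continuous_on {0..2 * pi} \<phi>" by (intro continuous_at_imp_continuous_on ballI smooth_isCont sm)
    have sq1: "square_integrable (\<lambda>t. g t * \<phi> t)"
      using square_integrable_mult_continuous[OF \<phi>c g] by (simp add: mult.commute)
    have cv: "continuous_on {0..2 * pi} (\<lambda>t. v t * deriv \<phi> t)" by (intro continuous_intros v dc)
    have cF: "continuous_on {0..2 * pi} (\<lambda>t. F t * deriv \<phi> t)" by (intro continuous_intros Fc dc)
    have "integral {0..2 * pi} (\<lambda>t. v t * deriv \<phi> t) = - integral {0..2 * pi} (\<lambda>t. g t * \<phi> t)"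
      using weak[unfolded weak_derivative_def, rule_format, OF \<phi>]
      by (simp add: integral_L2_measure square_integrable_imp_integrable sq1 square_integrable_continuous cv)
    moreover have "integral {0..2 * pi} (\<lambda>t. F t * deriv \<phi> t) = - integral {0..2 * pi} (\<lambda>t. g t * \<phi> t)"
      by (rule prim_imp_weak_derivative(2)[OF g _ \<phi>]) (simp add: F_def)
    moreover have "integral {0..2 * pi} (\<lambda>t. v t * deriv \<phi> t - F t * deriv \<phi> t) =
       integral {0..2 * pi} (\<lambda>t. v t * deriv \<phi> t) - integral {0..2 * pi} (\<lambda>t. F t * deriv \<phi> t)"
      by (intro Henstock_Kurzweil_Integration.integral_diff integrable_continuous_real cv cF)
    ultimately show ?thesis by (simp add: H_def left_diff_distrib)
  qed
  obtain M where M: "M > 0" "\<And>t. \<bar>deriv smooth_step t\<bar> \<le> M" "\<And>t. t \<notin> {0..1} \<Longrightarrow> deriv smooth_step t = 0"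
    using smooth_step_deriv_bound by blast
  define S where "S = (\<lambda>\<delta> a t. smooth_step ((t - a) / \<delta>))"
  define S' where "S' = (\<lambda>\<delta> a t. deriv smooth_step ((t - a) / \<delta>) * (1 / \<delta>))"
  have Sd: "(S \<delta> a has_real_derivative S' \<delta> a t) (at t)" for \<delta> a t
  proof -
    have "((\<lambda>t. (t - a) / \<delta>) has_real_derivative 1 / \<delta>) (at t)"
      by (intro DERIV_cdivide) (auto intro!: derivative_eq_intros)
    from DERIV_chain2[OF smooth_real_deriv(1)[OF smooth_smooth_step] this] show ?thesis
      unfolding S_def S'_def .
  qed
  have S'c: "continuous_on A (S' \<delta> a)" if "\<delta> \<noteq> 0" for A \<delta> a
  proof -
    have "isCont (\<lambda>t. deriv smooth_step ((t - a) / \<delta>)) t" for t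
      using isCont_o2[of t "\<lambda>t. (t - a) / \<delta>" "deriv smooth_step"] smooth_real_deriv(2)[OF smooth_smooth_step] that
      by simp
    then show ?thesis unfolding S'_def by (intro continuous_at_imp_continuous_on ballI continuous_intros)
  qed
  \<comment> \<open>\<open>S' \<delta> a\<close> has integral 1, vanishes outside
    \<open>{a..a + \<delta>}\<close> and is bounded by \<open>M / \<delta>\<close>. Integrated
    against it, \<open>H\<close> gives \<open>H a\<close> up to \<open>M\<close> times its
    oscillation \<epsilon> there.\<close>
  have approx: "\<bar>integral {0..2 * pi} (\<lambda>t. H t * S' \<delta> a t) - H a\<bar> \<le> M * \<epsilon>"
    if \<delta>: "\<delta> > 0" and a: "0 < a" "a + \<delta> < 2 * pi" and \<epsilon>: "\<And>t. t \<in> {a..a + \<delta>} \<Longrightarrow> \<bar>H t - H a\<bar> \<le> \<epsilon>" for \<delta> a \<epsilon>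
  proof -
    have "\<epsilon> \<ge> 0" using \<epsilon>[of a] \<delta> by simp
    have "(S' \<delta> a has_integral (S \<delta> a (2 * pi) - S \<delta> a 0)) {0..2 * pi}"
      by (intro fundamental_theorem_of_calculus)
         (auto simp: has_real_derivative_iff_has_vector_derivative[symmetric] intro: has_field_derivative_at_within[OF Sd])
    moreover have "S \<delta> a (2 * pi) = 1" unfolding S_def using \<delta> a by (intro smooth_step_1) (simp add: pos_le_divide_eq)
    moreover have "S \<delta> a 0 = 0" unfolding S_def using \<delta> a by (intro smooth_step_0) (simp add: divide_nonpos_pos)
    ultimately have 1: "integral {0..2 * pi} (S' \<delta> a) = 1" by (simp add: integral_unique)
    have c1: "continuous_on {0..2 * pi} (\<lambda>t. H t * S' \<delta> a t)" using \<delta> by (intro continuous_intros Hc S'c) simp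
    have c2: "continuous_on {0..2 * pi} (\<lambda>t. H a * S' \<delta> a t)" using \<delta> by (intro continuous_intros S'c) simp
    have "integral {0..2 * pi} (\<lambda>t. H t * S' \<delta> a t) - H a = integral {0..2 * pi} (\<lambda>t. H t * S' \<delta> a t - H a * S' \<delta> a t)"
      unfolding Henstock_Kurzweil_Integration.integral_diff[OF integrable_continuous_real[OF c1] integrable_continuous_real[OF c2]]
      by (simp add: 1)
    also have "norm \<dots> \<le> integral {0..2 * pi} (\<lambda>t. indicator {a..a + \<delta>} t * (\<epsilon> * M / \<delta>))"
    proof (rule Henstock_Kurzweil_Integration.integral_norm_bound_integral)
      show "(\<lambda>t. H t * S' \<delta> a t - H a * S' \<delta> a t) integrable_on {0..2 * pi}"
        by (intro integrable_continuous_real continuous_on_diff c1 c2)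
      show "(\<lambda>t. indicator {a..a + \<delta>} t * (\<epsilon> * M / \<delta>)) integrable_on {0..2 * pi}"
        by (rule square_integrable_integrable_on[OF square_integrable_cut[OF square_integrable_const]]) simp_all
      fix t assume "t \<in> {0..2 * pi}"
      show "norm (H t * S' \<delta> a t - H a * S' \<delta> a t) \<le> indicator {a..a + \<delta>} t * (\<epsilon> * M / \<delta>)"
      proof (cases "t \<in> {a..a + \<delta>}")
        case True
        have "\<bar>S' \<delta> a t\<bar> \<le> M / \<delta>"
          unfolding S'_def using M(2) \<delta> by (simp add: abs_mult divide_right_mono)
        then have "\<bar>H t - H a\<bar> * \<bar>S' \<delta> a t\<bar> \<le> \<epsilon> * (M / \<delta>)"
          by (rule mult_mono[OF \<epsilon>[OF True] _ \<open>\<epsilon> \<ge> 0\<close> abs_ge_zero])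
        moreover have "norm (H t * S' \<delta> a t - H a * S' \<delta> a t) = \<bar>H t - H a\<bar> * \<bar>S' \<delta> a t\<bar>"
          by (simp only: left_diff_distrib[symmetric] real_norm_def abs_mult)
        ultimately show ?thesis using True by simp
      next
        case False
        then have "(t - a) / \<delta> \<notin> {0..1}" using \<delta> by (auto simp: pos_divide_le_eq pos_le_divide_eq)
        then have "S' \<delta> a t = 0" unfolding S'_def by (simp add: M(3))
        then show ?thesis using False by simp
      qed
    qed
    also have "\<dots> = integral {a..a + \<delta>} (\<lambda>t. \<epsilon> * M / \<delta>)" using a by (intro integral_cut) auto
    also have "\<dots> = M * \<epsilon>" using \<delta> by simp
    finally show ?thesis by simp
  qed
  have const: "H a = H b" if ab: "0 < a" "a < b" "b < 2 * pi" for a b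
  proof -
    have "\<bar>H a - H b\<bar> \<le> 2 * M * \<epsilon>" if "\<epsilon> > 0" for \<epsilon>
    proof -
      have near: "\<exists>d>0. \<forall>t\<in>{0..2 * pi}. dist t c < d \<longrightarrow> dist (H t) (H c) < \<epsilon>" if "c \<in> {0..2 * pi}" for c
        using Hc[unfolded continuous_on_iff, rule_format, OF that \<open>\<epsilon> > 0\<close>] by simp
      obtain d1 where d1: "d1 > 0" "\<forall>t\<in>{0..2 * pi}. dist t a < d1 \<longrightarrow> dist (H t) (H a) < \<epsilon>"
        using near[of a] ab by auto
      obtain d2 where d2: "d2 > 0" "\<forall>t\<in>{0..2 * pi}. dist t b < d2 \<longrightarrow> dist (H t) (H b) < \<epsilon>"
        using near[of b] ab by auto
      \<comment> \<open>Halving keeps \<delta> strictly below \<open>d1\<close> and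
        \<open>d2\<close>; the last entry keeps \<open>{a..b + \<delta>}\<close>, which contains the
        support of \<phi>, inside the open interval.\<close>
      define \<delta> where "\<delta> = min (min (d1 / 2) (d2 / 2)) ((2 * pi - b) / 2)"
      have \<delta>: "\<delta> > 0" "\<delta> < d1" "\<delta> < d2" "b + \<delta> < 2 * pi"
      proof -
        have "\<delta> \<le> (2 * pi - b) / 2" "\<delta> \<le> d1 / 2" "\<delta> \<le> d2 / 2"
          unfolding \<delta>_def by (rule min.cobounded2 min.coboundedI1[OF min.cobounded1] min.coboundedI1[OF min.cobounded2])+
        moreover have "(2 * pi - b) / 2 < 2 * pi - b" using ab by simp
        ultimately show "\<delta> < d1" "\<delta> < d2" "b + \<delta> < 2 * pi" using d1(1) d2(1) by linarith+
        show "\<delta> > 0" using d1(1) d2(1) ab by (simp add: \<delta>_def)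
      qed
      have A: "\<bar>integral {0..2 * pi} (\<lambda>t. H t * S' \<delta> a t) - H a\<bar> \<le> M * \<epsilon>"
      proof (rule approx[OF \<delta>(1)])
        show "\<bar>H t - H a\<bar> \<le> \<epsilon>" if "t \<in> {a..a + \<delta>}" for t
          using d1(2)[rule_format, of t] that \<delta> ab by (auto simp: dist_real_def)
      qed (use ab \<delta> in auto)
      have B: "\<bar>integral {0..2 * pi} (\<lambda>t. H t * S' \<delta> b t) - H b\<bar> \<le> M * \<epsilon>"
      proof (rule approx[OF \<delta>(1)])
        show "\<bar>H t - H b\<bar> \<le> \<epsilon>" if "t \<in> {b..b + \<delta>}" for t
          using d2(2)[rule_format, of t] that \<delta> ab by (auto simp: dist_real_def)
      qed (use ab \<delta> in auto)
      define \<phi> where "\<phi> = (\<lambda>t. S \<delta> a t - S \<delta> b t)"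
      have "{t. \<phi> t \<noteq> 0} \<subseteq> {a..b + \<delta>}"
      proof
        fix t assume t: "t \<in> {t. \<phi> t \<noteq> 0}"
        have "\<phi> t = 0" if "t < a"
          unfolding \<phi>_def S_def using \<delta>(1) ab that by (simp add: smooth_step_0 divide_nonpos_pos)
        moreover have "\<phi> t = 0" if "t > b + \<delta>"
          unfolding \<phi>_def S_def using \<delta>(1) ab that by (simp add: smooth_step_1 pos_le_divide_eq)
        moreover have "\<phi> t \<noteq> 0" using t by simp
        ultimately show "t \<in> {a..b + \<delta>}" by (meson atLeastAtMost_iff not_le)
      qed
      then have "closure {t. \<phi> t \<noteq> 0} \<subseteq> {a..b + \<delta>}" by (rule closure_minimal) simp
      moreover have "smooth \<phi>"
      proof -
        have "smooth (\<lambda>t. (t - c) / \<delta>)" for c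
          using smooth_mult[OF smooth_diff[OF smooth_ident smooth_const[of c]] smooth_const[of "1 / \<delta>"]] by simp
        from smooth_compose[OF smooth_smooth_step this] show ?thesis
          unfolding \<phi>_def S_def by (intro smooth_diff) simp_all
      qed
      moreover have "{a..b + \<delta>} \<subseteq> {0<..<2 * pi}" using ab \<delta> by auto
      ultimately have "test_function \<phi>" unfolding test_function_def by blast
      from Hphi[OF this] have "integral {0..2 * pi} (\<lambda>t. H t * deriv \<phi> t) = 0" .
      moreover have "deriv \<phi> t = S' \<delta> a t - S' \<delta> b t" for t
        unfolding \<phi>_def by (intro DERIV_imp_deriv DERIV_diff Sd)
      moreover have "integral {0..2 * pi} (\<lambda>t. H t * S' \<delta> a t - H t * S' \<delta> b t) =
          integral {0..2 * pi} (\<lambda>t. H t * S' \<delta> a t) - integral {0..2 * pi} (\<lambda>t. H t * S' \<delta> b t)"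
        using \<delta>(1) by (intro Henstock_Kurzweil_Integration.integral_diff integrable_continuous_real continuous_intros Hc S'c) auto
      ultimately have "integral {0..2 * pi} (\<lambda>t. H t * S' \<delta> a t) = integral {0..2 * pi} (\<lambda>t. H t * S' \<delta> b t)"
        by (simp add: right_diff_distrib)
      with A B show ?thesis by linarith
    qed
    note * = this
    show ?thesis
    proof (rule ccontr)
      assume "H a \<noteq> H b"
      then have x: "\<bar>H a - H b\<bar> > 0" by simp
      \<comment> \<open>This \<epsilon> makes the bound \<open>2 * M * \<epsilon>\<close> half of
        the quantity that it bounds.\<close>
      then have "\<bar>H a - H b\<bar> \<le> 2 * M * (\<bar>H a - H b\<bar> / (4 * M))" using M(1) by (intro *) simp
      also have "\<dots> = \<bar>H a - H b\<bar> / 2" using M(1) by simp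
      finally show False using x by simp
    qed
  qed
  have open_const: "H x = H pi" if x: "x \<in> {0<..<2 * pi}" for x
  proof (cases x pi rule: linorder_cases)
    case less
    then show ?thesis using x by (intro const) auto
  next
    case greater
    then have "H pi = H x" using x by (intro const) auto
    then show ?thesis by (rule sym)
  qed simp
  have cl: "closure {0<..<2 * pi} = {0..2 * pi}" by (simp add: closure_greaterThanLessThan)
  have H: "H x = H pi" if "x \<in> {0..2 * pi}" for x
    by (rule continuous_constant_on_closure[of "{0<..<2 * pi}" H "H pi" x]) (unfold cl, rule Hc, rule open_const, assumption, rule that)
  have "H t = H pi" by (rule H[OF t])
  moreover have "H 0 = H pi" by (rule H) simp
  ultimately have "H t = H 0" by (rule trans[OF _ sym])
  then show ?thesis by (simp add: H_def F_def)
qed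

text \<open>Du Bois-Reymond turns both weak derivatives into derivatives of the continuous
  representatives, integration by parts leads back. The equation, valid only almost everywhere,
  enters through the equality of the classes of \<open>v''\<close> and \<open>q v\<close>.\<close>

lemma periodic_solution_iff:
  "has_nontrivial_periodic_solution q \<longleftrightarrow>
     (\<exists>v v'. solution q v v' \<and> v 0 = v (2 * pi) \<and> v' 0 = v' (2 * pi) \<and> (\<exists>t\<in>{0..2 * pi}. v t \<noteq> 0))"
proof -
  obtain f where f: "square_integrable f" "q = abs_L2 f" by (rule L2_cases)
  have eq: "has_nontrivial_periodic_solution q \<longleftrightarrow> (\<exists>v v' v''. sobolev_H2 v v' v'' \<and>
     (AE t in L2_measure. - v'' t + f t * v t = 0) \<and>
     v 0 = v (2 * pi) \<and> v' 0 = v' (2 * pi) \<and> (\<exists>t\<in>{0..2 * pi}. v t \<noteq> 0))"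
    unfolding f(2) by (rule has_nontrivial_periodic_solution.abs_eq) (simp add: L2_rel_self f)
  have 1: "solution q v v'" if s: "sobolev_H2 v v' v''" and ae: "AE t in L2_measure. - v'' t + f t * v t = 0" for v v' v''
  proof -
    have c: "continuous_on {0..2 * pi} v" "continuous_on {0..2 * pi} v'" and sq: "square_integrable v'" "square_integrable v''"
      and w: "weak_derivative v v'" "weak_derivative v' v''"
      using s by (simp_all add: sobolev_H2_def)
    have fv: "square_integrable (\<lambda>t. f t * v t)"
      using square_integrable_mult_continuous[OF c(1) f(1)] by (simp add: mult.commute)
    have "abs_L2 v'' = abs_L2 (\<lambda>t. f t * v t)"
      unfolding abs_L2_eq_iff[OF sq(2) fv] using ae by eventually_elim simp
    then have int: "integral {0..t} v'' = integral {0..t} (\<lambda>t. f t * v t)" if "t \<in> {0..2 * pi}" for t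
      using W1_abs[OF sq(2) that] W1_abs[OF fv that] by simp
    show ?thesis
      unfolding f(2) solution_abs_iff[OF f(1)]
    proof (intro conjI ballI c)
      fix t :: real assume t: "t \<in> {0..2 * pi}"
      show "v' t = v' 0 + integral {0..t} (\<lambda>s. f s * v s)"
        using weak_derivative_imp_prim[OF c(2) sq(2) w(2) t] int[OF t] by simp
      have "((\<lambda>x. v 0 + integral {0..x} v') has_real_derivative 0 + v' t) (at t within {0..2 * pi})"
        by (intro DERIV_add DERIV_const integral_has_real_derivative c t)
      then show "(v has_real_derivative v' t) (at t within {0..2 * pi})"
        unfolding has_field_derivative_def
        by (intro has_derivative_transform[OF t weak_derivative_imp_prim[OF c(1) sq(1) w(1)]]) simp_all
    qed
  qed
  have 2: "sobolev_H2 v v' (\<lambda>t. f t * v t)" if s: "solution q v v'" for v v'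
  proof -
    note s' = s[unfolded f(2) solution_abs_iff[OF f(1)]]
    have c: "continuous_on {0..2 * pi} v'" "continuous_on {0..2 * pi} v" by (rule solutionD(1)[OF s], rule solutionD(2)[OF s])
    have fv: "square_integrable (\<lambda>t. f t * v t)"
      using square_integrable_mult_continuous[OF c(2) f(1)] by (simp add: mult.commute)
    have v: "v t = v 0 + integral {0..t} v'" if t: "t \<in> {0..2 * pi}" for t
    proof -
      have "(v' has_integral (v t - v 0)) {0..t}"
        using t by (intro fundamental_theorem_of_calculus)
          (auto simp: has_real_derivative_iff_has_vector_derivative[symmetric] intro: DERIV_subset[OF solutionD(3)[OF s]])
      from integral_unique[OF this] show ?thesis by simp
    qed
    have v': "v' t = v' 0 + integral {0..t} (\<lambda>s. f s * v s)" if "t \<in> {0..2 * pi}" for t using s' that by blast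
    show ?thesis
      unfolding sobolev_H2_def
      by (intro conjI c square_integrable_continuous fv
          prim_imp_weak_derivative(1)[OF square_integrable_continuous[OF c(1)] v] prim_imp_weak_derivative(1)[OF fv v'])
  qed
  show ?thesis
    unfolding eq
  proof (intro iffI; elim exE conjE)
    fix v v' v'' assume "sobolev_H2 v v' v''" "AE t in L2_measure. - v'' t + f t * v t = 0" "v 0 = v (2 * pi)" "v' 0 = v' (2 * pi)" "\<exists>t\<in>{0..2 * pi}. v t \<noteq> 0"
    then show "\<exists>v v'. solution q v v' \<and> v 0 = v (2 * pi) \<and> v' 0 = v' (2 * pi) \<and> (\<exists>t\<in>{0..2 * pi}. v t \<noteq> 0)"
      using 1 by blast
  next
    fix v v' assume "solution q v v'" "v 0 = v (2 * pi)" "v' 0 = v' (2 * pi)" "\<exists>t\<in>{0..2 * pi}. v t \<noteq> 0"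
    then show "\<exists>v v' v''. sobolev_H2 v v' v'' \<and> (AE t in L2_measure. - v'' t + f t * v t = 0) \<and>
      v 0 = v (2 * pi) \<and> v' 0 = v' (2 * pi) \<and> (\<exists>t\<in>{0..2 * pi}. v t \<noteq> 0)"
      using 2[of v v'] by (intro exI[of _ v] exI[of _ v'] exI[of _ "\<lambda>t. f t * v t"]) simp
  qed
qed

section \<open>The Riccati parametrization of potentials\<close>

text \<open>
  If \<open>\<phi>' = exp w\<close>, then \<open>v = exp (-w/2) cos (\<phi> - c)\<close> satisfies \<open>v'' = (- w''/2 + w'\<^sup>2/4 - exp (2 w)) v\<close>;
  below, \<open>w = W0 u\<close> and \<open>w'' = u\<close>.
\<close>

definition potential_fun :: "L2 \<Rightarrow> real \<Rightarrow> real" where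
  "potential_fun u t = - (1 / 2) * rep_L2 u t + ((W1 u t)\<^sup>2 / 4 - exp (2 * W0 u t))"

definition potential :: "L2 \<Rightarrow> L2" where
  "potential u = abs_L2 (potential_fun u)"

definition phase :: "L2 \<Rightarrow> real \<Rightarrow> real" where
  "phase u t = integral {0..t} (\<lambda>s. exp (W0 u s))"

definition wave :: "real \<Rightarrow> L2 \<Rightarrow> real \<Rightarrow> real" where
  "wave c u t = exp (- W0 u t / 2) * cos (phase u t - c)"

definition wave' :: "real \<Rightarrow> L2 \<Rightarrow> real \<Rightarrow> real" where
  "wave' c u t = - (W1 u t / 2) * wave c u t - exp (W0 u t / 2) * sin (phase u t - c)"

lemma continuous_on_potential_part:
  "continuous_on {0..2 * pi} (\<lambda>t. (W1 u t)\<^sup>2 / 4 - exp (2 * W0 u t))"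
  by (intro continuous_intros continuous_on_W1 continuous_on_W0) simp

lemma square_integrable_potential: "square_integrable (potential_fun u)"
proof -
  have "square_integrable (\<lambda>t. - (1 / 2) * rep_L2 u t + ((W1 u t)\<^sup>2 / 4 - exp (2 * W0 u t)))"
    by (rule square_integrable_add[OF square_integrable_scale[OF square_integrable_rep]
          square_integrable_continuous[OF continuous_on_potential_part]])
  then show ?thesis by (simp add: potential_fun_def[abs_def])
qed

lemma phase_has_derivative:
  assumes "t \<in> {0..2 * pi}"
  shows "(phase u has_real_derivative exp (W0 u t)) (at t within {0..2 * pi})"
  unfolding phase_def
  by (rule integral_has_real_derivative[OF _ assms]) (intro continuous_intros continuous_on_W0)

lemma continuous_on_phase: "continuous_on {0..2 * pi} (phase u)"
  by (rule DERIV_continuous_on[OF phase_has_derivative])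

lemma phase_0 [simp]: "phase u 0 = 0" by (simp add: phase_def)

lemma wave_has_derivative:
  assumes t: "t \<in> {0..2 * pi}"
  shows "(wave c u has_real_derivative wave' c u t) (at t within {0..2 * pi})"
proof -
  define I where "I = {0..2 * pi}"
  note d [derivative_intros] = W0_has_derivative[OF t, of u, folded I_def] phase_has_derivative[OF t, of u, folded I_def]
  have e: "exp (- W0 u t / 2) * exp (W0 u t) = exp (W0 u t / 2)"
    by (simp add: exp_add[symmetric])
  have "((\<lambda>t. exp (- W0 u t / 2) * cos (phase u t - c)) has_real_derivative
     exp (- W0 u t / 2) * (- W1 u t / 2) * cos (phase u t - c)
     + exp (- W0 u t / 2) * (- sin (phase u t - c) * exp (W0 u t))) (at t within I)"
    by (auto intro!: derivative_eq_intros)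
  moreover have "exp (- W0 u t / 2) * (- W1 u t / 2) * cos (phase u t - c)
     + exp (- W0 u t / 2) * (- sin (phase u t - c) * exp (W0 u t)) = wave' c u t"
    unfolding wave'_def wave_def e[symmetric] by (simp add: algebra_simps)
  ultimately show ?thesis unfolding I_def wave_def[abs_def] by simp
qed

lemma continuous_on_wave: "continuous_on {0..2 * pi} (wave c u)"
  unfolding wave_def by (intro continuous_intros continuous_on_W0 continuous_on_phase) simp

lemma continuous_on_wave': "continuous_on {0..2 * pi} (wave' c u)"
  unfolding wave'_def
  by (intro continuous_intros continuous_on_W0 continuous_on_W1 continuous_on_phase continuous_on_wave) simp_all

lemma solution_wave: "solution (potential u) (wave c u) (wave' c u)"
  unfolding potential_def solution_abs_iff[OF square_integrable_potential]
proof (intro conjI ballI)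
  show "continuous_on {0..2 * pi} (wave' c u)" by (rule continuous_on_wave')
  fix t :: real assume t: "t \<in> {0..2 * pi}"
  show "(wave c u has_real_derivative wave' c u t) (at t within {0..2 * pi})" by (rule wave_has_derivative[OF t])
  \<comment> \<open>\<open>N\<close> is the continuously differentiable part of
    \<open>wave'\<close>. The other part contains \<open>W1 u\<close>, which is only a primitive of
    a square integrable function, and goes through \<open>prim_mult\<close>.\<close>
  define N where "N = (\<lambda>t. - (exp (W0 u t / 2) * sin (phase u t - c)))"
  define N' where "N' = (\<lambda>t. - (exp (W0 u t / 2) * (W1 u t / 2) * sin (phase u t - c) + exp (W0 u t / 2) * (cos (phase u t - c) * exp (W0 u t))))"
  have dN: "(N has_real_derivative N' t) (at t within {0..2 * pi})" if t: "t \<in> {0..2 * pi}" for t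
  proof -
    define I where "I = {0..2 * pi}"
    note d [derivative_intros] = W0_has_derivative[OF t, of u, folded I_def] phase_has_derivative[OF t, of u, folded I_def]
    show ?thesis unfolding N_def N'_def I_def[symmetric]
      by (auto intro!: derivative_eq_intros)
  qed
  have cN': "continuous_on {0..2 * pi} N'" unfolding N'_def
    by (intro continuous_intros continuous_on_W0 continuous_on_W1 continuous_on_phase) simp_all
  have iN: "integral {0..t} N' = N t - N 0"
  proof -
    have "(N' has_integral (N t - N 0)) {0..t}"
      using t by (intro fundamental_theorem_of_calculus)
        (auto simp: has_real_derivative_iff_has_vector_derivative[symmetric] intro: DERIV_subset[OF dN])
    then show ?thesis by (rule integral_unique)
  qed
  have sq: "square_integrable (\<lambda>s. rep_L2 u s * (- (1 / 2) * wave c u s) + W1 u s * (- (1 / 2) * wave' c u s))"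
  proof (rule square_integrable_add)
    have "continuous_on {0..2 * pi} (\<lambda>s. - (1 / 2) * wave c u s)" by (intro continuous_intros continuous_on_wave)
    from square_integrable_mult_continuous[OF this square_integrable_rep[of u]]
    show "square_integrable (\<lambda>s. rep_L2 u s * (- (1 / 2) * wave c u s))" by (simp only: mult.commute)
    show "square_integrable (\<lambda>s. W1 u s * (- (1 / 2) * wave' c u s))"
      by (intro square_integrable_continuous continuous_intros continuous_on_W1 continuous_on_wave')
  qed
  have "W1 u t * (- (1 / 2) * wave c u t) = W1 u 0 * (- (1 / 2) * wave c u 0) +
      integral {0..t} (\<lambda>s. rep_L2 u s * (- (1 / 2) * wave c u s) + W1 u s * (- (1 / 2) * wave' c u s))"
  proof (rule prim_mult[OF square_integrable_rep _ _ _ t])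
    show "W1 u t = W1 u 0 + integral {0..t} (rep_L2 u)" for t by (simp add: W1_def)
    show "((\<lambda>s. - (1 / 2) * wave c u s) has_real_derivative - (1 / 2) * wave' c u t) (at t within {0..2 * pi})"
      if "t \<in> {0..2 * pi}" for t by (rule DERIV_cmult[OF wave_has_derivative[OF that]])
    show "continuous_on {0..2 * pi} (\<lambda>s. - (1 / 2) * wave' c u s)" by (intro continuous_intros continuous_on_wave')
  qed
  then have 1: "- (W1 u t / 2) * wave c u t =
      integral {0..t} (\<lambda>s. rep_L2 u s * (- (1 / 2) * wave c u s) + W1 u s * (- (1 / 2) * wave' c u s))" by simp
  have int1: "(\<lambda>s. rep_L2 u s * (- (1 / 2) * wave c u s) + W1 u s * (- (1 / 2) * wave' c u s)) integrable_on {0..t}"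
    by (rule square_integrable_integrable_on[OF sq]) (use t in auto)
  have int2: "N' integrable_on {0..t}"
    by (rule square_integrable_integrable_on[OF square_integrable_continuous[OF cN']]) (use t in auto)
  have "wave' c u t = - (W1 u t / 2) * wave c u t + N t" by (simp add: wave'_def N_def)
  also have "\<dots> = N 0 + (integral {0..t} (\<lambda>s. rep_L2 u s * (- (1 / 2) * wave c u s) + W1 u s * (- (1 / 2) * wave' c u s)) + integral {0..t} N')"
    unfolding 1 iN by simp
  also have "integral {0..t} (\<lambda>s. rep_L2 u s * (- (1 / 2) * wave c u s) + W1 u s * (- (1 / 2) * wave' c u s)) + integral {0..t} N' =
      integral {0..t} (\<lambda>s. (rep_L2 u s * (- (1 / 2) * wave c u s) + W1 u s * (- (1 / 2) * wave' c u s)) + N' s)"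
    by (rule Henstock_Kurzweil_Integration.integral_add[OF int1 int2, symmetric])
  also have "\<dots> = integral {0..t} (\<lambda>s. potential_fun u s * wave c u s)"
  proof (rule Henstock_Kurzweil_Integration.integral_cong)
    fix s
    \<comment> \<open>All exponentials are powers of this \<open>e\<close>, which reduces the
      identity of the integrands to field arithmetic.\<close>
    define e where "e = exp (W0 u s / 2)"
    have e: "e > 0" "exp (W0 u s) = e * e" "exp (2 * W0 u s) = e * e * e * e" "exp (- W0 u s / 2) = 1 / e"
      unfolding e_def by (simp, simp add: exp_add[symmetric], simp add: exp_add[symmetric], simp add: exp_minus inverse_eq_divide)
    show "(rep_L2 u s * (- (1 / 2) * wave c u s) + W1 u s * (- (1 / 2) * wave' c u s)) + N' s = potential_fun u s * wave c u s"
      unfolding potential_fun_def wave'_def wave_def N'_def e e_def[symmetric] using e(1)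
      by (simp add: field_simps power2_eq_square)
  qed
  also have "N 0 = wave' c u 0" by (simp add: N_def wave'_def)
  finally show "wave' c u t = wave' c u 0 + integral {0..t} (\<lambda>s. potential_fun u s * wave c u s)" .
qed

text \<open>For a matrix \<open>M\<close> of determinant 1 one has
  \<open>det (M - 1) = 2 - tr M\<close>. One direction multiplies the fixed point equations by the
  adjugate of \<open>M - 1\<close>, the other exhibits the kernel vector
  \<open>(b, 1 - a)\<close>.\<close>

lemma unimodular_fixed_vector_iff:
  fixes a b c d :: real
  assumes det: "a * d - b * c = 1"
  shows "(\<exists>x y. (x \<noteq> 0 \<or> y \<noteq> 0) \<and> x = x * a + y * b \<and> y = x * c + y * d) \<longleftrightarrow> a + d = 2"
proof
  assume "\<exists>x y. (x \<noteq> 0 \<or> y \<noteq> 0) \<and> x = x * a + y * b \<and> y = x * c + y * d"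
  then obtain x y where xy: "x \<noteq> 0 \<or> y \<noteq> 0" "x = x * a + y * b" "y = x * c + y * d" by blast
  have "x * (2 - (a + d)) = (d - 1) * (x * a + y * b - x) - b * (x * c + y * d - y) + x * (1 - (a * d - b * c))"
    by (simp add: algebra_simps)
  moreover have "y * (2 - (a + d)) = (a - 1) * (x * c + y * d - y) - c * (x * a + y * b - x) + y * (1 - (a * d - b * c))"
    by (simp add: algebra_simps)
  ultimately have "x * (2 - (a + d)) = 0" "y * (2 - (a + d)) = 0"
    using xy(2,3)[symmetric] det by simp_all
  then show "a + d = 2" using xy(1) by auto
next
  assume tr: "a + d = 2"
  then have d: "d = 2 - a" by simp
  have bc: "b * c = - (a - 1)\<^sup>2" using det by (simp add: d power2_eq_square algebra_simps)
  show "\<exists>x y. (x \<noteq> 0 \<or> y \<noteq> 0) \<and> x = x * a + y * b \<and> y = x * c + y * d"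
  \<comment> \<open>Exactly here the vector \<open>(b, 1 - a)\<close> is zero; then also
    \<open>d = 1\<close>, and \<open>(0, 1)\<close> is fixed.\<close>
  proof (cases "b = 0 \<and> a = 1")
    case True
    then show ?thesis using d by (intro exI[of _ 0] exI[of _ 1]) simp
  next
    case False
    have "1 - a = b * c + (1 - a) * d" unfolding bc d by (simp add: power2_eq_square algebra_simps)
    moreover have "b = b * a + (1 - a) * b" by (simp add: algebra_simps)
    ultimately show ?thesis using False by (intro exI[of _ b] exI[of _ "1 - a"]) auto
  qed
qed

lemma solution_zero:
  assumes v: "solution q v v'" and 0: "\<And>t. t \<in> {0..2 * pi} \<Longrightarrow> v t = 0"
  shows "v' 0 = 0"
proof -
  have const: "v' t = v' 0" if t: "t \<in> {0..2 * pi}" for t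
  proof -
    have "integral {0..t} (\<lambda>s. rep_L2 q s * v s) = integral {0..t} (\<lambda>s. 0)"
      using t 0 by (intro Henstock_Kurzweil_Integration.integral_cong) auto
    then show ?thesis using solutionD(4)[OF v t] by simp
  qed
  have "(v' has_integral (v (2 * pi) - v 0)) {0..2 * pi}"
    by (intro fundamental_theorem_of_calculus)
       (auto simp: has_real_derivative_iff_has_vector_derivative[symmetric] intro: solutionD(3)[OF v])
  then have "integral {0..2 * pi} v' = 0" using 0[of 0] 0[of "2 * pi"] by (simp add: integral_unique)
  moreover have "integral {0..2 * pi} v' = integral {0..2 * pi} (\<lambda>t. v' 0)"
    by (rule Henstock_Kurzweil_Integration.integral_cong) (rule const)
  ultimately show ?thesis by simp
qed

lemma periodic_iff_trace:
  assumes v1: "solution q v1 v1'" "v1 0 = 1" "v1' 0 = 0" and v2: "solution q v2 v2'" "v2 0 = 0" "v2' 0 = 1"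
  shows "has_nontrivial_periodic_solution q \<longleftrightarrow> v1 (2 * pi) + v2' (2 * pi) = 2"
proof -
  let ?T = "2 * pi"
  have T: "?T \<in> {0..2 * pi}" by simp
  have det: "v1 ?T * v2' ?T - v2 ?T * v1' ?T = 1"
    using wronskian_constant[OF v1(1) v2(1) T] v1 v2 by (simp add: mult.commute)
  have "has_nontrivial_periodic_solution q \<longleftrightarrow>
    (\<exists>x y. (x \<noteq> 0 \<or> y \<noteq> 0) \<and> x = x * v1 ?T + y * v2 ?T \<and> y = x * v1' ?T + y * v2' ?T)"
    unfolding periodic_solution_iff
  proof
    assume "\<exists>v v'. solution q v v' \<and> v 0 = v ?T \<and> v' 0 = v' ?T \<and> (\<exists>t\<in>{0..2 * pi}. v t \<noteq> 0)"
    then obtain v v' t where v: "solution q v v'" "v 0 = v ?T" "v' 0 = v' ?T" "t \<in> {0..2 * pi}" "v t \<noteq> 0" by blast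
    note comb = solution_combination[OF v(1) v1 v2]
    have "v 0 \<noteq> 0 \<or> v' 0 \<noteq> 0" using comb(1)[OF v(4)] v(5) by auto
    moreover have "v 0 = v 0 * v1 ?T + v' 0 * v2 ?T" by (rule trans[OF v(2) comb(1)[OF T]])
    moreover have "v' 0 = v 0 * v1' ?T + v' 0 * v2' ?T" by (rule trans[OF v(3) comb(2)[OF T]])
    ultimately show "\<exists>x y. (x \<noteq> 0 \<or> y \<noteq> 0) \<and> x = x * v1 ?T + y * v2 ?T \<and> y = x * v1' ?T + y * v2' ?T"
      by (intro exI[of _ "v 0"] exI[of _ "v' 0"] conjI)
  next
    assume "\<exists>x y. (x \<noteq> 0 \<or> y \<noteq> 0) \<and> x = x * v1 ?T + y * v2 ?T \<and> y = x * v1' ?T + y * v2' ?T"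
    then obtain x y where xy: "x \<noteq> 0 \<or> y \<noteq> 0" "x = x * v1 ?T + y * v2 ?T" "y = x * v1' ?T + y * v2' ?T" by blast
    define v where "v = (\<lambda>t. x * v1 t + y * v2 t)"
    define v' where "v' = (\<lambda>t. x * v1' t + y * v2' t)"
    have s: "solution q v v'" unfolding v_def v'_def by (rule solution_linear[OF v1(1) v2(1)])
    have i: "v 0 = x" "v' 0 = y" by (simp_all add: v_def v'_def v1 v2)
    have "\<exists>t\<in>{0..2 * pi}. v t \<noteq> 0"
    proof (rule ccontr)
      assume "\<not> (\<exists>t\<in>{0..2 * pi}. v t \<noteq> 0)"
      then have z: "v t = 0" if "t \<in> {0..2 * pi}" for t using that by blast
      have "v 0 = 0" by (rule z) simp
      moreover have "v' 0 = 0" by (rule solution_zero[OF s z])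
      ultimately show False using xy(1) i by simp
    qed
    moreover have "v 0 = v ?T" using xy(2) by (simp only: i(1)) (simp only: v_def)
    moreover have "v' 0 = v' ?T" using xy(3) by (simp only: i(2)) (simp only: v'_def)
    ultimately show "\<exists>v v'. solution q v v' \<and> v 0 = v ?T \<and> v' 0 = v' ?T \<and> (\<exists>t\<in>{0..2 * pi}. v t \<noteq> 0)"
      using s by blast
  qed
  also have "\<dots> \<longleftrightarrow> v1 ?T + v2' ?T = 2" by (rule unimodular_fixed_vector_iff[OF det])
  finally show ?thesis .
qed

text \<open>The shifts 0 and \<pi>/2 turn the wave into its cosine and its sine version: the
  fundamental system whose initial matrix is the identity.\<close>

lemma wave_initial: "wave 0 u 0 = 1" "wave' 0 u 0 = 0" "wave (pi / 2) u 0 = 0" "wave' (pi / 2) u 0 = 1"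
  by (simp_all add: wave_def wave'_def)

lemma potential_periodic_iff:
  "has_nontrivial_periodic_solution (potential u) \<longleftrightarrow>
     cosh (W0 u (2 * pi) / 2) * cos (phase u (2 * pi)) - W1 u (2 * pi) / 4 * exp (- W0 u (2 * pi) / 2) * sin (phase u (2 * pi)) = 1"
proof -
  have "has_nontrivial_periodic_solution (potential u) \<longleftrightarrow> wave 0 u (2 * pi) + wave' (pi / 2) u (2 * pi) = 2"
    by (rule periodic_iff_trace[OF solution_wave wave_initial(1,2) solution_wave wave_initial(3,4)])
  moreover have trig: "cos (x - pi / 2) = sin x" "sin (x - pi / 2) = - cos x" for x :: real
    by (simp_all add: cos_diff sin_diff)
  have "wave 0 u (2 * pi) + wave' (pi / 2) u (2 * pi) = 2 * (cosh (W0 u (2 * pi) / 2) * cos (phase u (2 * pi)) -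
      W1 u (2 * pi) / 4 * exp (- W0 u (2 * pi) / 2) * sin (phase u (2 * pi)))"
    by (simp only: wave_def wave'_def trig diff_0_right cosh_def) (simp add: algebra_simps)
  moreover have "2 * x = 2 \<longleftrightarrow> x = 1" for x :: real by simp
  ultimately show ?thesis by (simp only:)
qed

text \<open>The fundamental system depends on the potential alone. The sum of its squares is
  \<open>exp (- W0 u t)\<close>; minus the logarithmic derivative of that sum is
  \<open>W1 u\<close>, which determines \<open>u\<close>.\<close>

lemma inj_potential: "inj potential"
proof (rule injI)
  fix u1 u2 assume eq: "potential u1 = potential u2"
  have same: "wave c u1 t = wave c u2 t \<and> wave' c u1 t = wave' c u2 t"
    if init: "wave c u1 0 = wave c u2 0" "wave' c u1 0 = wave' c u2 0" and t: "t \<in> {0..2 * pi}" for c t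
  proof -
    have s1: "solution (potential u1) (wave c u1) (wave' c u1)" by (rule solution_wave)
    have s2: "solution (potential u1) (wave c u2) (wave' c u2)" unfolding eq by (rule solution_wave)
    note c = solution_combination[OF _ solution_wave[of u1 0] wave_initial(1,2) solution_wave[of u1 "pi / 2"] wave_initial(3,4) t]
    show ?thesis using c[OF s1] c[OF s2] init by simp
  qed
  show "u1 = u2"
  proof -
    have "W1 u1 t = W1 u2 t" if t: "t \<in> {0..2 * pi}" for t
    proof -
      have s: "wave 0 u1 t = wave 0 u2 t" "wave' 0 u1 t = wave' 0 u2 t"
         "wave (pi / 2) u1 t = wave (pi / 2) u2 t" "wave' (pi / 2) u1 t = wave' (pi / 2) u2 t"
        using same[OF _ _ t, of 0] same[OF _ _ t, of "pi / 2"] by (simp_all add: wave_initial)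
      have trig: "cos (x - pi / 2) = sin x" "sin (x - pi / 2) = - cos x" for x :: real
        by (simp_all add: cos_diff sin_diff)
      have R: "(wave 0 u t)\<^sup>2 + (wave (pi / 2) u t)\<^sup>2 = (exp (- W0 u t / 2))\<^sup>2" for u
        by (simp add: wave_def trig power_mult_distrib distrib_left[symmetric])
      have W: "wave 0 u t * wave' 0 u t + wave (pi / 2) u t * wave' (pi / 2) u t = - (W1 u t / 2) * ((wave 0 u t)\<^sup>2 + (wave (pi / 2) u t)\<^sup>2)" for u
        by (simp add: wave'_def algebra_simps power2_eq_square) (simp add: wave_def trig)
      have "(W1 u1 t / 2) * ((wave 0 u1 t)\<^sup>2 + (wave (pi / 2) u1 t)\<^sup>2) = (W1 u2 t / 2) * ((wave 0 u1 t)\<^sup>2 + (wave (pi / 2) u1 t)\<^sup>2)"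
        using W[of u1] W[of u2] unfolding s by (simp only: minus_mult_left[symmetric])
      moreover have "(wave 0 u1 t)\<^sup>2 + (wave (pi / 2) u1 t)\<^sup>2 \<noteq> 0" unfolding R by simp
      ultimately have "W1 u1 t / 2 = W1 u2 t / 2" by (metis mult_right_cancel)
      then show ?thesis by simp
    qed
    then have "(u1 - u2) \<bullet> abs_L2 (indicator {0..c}) = 0" if "c \<in> {0..2 * pi}" for c
      using that by (simp add: inner_diff_left W1_inner ind_L2_def)
    then have "u1 - u2 = 0" by (rule L2_eq_0I)
    then show ?thesis by simp
  qed
qed

text \<open>With \<open>p1\<close>, \<open>p2\<close> as the derivatives of \<open>v1\<close>,
  \<open>v2\<close>, \<omega> is the derivative of \<open>- ln R\<close> and the left-hand side is
  the derivative of \<omega>. The Wronskian enters through Lagrange's identity for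
  \<open>(v1\<^sup>2 + v2\<^sup>2) * (p1\<^sup>2 + p2\<^sup>2)\<close>. This is the Ermakov equation
  of the amplitude.\<close>

lemma log_amplitude_identity:
  fixes v1 v2 p1 p2 q R \<omega> :: real
  assumes R: "R = v1\<^sup>2 + v2\<^sup>2" "R > 0" and W: "v1 * p2 - p1 * v2 = 1" and \<omega>: "\<omega> = - 2 * (v1 * p1 + v2 * p2) / R"
  shows "(q * v1 * (- 2 * v1 / R) + p1 * (- 2 * (p1 + \<omega> * v1) / R)) + (q * v2 * (- 2 * v2 / R) + p2 * (- 2 * (p2 + \<omega> * v2) / R))
    = - 2 * q + (\<omega>\<^sup>2 / 2 - 2 / R\<^sup>2)"
proof -
  define P where "P = p1\<^sup>2 + p2\<^sup>2"
  define d where "d = v1 * p1 + v2 * p2"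
  have d: "d = - \<omega> * R / 2" using R(2) by (simp add: \<omega> d_def)
  have "P * R = d\<^sup>2 + (v1 * p2 - p1 * v2)\<^sup>2" unfolding P_def R d_def by (simp add: power2_eq_square algebra_simps)
  then have "P * R = \<omega>\<^sup>2 * R\<^sup>2 / 4 + 1" unfolding W d by (simp add: power_mult_distrib power_divide)
  then have P: "P / R = \<omega>\<^sup>2 / 4 + 1 / R\<^sup>2" using R(2) by (simp add: field_simps power2_eq_square)
  have "(q * v1 * (- 2 * v1 / R) + p1 * (- 2 * (p1 + \<omega> * v1) / R)) + (q * v2 * (- 2 * v2 / R) + p2 * (- 2 * (p2 + \<omega> * v2) / R))
     = - 2 * q * ((v1\<^sup>2 + v2\<^sup>2) / R) - 2 * (P / R) - 2 * \<omega> * (d / R)"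
    using R(2) unfolding P_def d_def by (simp add: field_simps power2_eq_square)
  also have "(v1\<^sup>2 + v2\<^sup>2) / R = 1" unfolding R(1)[symmetric] using R(2) by simp
  also have "d / R = - \<omega> / 2" using R(2) d by simp
  finally show ?thesis unfolding P by (simp add: power2_eq_square)
qed

text \<open>For the fundamental system of \<open>q\<close> the sum of squares \<open>R\<close> is
  positive, since the Wronskian is 1. The preimage of \<open>q\<close> is the second derivative of
  \<open>- ln R\<close>; that \<open>R\<close> is 1 with derivative 0 at the origin matches the
  normalization of \<open>W0\<close>.\<close>

lemma surj_potential: "surj potential"
  unfolding surj_def
proof
  fix q
  obtain v1 v1' where v1: "solution q v1 v1'" "v1 0 = 1" "v1' 0 = 0" using solution_exists by blast
  obtain v2 v2' where v2: "solution q v2 v2'" "v2 0 = 0" "v2' 0 = 1" using solution_exists by blast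
  let ?I = "{0..2 * pi}"
  note c = solutionD(1,2)[OF v1(1)] solutionD(1,2)[OF v2(1)]
  note d1 = solutionD(3)[OF v1(1)] and d2 = solutionD(3)[OF v2(1)]
  define R where "R = (\<lambda>t. (v1 t)\<^sup>2 + (v2 t)\<^sup>2)"
  define \<omega> where "\<omega> = (\<lambda>t. - 2 * (v1 t * v1' t + v2 t * v2' t) / R t)"
  have Wr: "v1 t * v2' t - v1' t * v2 t = 1" if "t \<in> ?I" for t
    using wronskian_constant[OF v1(1) v2(1) that] v1(2,3) v2(2,3) by simp
  have Rpos: "R t > 0" if "t \<in> ?I" for t
  proof -
    have "v1 t \<noteq> 0 \<or> v2 t \<noteq> 0" using Wr[OF that] by auto
    then show ?thesis unfolding R_def by (simp add: sum_power2_gt_zero_iff)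
  qed
  have cR: "continuous_on ?I R" unfolding R_def by (intro continuous_intros c)
  have c\<omega>: "continuous_on ?I \<omega>" unfolding \<omega>_def using Rpos by (intro continuous_intros c cR) force
  have dR: "(R has_real_derivative - (\<omega> t * R t)) (at t within ?I)" if t: "t \<in> ?I" for t
  proof -
    have "(R has_real_derivative 2 * v1 t * v1' t + 2 * v2 t * v2' t) (at t within ?I)"
      unfolding R_def using DERIV_add[OF DERIV_power[OF d1[OF t], of 2] DERIV_power[OF d2[OF t], of 2]] by (simp add: mult_ac)
    moreover have "2 * v1 t * v1' t + 2 * v2 t * v2' t = - (\<omega> t * R t)" using Rpos[OF t] by (simp add: \<omega>_def)
    ultimately show ?thesis by simp
  qed
  have dinv: "((\<lambda>t. - 2 * v t / R t) has_real_derivative - 2 * (v' t + \<omega> t * v t) / R t) (at t within ?I)"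
    if v: "(v has_real_derivative v' t) (at t within ?I)" and t: "t \<in> ?I" for v v' t
  proof -
    have "((\<lambda>t. - 2 * v t / R t) has_real_derivative ((- 2 * v' t) * R t - (- 2 * v t) * (- (\<omega> t * R t))) / (R t * R t)) (at t within ?I)"
      by (rule DERIV_divide[OF DERIV_cmult[OF v] dR[OF t]]) (use Rpos[OF t] in simp)
    moreover have "((- 2 * v' t) * R t - (- 2 * v t) * (- (\<omega> t * R t))) / (R t * R t) = - 2 * (v' t + \<omega> t * v t) / R t"
      using Rpos[OF t] by (simp add: field_simps)
    ultimately show ?thesis by simp
  qed
  have Rnz: "R t \<noteq> 0" if "t \<in> ?I" for t using Rpos[OF that] by simp
  \<comment> \<open>The right-hand side of \<open>log_amplitude_identity\<close>, so formally the
    derivative of \<omega>. It is also what solving \<open>potential_fun\<close> for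
    \<open>u\<close> gives when \<open>W1 u\<close> is \<omega> and \<open>exp (2 * W0 u)\<close> is
    \<open>1 / R\<^sup>2\<close>.\<close>
  define f where "f = (\<lambda>t. - 2 * rep_L2 q t + ((\<omega> t)\<^sup>2 / 2 - 2 / (R t)\<^sup>2))"
  have cpart: "continuous_on ?I (\<lambda>t. (\<omega> t)\<^sup>2 / 2 - 2 / (R t)\<^sup>2)" using Rnz by (intro continuous_intros c\<omega> cR) auto
  have f: "square_integrable f" unfolding f_def
    by (rule square_integrable_add[OF square_integrable_scale[OF square_integrable_rep] square_integrable_continuous[OF cpart]])
  have W1: "W1 (abs_L2 f) t = \<omega> t" if t: "t \<in> ?I" for t
  proof -
    let ?g = "\<lambda>v v' s. rep_L2 q s * v s * (- 2 * v s / R s) + v' s * (- 2 * (v' s + \<omega> s * v s) / R s)"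
    have cm: "continuous_on ?I (\<lambda>s. - 2 * (v' s + \<omega> s * v s) / R s)" if "continuous_on ?I v" "continuous_on ?I v'" for v v'
      using Rnz that by (intro continuous_intros c\<omega> cR) auto
    have cm2: "continuous_on ?I (\<lambda>s. - 2 * v s / R s)" if "continuous_on ?I v" for v
      using Rnz that by (intro continuous_intros cR) auto
    have int: "?g v v' integrable_on {0..t}" if s: "solution q v v'" for v v'
    proof (rule square_integrable_integrable_on[OF square_integrable_add])
      show "square_integrable (\<lambda>s. rep_L2 q s * v s * (- 2 * v s / R s))"
        using square_integrable_mult_continuous[OF cm2[OF solutionD(2)[OF s]] solutionD(5)[OF s]] by (simp only: mult.commute)
      show "square_integrable (\<lambda>s. v' s * (- 2 * (v' s + \<omega> s * v s) / R s))"
        by (intro square_integrable_continuous continuous_on_mult cm solutionD(1,2)[OF s])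
    qed (use t in auto)
    have p: "v' t * (- 2 * v t / R t) = v' 0 * (- 2 * v 0 / R 0) + integral {0..t} (?g v v')" if s: "solution q v v'" for v v'
    proof (rule solution_product[OF s _ cm[OF solutionD(2,1)[OF s]] t])
      fix r assume r: "r \<in> ?I"
      show "((\<lambda>s. - 2 * v s / R s) has_real_derivative - 2 * (v' r + \<omega> r * v r) / R r) (at r within ?I)"
        by (rule dinv[where v = v and v' = v', OF solutionD(3)[OF s r] r])
    qed
    have "\<omega> t = v1' t * (- 2 * v1 t / R t) + v2' t * (- 2 * v2 t / R t)"
      using Rnz[OF t] by (simp add: \<omega>_def field_simps)
    also have "\<dots> = integral {0..t} (?g v1 v1') + integral {0..t} (?g v2 v2')"
      unfolding p[OF v1(1)] p[OF v2(1)] using v1(3) v2(2) by simp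
    also have "\<dots> = integral {0..t} (\<lambda>s. ?g v1 v1' s + ?g v2 v2' s)"
      by (rule Henstock_Kurzweil_Integration.integral_add[symmetric, OF int[OF v1(1)] int[OF v2(1)]])
    also have "\<dots> = integral {0..t} f"
    proof (rule Henstock_Kurzweil_Integration.integral_cong)
      fix s assume "s \<in> {0..t}"
      then have s: "s \<in> ?I" using t by auto
      show "?g v1 v1' s + ?g v2 v2' s = f s"
        unfolding f_def by (rule log_amplitude_identity[OF _ Rpos[OF s] Wr[OF s]]) (simp_all add: R_def \<omega>_def)
    qed
    finally show ?thesis using W1_abs[OF f t] by simp
  qed
  have W0: "W0 (abs_L2 f) t = - ln (R t)" if t: "t \<in> ?I" for t
  proof -
    have dln: "((\<lambda>t. - ln (R t)) has_real_derivative \<omega> t) (at t within ?I)" if t: "t \<in> ?I" for t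
    proof -
      have "(ln has_real_derivative inverse (R t)) (at (R t))" by (rule DERIV_ln[OF Rpos[OF t]])
      note * = DERIV_minus[OF DERIV_chain2[OF this dR[OF t]]]
      have "- (inverse (R t) * - (\<omega> t * R t)) = \<omega> t" using Rnz[OF t] by (simp add: field_simps)
      with * show ?thesis by (simp only:)
    qed
    have "(\<omega> has_integral (- ln (R t) - - ln (R 0))) {0..t}"
      using t by (intro fundamental_theorem_of_calculus)
        (auto simp: has_real_derivative_iff_has_vector_derivative[symmetric] intro: DERIV_subset[OF dln])
    moreover have "R 0 = 1" by (simp add: R_def v1 v2)
    ultimately have "integral {0..t} \<omega> = - ln (R t)" by (simp add: integral_unique)
    moreover have "W0 (abs_L2 f) t = integral {0..t} \<omega>"
      unfolding W0_def using t by (intro Henstock_Kurzweil_Integration.integral_cong W1) auto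
    ultimately show ?thesis by simp
  qed
  have "potential (abs_L2 f) = abs_L2 (rep_L2 q)"
    unfolding potential_def
  proof (subst abs_L2_eq_iff[OF square_integrable_potential square_integrable_rep])
    have "AE t in L2_measure. t \<in> ?I" by (rule AE_I2) (simp add: space_restrict_space)
    with rep_abs_L2[OF f] show "AE t in L2_measure. potential_fun (abs_L2 f) t = rep_L2 q t"
    proof eventually_elim
      case (elim t)
      have exp_W0: "exp (2 * W0 (abs_L2 f) t) = 1 / (R t)\<^sup>2"
      proof -
        have "exp (2 * W0 (abs_L2 f) t) = exp (- ln (R t)) * exp (- ln (R t))"
          unfolding W0[OF elim(2)] by (simp add: exp_add[symmetric])
        also have "exp (- ln (R t)) = inverse (R t)" using Rpos[OF elim(2)] by (simp add: exp_minus)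
        finally show ?thesis by (simp add: power2_eq_square divide_inverse)
      qed
      show ?case unfolding potential_fun_def elim(1) W1[OF elim(2)] exp_W0
        by (simp add: f_def diff_divide_distrib add_divide_distrib)
    qed
  qed
  then have "q = potential (abs_L2 f)" by (simp add: abs_rep_L2)
  then show "\<exists>u. q = potential u" by blast
qed

section \<open>Smoothness and derivative of the parametrization\<close>

lemma W1_add: "t \<in> {0..2 * pi} \<Longrightarrow> W1 (u + v) t = W1 u t + W1 v t"
  by (simp add: W1_inner inner_add_left)

lemma W1_scaleR: "t \<in> {0..2 * pi} \<Longrightarrow> W1 (c *\<^sub>R u) t = c * W1 u t"
  by (simp add: W1_inner)

lemma W0_add: "t \<in> {0..2 * pi} \<Longrightarrow> W0 (u + v) t = W0 u t + W0 v t"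
  by (simp add: W0_inner inner_add_left)

lemma W0_scaleR: "t \<in> {0..2 * pi} \<Longrightarrow> W0 (c *\<^sub>R u) t = c * W0 u t"
  by (simp add: W0_inner)

lemma W1_bound:
  assumes t: "t \<in> {0..2 * pi}"
  shows "\<bar>W1 u t\<bar> \<le> sqrt (2 * pi) * norm u"
proof -
  have "\<bar>W1 u t\<bar> \<le> norm u * norm (ind_L2 t)" unfolding W1_inner[OF t] by (rule Cauchy_Schwarz_ineq2)
  also have "\<dots> \<le> norm u * (sqrt (2 * pi) * 1)"
    unfolding ind_L2_def
    by (rule mult_left_mono[OF norm_abs_L2_bounded[OF square_integrable_indicator]]) (simp_all add: indicator_def)
  finally show ?thesis by (simp add: mult.commute)
qed

lemma W0_bound:
  assumes t: "t \<in> {0..2 * pi}"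
  shows "\<bar>W0 u t\<bar> \<le> 2 * pi * sqrt (2 * pi) * norm u"
proof -
  have "\<bar>W0 u t\<bar> \<le> norm u * norm (ramp_L2 t)" unfolding W0_inner[OF t] by (rule Cauchy_Schwarz_ineq2)
  also have "\<dots> \<le> norm u * (sqrt (2 * pi) * (2 * pi))"
    unfolding ramp_L2_def
    by (rule mult_left_mono[OF norm_abs_L2_bounded[OF square_integrable_ramp]]) (use t in \<open>auto simp: indicator_def\<close>)
  finally show ?thesis by (simp add: mult_ac)
qed

text \<open>The derivative of order \<open>k\<close> of the exponential of \<open>W0 u\<close>: as
  \<open>W0\<close> is linear, each differentiation only contributes one more factor
  \<open>W0 h\<close>.\<close>

definition exp_form :: "nat \<Rightarrow> L2 \<Rightarrow> (nat \<Rightarrow> L2) \<Rightarrow> L2" where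
  "exp_form k u \<eta> = abs_L2 (\<lambda>t. exp (W0 u t) * (\<Prod>i<k. W0 (\<eta> i) t))"

lemma continuous_on_exp_form:
  "continuous_on {0..2 * pi} (\<lambda>t. exp (W0 u t) * (\<Prod>i<k. W0 (\<eta> i) t))"
  by (intro continuous_intros continuous_on_W0)

lemma exp_remainder:
  fixes x :: real
  assumes "\<bar>x\<bar> \<le> B"
  shows "\<bar>exp x - 1 - x\<bar> \<le> exp B * x\<^sup>2"
proof -
  have "\<exists>z. \<bar>z\<bar> \<le> \<bar>x\<bar> \<and> exp x = (\<Sum>m<2. x ^ m / fact m) + exp z / fact 2 * x ^ 2"
    by (rule Maclaurin_exp_le)
  then obtain z where z: "\<bar>z\<bar> \<le> \<bar>x\<bar>" "exp x = (\<Sum>m<2. x ^ m / fact m) + exp z / fact 2 * x ^ 2" by blast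
  have "exp x - 1 - x = exp z / 2 * x\<^sup>2" using z(2) by (simp add: numeral_2_eq_2)
  then have "\<bar>exp x - 1 - x\<bar> = \<bar>exp z / 2 * x\<^sup>2\<bar>" by (rule arg_cong)
  also have "\<dots> = exp z / 2 * x\<^sup>2" by (simp add: abs_mult)
  also have "\<dots> \<le> exp B * x\<^sup>2"
  proof (rule mult_right_mono)
    have "exp z \<le> exp B" using z(1) assms by simp
    then show "exp z / 2 \<le> exp B" using exp_gt_zero[of z] by linarith
  qed simp
  finally show ?thesis .
qed

lemma exp_form_locally_bounded: "locally_bounded_form (exp_form k)"
proof (rule locally_bounded_formI)
  fix x :: L2 and M :: real
  define c where "c = 2 * pi * sqrt (2 * pi)"
  have c: "c > 0" by (simp add: c_def)
  define K where "K = exp (c * (norm x + 1)) * (c * M) ^ k"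
  show "\<exists>r>0. \<exists>K. \<forall>y \<eta>. norm (y - x) < r \<longrightarrow> (\<forall>i. norm (\<eta> i) \<le> M) \<longrightarrow> norm (exp_form k y \<eta>) \<le> K"
  proof (rule exI[of _ "1::real"], intro conjI exI[of _ "sqrt (2 * pi) * K"] allI impI)
    fix y and \<eta> :: "nat \<Rightarrow> L2" assume y: "norm (y - x) < 1" and \<eta>: "\<forall>i. norm (\<eta> i) \<le> M"
    show "norm (exp_form k y \<eta>) \<le> sqrt (2 * pi) * K"
      unfolding exp_form_def
    proof (rule norm_abs_L2_bounded[OF square_integrable_continuous[OF continuous_on_exp_form]])
      fix t :: real assume t: "t \<in> {0..2 * pi}"
      have "norm y \<le> norm x + 1" using norm_triangle_sub[of y x] y by linarith
      then have "c * norm y \<le> c * (norm x + 1)" using c by (intro mult_left_mono) auto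
      moreover have "\<bar>W0 y t\<bar> \<le> c * norm y" unfolding c_def by (rule W0_bound[OF t])
      ultimately have "W0 y t \<le> c * (norm x + 1)" by linarith
      then have 1: "exp (W0 y t) \<le> exp (c * (norm x + 1))" by simp
      have 2: "(\<Prod>i<k. \<bar>W0 (\<eta> i) t\<bar>) \<le> (\<Prod>i<k. c * M)"
      proof (rule prod_mono, rule conjI)
        fix i
        have "\<bar>W0 (\<eta> i) t\<bar> \<le> c * norm (\<eta> i)" unfolding c_def by (rule W0_bound[OF t])
        also have "\<dots> \<le> c * M" using \<eta> c by (intro mult_left_mono) auto
        finally show "\<bar>W0 (\<eta> i) t\<bar> \<le> c * M" .
      qed simp
      have "\<bar>exp (W0 y t) * (\<Prod>i<k. W0 (\<eta> i) t)\<bar> = exp (W0 y t) * (\<Prod>i<k. \<bar>W0 (\<eta> i) t\<bar>)"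
        by (simp add: abs_mult abs_prod)
      also have "\<dots> \<le> exp (c * (norm x + 1)) * (\<Prod>i<k. c * M)"
        by (rule mult_mono[OF 1 2]) (auto intro: prod_nonneg)
      finally show "\<bar>exp (W0 y t) * (\<Prod>i<k. W0 (\<eta> i) t)\<bar> \<le> K" by (simp add: K_def)
    qed
  qed simp
qed

lemma exp_form_derivative: "form_derivative (exp_form k) (exp_form (Suc k))"
  unfolding form_derivative_def
proof (intro allI)
  fix x h :: L2 and \<eta> :: "nat \<Rightarrow> L2"
  define P where "P = (\<lambda>t. \<Prod>i<k. W0 (\<eta> i) t)"
  have Pc: "continuous_on {0..2 * pi} P" unfolding P_def by (intro continuous_intros continuous_on_W0)
  define g where "g = (\<lambda>s t. exp (W0 (x + s *\<^sub>R h) t) * P t)"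
  have gc: "square_integrable (g s)" for s
    unfolding g_def by (intro square_integrable_continuous continuous_intros continuous_on_W0 Pc)
  define d where "d = (\<lambda>t. W0 h t * (exp (W0 x t) * P t))"
  have dc: "square_integrable d"
    unfolding d_def by (intro square_integrable_continuous continuous_intros continuous_on_W0 Pc)
  have ef: "exp_form k (x + s *\<^sub>R h) \<eta> = abs_L2 (g s)" for s by (simp add: exp_form_def g_def P_def)
  have ed: "exp_form (Suc k) x (case_nat h \<eta>) = abs_L2 d"
    unfolding exp_form_def d_def P_def by (simp add: prod.lessThan_Suc_shift mult_ac del: prod.lessThan_Suc)
  define c where "c = 2 * pi * sqrt (2 * pi)"
  define B where "B = c * norm h"
  have "bounded ((\<lambda>t. exp (W0 x t) * P t) ` {0..2 * pi})"
    by (intro compact_imp_bounded compact_continuous_image continuous_intros continuous_on_W0 Pc) simp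
  then obtain Q where Q: "\<forall>t\<in>{0..2 * pi}. \<bar>exp (W0 x t) * P t\<bar> \<le> Q" unfolding bounded_iff by auto
  have "((\<lambda>s. abs_L2 (g s)) has_vector_derivative abs_L2 d) (at 0)"
  proof (rule has_vector_derivative_quadratic[where d = 1 and L = "sqrt (2 * pi) * (exp B * B\<^sup>2 * Q)"])
    fix s :: real assume s: "\<bar>s\<bar> < 1"
    define r where "r = (\<lambda>t. (g s t - g 0 t) - s * d t)"
    have rc: "square_integrable r"
      unfolding r_def by (intro square_integrable_diff square_integrable_scale gc dc)
    have "abs_L2 (g s) - abs_L2 (g 0) - s *\<^sub>R abs_L2 d = abs_L2 r"
      unfolding r_def by (simp add: abs_L2_diff abs_L2_scaleR gc dc square_integrable_diff square_integrable_scale)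
    moreover have "norm (abs_L2 r) \<le> sqrt (2 * pi) * (exp B * (B\<^sup>2 * s\<^sup>2) * Q)"
    proof (rule norm_abs_L2_bounded[OF rc])
      fix t :: real assume t: "t \<in> {0..2 * pi}"
      define y where "y = s * W0 h t"
      have hB: "\<bar>W0 h t\<bar> \<le> B" unfolding B_def c_def by (rule W0_bound[OF t])
      have "\<bar>y\<bar> \<le> \<bar>s\<bar> * B" unfolding y_def abs_mult using hB by (intro mult_left_mono) auto
      also have "\<dots> \<le> 1 * B" using s hB by (intro mult_right_mono) auto
      finally have yB: "\<bar>y\<bar> \<le> B" by simp
      \<comment> \<open>By additivity of \<open>W0\<close> the remainder factors through that of the
        exponential at \<open>y = s * W0 h t\<close>, so it is quadratic in \<open>s\<close>
        uniformly in \<open>t\<close>.\<close>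
      have "r t = (exp y - 1 - y) * (exp (W0 x t) * P t)"
        unfolding r_def g_def d_def y_def using t by (simp add: W0_add W0_scaleR exp_add algebra_simps)
      then have "\<bar>r t\<bar> = \<bar>exp y - 1 - y\<bar> * \<bar>exp (W0 x t) * P t\<bar>" by (simp only: abs_mult)
      also have "\<dots> \<le> exp B * (B\<^sup>2 * s\<^sup>2) * Q"
      proof (rule mult_mono)
        have "\<bar>exp y - 1 - y\<bar> \<le> exp B * y\<^sup>2" by (rule exp_remainder[OF yB])
        also have "\<dots> \<le> exp B * (B\<^sup>2 * s\<^sup>2)"
        proof (rule mult_left_mono)
          have "(W0 h t)\<^sup>2 \<le> B\<^sup>2" using power_mono[OF hB, of 2] by simp
          then show "y\<^sup>2 \<le> B\<^sup>2 * s\<^sup>2" unfolding y_def power_mult_distrib mult.commute[of "B\<^sup>2"] by (rule mult_left_mono) simp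
        qed simp
        finally show "\<bar>exp y - 1 - y\<bar> \<le> exp B * (B\<^sup>2 * s\<^sup>2)" .
      qed (use Q t in auto)
      finally show "\<bar>r t\<bar> \<le> exp B * (B\<^sup>2 * s\<^sup>2) * Q" .
    qed
    ultimately show "norm (abs_L2 (g s) - abs_L2 (g 0) - s *\<^sub>R abs_L2 d) \<le> sqrt (2 * pi) * (exp B * B\<^sup>2 * Q) * s\<^sup>2"
      by (simp add: mult_ac)
  qed simp
  then show "((\<lambda>s. exp_form k (x + s *\<^sub>R h) \<eta>) has_vector_derivative exp_form (Suc k) x (case_nat h \<eta>)) (at 0)"
    unfolding ef ed .
qed

lemma Cn_exp_form: "Cn n (exp_form k)"
proof (induction n arbitrary: k)
  case 0
  then show ?case using exp_form_locally_bounded by simp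
next
  case (Suc n)
  from Cn_SucI[OF exp_form_locally_bounded exp_form_derivative Suc] show ?case .
qed

definition exp_L2 :: "L2 \<Rightarrow> L2" where
  "exp_L2 u = abs_L2 (\<lambda>t. exp (W0 u t))"

lemma exp_L2_eq_form: "exp_L2 u = exp_form 0 u \<eta>" by (simp add: exp_L2_def exp_form_def)

lemma smooth_exp_L2: "smooth exp_L2"
proof (rule Cn_imp_smooth)
  fix n
  have "(\<lambda>x \<eta>. exp_L2 x) = exp_form 0" by (auto simp: exp_L2_eq_form[symmetric] fun_eq_iff)
  then show "Cn n (\<lambda>x (\<eta> :: nat \<Rightarrow> L2). exp_L2 x)" using Cn_exp_form[of n 0] by simp
qed

text \<open>Smoothness already provides a Frechet derivative; derivatives along lines only have to
  identify it.\<close>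

lemma smooth_derivative_from_line:
  assumes "smooth f" and line: "\<And>h. ((\<lambda>s. f (x + s *\<^sub>R h)) has_vector_derivative d h) (at 0)"
  shows "(f has_derivative d) (at x)"
proof -
  obtain f' where f': "(f has_derivative f') (at x)"
    using smooth_imp_differentiable[OF assms(1)] unfolding differentiable_def by blast
  have "f' h = d h" for h
  proof -
    have "((\<lambda>s. x + s *\<^sub>R h) has_derivative (\<lambda>s. s *\<^sub>R h)) (at 0)"
      by (auto intro!: derivative_eq_intros)
    from has_derivative_compose[OF this, of f f'] f'
    have "((\<lambda>s. f (x + s *\<^sub>R h)) has_derivative (\<lambda>s. f' (s *\<^sub>R h))) (at 0)" by simp
    then have "((\<lambda>s. f (x + s *\<^sub>R h)) has_vector_derivative f' h) (at 0)"
      using has_derivative_bounded_linear[OF f']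
      by (simp add: has_vector_derivative_def linear_scale bounded_linear.linear)
    then show ?thesis using line by (rule vector_derivative_unique_at)
  qed
  then have "f' = d" by (rule ext)
  with f' show ?thesis by simp
qed

lemma exp_L2_has_derivative:
  "(exp_L2 has_derivative (\<lambda>h. abs_L2 (\<lambda>t. exp (W0 u t) * W0 h t))) (at u)"
proof (rule smooth_derivative_from_line[OF smooth_exp_L2])
  fix h
  have "((\<lambda>s. exp_form 0 (u + s *\<^sub>R h) (\<lambda>_. 0)) has_vector_derivative exp_form 1 u (case_nat h (\<lambda>_. 0))) (at 0)"
    using exp_form_derivative[of 0] unfolding form_derivative_def by simp
  then show "((\<lambda>s. exp_L2 (u + s *\<^sub>R h)) has_vector_derivative abs_L2 (\<lambda>t. exp (W0 u t) * W0 h t)) (at 0)"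
    by (simp add: exp_form_def exp_L2_def)
qed

definition W1_mult :: "L2 \<Rightarrow> L2 \<Rightarrow> L2" where
  "W1_mult u v = abs_L2 (\<lambda>t. W1 u t * W1 v t)"

lemma continuous_on_W1_mult: "continuous_on {0..2 * pi} (\<lambda>t. W1 u t * W1 v t)"
  by (intro continuous_intros continuous_on_W1)

lemma bounded_bilinear_W1_mult: "bounded_bilinear W1_mult"
proof
  note sq = square_integrable_continuous[OF continuous_on_W1_mult]
  show "W1_mult (a + a') b = W1_mult a b + W1_mult a' b" for a a' b
    unfolding W1_mult_def abs_L2_add[OF sq sq]
    by (intro abs_L2_cong sq square_integrable_add) (simp add: W1_add algebra_simps)
  show "W1_mult a (b + b') = W1_mult a b + W1_mult a b'" for a b b'
    unfolding W1_mult_def abs_L2_add[OF sq sq]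
    by (intro abs_L2_cong sq square_integrable_add) (simp add: W1_add algebra_simps)
  show "W1_mult (r *\<^sub>R a) b = r *\<^sub>R W1_mult a b" for r a b
    unfolding W1_mult_def abs_L2_scaleR[OF sq]
    by (intro abs_L2_cong sq square_integrable_scale) (simp add: W1_scaleR)
  show "W1_mult a (r *\<^sub>R b) = r *\<^sub>R W1_mult a b" for r a b
    unfolding W1_mult_def abs_L2_scaleR[OF sq]
    by (intro abs_L2_cong sq square_integrable_scale) (simp add: W1_scaleR)
  show "\<exists>K. \<forall>a b. norm (W1_mult a b) \<le> norm a * norm b * K"
  proof (rule exI[of _ "sqrt (2 * pi) * (sqrt (2 * pi) * sqrt (2 * pi))"], intro allI)
    fix a b
    have "norm (W1_mult a b) \<le> sqrt (2 * pi) * ((sqrt (2 * pi) * norm a) * (sqrt (2 * pi) * norm b))"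
      unfolding W1_mult_def
    proof (rule norm_abs_L2_bounded[OF sq])
      fix t :: real assume t: "t \<in> {0..2 * pi}"
      show "\<bar>W1 a t * W1 b t\<bar> \<le> (sqrt (2 * pi) * norm a) * (sqrt (2 * pi) * norm b)"
        unfolding abs_mult by (rule mult_mono[OF W1_bound[OF t] W1_bound[OF t]]) auto
    qed
    then show "norm (W1_mult a b) \<le> norm a * norm b * (sqrt (2 * pi) * (sqrt (2 * pi) * sqrt (2 * pi)))"
      by (simp only: mult_ac)
  qed
qed

lemma potential_eq: "potential u = - (1 / 2) *\<^sub>R u + ((1 / 4) *\<^sub>R W1_mult u u - exp_L2 (2 *\<^sub>R u))"
proof -
  have sqe: "square_integrable (\<lambda>t. exp (W0 (2 *\<^sub>R u) t))"
    by (intro square_integrable_continuous continuous_intros continuous_on_W0)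
  note sqw = square_integrable_continuous[OF continuous_on_W1_mult[of u u]]
  have "(1 / 4) *\<^sub>R W1_mult u u - exp_L2 (2 *\<^sub>R u) = abs_L2 (\<lambda>t. 1 / 4 * (W1 u t * W1 u t) - exp (W0 (2 *\<^sub>R u) t))"
    unfolding W1_mult_def exp_L2_def by (simp only: abs_L2_scaleR abs_L2_diff sqe sqw square_integrable_scale)
  also have "\<dots> = abs_L2 (\<lambda>t. (W1 u t)\<^sup>2 / 4 - exp (2 * W0 u t))"
    by (intro abs_L2_cong square_integrable_diff square_integrable_scale sqw sqe
        square_integrable_continuous[OF continuous_on_potential_part]) (simp add: W0_scaleR power2_eq_square)
  finally have 1: "(1 / 4) *\<^sub>R W1_mult u u - exp_L2 (2 *\<^sub>R u) = abs_L2 (\<lambda>t. (W1 u t)\<^sup>2 / 4 - exp (2 * W0 u t))" .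
  have "- (1 / 2) *\<^sub>R u = abs_L2 (\<lambda>t. - (1 / 2) * rep_L2 u t)"
    using abs_L2_scaleR[OF square_integrable_rep, of "- (1 / 2)" u] by (simp only: abs_rep_L2)
  then show ?thesis
    unfolding 1 potential_def potential_fun_def[abs_def]
    by (simp only: abs_L2_add square_integrable_scale square_integrable_rep
        square_integrable_continuous[OF continuous_on_potential_part])
qed

lemma smooth_potential: "smooth potential"
proof -
  have "smooth (\<lambda>u. - (1 / 2) *\<^sub>R u + ((1 / 4) *\<^sub>R W1_mult u u - exp_L2 (2 *\<^sub>R u)))"
    by (intro smooth_add smooth_diff smooth_scaleR smooth_const smooth_ident
        smooth_bilinear[OF bounded_bilinear_W1_mult] smooth_compose[OF smooth_exp_L2])
  then show ?thesis by (simp add: potential_eq[abs_def])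
qed

text \<open>Differentiating \<open>potential\<close> in direction \<open>h\<close> gives
  \<open>- h / 2 + W1 u * W1 h / 2 - 2 * exp (2 * W0 u) * W0 h\<close>. Pulling out
  \<open>- 1 / 2\<close> leaves \<open>h\<close> minus the pairing of \<open>h\<close> with this
  kernel.\<close>

definition potential_kernel :: "L2 \<Rightarrow> real \<Rightarrow> L2" where
  "potential_kernel u t = W1 u t *\<^sub>R ind_L2 t - (4 * exp (2 * W0 u t)) *\<^sub>R ramp_L2 t"

lemma continuous_on_ind_L2: "continuous_on {0..2 * pi} ind_L2"
proof -
  have *: "norm (ind_L2 t - ind_L2 s) \<le> sqrt \<bar>t - s\<bar>" if st: "s \<in> {0..2 * pi}" "t \<in> {0..2 * pi}" "s \<le> t" for s t
  proof -
    have ip: "ind_L2 a \<bullet> ind_L2 b = a" if "a \<in> {0..2 * pi}" "b \<in> {0..2 * pi}" "a \<le> b" for a b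
    proof -
      have "ind_L2 b \<bullet> ind_L2 a = integral {0..a} (indicat_real {0..b})"
        unfolding ind_L2_def using that by (intro inner_abs_L2_indicator square_integrable_indicator) auto
      also have "\<dots> = integral {0..a} (\<lambda>t. 1)"
        using that by (intro Henstock_Kurzweil_Integration.integral_cong) auto
      finally show ?thesis using that by (simp add: inner_commute)
    qed
    have "(norm (ind_L2 t - ind_L2 s))\<^sup>2 = t - s"
      using ip[of s t] ip[of s s] ip[of t t] st
      by (simp add: power2_norm_eq_inner inner_diff_left inner_diff_right inner_commute)
    then show ?thesis using st by (metis abs_of_nonneg diff_ge_0_iff_ge eq_refl norm_ge_zero real_sqrt_unique)
  qed
  have **: "norm (ind_L2 t - ind_L2 s) \<le> sqrt \<bar>t - s\<bar>" if "s \<in> {0..2 * pi}" "t \<in> {0..2 * pi}" for s t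
    using *[of s t] *[of t s] that by (cases "s \<le> t") (auto simp: norm_minus_commute abs_minus_commute)
  show ?thesis
    unfolding continuous_on_def
  proof
    fix s :: real assume s: "s \<in> {0..2 * pi}"
    have "((\<lambda>t. ind_L2 t - ind_L2 s) \<longlongrightarrow> 0) (at s within {0..2 * pi})"
    proof (rule Lim_null_comparison)
      show "\<forall>\<^sub>F t in at s within {0..2 * pi}. norm (ind_L2 t - ind_L2 s) \<le> sqrt \<bar>t - s\<bar>"
        unfolding eventually_at using ** s by (intro exI[of _ 1]) simp
      have "((\<lambda>t. sqrt \<bar>t - s\<bar>) \<longlongrightarrow> sqrt \<bar>s - s\<bar>) (at s within {0..2 * pi})" by (intro tendsto_intros)
      then show "((\<lambda>t. sqrt \<bar>t - s\<bar>) \<longlongrightarrow> 0) (at s within {0..2 * pi})" by simp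
    qed
    then show "(ind_L2 \<longlongrightarrow> ind_L2 s) (at s within {0..2 * pi})" by (simp add: LIM_zero_iff)
  qed
qed

lemma continuous_on_ramp_L2: "continuous_on {0..2 * pi} ramp_L2"
proof -
  have **: "norm (ramp_L2 t - ramp_L2 s) \<le> sqrt (2 * pi) * \<bar>t - s\<bar>" if "s \<in> {0..2 * pi}" "t \<in> {0..2 * pi}" for s t
    unfolding ramp_L2_def abs_L2_diff[OF square_integrable_ramp square_integrable_ramp]
    by (rule norm_abs_L2_bounded[OF square_integrable_diff[OF square_integrable_ramp square_integrable_ramp]])
       (auto simp: indicator_def abs_if)
  show ?thesis
    unfolding continuous_on_def
  proof
    fix s :: real assume s: "s \<in> {0..2 * pi}"
    have "((\<lambda>t. ramp_L2 t - ramp_L2 s) \<longlongrightarrow> 0) (at s within {0..2 * pi})"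
    proof (rule Lim_null_comparison)
      show "\<forall>\<^sub>F t in at s within {0..2 * pi}. norm (ramp_L2 t - ramp_L2 s) \<le> sqrt (2 * pi) * \<bar>t - s\<bar>"
        unfolding eventually_at using ** s by (intro exI[of _ 1]) simp
      have "((\<lambda>t. sqrt (2 * pi) * \<bar>t - s\<bar>) \<longlongrightarrow> sqrt (2 * pi) * \<bar>s - s\<bar>) (at s within {0..2 * pi})" by (intro tendsto_intros)
      then show "((\<lambda>t. sqrt (2 * pi) * \<bar>t - s\<bar>) \<longlongrightarrow> 0) (at s within {0..2 * pi})" by simp
    qed
    then show "(ramp_L2 \<longlongrightarrow> ramp_L2 s) (at s within {0..2 * pi})" by (simp add: LIM_zero_iff)
  qed
qed

lemma continuous_on_potential_kernel: "continuous_on {0..2 * pi} (potential_kernel u)"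
  unfolding potential_kernel_def
  by (intro continuous_intros continuous_on_W1 continuous_on_W0 continuous_on_ind_L2 continuous_on_ramp_L2)

lemma potential_has_derivative:
  "(potential has_derivative (\<lambda>h. - (1 / 2) *\<^sub>R (h - volterra (potential_kernel u) h))) (at u)"
proof -
  note sqw = square_integrable_continuous[OF continuous_on_W1_mult]
  have d1: "((\<lambda>u. W1_mult u u) has_derivative (\<lambda>h. W1_mult u h + W1_mult h u)) (at u)"
    using bounded_bilinear.FDERIV[OF bounded_bilinear_W1_mult has_derivative_ident has_derivative_ident] by simp
  have d2: "((\<lambda>u. exp_L2 (2 *\<^sub>R u)) has_derivative (\<lambda>h. abs_L2 (\<lambda>t. exp (W0 (2 *\<^sub>R u) t) * W0 (2 *\<^sub>R h) t))) (at u)"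
    using has_derivative_compose[OF has_derivative_scaleR_right[OF has_derivative_ident] exp_L2_has_derivative] by simp
  have "((\<lambda>u. - (1 / 2) *\<^sub>R u + ((1 / 4) *\<^sub>R W1_mult u u - exp_L2 (2 *\<^sub>R u))) has_derivative
     (\<lambda>h. - (1 / 2) *\<^sub>R h + ((1 / 4) *\<^sub>R (W1_mult u h + W1_mult h u) - abs_L2 (\<lambda>t. exp (W0 (2 *\<^sub>R u) t) * W0 (2 *\<^sub>R h) t)))) (at u)"
    by (intro has_derivative_add has_derivative_diff has_derivative_scaleR_right has_derivative_ident d1 d2)
  moreover have "- (1 / 2) *\<^sub>R h + ((1 / 4) *\<^sub>R (W1_mult u h + W1_mult h u) - abs_L2 (\<lambda>t. exp (W0 (2 *\<^sub>R u) t) * W0 (2 *\<^sub>R h) t))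
      = - (1 / 2) *\<^sub>R (h - volterra (potential_kernel u) h)" for h
  proof -
    have sqe: "square_integrable (\<lambda>t. exp (W0 (2 *\<^sub>R u) t) * W0 (2 *\<^sub>R h) t)"
      by (intro square_integrable_continuous continuous_intros continuous_on_W0)
    have sqk: "square_integrable (\<lambda>t. h \<bullet> potential_kernel u t)"
      by (rule square_integrable_inner[OF continuous_on_potential_kernel])
    have "W1_mult h u = W1_mult u h" by (simp add: W1_mult_def mult.commute)
    then have "(1 / 4) *\<^sub>R (W1_mult u h + W1_mult h u) = (1 / 2) *\<^sub>R W1_mult u h" by (simp add: scaleR_2[symmetric])
    then have "(1 / 4) *\<^sub>R (W1_mult u h + W1_mult h u) - abs_L2 (\<lambda>t. exp (W0 (2 *\<^sub>R u) t) * W0 (2 *\<^sub>R h) t)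
       = abs_L2 (\<lambda>t. 1 / 2 * (W1 u t * W1 h t) - exp (W0 (2 *\<^sub>R u) t) * W0 (2 *\<^sub>R h) t)"
      unfolding W1_mult_def by (simp only: abs_L2_scaleR abs_L2_diff sqe sqw square_integrable_scale)
    also have "\<dots> = abs_L2 (\<lambda>t. 1 / 2 * (h \<bullet> potential_kernel u t))"
      by (intro abs_L2_cong square_integrable_diff square_integrable_scale sqw sqe sqk)
         (simp add: potential_kernel_def W0_scaleR inner_diff_right W1_inner[symmetric] W0_inner[symmetric] algebra_simps)
    also have "\<dots> = (1 / 2) *\<^sub>R volterra (potential_kernel u) h"
      unfolding volterra_def by (simp only: abs_L2_scaleR sqk)
    finally show ?thesis by (simp add: algebra_simps)
  qed
  ultimately show ?thesis by (simp add: potential_eq[abs_def])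
qed

text \<open>Since \<open>ind_L2 t\<close> and \<open>ramp_L2 t\<close> live on
  \<open>{0..t}\<close>, the derivative is a multiple of the identity minus a Volterra operator, and
  is therefore invertible at every \<open>u\<close>.\<close>

lemma diffeomorphism_potential: "diffeomorphism potential"
proof -
  have bij: "bij potential" by (simp add: bij_def inj_potential surj_potential)
  have "smooth (inv potential)"
  proof (rule smooth_inv[OF smooth_potential bij potential_has_derivative])
    fix u
    have "\<exists>k. square_integrable k \<and> potential_kernel u t = abs_L2 (\<lambda>s. indicator {0..t} s * k s)" if t: "t \<in> {0..2 * pi}" for t
    proof (intro exI conjI)
      define k where "k = (\<lambda>s. W1 u t - (4 * exp (2 * W0 u t)) * (t - s))"
      show sk: "square_integrable k" unfolding k_def by (intro square_integrable_continuous continuous_intros)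
      have "potential_kernel u t = abs_L2 (\<lambda>s. W1 u t * indicator {0..t} s - (4 * exp (2 * W0 u t)) * (indicator {0..t} s * (t - s)))"
        unfolding potential_kernel_def ind_L2_def ramp_L2_def
        by (simp only: abs_L2_scaleR abs_L2_diff square_integrable_indicator square_integrable_ramp square_integrable_scale)
      also have "\<dots> = abs_L2 (\<lambda>s. indicator {0..t} s * k s)"
        by (intro abs_L2_cong square_integrable_diff square_integrable_scale square_integrable_indicator square_integrable_ramp
            square_integrable_cut sk) (simp add: k_def indicator_def)
      finally show "potential_kernel u t = abs_L2 (\<lambda>s. indicator {0..t} s * k s)" .
    qed
    from volterra_invertible[OF continuous_on_potential_kernel this]
    obtain A where A: "bounded_linear A" "\<And>h. A (h - volterra (potential_kernel u) h) = h"
      "\<And>k. A k - volterra (potential_kernel u) (A k) = k" by blast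
    have lin: "A (c *\<^sub>R x) = c *\<^sub>R A x" for c x
      using A(1) by (simp add: linear_scale bounded_linear.linear)
    show "\<exists>B. bounded_linear B \<and> (\<forall>h. B (- (1 / 2) *\<^sub>R (h - volterra (potential_kernel u) h)) = h) \<and>
        (\<forall>k. - (1 / 2) *\<^sub>R (B k - volterra (potential_kernel u) (B k)) = k)"
    proof (rule exI[of _ "\<lambda>k. A (- 2 *\<^sub>R k)"], intro conjI allI)
      show "bounded_linear (\<lambda>k. A (- 2 *\<^sub>R k))"
        by (rule bounded_linear_compose[OF A(1) bounded_linear_scaleR_right])
      show "A (- 2 *\<^sub>R (- (1 / 2) *\<^sub>R (h - volterra (potential_kernel u) h))) = h" for h by (simp add: A)
      show "- (1 / 2) *\<^sub>R (A (- 2 *\<^sub>R k) - volterra (potential_kernel u) (A (- 2 *\<^sub>R k))) = k" for k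
        unfolding A(3) by simp
    qed
  qed
  with bij smooth_potential show ?thesis by (simp add: diffeomorphism_def)
qed

section \<open>Straightening the cones\<close>

lemma real_surj_IVT:
  fixes f :: "real \<Rightarrow> real"
  assumes "\<And>s. isCont f s" "f a \<le> y" "y \<le> f b"
  shows "\<exists>s. f s = y"
proof (cases "a \<le> b")
  case True
  then show ?thesis using IVT[of f a y b] assms by blast
next
  case False
  then show ?thesis using IVT2[of f a y b] assms by fastforce
qed

lemma smooth_Pair_real:
  fixes f g :: "'a::real_normed_vector \<Rightarrow> real"
  assumes "smooth f" "smooth g"
  shows "smooth (\<lambda>x. (f x, g x))"
proof -
  have "smooth (\<lambda>x. f x *\<^sub>R (1 :: real, 0 :: real) + g x *\<^sub>R (0, 1))"
    by (rule smooth_add[OF smooth_scaleR[OF assms(1) smooth_const] smooth_scaleR[OF assms(2) smooth_const]])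
  then show ?thesis by simp
qed

text \<open>\<open>flat 0\<close> is bounded by 1; the factor \<open>r\<close> makes the function
  unbounded, which the surjectivity of the shears relies on.\<close>

definition flat_ramp :: "real \<Rightarrow> real" where
  "flat_ramp r = r * flat 0 r"

lemma smooth_flat_ramp: "smooth f \<Longrightarrow> smooth (\<lambda>x. flat_ramp (f x))"
  unfolding flat_ramp_def by (rule smooth_mult[OF _ smooth_compose[OF smooth_flat]])

lemma flat_ramp_derivative: "(flat_ramp has_real_derivative flat 0 r + r * flat 2 r) (at r)"
  using DERIV_mult[OF DERIV_ident flat_derivative[of 0 r]]
  unfolding flat_ramp_def[abs_def] by (simp add: algebra_simps numeral_2_eq_2)

lemma flat_ramp_derivative_nonneg: "0 \<le> flat 0 r + r * flat 2 r"
  by (cases "r > 0") (auto simp: flat_def)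

lemma flat_ramp_mono: "a \<le> b \<Longrightarrow> flat_ramp a \<le> flat_ramp b"
  by (rule DERIV_nonneg_imp_nondecreasing) (use flat_ramp_derivative flat_ramp_derivative_nonneg in blast)+

lemma flat_ramp_eq_0: "r \<le> 0 \<Longrightarrow> flat_ramp r = 0"
  by (simp add: flat_ramp_def flat_def)

lemma flat_ramp_pos: "r > 0 \<Longrightarrow> flat_ramp r > 0"
  by (simp add: flat_ramp_def flat_def)

lemma flat_ramp_nonneg: "0 \<le> flat_ramp r"
  using flat_ramp_eq_0[of r] flat_ramp_pos[of r] by (cases "r > 0") auto

lemma flat_ramp_unbounded: "\<exists>r\<ge>1. c \<le> flat_ramp r"
proof (intro exI[of _ "max 1 (c * exp 1)"] conjI)
  let ?r = "max 1 (c * exp 1)"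
  have "exp (- 1) \<le> exp (- inverse ?r)" by (simp add: inverse_le_1_iff)
  then have "?r * exp (- 1) \<le> flat_ramp ?r"
    unfolding flat_ramp_def flat_def by (simp add: mult_left_mono)
  moreover have "c \<le> ?r * exp (- 1)"
  proof -
    have "(c * exp 1) * exp (- 1) \<le> ?r * exp (- 1)" by (intro mult_right_mono) auto
    then show ?thesis by (simp add: exp_minus mult.assoc)
  qed
  ultimately show "c \<le> flat_ramp ?r" by simp
qed simp

definition amp :: "real \<Rightarrow> real" where "amp x = sqrt (1 + x\<^sup>2)"

text \<open>The polar angle of the point \<open>(amp x, y)\<close>, called \<delta> in the overview;
  \<open>amp x \<ge> 1\<close> makes it a smooth function of \<open>x\<close> and
  \<open>y\<close>.\<close>

definition tilt :: "real \<Rightarrow> real \<Rightarrow> real" where "tilt x y = arctan (y * inverse (amp x))"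

lemma amp_ge_1: "1 \<le> amp x"
  by (simp add: amp_def)

lemma amp_nonzero: "amp x \<noteq> 0"
  using amp_ge_1[of x] by simp

lemma smooth_amp:
  assumes "smooth f"
  shows "smooth (\<lambda>x. amp (f x))"
  unfolding amp_def
  by (rule smooth_sqrt[OF smooth_add[OF smooth_const smooth_power2[OF assms]]]) (simp add: add_pos_nonneg)

lemma smooth_tilt: "smooth f \<Longrightarrow> smooth g \<Longrightarrow> smooth (\<lambda>x. tilt (f x) (g x))"
  unfolding tilt_def
  by (rule smooth_arctan[OF smooth_mult[OF _ smooth_inverse_real[OF smooth_amp amp_nonzero]]])

lemma tilt_bounds: "- pi / 2 < tilt x y" "tilt x y < pi / 2"
  using arctan_lbound[of "y * inverse (amp x)"] arctan_ubound[of "y * inverse (amp x)"]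
  by (simp_all add: tilt_def)

lemma tilt_less: "y < y' \<Longrightarrow> tilt x y < tilt x y'"
  using amp_ge_1[of x] by (simp add: tilt_def arctan_less_iff)

lemma polar_form:
  obtains R where "R > 0" "R\<^sup>2 = 1 + x\<^sup>2 + y\<^sup>2" "amp x = R * cos (tilt x y)"
    "\<And>\<theta>. amp x * cos \<theta> + y * sin \<theta> = R * cos (\<theta> - tilt x y)"
proof
  let ?w = "y * inverse (amp x)" and ?R = "amp x * sqrt (1 + (y * inverse (amp x))\<^sup>2)"
  have A: "amp x > 0" using amp_ge_1[of x] by simp
  have w: "sqrt (1 + ?w\<^sup>2) > 0" by (simp add: add_pos_nonneg)
  show "?R > 0" using A w by simp
  have "(amp x)\<^sup>2 = 1 + x\<^sup>2" by (simp add: amp_def)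
  moreover have "?R\<^sup>2 = (amp x)\<^sup>2 + y\<^sup>2"
    using A by (simp add: power_mult_distrib field_simps)
  ultimately show "?R\<^sup>2 = 1 + x\<^sup>2 + y\<^sup>2" by simp
  show c: "amp x = ?R * cos (tilt x y)"
    using w by (simp add: tilt_def cos_arctan)
  have s: "y = ?R * sin (tilt x y)"
    using w A by (simp add: tilt_def sin_arctan)
  show "amp x * cos \<theta> + y * sin \<theta> = ?R * cos (\<theta> - tilt x y)" for \<theta>
  proof -
    have "?R * cos (\<theta> - tilt x y) = (?R * cos (tilt x y)) * cos \<theta> + (?R * sin (tilt x y)) * sin \<theta>"
      unfolding cos_diff by (simp add: algebra_simps)
    then show ?thesis using c s by metis
  qed
qed

text \<open>Tangent half-angle substitution \<open>exp s = tan (\<theta> / 2)\<close>: as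
  \<open>s\<close> runs through the reals, \<theta> runs through (0, \<pi>), and the equation can be
  solved for \<open>y\<close> rationally in \<open>exp s\<close>.\<close>

lemma half_angle_iff:
  "A * cos (2 * arctan (exp s)) + y * sin (2 * arctan (exp s)) = 1 \<longleftrightarrow> y = exp s + (A - 1) * sinh s"
proof -
  define \<tau> where "\<tau> = exp s"
  have \<tau>: "\<tau> > 0" by (simp add: \<tau>_def)
  have p: "1 + \<tau>\<^sup>2 > 0" by (simp add: add_pos_nonneg)
  have sq: "sqrt (1 + \<tau>\<^sup>2) * sqrt (1 + \<tau>\<^sup>2) = 1 + \<tau>\<^sup>2" using p by simp
  have c: "cos (2 * arctan \<tau>) = (1 - \<tau>\<^sup>2) / (1 + \<tau>\<^sup>2)"
    unfolding cos_double cos_arctan sin_arctan using p by (simp add: power_divide diff_divide_distrib)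
  have d: "sin (2 * arctan \<tau>) = 2 * \<tau> / (1 + \<tau>\<^sup>2)"
    unfolding sin_double cos_arctan sin_arctan using sq by simp
  have sh: "sinh s = (\<tau> - inverse \<tau>) / 2"
    by (simp add: \<tau>_def sinh_field_def exp_minus)
  have 1: "y = exp s + (A - 1) * sinh s \<longleftrightarrow> 2 * y * \<tau> = 2 * \<tau>\<^sup>2 + (A - 1) * (\<tau>\<^sup>2 - 1)"
    unfolding sh unfolding \<tau>_def[symmetric] using \<tau> by (auto simp: field_simps power2_eq_square)
  have "A * cos (2 * arctan \<tau>) + y * sin (2 * arctan \<tau>) = (A * (1 - \<tau>\<^sup>2) + 2 * y * \<tau>) / (1 + \<tau>\<^sup>2)"
    unfolding c d by (simp add: add_divide_distrib mult_ac)
  then have "A * cos (2 * arctan \<tau>) + y * sin (2 * arctan \<tau>) = 1 \<longleftrightarrow> A * (1 - \<tau>\<^sup>2) + 2 * y * \<tau> = 1 + \<tau>\<^sup>2"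
    using p by (auto simp: divide_eq_1_iff)
  moreover have "A * (1 - \<tau>\<^sup>2) + 2 * y * \<tau> = 1 + \<tau>\<^sup>2 \<longleftrightarrow> 2 * y * \<tau> = 2 * \<tau>\<^sup>2 + (A - 1) * (\<tau>\<^sup>2 - 1)"
    by (auto simp: algebra_simps)
  ultimately show ?thesis unfolding 1 unfolding \<tau>_def[symmetric] by blast
qed

text \<open>
  For \<open>\<theta> = 2 arctan (exp s) < \<pi>\<close> the equation \<open>amp x * cos \<theta> + y * sin \<theta> = 1\<close> determines \<open>y\<close>; subtracting
  the flat function of \<open>ln \<pi> - ln \<theta>\<close> makes the value range over all of \<open>\<real>\<close> as \<open>s\<close> does.
\<close>

definition height :: "real \<Rightarrow> real \<Rightarrow> real" where
  "height s x = exp s + (amp x - 1) * sinh s - flat_ramp (ln pi - ln (2 * arctan (exp s)))"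

lemma arctan_exp_pos: "0 < 2 * arctan (exp s)"
  by simp

lemma smooth_height:
  assumes "smooth f" "smooth g"
  shows "smooth (\<lambda>p. height (f p) (g p))"
proof -
  have "smooth (\<lambda>p. exp (f p) + (amp (g p) - 1) * ((exp (f p) - exp (- f p)) * (1 / 2)) -
      flat_ramp (ln pi - ln (2 * arctan (exp (f p)))))"
    by (intro smooth_diff smooth_add smooth_mult smooth_exp_real smooth_amp smooth_const smooth_minus
        smooth_flat_ramp smooth_ln smooth_arctan arctan_exp_pos assms)
  then show ?thesis by (simp add: height_def sinh_field_def)
qed

lemma height_derivative: "\<exists>d>0. ((\<lambda>s. height s x) has_real_derivative d) (at s)"
proof -
  define r where "r = ln pi - ln (2 * arctan (exp s))"
  define k where "k = inverse (2 * arctan (exp s)) * (2 * (inverse (1 + (exp s)\<^sup>2) * exp s))"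
  have a: "((\<lambda>s. 2 * arctan (exp s)) has_real_derivative 2 * (inverse (1 + (exp s)\<^sup>2) * exp s)) (at s)"
    by (rule DERIV_cmult[OF DERIV_chain2[OF DERIV_arctan DERIV_exp]])
  have b: "((\<lambda>s. ln pi - ln (2 * arctan (exp s))) has_real_derivative 0 - k) (at s)"
    unfolding k_def by (intro DERIV_diff DERIV_const DERIV_chain2[OF DERIV_ln a] arctan_exp_pos)
  have c: "((\<lambda>s. flat_ramp (ln pi - ln (2 * arctan (exp s)))) has_real_derivative
      (flat 0 r + r * flat 2 r) * (0 - k)) (at s)"
    unfolding r_def by (rule DERIV_chain2[OF flat_ramp_derivative b])
  have sh: "(sinh has_real_derivative cosh s) (at s)"
    by (auto intro!: derivative_eq_intros)
  have "((\<lambda>s. height s x) has_real_derivative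
      exp s + (amp x - 1) * cosh s - (flat 0 r + r * flat 2 r) * (0 - k)) (at s)"
    unfolding height_def by (intro DERIV_diff DERIV_add DERIV_exp DERIV_cmult sh c)
  moreover have "0 \<le> (amp x - 1) * cosh s" using amp_ge_1[of x] by simp
  moreover have "0 \<le> (flat 0 r + r * flat 2 r) * k"
    by (intro mult_nonneg_nonneg flat_ramp_derivative_nonneg) (simp add: k_def)
  ultimately show ?thesis
    by (intro exI[of _ "exp s + (amp x - 1) * cosh s - (flat 0 r + r * flat 2 r) * (0 - k)"])
      (simp add: add_pos_nonneg)
qed

lemma height_surj: "\<exists>s. height s x = y"
proof -
  have cont: "isCont (\<lambda>s. height s x) s" for s
    using height_derivative[of x s] DERIV_isCont by blast
  obtain r where r: "r \<ge> 1" "1 - y \<le> flat_ramp r" using flat_ramp_unbounded by blast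
  \<comment> \<open>Because \<open>arctan (exp a) \<le> exp a\<close>, the argument of
    \<open>flat_ramp\<close> at \<open>a\<close> is at least \<open>ln pi - ln 2 - a\<close>, hence
    at least \<open>r\<close>; the minimum with 0 makes \<open>sinh a \<le> 0\<close> and
    \<open>exp a \<le> 1\<close>.\<close>
  define a where "a = min 0 (ln pi - ln 2 - r)"
  have a: "a \<le> 0" "r \<le> ln pi - ln 2 - a" by (auto simp: a_def)
  have "arctan (exp a) \<le> exp a" by (rule arctan_le_self) simp
  then have "ln (2 * arctan (exp a)) \<le> ln (2 * exp a)" by simp
  also have "\<dots> = ln 2 + a" by (simp add: ln_mult)
  finally have "r \<le> ln pi - ln (2 * arctan (exp a))" using a by simp
  then have "1 - y \<le> flat_ramp (ln pi - ln (2 * arctan (exp a)))" using flat_ramp_mono r by fastforce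
  moreover have "(amp x - 1) * sinh a \<le> 0"
    using a amp_ge_1[of x] by (simp add: mult_nonneg_nonpos)
  moreover have "exp a \<le> 1" using a by simp
  ultimately have low: "height a x \<le> y" unfolding height_def by linarith
  define c where "c = flat_ramp (ln pi - ln (2 * arctan (exp 0)))"
  \<comment> \<open>For \<open>b \<ge> 0\<close> the flat term is at most \<open>c\<close> and the
    \<open>sinh\<close> term is nonnegative, so \<open>exp b \<ge> 1 + b\<close> outweighs
    \<open>y + c\<close>.\<close>
  define b where "b = max 0 (y + c)"
  have "arctan (exp 0) \<le> arctan (exp b)" unfolding arctan_le_iff by (simp add: b_def)
  then have "2 * arctan (exp 0) \<le> 2 * arctan (exp b)" by (rule mult_left_mono) simp
  then have "ln (2 * arctan (exp 0)) \<le> ln (2 * arctan (exp b))"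
    using ln_le_cancel_iff[OF arctan_exp_pos arctan_exp_pos] by blast
  then have "flat_ramp (ln pi - ln (2 * arctan (exp b))) \<le> c"
    unfolding c_def by (intro flat_ramp_mono) simp
  moreover have "0 \<le> (amp x - 1) * sinh b" using amp_ge_1[of x] by (simp add: b_def)
  moreover have "1 + b \<le> exp b" by (rule exp_ge_add_one_self)
  moreover have "y + c \<le> b" by (simp add: b_def)
  ultimately have "y \<le> height b x" unfolding height_def by linarith
  from real_surj_IVT[of "\<lambda>s. height s x", OF cont low this] show ?thesis .
qed

lemma height_inj: "height s x = height s' x \<Longrightarrow> s = s'"
proof (rule ccontr)
  assume eq: "height s x = height s' x" and ne: "s \<noteq> s'"
  have "a < b \<Longrightarrow> height a x < height b x" for a b
    by (rule DERIV_pos_imp_increasing) (use height_derivative in auto)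
  from this[of s s'] this[of s' s] show False using eq ne by linarith
qed

definition height_root :: "real \<Rightarrow> real \<Rightarrow> real" where
  "height_root y x = (THE s. height s x = y)"

lemma height_root: "height s x = y \<longleftrightarrow> s = height_root y x"
proof -
  obtain s' where s': "height s' x = y" using height_surj by blast
  have u: "s = s'" if "height s x = y" for s
    by (rule height_inj[of s x s']) (simp add: that s')
  have "height_root y x = s'"
    unfolding height_root_def by (rule the_equality) (rule s', rule u)
  then show ?thesis using s' u[of s] by metis
qed

text \<open>Implicit functions from the shear lemma: \<open>(s, x) \<mapsto> (height s x, x)\<close>
  is a diffeomorphism of the plane, and the root is the first component of its inverse.\<close>

lemma smooth_height_root:
  assumes "smooth f" "smooth g"
  shows "smooth (\<lambda>p. height_root (f p) (g p))"
proof -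
  let ?S = "\<lambda>p :: real \<times> real. p + (height (fst p) (snd p) - fst p) *\<^sub>R (1, 0)"
  have S: "?S (s, x) = (height s x, x)" for s x by simp
  have d: "diffeomorphism ?S"
  proof (rule diffeomorphism_shear[OF bounded_linear_fst])
    show "smooth (\<lambda>p :: real \<times> real. height (fst p) (snd p))"
      by (rule smooth_height[OF smooth_linear[OF bounded_linear_fst smooth_ident]
            smooth_linear[OF bounded_linear_snd smooth_ident]])
    show "\<exists>d>0. ((\<lambda>s. height (fst (p + s *\<^sub>R (1, 0))) (snd (p + s *\<^sub>R (1, 0)))) has_real_derivative d) (at 0)"
      for p :: "real \<times> real"
    proof -
      obtain d where d: "d > 0" "((\<lambda>s. height s (snd p)) has_real_derivative d) (at (0 + fst p))"
        using height_derivative[of "snd p" "0 + fst p"] by blast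
      have "((\<lambda>s. height (s + fst p) (snd p)) has_real_derivative d) (at 0)"
        using d(2) unfolding DERIV_shift .
      then show ?thesis using d(1) by (intro exI[of _ d]) (simp add: add.commute)
    qed
    show "\<exists>s. height (fst (p + s *\<^sub>R (1, 0))) (snd (p + s *\<^sub>R (1, 0))) = y" for p :: "real \<times> real" and y
    proof -
      obtain s where "height s (snd p) = y" using height_surj by blast
      then show ?thesis by (intro exI[of _ "s - fst p"]) simp
    qed
  qed simp
  have "inv ?S (y, x) = (height_root y x, x)" for y x
  proof -
    have "?S (height_root y x, x) = (y, x)" unfolding S using height_root by blast
    moreover have "inj ?S" using d unfolding diffeomorphism_def by (blast dest: bij_is_inj)
    ultimately show ?thesis by (rule inv_f_eq[rotated])
  qed
  then have "height_root (f p) (g p) = fst (inv ?S (f p, g p))" for p by simp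
  moreover have "smooth (\<lambda>p. fst (inv ?S (f p, g p)))"
    by (rule smooth_linear[OF bounded_linear_fst smooth_compose[OF _ smooth_Pair_real[OF assms]]])
      (use d in \<open>unfold diffeomorphism_def, blast\<close>)
  ultimately show ?thesis by simp
qed

definition root_angle :: "real \<Rightarrow> real \<Rightarrow> real" where
  "root_angle x y = 2 * arctan (exp (height_root y x))"

text \<open>The weight makes the third coordinate in \<open>angle_equation_Sigma\<close> vanish at \<open>\<theta> = root_angle x y\<close>.\<close>

definition weight :: "real \<Rightarrow> real \<Rightarrow> real" where
  "weight x y = (root_angle x y - tilt x y) * inverse (flat_ramp (ln pi - ln (root_angle x y)))"

lemma root_angle_bounds: "0 < root_angle x y" "root_angle x y < pi"
  using arctan_ubound[of "exp (height_root y x)"] by (simp_all add: root_angle_def)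

lemma ln_root_angle: "0 < ln pi - ln (root_angle x y)"
  using root_angle_bounds[of x y] by simp

lemma smooth_root_angle: "smooth f \<Longrightarrow> smooth g \<Longrightarrow> smooth (\<lambda>p. root_angle (f p) (g p))"
  unfolding root_angle_def
  by (rule smooth_mult[OF smooth_const smooth_arctan[OF smooth_exp_real[OF smooth_height_root]]])

lemma flat_ramp_root_angle: "flat_ramp (ln pi - ln (root_angle x y)) \<noteq> 0"
  using flat_ramp_pos[OF ln_root_angle[of x y]] by simp

lemma smooth_weight: "smooth f \<Longrightarrow> smooth g \<Longrightarrow> smooth (\<lambda>p. weight (f p) (g p))"
  unfolding weight_def
  by (intro smooth_mult smooth_diff smooth_root_angle smooth_tilt smooth_inverse_real smooth_flat_ramp
      smooth_ln smooth_const root_angle_bounds flat_ramp_root_angle)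

lemma angle_equation_iff:
  assumes "0 < \<theta>" "\<theta> < pi"
  shows "amp x * cos \<theta> + (y + flat_ramp (ln pi - ln \<theta>)) * sin \<theta> = 1 \<longleftrightarrow> \<theta> = root_angle x y"
proof -
  define s where "s = ln (tan (\<theta> / 2))"
  have "0 < tan (\<theta> / 2)" using assms by (intro tan_gt_zero) auto
  then have "exp s = tan (\<theta> / 2)" by (simp add: s_def)
  then have \<theta>: "\<theta> = 2 * arctan (exp s)" using assms arctan_tan[of "\<theta> / 2"] by simp
  have "amp x * cos \<theta> + (y + flat_ramp (ln pi - ln \<theta>)) * sin \<theta> = 1 \<longleftrightarrow> height s x = y"
    unfolding \<theta> half_angle_iff height_def by linarith
  also have "\<dots> \<longleftrightarrow> \<theta> = root_angle x y"
    unfolding height_root root_angle_def \<theta> by (simp add: arctan_eq_iff)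
  finally show ?thesis .
qed

text \<open>The claim is \<open>tilt x y < root_angle x y\<close>. Otherwise the solution \<theta>
  lies below \<open>tilt x Y\<close> for the larger \<open>Y\<close> of the equation; then the
  cosine of its distance to that tilt exceeds the cosine of the tilt itself, and
  \<open>amp x < 1\<close> would follow. Positivity is what makes the last shear increasing along
  its axis.\<close>

lemma weight_pos: "0 < weight x y"
proof -
  define \<theta> where "\<theta> = root_angle x y"
  define Y where "Y = y + flat_ramp (ln pi - ln \<theta>)"
  have \<theta>: "0 < \<theta>" "\<theta> < pi" unfolding \<theta>_def by (rule root_angle_bounds)+
  have eq: "amp x * cos \<theta> + Y * sin \<theta> = 1"
    using angle_equation_iff[OF \<theta>, of x y] \<theta>_def unfolding Y_def by blast
  have pos: "flat_ramp (ln pi - ln \<theta>) > 0"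
    unfolding \<theta>_def by (rule flat_ramp_pos[OF ln_root_angle])
  obtain R where R: "R > 0" "amp x = R * cos (tilt x Y)"
    "amp x * cos \<theta> + Y * sin \<theta> = R * cos (\<theta> - tilt x Y)"
    using polar_form[of x Y] by metis
  have "tilt x y < \<theta>"
  proof (rule ccontr)
    assume "\<not> tilt x y < \<theta>"
    then have le: "\<theta> < tilt x Y" using tilt_less[of y Y x] pos by (simp add: Y_def)
    have "cos (tilt x Y) < cos (tilt x Y - \<theta>)"
      by (rule cos_monotone_0_pi) (use le \<theta> tilt_bounds[of x Y] in auto)
    also have "\<dots> = cos (\<theta> - tilt x Y)" using cos_minus[of "\<theta> - tilt x Y"] by simp
    finally have "amp x < 1" using R eq mult_strict_left_mono[OF _ R(1)] by metis
    then show False using amp_ge_1[of x] by simp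
  qed
  then show ?thesis using pos by (simp add: weight_def \<theta>_def)
qed

section \<open>The equation and the cones\<close>

lemma Sigma_union_iff:
  "p \<in> Sigma_union \<longleftrightarrow> p $ 3 = 0 \<or> (\<exists>n>0. (p $ 1)\<^sup>2 + (p $ 2)\<^sup>2 = (tan (p $ 3))\<^sup>2 \<and>
     2 * pi * real n - pi / 2 < p $ 3 \<and> p $ 3 < 2 * pi * real n + pi / 2)" (is "_ \<longleftrightarrow> _ \<or> ?R")
proof -
  have "p \<in> Sigma_union \<longleftrightarrow> p \<in> Sigma_sheet 0 \<or> (\<exists>n>0. p \<in> Sigma_sheet n)"
    unfolding Sigma_union_def using neq0_conv by blast
  then show ?thesis by (simp add: Sigma_sheet_def cong: conj_cong)
qed

lemma cos_minus_2npi: "cos (z - 2 * pi * real n) = cos z"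
proof -
  have e: "2 * pi * real n = 2 * real n * pi" by simp
  show ?thesis unfolding e cos_diff cos_2npi sin_2npi by simp
qed

lemma cos_pos_iff_interval:
  assumes "pi / 2 < z"
  shows "cos z > 0 \<longleftrightarrow> (\<exists>n>0. 2 * pi * real n - pi / 2 < z \<and> z < 2 * pi * real n + pi / 2)"
proof
  assume pos: "cos z > 0"
  \<comment> \<open>Rounds to the period for which \<open>z - 2 * pi * n\<close> lies in [-\<pi>,
    \<pi>). The assumption on \<open>z\<close> makes the floor nonnegative here and excludes
    \<open>n = 0\<close> below.\<close>
  define n where "n = nat \<lfloor>(z + pi) / (2 * pi)\<rfloor>"
  define w where "w = z - 2 * pi * real n"
  have z: "0 < (z + pi) / (2 * pi)" using assms pi_gt_zero by (intro divide_pos_pos) linarith+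
  then have "real n \<le> (z + pi) / (2 * pi)" "(z + pi) / (2 * pi) < real n + 1"
    unfolding n_def by (simp_all add: of_nat_nat)
  then have "real n * (2 * pi) \<le> z + pi" "z + pi < (real n + 1) * (2 * pi)"
    by (simp_all add: pos_le_divide_eq pos_divide_less_eq)
  then have w: "- pi \<le> w" "w < pi" by (simp_all add: w_def algebra_simps)
  have "cos w = cos z" unfolding w_def by (rule cos_minus_2npi)
  then have cw: "cos \<bar>w\<bar> > 0" using pos by simp
  have "\<bar>w\<bar> < pi / 2"
  proof (rule ccontr)
    assume "\<not> \<bar>w\<bar> < pi / 2"
    then have "cos \<bar>w\<bar> \<le> cos (pi / 2)" using w by (intro cos_monotone_0_pi_le) auto
    then show False using cw by simp
  qed
  then have "2 * pi * real n - pi / 2 < z" "z < 2 * pi * real n + pi / 2"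
    unfolding w_def by linarith+
  moreover have "n > 0" using calculation(2) assms by (cases n) auto
  ultimately show "\<exists>n>0. 2 * pi * real n - pi / 2 < z \<and> z < 2 * pi * real n + pi / 2" by blast
next
  assume "\<exists>n>0. 2 * pi * real n - pi / 2 < z \<and> z < 2 * pi * real n + pi / 2"
  then obtain n :: nat where n: "2 * pi * real n - pi / 2 < z" "z < 2 * pi * real n + pi / 2" by blast
  have "0 < cos (z - 2 * pi * real n)" using n by (intro cos_gt_zero_pi) auto
  then show "cos z > 0" unfolding cos_minus_2npi .
qed

text \<open>For \<open>exp t < pi\<close> only the plane can be met, for
  \<open>exp t \<ge> pi\<close> only the cones; the bounds on \<open>tilt\<close> keep the two
  regimes apart.\<close>

lemma angle_equation_Sigma:
  fixes p :: "real ^ 3"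
  assumes z: "p $ 3 = exp t - tilt (p $ 1) (p $ 2) - weight (p $ 1) (p $ 2) * flat_ramp (ln pi - t)"
  shows "amp (p $ 1) * cos (exp t) + (p $ 2 + flat_ramp (ln pi - t)) * sin (exp t) = 1 \<longleftrightarrow> p \<in> Sigma_union"
proof -
  define x where "x = p $ 1"
  define y where "y = p $ 2"
  define z where "z = p $ 3"
  have zt: "z = exp t - tilt x y - weight x y * flat_ramp (ln pi - t)"
    using z by (simp add: x_def y_def z_def)
  have Sig: "p \<in> Sigma_union \<longleftrightarrow> z = 0 \<or> (\<exists>n>0. x\<^sup>2 + y\<^sup>2 = (tan z)\<^sup>2 \<and>
     2 * pi * real n - pi / 2 < z \<and> z < 2 * pi * real n + pi / 2)"
    unfolding Sigma_union_iff x_def y_def z_def ..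
  show ?thesis unfolding x_def[symmetric] y_def[symmetric]
  proof (cases "t < ln pi")
    case True
    define \<theta> where "\<theta> = exp t"
    have "exp t < exp (ln pi)" using True unfolding exp_less_cancel_iff .
    then have \<theta>: "0 < \<theta>" "\<theta> < pi" by (simp_all add: \<theta>_def)
    have t: "t = ln \<theta>" by (simp add: \<theta>_def)
    \<comment> \<open>For fixed \<open>x\<close> and \<open>y\<close> the height \<open>z\<close> is
      strictly increasing in \<open>t\<close>, and the weight is chosen so that its zero is at
      \<open>ln (root_angle x y)\<close>.\<close>
    define g where "g = (\<lambda>t. exp t - tilt x y - weight x y * flat_ramp (ln pi - t))"
    have mono: "g a < g b" if "a < b" for a b
    proof -
      have "weight x y * flat_ramp (ln pi - b) \<le> weight x y * flat_ramp (ln pi - a)"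
        using that weight_pos[of x y] by (intro mult_left_mono flat_ramp_mono) auto
      moreover have "exp a < exp b" using that by simp
      ultimately show ?thesis unfolding g_def by linarith
    qed
    have g0: "g (ln (root_angle x y)) = 0"
      using root_angle_bounds(1)[of x y] flat_ramp_root_angle[of x y] by (simp add: g_def weight_def)
    have "g t = 0 \<longleftrightarrow> t = ln (root_angle x y)"
      using mono[of t "ln (root_angle x y)"] mono[of "ln (root_angle x y)" t] g0
      by (cases t "ln (root_angle x y)" rule: linorder_cases) auto
    also have "\<dots> \<longleftrightarrow> \<theta> = root_angle x y"
      unfolding t using \<theta>(1) root_angle_bounds(1)[of x y] by simp
    finally have z0: "z = 0 \<longleftrightarrow> \<theta> = root_angle x y" unfolding zt g_def .
    \<comment> \<open>The flat term only lowers \<open>z\<close>, so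
      \<open>z \<le> \<theta> - tilt x y < 3 * pi / 2\<close>, and the first cone begins at
      \<open>3 * pi / 2\<close>.\<close>
    have no: "\<not> 2 * pi * real n - pi / 2 < z" if "n > 0" for n
    proof -
      have "z \<le> \<theta> - tilt x y"
        unfolding zt \<theta>_def using weight_pos[of x y] flat_ramp_nonneg[of "ln pi - t"] by simp
      then have "z < 2 * pi - pi / 2" using \<theta> tilt_bounds[of x y] by linarith
      moreover have "2 * pi * 1 \<le> 2 * pi * real n" using that by (intro mult_left_mono) auto
      ultimately show ?thesis by linarith
    qed
    have "p \<in> Sigma_union \<longleftrightarrow> z = 0" unfolding Sig using no by blast
    then show "amp x * cos (exp t) + (y + flat_ramp (ln pi - t)) * sin (exp t) = 1 \<longleftrightarrow> p \<in> Sigma_union"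
      using z0 angle_equation_iff[OF \<theta>, of x y] unfolding t[symmetric] unfolding \<theta>_def by blast
  next
    case False
    then have "exp (ln pi) \<le> exp t" unfolding exp_le_cancel_iff by simp
    then have \<theta>: "pi \<le> exp t" by simp
    have r0: "flat_ramp (ln pi - t) = 0" using False by (intro flat_ramp_eq_0) simp
    have ze: "z = exp t - tilt x y" unfolding zt r0 by simp
    have zl: "pi / 2 < z" unfolding ze using \<theta> tilt_bounds[of x y] by linarith
    have z0: "z \<noteq> 0" using zl pi_gt_zero by linarith
    obtain R where R: "R > 0" "R\<^sup>2 = 1 + x\<^sup>2 + y\<^sup>2"
      "amp x * cos (exp t) + y * sin (exp t) = R * cos (exp t - tilt x y)"
      using polar_form[of x y] by metis
    \<comment> \<open>Squaring forgets the sign; \<open>cos z > 0\<close> records it and at the same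
      time selects the intervals of the cones.\<close>
    have "R * cos z = 1 \<longleftrightarrow> cos z > 0 \<and> (R * cos z)\<^sup>2 = 1"
    proof
      assume 1: "R * cos z = 1"
      then have "0 < R * cos z" by simp
      then have "cos z > 0" using R(1) by (simp add: zero_less_mult_iff)
      then show "cos z > 0 \<and> (R * cos z)\<^sup>2 = 1" using 1 by simp
    next
      assume "cos z > 0 \<and> (R * cos z)\<^sup>2 = 1"
      moreover then have "0 \<le> R * cos z" using R(1) by simp
      ultimately show "R * cos z = 1" by (simp add: power2_eq_1_iff)
    qed
    also have "\<dots> \<longleftrightarrow> cos z > 0 \<and> x\<^sup>2 + y\<^sup>2 = (tan z)\<^sup>2"
    proof (rule conj_cong[OF refl])
      assume c: "cos z > 0"
      have cancel: "(1 + x\<^sup>2 + y\<^sup>2) * C = S + C \<longleftrightarrow> (x\<^sup>2 + y\<^sup>2) * C = S" for C S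
        by (simp add: algebra_simps)
      have "(R * cos z)\<^sup>2 = 1 \<longleftrightarrow> (1 + x\<^sup>2 + y\<^sup>2) * (cos z)\<^sup>2 = (sin z)\<^sup>2 + (cos z)\<^sup>2"
        unfolding power_mult_distrib R(2) by simp
      also have "\<dots> \<longleftrightarrow> x\<^sup>2 + y\<^sup>2 = (tan z)\<^sup>2"
        using c unfolding cancel tan_def power_divide by (simp add: eq_divide_eq)
      finally show "(R * cos z)\<^sup>2 = 1 \<longleftrightarrow> x\<^sup>2 + y\<^sup>2 = (tan z)\<^sup>2" .
    qed
    also have "\<dots> \<longleftrightarrow> p \<in> Sigma_union"
      unfolding Sig cos_pos_iff_interval[OF zl] using z0 by blast
    finally show "amp x * cos (exp t) + (y + flat_ramp (ln pi - t)) * sin (exp t) = 1 \<longleftrightarrow> p \<in> Sigma_union"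
      unfolding r0 add_0_right R(3) ze .
  qed
qed

section \<open>Coordinates on the space of potentials\<close>

text \<open>
  Up to sign and a multiple of \<open>mode2\<close>, the first two modes represent the functionals
  \<open>u \<mapsto> W0 u (2 * pi)\<close> and \<open>u \<mapsto> W1 u (2 * pi)\<close>; the third increases the phase.
\<close>

definition mode1 :: L2 where "mode1 = abs_L2 (\<lambda>t. pi - t)"
definition mode2 :: L2 where "mode2 = abs_L2 (\<lambda>t. - 1)"
definition mode3 :: L2 where "mode3 = abs_L2 cos"

lemma square_integrable_modes:
  "square_integrable (\<lambda>t. pi - t)" "square_integrable (\<lambda>t. - 1)" "square_integrable cos"
  by (rule square_integrable_continuous; intro continuous_intros)+

lemma integral_antiderivative:
  fixes F f :: "real \<Rightarrow> real"
  assumes "\<And>t. (F has_real_derivative f t) (at t)" "0 \<le> b"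
  shows "integral {0..b} f = F b - F 0"
proof (rule integral_unique, rule fundamental_theorem_of_calculus[OF assms(2)])
  fix t
  show "(F has_vector_derivative f t) (at t within {0..b})"
    using assms(1)[of t] unfolding has_real_derivative_iff_has_vector_derivative[symmetric]
    by (rule has_field_derivative_at_within)
qed

lemma mode_inner:
  "mode1 \<bullet> mode2 = 0" "mode1 \<bullet> mode3 = 0" "mode2 \<bullet> mode3 = 0"
  "mode1 \<noteq> 0" "mode2 \<noteq> 0" "mode3 \<noteq> 0"
proof -
  note sq = square_integrable_modes
  have d12: "((\<lambda>t. (pi - t)\<^sup>2 / 2) has_real_derivative (pi - t) * - 1) (at t)" for t
    by (auto intro!: derivative_eq_intros)
  show "mode1 \<bullet> mode2 = 0"
    unfolding mode1_def mode2_def inner_abs_L2[OF sq(1,2)]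
    using integral_antiderivative[OF d12, of "2 * pi"] by (simp add: power2_eq_square)
  have d13: "((\<lambda>t. (pi - t) * sin t - cos t) has_real_derivative (pi - t) * cos t) (at t)" for t
    by (auto intro!: derivative_eq_intros)
  show "mode1 \<bullet> mode3 = 0"
    unfolding mode1_def mode3_def inner_abs_L2[OF sq(1,3)]
    using integral_antiderivative[OF d13, of "2 * pi"] by simp
  have d23: "((\<lambda>t. - sin t) has_real_derivative - 1 * cos t) (at t)" for t :: real
    by (auto intro!: derivative_eq_intros)
  show "mode2 \<bullet> mode3 = 0"
    unfolding mode2_def mode3_def inner_abs_L2[OF sq(2,3)]
    using integral_antiderivative[OF d23, of "2 * pi"] by simp
  have d11: "((\<lambda>t. - ((pi - t) ^ 3) / 3) has_real_derivative (pi - t) * (pi - t)) (at t)" for t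
    by (auto intro!: derivative_eq_intros simp: power2_eq_square)
  have "mode1 \<bullet> mode1 = 2 * pi ^ 3 / 3"
    unfolding mode1_def inner_abs_L2[OF sq(1,1)]
    using integral_antiderivative[OF d11, of "2 * pi"] by simp
  then show "mode1 \<noteq> 0" by auto
  have "mode2 \<bullet> mode2 = 2 * pi"
    unfolding mode2_def inner_abs_L2[OF sq(2,2)] by simp
  then show "mode2 \<noteq> 0" by auto
  have d33: "((\<lambda>t. (t + sin t * cos t) / 2) has_real_derivative cos t * cos t) (at t)" for t :: real
  proof -
    have "cos t * (cos t * 2) + sin t * (sin t * 2) = 2"
      using sin_cos_squared_add[of t] unfolding power2_eq_square by linarith
    then show ?thesis by (auto intro!: derivative_eq_intros simp: field_simps)
  qed
  have "mode3 \<bullet> mode3 = pi"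
    unfolding mode3_def inner_abs_L2[OF sq(3,3)]
    using integral_antiderivative[OF d33, of "2 * pi"] by simp
  then show "mode3 \<noteq> 0" by auto
qed

lemma W1_end: "W1 u (2 * pi) = - (u \<bullet> mode2)"
proof -
  have "ind_L2 (2 * pi) = (- 1) *\<^sub>R mode2"
    unfolding ind_L2_def mode2_def abs_L2_scaleR[OF square_integrable_modes(2)]
    by (rule abs_L2_cong[OF _ square_integrable_indicator square_integrable_scale[OF square_integrable_modes(2)]]) simp
  then show ?thesis by (simp add: W1_inner)
qed

lemma W0_end: "W0 u (2 * pi) = u \<bullet> mode1 - pi * (u \<bullet> mode2)"
proof -
  have "ramp_L2 (2 * pi) = mode1 - pi *\<^sub>R mode2"
    unfolding ramp_L2_def mode1_def mode2_def abs_L2_scaleR[OF square_integrable_modes(2)]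
      abs_L2_diff[OF square_integrable_modes(1) square_integrable_scale[OF square_integrable_modes(2)]]
    by (rule abs_L2_cong[OF _ square_integrable_ramp
          square_integrable_diff[OF square_integrable_modes(1) square_integrable_scale[OF square_integrable_modes(2)]]]) simp
  then show ?thesis by (simp add: W0_inner inner_diff_right)
qed

text \<open>The first primitive of \<open>cos\<close> is \<open>sin\<close>, and both it and
  \<open>1 - cos t\<close> vanish at \<open>2 * pi\<close>, so a move along \<open>mode3\<close>
  leaves \<open>w\<close> and \<open>b\<close> alone. As \<open>1 - cos t\<close> is positive inside
  the interval, the phase grows.\<close>

lemma W0_mode3:
  assumes t: "t \<in> {0..2 * pi}"
  shows "W0 mode3 t = 1 - cos t"
proof -
  have "W1 mode3 s = sin s" if "s \<in> {0..t}" for s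
  proof -
    have "s \<in> {0..2 * pi}" using t that by simp
    then have "W1 mode3 s = integral {0..s} cos"
      unfolding mode3_def by (rule W1_abs[OF square_integrable_modes(3)])
    also have "\<dots> = sin s" using integral_antiderivative[of sin cos s] that by (simp add: DERIV_sin)
    finally show ?thesis .
  qed
  then have "W0 mode3 t = integral {0..t} sin"
    unfolding W0_def by (intro integral_cong) auto
  also have "\<dots> = 1 - cos t"
  proof -
    have "((\<lambda>t. - cos t) has_real_derivative sin t) (at t)" for t :: real
      by (auto intro!: derivative_eq_intros)
    from integral_antiderivative[OF this, of t] show ?thesis using t by simp
  qed
  finally show ?thesis .
qed

section \<open>The total phase as a coordinate along the third mode\<close>

definition total_phase :: "L2 \<Rightarrow> real" where
  "total_phase u = phase u (2 * pi)"

lemma square_integrable_exp_W0: "square_integrable (\<lambda>t. exp (W0 u t))"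
  by (rule square_integrable_continuous) (intro continuous_intros continuous_on_W0)

text \<open>\<open>- mode2\<close> is the class of the constant 1; written as an inner product, the
  phase inherits smoothness and derivative from \<open>exp_L2\<close>.\<close>

lemma total_phase_inner: "total_phase u = exp_L2 u \<bullet> - mode2"
proof -
  have "exp_L2 u \<bullet> mode2 = integral {0..2 * pi} (\<lambda>t. exp (W0 u t) * - 1)"
    unfolding exp_L2_def mode2_def by (rule inner_abs_L2[OF square_integrable_exp_W0 square_integrable_modes(2)])
  then show ?thesis by (simp add: total_phase_def phase_def)
qed

lemma smooth_total_phase: "smooth total_phase"
proof -
  have "smooth (\<lambda>u. exp_L2 u \<bullet> - mode2)"
    by (rule smooth_bilinear[OF bounded_bilinear_inner smooth_exp_L2 smooth_const])
  then show ?thesis by (simp add: total_phase_inner[abs_def])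
qed

lemma total_phase_line:
  "total_phase (u + s *\<^sub>R mode3) = integral {0..2 * pi} (\<lambda>t. exp (W0 u t + s * (1 - cos t)))"
  unfolding total_phase_def phase_def
  by (rule integral_cong) (simp add: W0_add W0_scaleR W0_mode3)

lemma integral_pos_real:
  fixes f :: "real \<Rightarrow> real"
  assumes "continuous_on {0..2 * pi} f" "\<And>t. t \<in> {0<..<2 * pi} \<Longrightarrow> 0 < f t"
  shows "0 < integral {0..2 * pi} f"
  using integral_less_real[where f = "\<lambda>_. 0" and g = f and a = 0 and b = "2 * pi"] assms pi_gt_zero by (simp add: continuous_on_const)

lemma total_phase_pos: "0 < total_phase u"
  unfolding total_phase_def phase_def
  by (rule integral_pos_real) (intro continuous_intros continuous_on_W0, simp)

lemma cos_less_1: "t \<in> {0<..<2 * pi} \<Longrightarrow> cos t < 1"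
proof -
  assume t: "t \<in> {0<..<2 * pi}"
  then have "0 < sin (t / 2)" by (intro sin_gt_zero) auto
  moreover have "cos t = 1 - 2 * (sin (t / 2))\<^sup>2" using cos_double_sin[of "t / 2"] by simp
  ultimately show "cos t < 1" by simp
qed

lemma mode3_weight_pos: "0 < integral {0..2 * pi} (\<lambda>t. exp (W0 u t) * (1 - cos t))"
  by (rule integral_pos_real) (intro continuous_intros continuous_on_W0, use cos_less_1 in simp)

lemma total_phase_derivative:
  "\<exists>d>0. ((\<lambda>s. total_phase (u + s *\<^sub>R mode3)) has_real_derivative d) (at 0)"
proof (intro exI conjI)
  let ?v = "abs_L2 (\<lambda>t. exp (W0 u t) * W0 mode3 t)"
  have line: "((\<lambda>s. u + s *\<^sub>R mode3) has_derivative (\<lambda>s. s *\<^sub>R mode3)) (at 0)"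
    by (auto intro!: derivative_eq_intros)
  have "((\<lambda>s. exp_L2 (u + s *\<^sub>R mode3)) has_derivative (\<lambda>s. abs_L2 (\<lambda>t. exp (W0 u t) * W0 (s *\<^sub>R mode3) t))) (at 0)"
    by (rule has_derivative_compose[OF line]) (simp add: exp_L2_has_derivative)
  then have "((\<lambda>s. exp_L2 (u + s *\<^sub>R mode3) \<bullet> - mode2) has_derivative
      (\<lambda>s. abs_L2 (\<lambda>t. exp (W0 u t) * W0 (s *\<^sub>R mode3) t) \<bullet> - mode2)) (at 0)"
    by (rule has_derivative_inner_left)
  moreover have "abs_L2 (\<lambda>t. exp (W0 u t) * W0 (s *\<^sub>R mode3) t) \<bullet> - mode2 =
      integral {0..2 * pi} (\<lambda>t. exp (W0 u t) * (1 - cos t)) * s" for s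
  proof -
    have sq: "square_integrable (\<lambda>t. exp (W0 u t) * W0 (s *\<^sub>R mode3) t)"
      by (rule square_integrable_continuous) (intro continuous_intros continuous_on_W0)
    have "abs_L2 (\<lambda>t. exp (W0 u t) * W0 (s *\<^sub>R mode3) t) \<bullet> mode2 =
        integral {0..2 * pi} (\<lambda>t. exp (W0 u t) * W0 (s *\<^sub>R mode3) t * - 1)"
      unfolding mode2_def by (rule inner_abs_L2[OF sq square_integrable_modes(2)])
    also have "\<dots> = integral {0..2 * pi} (\<lambda>t. (- s) * (exp (W0 u t) * (1 - cos t)))"
      by (rule integral_cong) (simp add: W0_scaleR W0_mode3)
    finally show ?thesis by simp
  qed
  ultimately show "((\<lambda>s. total_phase (u + s *\<^sub>R mode3)) has_real_derivative
      integral {0..2 * pi} (\<lambda>t. exp (W0 u t) * (1 - cos t))) (at 0)"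
    unfolding has_field_derivative_def total_phase_inner by simp
qed (rule mode3_weight_pos)

text \<open>As the parameter tends to minus infinity, the integrand tends to 0 except at the two end
  points, where \<open>1 - cos t\<close> vanishes; \<open>exp (W0 u t)\<close> dominates it.\<close>

lemma total_phase_small:
  assumes "y > 0"
  shows "\<exists>s. total_phase (u + s *\<^sub>R mode3) \<le> y"
proof -
  let ?f = "\<lambda>k t. exp (W0 u t + (- real k) * (1 - cos t))"
  let ?g = "\<lambda>t. if t \<in> {0, 2 * pi} then exp (W0 u t) else 0"
  have int: "?f k integrable_on {0..2 * pi}" for k
    by (rule integrable_continuous_interval) (intro continuous_intros continuous_on_W0)
  have "(\<lambda>k. integral {0..2 * pi} (?f k)) \<longlonglongrightarrow> integral {0..2 * pi} ?g"
  proof (rule dominated_convergence(2)[where h = "\<lambda>t. exp (W0 u t)"])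
    show "(\<lambda>t. exp (W0 u t)) integrable_on {0..2 * pi}"
      by (rule integrable_continuous_interval) (intro continuous_intros continuous_on_W0)
    show "norm (?f k t) \<le> exp (W0 u t)" for k t by simp
    show "(\<lambda>k. ?f k t) \<longlonglongrightarrow> ?g t" if t: "t \<in> {0..2 * pi}" for t
    proof (cases "t \<in> {0, 2 * pi}")
      case True
      then have "cos t = 1" by auto
      then show ?thesis using True by simp
    next
      case False
      define r where "r = exp (- (1 - cos t))"
      have "cos t < 1" using cos_less_1[of t] t False by simp
      then have r: "0 \<le> r" "r < 1" by (simp_all add: r_def)
      have "(\<lambda>k. exp (W0 u t) * r ^ k) \<longlonglongrightarrow> exp (W0 u t) * 0"
        by (rule tendsto_mult_left, rule LIMSEQ_realpow_zero[OF r])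
      moreover have "exp (W0 u t) * r ^ k = ?f k t" for k
        unfolding r_def exp_of_nat_mult[symmetric] exp_add[symmetric] by (simp add: algebra_simps)
      ultimately show ?thesis using False by simp
    qed
  qed (rule int)
  moreover have "integral {0..2 * pi} ?g = 0"
    by (rule integral_unique, rule has_integral_spike_finite[of "{0, 2 * pi}" _ _ "\<lambda>_. 0"]) auto
  ultimately have "(\<lambda>k. integral {0..2 * pi} (?f k)) \<longlonglongrightarrow> 0" by simp
  from order_tendstoD(2)[OF this assms] obtain k where "integral {0..2 * pi} (?f k) < y"
    unfolding eventually_sequentially by blast
  then show ?thesis
    by (intro exI[of _ "- real k"]) (simp only: total_phase_line less_imp_le)
qed

lemma total_phase_large: "\<exists>s. y \<le> total_phase (u + s *\<^sub>R mode3)"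
proof -
  let ?a = "\<lambda>t. exp (W0 u t)" and ?b = "\<lambda>t. exp (W0 u t) * (1 - cos t)"
  \<comment> \<open>Solves the affine equation that results from the lower bound
    \<open>exp x \<ge> 1 + x\<close>; the slope is positive by
    \<open>mode3_weight_pos\<close>.\<close>
  define s where "s = (y - integral {0..2 * pi} ?a) / integral {0..2 * pi} ?b"
  have ia: "?a integrable_on {0..2 * pi}" and ib: "?b integrable_on {0..2 * pi}"
    and iab: "(\<lambda>t. ?a t + s * ?b t) integrable_on {0..2 * pi}"
    and ic: "(\<lambda>t. exp (W0 u t + s * (1 - cos t))) integrable_on {0..2 * pi}"
    by (rule integrable_continuous_interval; intro continuous_intros continuous_on_W0)+
  have "y = integral {0..2 * pi} ?a + s * integral {0..2 * pi} ?b"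
    unfolding s_def using mode3_weight_pos[of u] by simp
  also have "\<dots> = integral {0..2 * pi} (\<lambda>t. ?a t + s * ?b t)"
    using Henstock_Kurzweil_Integration.integral_add[OF ia integrable_on_cmult_left[OF ib, of s]] by simp
  also have "\<dots> \<le> integral {0..2 * pi} (\<lambda>t. exp (W0 u t + s * (1 - cos t)))"
  proof (rule integral_le[OF iab ic])
    fix t
    have "?a t * (1 + s * (1 - cos t)) \<le> ?a t * exp (s * (1 - cos t))"
      by (rule mult_left_mono[OF exp_ge_add_one_self]) simp
    then show "?a t + s * ?b t \<le> exp (W0 u t + s * (1 - cos t))"
      unfolding exp_add by (simp only: distrib_left mult_1_right mult_ac)
  qed
  also have "\<dots> = total_phase (u + s *\<^sub>R mode3)" by (rule total_phase_line[symmetric])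
  finally show ?thesis by blast
qed

lemma total_phase_surj:
  assumes "y > 0"
  shows "\<exists>s. total_phase (u + s *\<^sub>R mode3) = y"
proof -
  obtain a where a: "total_phase (u + a *\<^sub>R mode3) \<le> y" using total_phase_small[OF assms] by blast
  obtain b where b: "y \<le> total_phase (u + b *\<^sub>R mode3)" using total_phase_large by blast
  have "smooth (\<lambda>s. total_phase (u + s *\<^sub>R mode3))"
    by (rule smooth_compose[OF smooth_total_phase smooth_add[OF smooth_const smooth_scaleR[OF smooth_ident smooth_const]]])
  from real_surj_IVT[of "\<lambda>s. total_phase (u + s *\<^sub>R mode3)", OF smooth_isCont[OF this] a b] show ?thesis .
qed

lemma fourier_map_basis:
  fixes e :: "nat \<Rightarrow> 'a::{real_inner,complete_space}" and f :: "nat \<Rightarrow> 'b::{real_inner,complete_space}"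
  assumes e: "orthonormal_seq e" and f: "orthonormal_seq f" "total_seq f"
  shows "fourier_map e f (e k) = f k"
proof -
  have "(fourier_map e f (e k) - f k) \<bullet> f n = 0" for n
    using e f(1) by (simp add: inner_diff_left inner_fourier_map[OF e f(1)] orthonormal_seq_def)
  then have "fourier_map e f (e k) - f k = 0" using f(2) unfolding total_seq_def by blast
  then show ?thesis by simp
qed

definition prepend_axes :: "(nat \<Rightarrow> 'h::real_inner) \<Rightarrow> nat \<Rightarrow> (real^3) \<times> 'h" where
  "prepend_axes h n = (if n = 0 then (axis 1 1, 0) else if n = 1 then (axis 2 1, 0)
     else if n = 2 then (axis 3 1, 0) else (0, h (n - 3)))"

lemma prepend_axes_orthonormal: "orthonormal_seq h \<Longrightarrow> orthonormal_seq (prepend_axes h)"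
  unfolding orthonormal_seq_def prepend_axes_def by (auto simp: inner_axis_axis)

lemma prepend_axes_total:
  assumes "total_seq h"
  shows "total_seq (prepend_axes h)"
  unfolding total_seq_def
proof (intro allI impI)
  fix u :: "(real^3) \<times> 'a" assume u: "\<forall>n. u \<bullet> prepend_axes h n = 0"
  have "snd u \<bullet> h n = 0" for n
    using u[rule_format, of "n + 3"] by (simp add: prepend_axes_def inner_prod_def)
  then have "snd u = 0" using assms unfolding total_seq_def by blast
  moreover have "fst u = 0"
    using u[rule_format, of 0] u[rule_format, of 1] u[rule_format, of 2]
    by (simp add: prepend_axes_def inner_prod_def inner_axis vec_eq_iff forall_3)
  ultimately show "u = 0" by (simp add: prod_eq_iff)
qed

text \<open>Both sides receive an orthonormal basis, with the three axes matched to the normalized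
  modes, and \<open>U\<close> is the resulting unitary map. The norms in the formulas undo the
  normalization of the modes.\<close>

lemma exists_coordinates:
  assumes separable: "\<exists>S :: 'h::{real_inner, complete_space} set. countable S \<and> closure S = UNIV"
    and infinite_dimensional: "\<not> (\<exists>B :: 'h::{real_inner, complete_space} set. finite B \<and> span B = UNIV)"
  obtains U :: "(real^3) \<times> 'h::{real_inner, complete_space} \<Rightarrow> L2" where "diffeomorphism U" "bounded_linear U"
    "\<And>p. U p \<bullet> mode1 = norm mode1 * fst p $ 1" "\<And>p. U p \<bullet> mode2 = norm mode2 * fst p $ 2"
    "U (axis 3 1, 0) = sgn mode3"
proof -
  define b where "b = (\<lambda>n :: nat. if n = 0 then sgn mode1 else if n = 1 then sgn mode2
     else if n = 2 then sgn mode3 else L2_dense_seq (n - 3))"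
  have "total_seq b"
    unfolding total_seq_def
  proof (intro allI impI)
    fix u assume u: "\<forall>n. u \<bullet> b n = 0"
    have "u \<bullet> L2_dense_seq n = 0" for n
      using u[rule_format, of "n + 3"] by (simp add: b_def)
    then show "u = 0" by (rule L2_dense_seq_total)
  qed
  moreover have "b i \<bullet> b j = (if i = j then 1 else 0)" if "i < 3" "j < 3" for i j
  proof -
    have self: "sgn v \<bullet> sgn v = 1" if "v \<noteq> 0" for v :: L2
      using that norm_sgn[of v] by (simp add: dot_square_norm)
    have cross: "sgn v \<bullet> sgn w = 0" "sgn w \<bullet> sgn v = 0" if "v \<bullet> w = 0" for v w :: L2
      using that by (simp_all add: sgn_div_norm inner_commute)
    have "i = 0 \<or> i = 1 \<or> i = 2" "j = 0 \<or> j = 1 \<or> j = 2" using that by linarith+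
    then show ?thesis
      by (elim disjE) (simp_all add: b_def self mode_inner cross)
  qed
  ultimately obtain e where e: "orthonormal_seq e" "total_seq e" "\<And>n. n < 3 \<Longrightarrow> e n = b n"
    using exists_orthonormal_basis[of b 3] L2_infinite_dimensional by blast
  obtain S :: "'h set" where S: "countable S" "closure S = UNIV" using separable by blast
  obtain h :: "nat \<Rightarrow> 'h" where h: "orthonormal_seq h" "total_seq h"
    using exists_orthonormal_basis[OF total_seq_separable[OF S] infinite_dimensional, of 0] by blast
  note X = prepend_axes_orthonormal[OF h(1)] prepend_axes_total[OF h(2)]
  let ?U = "fourier_map (prepend_axes h) e"
  have inner: "?U p \<bullet> v = norm v * (p \<bullet> prepend_axes h n)" if "e n = sgn v" for p v n
  proof -
    have "v = norm v *\<^sub>R e n" unfolding that sgn_div_norm by (cases "v = 0") simp_all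
    then have "?U p \<bullet> v = norm v * (?U p \<bullet> e n)" by (metis inner_scaleR_right)
    then show ?thesis unfolding inner_fourier_map[OF X(1) e(1)] .
  qed
  show thesis
  proof (rule that)
    show "diffeomorphism ?U" by (rule diffeomorphism_fourier_map[OF X e(1,2)])
    show "bounded_linear ?U" by (rule bounded_linear_fourier_map[OF X(1) e(1)])
    show "?U p \<bullet> mode1 = norm mode1 * fst p $ 1" for p
      using inner[of 0 mode1 p] e(3)[of 0] by (simp add: b_def prepend_axes_def inner_prod_def inner_axis)
    show "?U p \<bullet> mode2 = norm mode2 * fst p $ 2" for p
      using inner[of 1 mode2 p] e(3)[of 1] by (simp add: b_def prepend_axes_def inner_prod_def inner_axis)
    show "?U (axis 3 1, 0) = sgn mode3"
      using fourier_map_basis[OF X(1) e(1,2), of 2] e(3)[of 2] by (simp add: b_def prepend_axes_def)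
  qed
qed

abbreviation axis_vec :: "3 \<Rightarrow> (real^3) \<times> 'h::real_inner" where
  "axis_vec i \<equiv> (axis i 1, 0)"

lemma fst_shift_nth: "fst (p + s *\<^sub>R axis_vec i) $ j = (if j = i then s + fst p $ j else fst p $ j)"
  by (simp add: axis_def)

lemma smooth_coord: "smooth (\<lambda>p :: (real^3) \<times> 'h::real_inner. fst p $ i)"
  by (rule smooth_linear[OF bounded_linear_vec_nth smooth_linear[OF bounded_linear_fst smooth_ident]])

lemma diffeomorphism_coordinate_shear:
  fixes f :: "(real^3) \<times> 'h::{real_inner,complete_space} \<Rightarrow> real"
  assumes "smooth f"
    and "\<And>p. \<exists>d>0. ((\<lambda>s. f (p + s *\<^sub>R axis_vec i)) has_real_derivative d) (at 0)"
    and "\<And>p y. \<exists>s. f (p + s *\<^sub>R axis_vec i) = y"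
  shows "diffeomorphism (\<lambda>p. p + (f p - fst p $ i) *\<^sub>R axis_vec i)"
  by (rule diffeomorphism_shear[OF bounded_linear_compose[OF bounded_linear_vec_nth bounded_linear_fst] _ assms])
    (simp add: axis_def)

text \<open>
  The case in which the function depends on the coordinates alone; \<open>g p\<close> is its restriction
  to the line through \<open>p\<close>, parametrized by the coordinate.
\<close>

lemma diffeomorphism_scalar_shear:
  fixes f :: "(real^3) \<times> 'h::{real_inner,complete_space} \<Rightarrow> real"
  assumes f: "smooth f"
    and fg: "\<And>p s. f (p + s *\<^sub>R axis_vec i) = g p (s + fst p $ i)"
    and der: "\<And>p s. \<exists>d>0. (g p has_real_derivative d) (at s)"
    and surj: "\<And>p y. \<exists>s. g p s = y"
  shows "diffeomorphism (\<lambda>p. p + (f p - fst p $ i) *\<^sub>R axis_vec i)"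
proof (rule diffeomorphism_coordinate_shear[OF f])
  fix p :: "(real^3) \<times> 'h" and y
  obtain d where d: "d > 0" "(g p has_real_derivative d) (at (0 + fst p $ i))"
    using der by blast
  have "((\<lambda>s. g p (s + fst p $ i)) has_real_derivative d) (at 0)"
    using d(2) unfolding DERIV_shift .
  then show "\<exists>d>0. ((\<lambda>s. f (p + s *\<^sub>R axis_vec i)) has_real_derivative d) (at 0)"
    unfolding fg using d(1) by blast
  obtain s where "g p s = y" using surj by blast
  then have "f (p + (s - fst p $ i) *\<^sub>R axis_vec i) = y" unfolding fg by simp
  then show "\<exists>s. f (p + s *\<^sub>R axis_vec i) = y" by blast
qed

lemma fold_derivative:
  assumes "\<kappa> > 0"
  shows "\<exists>d>0. ((\<lambda>t. exp t - c - \<kappa> * flat_ramp (ln pi - t)) has_real_derivative d) (at t)"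
proof (intro exI conjI)
  define r where "r = ln pi - t"
  define D where "D = flat 0 r + r * flat 2 r"
  have "((\<lambda>t. ln pi - t) has_real_derivative 0 - 1) (at t)"
    by (rule DERIV_diff[OF DERIV_const DERIV_ident])
  then have "((\<lambda>t. flat_ramp (ln pi - t)) has_real_derivative D * (0 - 1)) (at t)"
    unfolding D_def r_def by (rule DERIV_chain2[OF flat_ramp_derivative])
  then show "((\<lambda>t. exp t - c - \<kappa> * flat_ramp (ln pi - t)) has_real_derivative
      exp t - 0 - \<kappa> * (D * (0 - 1))) (at t)"
    by (intro DERIV_diff DERIV_exp DERIV_const DERIV_cmult)
  have "0 \<le> \<kappa> * D"
    unfolding D_def using assms by (intro mult_nonneg_nonneg flat_ramp_derivative_nonneg) simp
  then show "0 < exp t - 0 - \<kappa> * (D * (0 - 1))"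
    by (simp add: add_pos_nonneg)
qed

lemma fold_surj:
  assumes "\<kappa> > 0"
  shows "\<exists>t. exp t - c - \<kappa> * flat_ramp (ln pi - t) = y"
proof -
  let ?g = "\<lambda>t. exp t - c - \<kappa> * flat_ramp (ln pi - t)"
  have cont: "isCont ?g t" for t
    using fold_derivative[OF assms, of c t] DERIV_isCont by blast
  obtain r where r: "(1 - c - y) / \<kappa> \<le> flat_ramp r" using flat_ramp_unbounded by blast
  define a where "a = min 0 (ln pi - r)"
  have "flat_ramp r \<le> flat_ramp (ln pi - a)" by (rule flat_ramp_mono) (simp add: a_def)
  then have "(1 - c - y) / \<kappa> \<le> flat_ramp (ln pi - a)" using r by simp
  then have "1 - c - y \<le> \<kappa> * flat_ramp (ln pi - a)"
    using assms by (simp add: pos_divide_le_eq mult.commute)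
  moreover have "exp a \<le> 1" by (simp add: a_def)
  ultimately have low: "?g a \<le> y" by linarith
  define b where "b = max (ln pi) (y + c)"
  have "flat_ramp (ln pi - b) = 0" by (rule flat_ramp_eq_0) (simp add: b_def)
  then have "\<kappa> * flat_ramp (ln pi - b) = 0" by simp
  moreover have "1 + b \<le> exp b" by (rule exp_ge_add_one_self)
  moreover have "y + c \<le> b" by (simp add: b_def)
  ultimately have "y \<le> ?g b" by linarith
  from real_surj_IVT[of ?g, OF cont low this] show ?thesis .
qed

lemma less_amp: "x < amp x"
  unfolding amp_def by (rule real_less_rsqrt) simp

lemma amp_sinh: "amp (sinh a) = cosh a"
proof -
  have "1 + (sinh a)\<^sup>2 = (cosh a)\<^sup>2" by (simp add: cosh_square_eq)
  then show ?thesis by (simp add: amp_def)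
qed

section \<open>The four coordinate changes and their composition\<close>

context
  fixes U :: "(real^3) \<times> 'h::{real_inner, complete_space} \<Rightarrow> L2" and n1 n2 :: real
  assumes U: "diffeomorphism U" "bounded_linear U"
    and U1: "\<And>p. U p \<bullet> mode1 = n1 * fst p $ 1" and U2: "\<And>p. U p \<bullet> mode2 = n2 * fst p $ 2"
    and U3: "U (axis_vec 3) = sgn mode3"
    and n: "n1 > 0" "n2 > 0"
begin

definition shear_phase :: "(real^3) \<times> 'h \<Rightarrow> (real^3) \<times> 'h" where
  "shear_phase p = p + (ln (total_phase (U p)) - fst p $ 3) *\<^sub>R axis_vec 3"

text \<open>By \<open>W0_end\<close> the argument of \<open>sinh\<close> is
  \<open>W0 (U p) (2 * pi) / 2\<close>, so the new first coordinate is the \<open>x\<close> of the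
  overview.\<close>

definition shear_sinh :: "(real^3) \<times> 'h \<Rightarrow> (real^3) \<times> 'h" where
  "shear_sinh p = p + (sinh ((n1 * fst p $ 1 - pi * (n2 * fst p $ 2)) * (1 / 2)) - fst p $ 1) *\<^sub>R axis_vec 1"

text \<open>Once the first coordinate is \<open>x = sinh (w / 2)\<close>, the difference
  \<open>amp x - x\<close> is \<open>exp (- w / 2)\<close>; together with
  \<open>n2 * fst p $ 2 = - b\<close> the product is the \<open>y\<close> of the overview, from
  which the flat term is then subtracted.\<close>

definition shear_slope :: "(real^3) \<times> 'h \<Rightarrow> (real^3) \<times> 'h" where
  "shear_slope p = p + (fst p $ 2 * ((amp (fst p $ 1) - fst p $ 1) * (n2 / 4)) - flat_ramp (ln pi - fst p $ 3) - fst p $ 2) *\<^sub>R axis_vec 2"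

text \<open>Sends \<open>ln \<theta>\<close> to \<open>z\<close>: for \<theta> at least \<pi> this
  is \<theta> minus the tilt, for smaller \<theta> the weighted flat term brings the first sheet to
  height 0.\<close>

definition shear_fold :: "(real^3) \<times> 'h \<Rightarrow> (real^3) \<times> 'h" where
  "shear_fold p = p + (exp (fst p $ 3) - tilt (fst p $ 1) (fst p $ 2)
     - weight (fst p $ 1) (fst p $ 2) * flat_ramp (ln pi - fst p $ 3) - fst p $ 3) *\<^sub>R axis_vec 3"

lemma diffeomorphism_shear_phase: "diffeomorphism shear_phase"
  unfolding shear_phase_def
proof (rule diffeomorphism_coordinate_shear)
  have sm: "smooth (\<lambda>p. total_phase (U p))"
    by (rule smooth_compose[OF smooth_total_phase bounded_linear_imp_smooth[OF U(2)]])
  show "smooth (\<lambda>p. ln (total_phase (U p)))"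
    by (rule smooth_ln[OF sm total_phase_pos])
  fix p :: "(real^3) \<times> 'h" and y
  \<comment> \<open>\<open>U\<close> maps the third axis to the unit vector
    \<open>sgn mode3\<close>, while the phase lemmas use \<open>mode3\<close> itself.\<close>
  define c where "c = inverse (norm mode3)"
  have c: "c > 0" using mode_inner(6) by (simp add: c_def)
  have line: "U (p + s *\<^sub>R axis_vec 3) = U p + (s * c) *\<^sub>R mode3" for s
    unfolding linear_add[OF bounded_linear.linear[OF U(2)]] linear_scale[OF bounded_linear.linear[OF U(2)]]
      U3 sgn_div_norm c_def by simp
  obtain d where d: "d > 0" "((\<lambda>s. total_phase (U p + s *\<^sub>R mode3)) has_real_derivative d) (at (0 * c))"
    using total_phase_derivative[of "U p"] by auto
  have "((\<lambda>s. s * c) has_real_derivative 1 * c) (at 0)"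
    by (rule DERIV_cmult_right[OF DERIV_ident])
  from DERIV_chain2[OF d(2) this]
  have 1: "((\<lambda>s. total_phase (U p + (s * c) *\<^sub>R mode3)) has_real_derivative d * (1 * c)) (at 0)" .
  have "((\<lambda>s. ln (total_phase (U p + (s * c) *\<^sub>R mode3))) has_real_derivative
      inverse (total_phase (U p + (0 * c) *\<^sub>R mode3)) * (d * (1 * c))) (at 0)"
    by (rule DERIV_chain2[OF DERIV_ln[OF total_phase_pos] 1])
  moreover have "0 < inverse (total_phase (U p + (0 * c) *\<^sub>R mode3)) * (d * (1 * c))"
    using d(1) c total_phase_pos by simp
  ultimately show "\<exists>d>0. ((\<lambda>s. ln (total_phase (U (p + s *\<^sub>R axis_vec 3)))) has_real_derivative d) (at 0)"
    unfolding line by blast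
  obtain s where "total_phase (U p + s *\<^sub>R mode3) = exp y"
    using total_phase_surj[of "exp y" "U p"] by auto
  then show "\<exists>s. ln (total_phase (U (p + s *\<^sub>R axis_vec 3))) = y"
    unfolding line using c by (intro exI[of _ "s / c"]) simp
qed

lemma diffeomorphism_shear_sinh: "diffeomorphism shear_sinh"
  unfolding shear_sinh_def
proof (rule diffeomorphism_scalar_shear[where
      g = "\<lambda>p s. sinh ((n1 * s - pi * (n2 * fst p $ 2)) * (1 / 2))"])
  have "smooth (\<lambda>p :: (real^3) \<times> 'h. (exp ((n1 * fst p $ 1 - pi * (n2 * fst p $ 2)) * (1 / 2))
      - exp (- ((n1 * fst p $ 1 - pi * (n2 * fst p $ 2)) * (1 / 2)))) * (1 / 2))"
    by (intro smooth_mult smooth_diff smooth_exp_real smooth_minus smooth_const smooth_coord)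
  then show "smooth (\<lambda>p :: (real^3) \<times> 'h. sinh ((n1 * fst p $ 1 - pi * (n2 * fst p $ 2)) * (1 / 2)))"
    by (simp add: sinh_field_def)
  fix p :: "(real^3) \<times> 'h" and s y
  show "sinh ((n1 * fst (p + s *\<^sub>R axis_vec 1) $ 1 - pi * (n2 * fst (p + s *\<^sub>R axis_vec 1) $ 2)) * (1 / 2)) =
      sinh ((n1 * (s + fst p $ 1) - pi * (n2 * fst p $ 2)) * (1 / 2))"
    unfolding fst_shift_nth by simp
  let ?l = "\<lambda>s. (n1 * s - pi * (n2 * fst p $ 2)) * (1 / 2)"
  have "((\<lambda>s. sinh (?l s)) has_real_derivative cosh (?l s) * (n1 * (1 / 2))) (at s)"
    by (auto intro!: derivative_eq_intros)
  moreover have "0 < cosh (?l s) * (n1 * (1 / 2))" using n(1) by simp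
  ultimately show "\<exists>d>0. ((\<lambda>s. sinh (?l s)) has_real_derivative d) (at s)" by blast
  have "?l ((arsinh y * 2 + pi * (n2 * fst p $ 2)) / n1) = arsinh y" using n(1) by simp
  then show "\<exists>s. sinh (?l s) = y" using sinh_arsinh_real[of y] by metis
qed

lemma diffeomorphism_shear_slope: "diffeomorphism shear_slope"
  unfolding shear_slope_def
proof (rule diffeomorphism_scalar_shear[where
      g = "\<lambda>p s. s * ((amp (fst p $ 1) - fst p $ 1) * (n2 / 4)) - flat_ramp (ln pi - fst p $ 3)"])
  show "smooth (\<lambda>p :: (real^3) \<times> 'h. fst p $ 2 * ((amp (fst p $ 1) - fst p $ 1) * (n2 / 4)) - flat_ramp (ln pi - fst p $ 3))"
    by (intro smooth_mult smooth_diff smooth_amp smooth_flat_ramp smooth_const smooth_coord)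
  fix p :: "(real^3) \<times> 'h" and s y
  show "fst (p + s *\<^sub>R axis_vec 2) $ 2 *
       ((amp (fst (p + s *\<^sub>R axis_vec 2) $ 1) - fst (p + s *\<^sub>R axis_vec 2) $ 1) * (n2 / 4)) -
       flat_ramp (ln pi - fst (p + s *\<^sub>R axis_vec 2) $ 3) =
       (s + fst p $ 2) * ((amp (fst p $ 1) - fst p $ 1) * (n2 / 4)) - flat_ramp (ln pi - fst p $ 3)"
    unfolding fst_shift_nth by simp
  define c where "c = (amp (fst p $ 1) - fst p $ 1) * (n2 / 4)"
  have c: "c > 0" unfolding c_def using n(2) less_amp[of "fst p $ 1"] by (intro mult_pos_pos) auto
  have "((\<lambda>s. s * c - flat_ramp (ln pi - fst p $ 3)) has_real_derivative 1 * c - 0) (at s)"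
    by (intro DERIV_diff DERIV_cmult_right DERIV_ident DERIV_const)
  moreover have "0 < 1 * c - 0" using c by simp
  ultimately show "\<exists>d>0. ((\<lambda>s. s * ((amp (fst p $ 1) - fst p $ 1) * (n2 / 4)) - flat_ramp (ln pi - fst p $ 3)) has_real_derivative d) (at s)"
    unfolding c_def[symmetric] by blast
  show "\<exists>s. s * ((amp (fst p $ 1) - fst p $ 1) * (n2 / 4)) - flat_ramp (ln pi - fst p $ 3) = y"
    unfolding c_def[symmetric] using c by (intro exI[of _ "(y + flat_ramp (ln pi - fst p $ 3)) / c"]) simp
qed

lemma diffeomorphism_shear_fold: "diffeomorphism shear_fold"
  unfolding shear_fold_def
proof (rule diffeomorphism_scalar_shear[where
      g = "\<lambda>p s. exp s - tilt (fst p $ 1) (fst p $ 2) - weight (fst p $ 1) (fst p $ 2) * flat_ramp (ln pi - s)"])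
  show "smooth (\<lambda>p :: (real^3) \<times> 'h. exp (fst p $ 3) - tilt (fst p $ 1) (fst p $ 2)
     - weight (fst p $ 1) (fst p $ 2) * flat_ramp (ln pi - fst p $ 3))"
    by (intro smooth_mult smooth_diff smooth_exp_real smooth_tilt smooth_weight smooth_flat_ramp smooth_const smooth_coord)
  fix p :: "(real^3) \<times> 'h" and s y
  show "exp (fst (p + s *\<^sub>R axis_vec 3) $ 3) - tilt (fst (p + s *\<^sub>R axis_vec 3) $ 1) (fst (p + s *\<^sub>R axis_vec 3) $ 2)
     - weight (fst (p + s *\<^sub>R axis_vec 3) $ 1) (fst (p + s *\<^sub>R axis_vec 3) $ 2) * flat_ramp (ln pi - fst (p + s *\<^sub>R axis_vec 3) $ 3) =
     exp (s + fst p $ 3) - tilt (fst p $ 1) (fst p $ 2) - weight (fst p $ 1) (fst p $ 2) * flat_ramp (ln pi - (s + fst p $ 3))"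
    unfolding fst_shift_nth by simp
qed (rule fold_derivative[OF weight_pos], rule fold_surj[OF weight_pos])

definition straighten :: "(real^3) \<times> 'h \<Rightarrow> (real^3) \<times> 'h" where
  "straighten p = shear_fold (shear_slope (shear_sinh (shear_phase p)))"

lemma diffeomorphism_straighten: "diffeomorphism straighten"
  unfolding straighten_def
  by (rule diffeomorphism_compose[OF diffeomorphism_compose[OF diffeomorphism_compose[
        OF diffeomorphism_shear_phase diffeomorphism_shear_sinh] diffeomorphism_shear_slope]
        diffeomorphism_shear_fold])

lemma straighten_Sigma: "potential (U p) \<in> periodic_potentials \<longleftrightarrow> fst (straighten p) \<in> Sigma_union"
proof -
  define a where "a = W0 (U p) (2 * pi) / 2"
  define x where "x = sinh a"
  define t where "t = ln (total_phase (U p))"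
  define y where "y = fst p $ 2 * ((amp x - x) * (n2 / 4)) - flat_ramp (ln pi - t)"
  define p1 where "p1 = shear_phase p"
  define p2 where "p2 = shear_sinh p1"
  define p3 where "p3 = shear_slope p2"
  define p4 where "p4 = shear_fold p3"
  have p1: "fst p1 $ 1 = fst p $ 1" "fst p1 $ 2 = fst p $ 2" "fst p1 $ 3 = t"
    unfolding p1_def shear_phase_def fst_shift_nth t_def by simp_all
  have "(n1 * fst p $ 1 - pi * (n2 * fst p $ 2)) * (1 / 2) = a"
    unfolding a_def W0_end U1 U2 by simp
  then have p2: "fst p2 $ 1 = x" "fst p2 $ 2 = fst p $ 2" "fst p2 $ 3 = t"
    unfolding p2_def shear_sinh_def fst_shift_nth p1 x_def by simp_all
  have p3: "fst p3 $ 1 = x" "fst p3 $ 2 = y" "fst p3 $ 3 = t"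
    unfolding p3_def shear_slope_def fst_shift_nth p2 y_def by simp_all
  have p4: "fst p4 $ 1 = x" "fst p4 $ 2 = y" "fst p4 $ 3 = exp t - tilt x y - weight x y * flat_ramp (ln pi - t)"
    unfolding p4_def shear_fold_def fst_shift_nth p3 by simp_all
  have et: "exp t = phase (U p) (2 * pi)"
    unfolding t_def using total_phase_pos[of "U p"] by (simp add: total_phase_def)
  have ax: "amp x = cosh a" unfolding x_def by (rule amp_sinh)
  have "amp x - x = exp (- a)" unfolding ax unfolding x_def by (rule cosh_minus_sinh)
  then have yt: "y + flat_ramp (ln pi - t) = - (W1 (U p) (2 * pi) / 4 * exp (- a))"
    unfolding y_def W1_end U2 by simp
  have "potential (U p) \<in> periodic_potentials \<longleftrightarrow>
      cosh a * cos (exp t) - W1 (U p) (2 * pi) / 4 * exp (- a) * sin (exp t) = 1"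
    unfolding periodic_potentials_def mem_Collect_eq potential_periodic_iff et a_def by simp
  also have "\<dots> \<longleftrightarrow> amp x * cos (exp t) + (y + flat_ramp (ln pi - t)) * sin (exp t) = 1"
    unfolding yt ax by simp
  also have "\<dots> \<longleftrightarrow> fst p4 \<in> Sigma_union"
    using angle_equation_Sigma[of "fst p4" t] unfolding p4 by blast
  finally show ?thesis unfolding straighten_def p4_def p3_def p2_def p1_def .
qed

lemma periodic_potentials_diffeomorphic:
  "\<exists>\<Phi> :: (real^3) \<times> 'h \<Rightarrow> L2. diffeomorphism \<Phi> \<and> \<Phi> ` (Sigma_union \<times> UNIV) = periodic_potentials"
proof (intro exI conjI)
  let ?\<Phi> = "\<lambda>p. potential (U (inv straighten p))"
  show "diffeomorphism ?\<Phi>"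
    by (rule diffeomorphism_compose[OF diffeomorphism_compose[OF diffeomorphism_inv[OF diffeomorphism_straighten] U(1)]
          diffeomorphism_potential])
  have bij: "bij straighten" using diffeomorphism_straighten unfolding diffeomorphism_def by blast
  show "?\<Phi> ` (Sigma_union \<times> UNIV) = periodic_potentials"
  proof (rule set_eqI, rule iffI)
    fix q assume "q \<in> ?\<Phi> ` (Sigma_union \<times> UNIV)"
    then obtain p where q: "q = ?\<Phi> p" and p: "p \<in> Sigma_union \<times> UNIV" by (rule imageE)
    have "straighten (inv straighten p) = p" by (rule surj_f_inv_f[OF bij_is_surj[OF bij]])
    then show "q \<in> periodic_potentials" 
      unfolding q straighten_Sigma using p by (simp add: mem_Times_iff)
  next
    fix q assume q: "q \<in> periodic_potentials"
    have "surj U" using U(1) unfolding diffeomorphism_def by (blast dest: bij_is_surj)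
    obtain u where u: "q = potential u" using surjD[OF surj_potential] by blast
    obtain p where p: "u = U p" using surjD[OF \<open>surj U\<close>] by blast
    have "straighten p \<in> Sigma_union \<times> UNIV"
      using q unfolding u p straighten_Sigma by (simp add: mem_Times_iff)
    moreover have "q = ?\<Phi> (straighten p)"
      unfolding u p inv_f_f[OF bij_is_inj[OF bij]] ..
    ultimately show "q \<in> ?\<Phi> ` (Sigma_union \<times> UNIV)" by (rule rev_image_eqI)
  qed
qed

end

theorem theorem2:
  assumes separable: "\<exists>S :: 'h::{real_inner, complete_space} set. countable S \<and> closure S = UNIV"
    and infinite_dimensional: "\<not> (\<exists>B :: 'h set. finite B \<and> span B = UNIV)"
  shows "\<exists>\<Phi> :: (real^3) \<times> 'h \<Rightarrow> L2.
           diffeomorphism \<Phi> \<and> \<Phi> ` (Sigma_union \<times> UNIV) = periodic_potentials"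
proof -
  obtain U :: "(real^3) \<times> 'h \<Rightarrow> L2" where U: "diffeomorphism U" "bounded_linear U"
    "\<And>p. U p \<bullet> mode1 = norm mode1 * fst p $ 1" "\<And>p. U p \<bullet> mode2 = norm mode2 * fst p $ 2"
    "U (axis 3 1, 0) = sgn mode3"
    using exists_coordinates[OF assms] by blast
  show ?thesis
    by (rule periodic_potentials_diffeomorphic[OF U]) (simp_all add: mode_inner)
qed

end
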